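(* Let $\beta>0$ and consider the XY model on $\mathbb Z^2$ with spin potential $\mathcal U(t)=-\beta\cos t$ and dual height function potential $\mathcal V(n)=-\log I_n(\beta)$, where $I_n$ is the modified Bessel function of the first kind. Let $\mu$ be any subsequential weak limit, as $N\to\infty$, of the spin measures $\mu_{\mathbb T_N,\Diamond}$ on the tori $\mathbb T_N=(\mathbb Z/2^N\mathbb Z)^2$, and let $\theta$ be the associated spin field on the faces of $\mathbb Z^2$. If the height function delocalises, i.e. there is no translation-invariant Gibbs measure with respect to $\mathcal V$ on height functions $h:\mathbb Z^2\to\mathbb Z$, then $$\sum_{i=1}^\infty i\,\mu[\cos(\theta_0-\theta_i)]^2\ \ge\ \sum_{i=1}^\infty i\Big(\mu[\cos(\theta_0-\theta_i)]^2-\tfrac12\mu[\cos(\theta_0+\theta_0'-\theta_i-\theta_i')]\Big)=\infty .$$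
   Context: $\mathbb S=\{z\in\mathbb C:|z|=1\}$ is identified with $\mathbb R/2\pi\mathbb Z$ and written additively. For a graph, a 1-form with values in $\mathbb S$ is an antisymmetric $\mathbb S$-valued function $J$ on directed edges, $\mathrm d^*J_x=\sum_{y\sim x}J_{yx}$, and $H_\Diamond(\mathbb S)=\ker(\mathrm d^* )$. On a finite graph $G=(V,E)$, $\mu_{G,\Diamond}$ is the probability measure on $H_\Diamond(G,\mathbb S)$ with density proportional to $\prod_{e\in E}e^{-\mathcal U(J_e)}$ with respect to Haar probability measure. The torus $\mathbb T_N$ (nearest-neighbour graph) is identified with a fundamental domain in $\mathbb Z^2$ centred at the origin, and limits are weak limits of the laws restricted to finite sets of edges of $\mathbb Z^2$; $\mu$ is then a measure on $H_\Diamond(\mathbb Z^2,\mathbb S)$. Spin field: for $J\in H_\Diamond(\mathbb Z^2,\mathbb S)$ there is a field $\theta$ on the faces of $\mathbb Z^2$ (the vertices of the dual lattice $(1/2,1/2)+\mathbb Z^2$), unique given $\theta_{(1/2,1/2)}=0$, such that $J_{vv'}=\theta_u-\theta_{u'}$ for each directed edge $vv'$, where $u,u'$ are the faces to the right and left of $vv'$. Let $e_i$ be the edge from $(i,0)$ to $(i+1,0)$, and $\{u_i,u_i'\}$ its dual edge, where $u_i=(i+\frac12,\frac12)$ and $u_i'=(i+\frac12,-\frac12)$; write $\theta_i=\theta_{u_i}$, $\theta_i'=\theta_{u_i'}$. Gibbs measures for height functions: for finite $\Lambda\subset\mathbb Z^2$ let $E(\Lambda)$ be the set of edges with at least one endpoint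 in $\Lambda$; for $\varphi:\Lambda^c\to\mathbb Z$ let $\nu_\Lambda^\varphi$ be the probability measure on $h:\mathbb Z^2\to\mathbb Z$ with $h|_{\Lambda^c}=\varphi$ given by $\nu_\Lambda^\varphi(h)\propto\exp(-\sum_{xy\in E(\Lambda)}\mathcal V(h_y-h_x))$. A probability measure $\nu$ on $\mathbb Z^{\mathbb Z^2}$ is a Gibbs measure if for all finite $\Lambda$ the restriction of $\nu$ to $\Lambda$ equals $\int\nu_\Lambda^\varphi(\cdot)\,d\nu(\varphi)$. *)

theory Defs
  imports "HOL-Probability.Probability"
begin

text \<open>
  The circle group is the multiplicative group of unit complex numbers: the class of the angle
  \<open>t\<close> modulo \<open>2\<pi>\<close> is \<open>cis t\<close>, so that sums of angles become products, \<open>-t\<close> becomes the inverse,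
  and \<open>cos t\<close> becomes the real part.

  A graph is given by its set \<open>D\<close> of directed edges, a symmetric irreflexive relation;
  an undirected edge corresponds to a pair of opposite elements of \<open>D\<close>.
\<close>

type_synonym site = "int \<times> int"
type_synonym 'v form = "'v \<times> 'v \<Rightarrow> complex"

text \<open>
  Sum over undirected edges of a quantity that does not depend on the orientation of the edge.
\<close>

definition edge_sum :: "('v \<times> 'v) set \<Rightarrow> ('v \<times> 'v \<Rightarrow> real) \<Rightarrow> real" where
  "edge_sum D f = (\<Sum>e\<in>D. f e) / 2"

text \<open>The probability measure whose density with respect to \<open>M\<close> is proportional to \<open>f\<close>.\<close>

definition normalised_density :: "'a measure \<Rightarrow> ('a \<Rightarrow> real) \<Rightarrow> 'a measure" where
  "normalised_density M f = density M (\<lambda>x. ennreal (f x) / (\<integral>\<^sup>+y. ennreal (f y) \<partial>M))"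


subsection \<open>Circle-valued forms and spin measures\<close>

definition one_forms :: "('v \<times> 'v) set \<Rightarrow> 'v form set" where
  "one_forms D = {J \<in> D \<rightarrow>\<^sub>E sphere 0 1. \<forall>(x, y)\<in>D. J (y, x) = inverse (J (x, y))}"

definition d_star :: "('v \<times> 'v) set \<Rightarrow> 'v form \<Rightarrow> 'v \<Rightarrow> complex" where
  "d_star D J x = (\<Prod>y | (y, x) \<in> D. J (y, x))"

definition H_diamond :: "('v \<times> 'v) set \<Rightarrow> 'v form set" where
  "H_diamond D = {J \<in> one_forms D. \<forall>x. d_star D J x = 1}"

definition H_diamond_space :: "('v \<times> 'v) set \<Rightarrow> 'v form measure" where
  "H_diamond_space D = restrict_space (Pi\<^sub>M D (\<lambda>_. borel)) (H_diamond D)"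

definition haar_probability :: "('v \<times> 'v) set \<Rightarrow> 'v form measure \<Rightarrow> bool" where
  "haar_probability D m \<longleftrightarrow>
     prob_space m \<and> sets m = sets (H_diamond_space D) \<and>
     (\<forall>K\<in>H_diamond D. distr m m (\<lambda>J. \<lambda>e\<in>D. K e * J e) = m)"

text \<open>
  The potential \<open>U\<close> is an even function on the circle. The Haar probability measure of the compact
  group \<open>H_diamond D\<close> is unique, so the measure \<open>M\<close> below is determined by \<open>U\<close> and \<open>D\<close>.
\<close>

definition spin_measure ::
    "(complex \<Rightarrow> real) \<Rightarrow> ('v \<times> 'v) set \<Rightarrow> 'v form measure \<Rightarrow> bool" where
  "spin_measure U D M \<longleftrightarrow>
     (\<exists>m. haar_probability D m \<and>
          M = normalised_density m (\<lambda>J. exp (- edge_sum D (\<lambda>e. U (J e)))))"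

definition xy_potential :: "real \<Rightarrow> complex \<Rightarrow> real" where
  "xy_potential \<beta> z = - \<beta> * Re z"


subsection \<open>The square lattice and the tori\<close>

definition Z2_edges :: "(site \<times> site) set" where
  "Z2_edges = {(x, y). \<bar>fst y - fst x\<bar> + \<bar>snd y - snd x\<bar> = 1}"

text \<open>
  The torus of side length \<open>2^N\<close>, with the vertices represented in the fundamental domain
  \<open>[-2^N/2, 2^N/2)\<^sup>2\<close>. In this way the edges of the square lattice inside the
  fundamental domain are also edges of the torus.
\<close>

definition torus_box :: "nat \<Rightarrow> site set" where
  "torus_box N = {x. - (2 ^ N) \<le> 2 * fst x \<and> 2 * fst x < 2 ^ N \<and>
                     - (2 ^ N) \<le> 2 * snd x \<and> 2 * snd x < 2 ^ N}"

definition torus_edges :: "nat \<Rightarrow> (site \<times> site) set" where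
  "torus_edges N = {(x, y). x \<in> torus_box N \<and> y \<in> torus_box N \<and> x \<noteq> y \<and>
     (\<exists>z. (x, z) \<in> Z2_edges \<and> fst z mod 2 ^ N = fst y mod 2 ^ N \<and>
          snd z mod 2 ^ N = snd y mod 2 ^ N)}"

text \<open>
  For a form on a torus, \<open>F\<close> is contained in the set of edges of the torus as soon as the torus is
  large enough.
\<close>

definition edge_law :: "('v \<times> 'v) set \<Rightarrow> 'v form measure \<Rightarrow> 'v form measure" where
  "edge_law F M = distr M (Pi\<^sub>M F (\<lambda>_. borel)) (\<lambda>J. restrict J F)"

definition weakly_converges ::
    "(nat \<Rightarrow> 'a::topological_space measure) \<Rightarrow> 'a measure \<Rightarrow> bool" where
  "weakly_converges P Q \<longleftrightarrow>
     (\<forall>f :: 'a \<Rightarrow> real. continuous_on (space Q) f \<and> bounded (f ` space Q) \<longrightarrow>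
        (\<lambda>n. integral\<^sup>L (P n) f) \<longlonglongrightarrow> integral\<^sup>L Q f)"

definition subsequential_torus_limit ::
    "(complex \<Rightarrow> real) \<Rightarrow> site form measure \<Rightarrow> bool" where
  "subsequential_torus_limit U \<mu> \<longleftrightarrow>
     prob_space \<mu> \<and> sets \<mu> = sets (H_diamond_space Z2_edges) \<and>
     (\<exists>M r. (\<forall>N. spin_measure U (torus_edges N) (M N)) \<and> strict_mono (r :: nat \<Rightarrow> nat) \<and>
        (\<forall>F. finite F \<and> F \<subseteq> Z2_edges \<longrightarrow>
           weakly_converges (\<lambda>n. edge_law F (M (r n))) (edge_law F \<mu>)))"


subsection \<open>The spin field\<close>

text \<open>
  The face with centre \<open>(a + 1/2, b + 1/2)\<close> is represented by its lower left corner \<open>(a, b)\<close>.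
  The directed edges starting at \<open>(a, b)\<close> are listed in the order east, north, west, south.
\<close>

definition right_face :: "site \<Rightarrow> site \<Rightarrow> site" where
  "right_face v v' = (let (a, b) = v in
     if v' = (a + 1, b) then (a, b - 1)
     else if v' = (a, b + 1) then (a, b)
     else if v' = (a - 1, b) then (a - 1, b)
     else (a - 1, b - 1))"

definition left_face :: "site \<Rightarrow> site \<Rightarrow> site" where
  "left_face v v' = right_face v' v"

definition spin_field :: "site form \<Rightarrow> site \<Rightarrow> complex" where
  "spin_field J = (THE \<theta>. (\<forall>u. \<theta> u \<in> sphere 0 1) \<and> \<theta> (0, 0) = 1 \<and>
     (\<forall>(v, v')\<in>Z2_edges. J (v, v') = \<theta> (right_face v v') / \<theta> (left_face v v')))"

definition spin_upper :: "site form \<Rightarrow> nat \<Rightarrow> complex" where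
  "spin_upper J i = spin_field J (int i, 0)"

definition spin_lower :: "site form \<Rightarrow> nat \<Rightarrow> complex" where
  "spin_lower J i = spin_field J (int i, -1)"

text \<open>
  The expectations of \<open>cos (\<theta>\<^sub>0 - \<theta>\<^sub>i)\<close> and of \<open>cos (\<theta>\<^sub>0 + \<theta>'\<^sub>0 - \<theta>\<^sub>i - \<theta>'\<^sub>i)\<close>.
\<close>

definition two_point :: "site form measure \<Rightarrow> nat \<Rightarrow> real" where
  "two_point \<mu> i = (\<integral>J. Re (spin_upper J 0 / spin_upper J i) \<partial>\<mu>)"

definition four_point :: "site form measure \<Rightarrow> nat \<Rightarrow> real" where
  "four_point \<mu> i =
     (\<integral>J. Re ((spin_upper J 0 * spin_lower J 0) / (spin_upper J i * spin_lower J i)) \<partial>\<mu>)"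


subsection \<open>Height functions\<close>

text \<open>
  The modified Bessel function of the first kind of integer order. The function \<open>rGamma\<close> is the
  reciprocal Gamma function, which vanishes at the nonpositive integers.
\<close>

definition bessel_I :: "int \<Rightarrow> real \<Rightarrow> real" where
  "bessel_I n x =
     (\<Sum>m. (x / 2) powi (2 * int m + n) * rGamma (of_int (int m + n + 1)) / fact m)"

definition height_potential :: "real \<Rightarrow> int \<Rightarrow> real" where
  "height_potential \<beta> n = - ln (bessel_I n \<beta>)"

definition height_space :: "(site \<Rightarrow> int) measure" where
  "height_space = Pi\<^sub>M UNIV (\<lambda>_. count_space UNIV)"

definition incident_edges :: "site set \<Rightarrow> (site \<times> site) set" where
  "incident_edges \<Lambda> = {(x, y) \<in> Z2_edges. x \<in> \<Lambda> \<or> y \<in> \<Lambda>}"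

text \<open>
  The potential \<open>V\<close> is even. The boundary condition is the restriction of \<open>\<phi>\<close> to the complement
  of \<open>\<Lambda>\<close>.
\<close>

definition gibbs_kernel ::
    "(int \<Rightarrow> real) \<Rightarrow> site set \<Rightarrow> (site \<Rightarrow> int) \<Rightarrow> (site \<Rightarrow> int) measure" where
  "gibbs_kernel V \<Lambda> \<phi> =
     distr (normalised_density (count_space {h. \<forall>x. x \<notin> \<Lambda> \<longrightarrow> h x = \<phi> x})
              (\<lambda>h. exp (- edge_sum (incident_edges \<Lambda>) (\<lambda>(x, y). V (h y - h x)))))
           height_space (\<lambda>h. h)"

definition height_law :: "site set \<Rightarrow> (site \<Rightarrow> int) measure \<Rightarrow> (site \<Rightarrow> int) measure" where
  "height_law \<Lambda> \<nu> = distr \<nu> (Pi\<^sub>M \<Lambda> (\<lambda>_. count_space UNIV)) (\<lambda>h. restrict h \<Lambda>)"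

definition gibbs_measure :: "(int \<Rightarrow> real) \<Rightarrow> (site \<Rightarrow> int) measure \<Rightarrow> bool" where
  "gibbs_measure V \<nu> \<longleftrightarrow>
     prob_space \<nu> \<and> sets \<nu> = sets height_space \<and>
     (\<forall>\<Lambda>. finite \<Lambda> \<longrightarrow>
        (\<forall>A \<in> sets (Pi\<^sub>M \<Lambda> (\<lambda>_. count_space UNIV)).
           emeasure (height_law \<Lambda> \<nu>) A =
             (\<integral>\<^sup>+\<phi>. emeasure (height_law \<Lambda> (gibbs_kernel V \<Lambda> \<phi>)) A \<partial>\<nu>)))"

definition translation_invariant :: "(site \<Rightarrow> int) measure \<Rightarrow> bool" where
  "translation_invariant \<nu> \<longleftrightarrow>
     (\<forall>a. distr \<nu> height_space (\<lambda>h x. h (x + a)) = \<nu>)"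

definition delocalises :: "(int \<Rightarrow> real) \<Rightarrow> bool" where
  "delocalises V \<longleftrightarrow> \<not> (\<exists>\<nu>. gibbs_measure V \<nu> \<and> translation_invariant \<nu>)"

end

theory Submission
  imports Defs
begin

text \<open>
  Let \<open>J\<^sub>i\<close> be the flow through the edge \<open>e\<^sub>i\<close>. A Ginibre inequality for the four spins at the ends of
  the dual edges bounds the covariance of \<open>sin J\<^sub>0\<close> and \<open>sin J\<^sub>i\<close> from above by the i-th bracket of the
  series, and reflection positivity shows that it is nonnegative. Ginibre's monotonicity
  places the torus between the free field and the field with pinned boundary; recurrence of the
  lattice (Mermin-Wagner) makes both agree in the limit, at least for neutral observables.

  By Fourier duality \<open>\<beta>\<^sup>2\<close> times the covariance of the sines is, up to the sign, the covariance of the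
  height gradients under zero boundary conditions. The height variance along a row grows
  sublinearly, because a row may be replaced by an average over parallel rows. If the series were
  finite, the gradient covariances would therefore sum to zero with a summable first moment, and
  the height variance would be bounded. Averaging the heights over shifts and over base points
  then gives a tight family, whose limits are translation invariant Gibbs measures.
\<close>

section \<open>Ginibre inequalities on compact abelian groups\<close>

text \<open>A divergence free flow on the torus may wind around it and then is not the gradient of a
  spin field, so the torus is not itself an XY model. The Ginibre inequalities are therefore proved
  for a group with square roots, not only for products of circles; gradients of fields supported in
  a square are group elements over which the Haar measure can be averaged.

  One-sided comparisons suffice: the bracket grows with a nonnegative two-point function, bounded
  below by the free field, and decreases in the four-point function, bounded above by the pinned
  field. Free and pinned fields only have to be matched for one neutral four-spin character.

  The weight i comes from summing twice: the increments of the height variance along a row are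
  bounded by multiples of tails of the current correlations, and the sum of all tails is their first
  moment.

  Subtracting the height at a base point spoils the Gibbs property at that point; averaging over
  base points makes the defect vanish. Base point and shift are independent and may be far apart, so
  tightness needs a variance bound uniform in the distance.\<close>

definition bdd_meas :: "'a measure => ('a => real) => bool" where
 "bdd_meas M f \<longleftrightarrow> f \<in> borel_measurable M \<and> (\<exists>C. \<forall>x\<in>space M. \<bar>f x\<bar> <= C)"

lemma bdd_measI: "f \<in> borel_measurable M ==> (\<And>x. x \<in> space M ==> \<bar>f x\<bar> <= C) ==> bdd_meas M f"
 unfolding bdd_meas_def by blast

lemma bdd_meas_measurable: "bdd_meas M f ==> f \<in> borel_measurable M"
 unfolding bdd_meas_def by blast

lemma bdd_meas_const: "bdd_meas M (%_. c)"
 by (rule bdd_measI[where C="\<bar>c\<bar>"]) auto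

lemma bdd_meas_add: "bdd_meas M f ==> bdd_meas M g ==> bdd_meas M (%x. f x + g x)"
proof -
 assume f: "bdd_meas M f" and g: "bdd_meas M g"
 obtain C D where C: "\<forall>x\<in>space M. \<bar>f x\<bar> <= C" and D: "\<forall>x\<in>space M. \<bar>g x\<bar> <= D"
  using f g unfolding bdd_meas_def by blast
 show ?thesis
 proof (rule bdd_measI[where C="C + D"])
  show "(%x. f x + g x) \<in> borel_measurable M"
   using f[THEN bdd_meas_measurable] g[THEN bdd_meas_measurable] by measurable
  fix x assume "x \<in> space M"
  then have "\<bar>f x\<bar> <= C" "\<bar>g x\<bar> <= D" using C D by auto
  then show "\<bar>f x + g x\<bar> <= C + D" by linarith
 qed
qed

lemma bdd_meas_mult: "bdd_meas M f ==> bdd_meas M g ==> bdd_meas M (%x. f x * g x)"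
proof -
 assume f: "bdd_meas M f" and g: "bdd_meas M g"
 obtain C D where C: "\<forall>x\<in>space M. \<bar>f x\<bar> <= C" and D: "\<forall>x\<in>space M. \<bar>g x\<bar> <= D"
  using f g unfolding bdd_meas_def by blast
 show ?thesis
 proof (rule bdd_measI[where C="C * D"])
  show "(%x. f x * g x) \<in> borel_measurable M"
   using f[THEN bdd_meas_measurable] g[THEN bdd_meas_measurable] by measurable
  fix x assume "x \<in> space M"
  then have "\<bar>f x\<bar> <= C" "\<bar>g x\<bar> <= D" using C D by auto
  then show "\<bar>f x * g x\<bar> <= C * D" by (simp add: abs_mult mult_mono')
 qed
qed

lemma bdd_meas_cmult: "bdd_meas M f ==> bdd_meas M (%x. c * f x)"
 by (rule bdd_meas_mult[OF bdd_meas_const])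

lemma bdd_meas_minus: "bdd_meas M f ==> bdd_meas M (%x. - f x)"
 using bdd_meas_cmult[of M f "-1"] by simp

lemma bdd_meas_diff: "bdd_meas M f ==> bdd_meas M g ==> bdd_meas M (%x. f x - g x)"
 using bdd_meas_add[OF _ bdd_meas_minus, of M f g] by simp

lemma bdd_meas_divide: "bdd_meas M f ==> bdd_meas M (%x. f x / c)"
 using bdd_meas_cmult[of M f "1/c"] by simp

lemma bdd_meas_abs: "bdd_meas M f ==> bdd_meas M (%x. \<bar>f x\<bar>)"
 unfolding bdd_meas_def by auto

lemma bdd_meas_power: "bdd_meas M f ==> bdd_meas M (%x. f x ^ n)"
 by (induction n) (auto intro: bdd_meas_const bdd_meas_mult)

lemma bdd_meas_sum: "(\<And>i. i \<in> I ==> bdd_meas M (f i)) ==> bdd_meas M (%x. \<Sum>i\<in>I. f i x)"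
 by (induction I rule: infinite_finite_induct) (auto intro: bdd_meas_const bdd_meas_add)

lemma bdd_meas_prod: "(\<And>i. i \<in> I ==> bdd_meas M (f i)) ==> bdd_meas M (%x. \<Prod>i\<in>I. f i x)"
 by (induction I rule: infinite_finite_induct) (auto intro: bdd_meas_const bdd_meas_mult)

lemma bdd_meas_exp: "bdd_meas M f ==> bdd_meas M (%x. exp (f x))"
proof -
 assume f: "bdd_meas M f"
 obtain C where C: "\<forall>x\<in>space M. \<bar>f x\<bar> <= C" using f unfolding bdd_meas_def by blast
 show ?thesis
 proof (rule bdd_measI[where C="exp C"])
  show "(%x. exp (f x)) \<in> borel_measurable M"
   using f[THEN bdd_meas_measurable] by measurable
  fix x assume "x \<in> space M"
  then show "\<bar>exp (f x)\<bar> <= exp C" using C by fastforce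
 qed
qed

lemma bdd_meas_compose:
 "bdd_meas N f ==> g \<in> measurable M N ==> bdd_meas M (%x. f (g x))"
 unfolding bdd_meas_def by (blast intro: measurable_compose[of g M N f borel] dest: measurable_space[of g])

lemma bdd_meas_fst: "bdd_meas M f ==> bdd_meas (M \<Otimes>\<^sub>M N) (%z. f (fst z))"
 by (rule bdd_meas_compose) auto

lemma bdd_meas_snd: "bdd_meas N f ==> bdd_meas (M \<Otimes>\<^sub>M N) (%z. f (snd z))"
 by (rule bdd_meas_compose) auto

lemmas bdd_meas_arith = bdd_meas_const bdd_meas_add bdd_meas_mult bdd_meas_minus bdd_meas_diff
 bdd_meas_divide bdd_meas_abs bdd_meas_power bdd_meas_sum bdd_meas_prod bdd_meas_exp

lemmas bdd_meas_intros = bdd_meas_arith bdd_meas_fst bdd_meas_snd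

lemma (in finite_measure) bdd_meas_integrable: "bdd_meas M f ==> integrable M f"
 unfolding bdd_meas_def
 by (elim conjE exE) (rule integrable_const_bound, auto)

lemma (in prob_space) bdd_meas_exp_pos:
 assumes "bdd_meas M f" shows "(\<integral>x. exp (f x) \<partial>M) > 0"
proof -
 obtain C where C: "\<forall>x\<in>space M. \<bar>f x\<bar> <= C" using assms unfolding bdd_meas_def by blast
 have "exp (- C) <= (\<integral>x. exp (f x) \<partial>M)"
 proof (rule integral_ge_const)
  show "integrable M (%x. exp (f x))"
   by (intro bdd_meas_integrable bdd_meas_exp assms)
  show "AE x in M. exp (- C) <= exp (f x)"
  proof (rule AE_I2)
   fix x assume "x \<in> space M"
   then have "\<bar>f x\<bar> <= C" using C by blast
   then show "exp (- C) <= exp (f x)" by simp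
  qed
 qed
 then show ?thesis by (rule order.strict_trans2[rotated]) simp
qed

text \<open>The exponential series is integrated term by term, so positivity of an average with
  weight \<open>exp S\<close> reduces to positivity of moments, which is algebra.\<close>

lemma (in finite_measure) integral_mult_exp_nonneg:
 assumes T: "bdd_meas M T" and S: "bdd_meas M S"
  and nn: "\<And>j. (\<integral>x. T x * S x ^ j \<partial>M) \<ge> 0"
 shows "(\<integral>x. T x * exp (S x) \<partial>M) \<ge> 0"
proof -
 obtain C D where C: "\<forall>x\<in>space M. \<bar>T x\<bar> <= C" and D: "\<forall>x\<in>space M. \<bar>S x\<bar> <= D"
  using T S unfolding bdd_meas_def by blast
 define F where "F n x = (\<Sum>j<n. T x * S x ^ j / fact j)" for n x
 have bF: "bdd_meas M (F n)" for n
  unfolding F_def by (intro bdd_meas_intros T S)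
 have lim: "(%n. \<integral>x. F n x \<partial>M) \<longlonglongrightarrow> (\<integral>x. T x * exp (S x) \<partial>M)"
 \<comment> \<open>With C bounding |T| and D bounding |S|, every partial sum is at most C times a
   partial sum of the series of \<open>exp D\<close>.\<close>
 proof (rule integral_dominated_convergence[where w="%_. C * exp D"])
  show "(%x. T x * exp (S x)) \<in> borel_measurable M"
   by (intro bdd_meas_measurable bdd_meas_intros T S)
  show "F n \<in> borel_measurable M" for n by (intro bdd_meas_measurable bF)
  show "integrable M (%_. C * exp D)" by simp
  show "AE x in M. (%n. F n x) \<longlonglongrightarrow> T x * exp (S x)"
  proof (rule AE_I2)
   fix x
   have "(%j. S x ^ j /\<^sub>R fact j) sums exp (S x)" by (rule exp_converges)
   then have "(%j. T x * (S x ^ j /\<^sub>R fact j)) sums (T x * exp (S x))"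
    by (rule sums_mult)
   then show "(%n. F n x) \<longlonglongrightarrow> T x * exp (S x)"
    unfolding sums_def F_def by (simp add: field_simps)
  qed
  show "AE x in M. norm (F n x) <= C * exp D" for n
  proof (rule AE_I2)
   fix x assume x: "x \<in> space M"
   have "\<bar>F n x\<bar> <= (\<Sum>j<n. \<bar>T x\<bar> * (\<bar>S x\<bar> ^ j / fact j))"
    unfolding F_def by (rule order.trans[OF sum_abs]) (simp add: abs_mult power_abs)
   also have "... <= (\<Sum>j<n. C * (D ^ j / fact j))"
    using C D x by (intro sum_mono mult_mono divide_right_mono power_mono)
     (auto intro: order.trans[OF abs_ge_zero])
   also have "... = C * (\<Sum>j<n. D ^ j /\<^sub>R fact j)"
    by (simp add: sum_distrib_left field_simps)
   also have "... <= C * exp D"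
   proof (rule mult_left_mono)
    have D0: "0 <= D" using D x by (meson abs_ge_zero order.trans)
    have "(%j. D ^ j /\<^sub>R fact j) sums exp D" by (rule exp_converges)
    then show "(\<Sum>j<n. D ^ j /\<^sub>R fact j) <= exp D"
     using sum_le_suminf[of "%j. D ^ j /\<^sub>R fact j" "{..<n}"] D0
     by (simp add: sums_iff)
    show "0 <= C" using C x by (meson abs_ge_zero order.trans)
   qed
   finally show "norm (F n x) <= C * exp D" by simp
  qed
 qed
 have "(\<integral>x. F n x \<partial>M) = (\<Sum>j<n. (\<integral>x. T x * S x ^ j \<partial>M) / fact j)" for n
  unfolding F_def
  by (subst Bochner_Integration.integral_sum)
    (auto intro!: bdd_meas_integrable bdd_meas_intros T S)
 then have "(\<integral>x. F n x \<partial>M) \<ge> 0" for n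
  using nn by (simp add: sum_nonneg)
 then show ?thesis by (intro LIMSEQ_le_const[OF lim]) auto
qed

text \<open>Exponentials of sums of squares \<open>h \<otimes> h\<close> are positive definite kernels.\<close>

lemma (in prob_space) reflection_positive:
 assumes g: "bdd_meas M g" and h: "\<And>i. i \<in> I ==> bdd_meas M (h i)"
 shows "(\<integral>z. g (fst z) * g (snd z) * exp (\<Sum>i\<in>I. h i (fst z) * h i (snd z)) \<partial>(M \<Otimes>\<^sub>M M)) \<ge> 0"
proof -
 interpret P: pair_prob_space M M ..
 \<comment> \<open>The claim is made for all \<open>g\<close>: in the induction one factor of the
   power is expanded and each of its terms is absorbed by replacing \<open>g\<close> with
   \<open>g\<close> times \<open>h k\<close>. For j = 0 the integral is a square.\<close>
 have main: "(\<integral>z. g (fst z) * g (snd z) * (\<Sum>i\<in>I. h i (fst z) * h i (snd z)) ^ j \<partial>(M \<Otimes>\<^sub>M M)) \<ge> 0"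
  if "bdd_meas M g" for g j
  using that
 proof (induction j arbitrary: g)
  case 0
  have "(\<integral>z. g (fst z) * g (snd z) \<partial>(M \<Otimes>\<^sub>M M)) = (\<integral>x. g x \<partial>M) * (\<integral>x. g x \<partial>M)"
  proof -
   have "(\<integral>z. g (fst z) * g (snd z) \<partial>(M \<Otimes>\<^sub>M M)) = (\<integral>x. (\<integral>y. g x * g y \<partial>M) \<partial>M)"
    by (subst P.integral_fst'[symmetric]) (auto intro!: P.bdd_meas_integrable bdd_meas_intros 0)
   then show ?thesis by simp
  qed
  then show ?case by simp
 next
  case (Suc j)
  have "(\<integral>z. g (fst z) * g (snd z) * (\<Sum>i\<in>I. h i (fst z) * h i (snd z)) ^ Suc j \<partial>(M \<Otimes>\<^sub>M M)) =
   (\<integral>z. (\<Sum>k\<in>I. (g (fst z) * h k (fst z)) * (g (snd z) * h k (snd z)) * (\<Sum>i\<in>I. h i (fst z) * h i (snd z)) ^ j) \<partial>(M \<Otimes>\<^sub>M M))"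
   by (intro Bochner_Integration.integral_cong refl)
    (simp add: sum_distrib_left sum_distrib_right mult_ac)
  also have "... = (\<Sum>k\<in>I. \<integral>z. (g (fst z) * h k (fst z)) * (g (snd z) * h k (snd z)) * (\<Sum>i\<in>I. h i (fst z) * h i (snd z)) ^ j \<partial>(M \<Otimes>\<^sub>M M))"
   by (intro Bochner_Integration.integral_sum P.bdd_meas_integrable bdd_meas_intros Suc.prems h)
  also have "... \<ge> 0"
   by (intro sum_nonneg Suc.IH bdd_meas_intros Suc.prems h)
  finally show ?case .
 qed
 show ?thesis
  by (intro P.integral_mult_exp_nonneg main bdd_meas_intros g h)
qed

text \<open>Only what the duplication of variables needs is postulated. \<open>halving\<close> says
  that every translation (x, y) of the target of (u, v) -> (u v, u / v) lifts to a translation (a,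
  b) of the source, that is a b = x and a / b = y. Since then a a = x y, this amounts to the
  existence of square roots. The instances are the product of circles and the divergence free flows
  on a torus.\<close>

locale ginibre_group = prob_space M for M :: "'g measure" +
 fixes mul :: "'g => 'g => 'g" and iv :: "'g => 'g"
 assumes mul_measurable: "(%z. mul (fst z) (snd z)) \<in> measurable (M \<Otimes>\<^sub>M M) M"
  and iv_measurable: "iv \<in> measurable M M"
  and invariant: "x \<in> space M ==> distr M M (mul x) = M"
  and mul_commute: "x \<in> space M ==> y \<in> space M ==> mul x y = mul y x"
  and halving: "x \<in> space M ==> y \<in> space M ==> \<exists>a\<in>space M. \<exists>b\<in>space M. \<forall>u\<in>space M. \<forall>v\<in>space M.
   mul x (mul u v) = mul (mul a u) (mul b v) \<and>
   mul y (mul u (iv v)) = mul (mul a u) (iv (mul b v))"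
begin

sublocale P: pair_prob_space M M ..

lemma mul_closed: "x \<in> space M ==> y \<in> space M ==> mul x y \<in> space M"
 using measurable_space[OF mul_measurable, of "(x, y)"] by (simp add: space_pair_measure)

lemma iv_closed: "x \<in> space M ==> iv x \<in> space M"
 using measurable_space[OF iv_measurable] .

lemma mul_left_measurable: "x \<in> space M ==> mul x \<in> measurable M M"
 using measurable_compose[OF measurable_Pair1' mul_measurable, of x] by simp

lemma integral_mul:
 fixes f :: "'g => real"
 assumes "x \<in> space M" "f \<in> borel_measurable M"
 shows "(\<integral>y. f (mul x y) \<partial>M) = (\<integral>y. f y \<partial>M)"
proof -
 have "(\<integral>y. f y \<partial>M) = (\<integral>y. f y \<partial>distr M M (mul x))"
  using invariant[OF assms(1)] by simp
 also have "... = (\<integral>y. f (mul x y) \<partial>M)"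
  by (rule integral_distr) (auto intro: mul_left_measurable assms)
 finally show ?thesis ..
qed

lemma integral_pair_iterated:
 assumes "bdd_meas (M \<Otimes>\<^sub>M M) f"
 shows "(\<integral>z. f z \<partial>(M \<Otimes>\<^sub>M M)) = (\<integral>x. (\<integral>y. f (x, y) \<partial>M) \<partial>M)"
 by (subst P.integral_fst'[symmetric]) (auto intro!: P.bdd_meas_integrable assms)

lemma integral_pair_mul:
 assumes f: "bdd_meas (M \<Otimes>\<^sub>M M) f" and ab: "a \<in> space M" "b \<in> space M"
 shows "(\<integral>z. f (mul a (fst z), mul b (snd z)) \<partial>(M \<Otimes>\<^sub>M M)) = (\<integral>z. f z \<partial>(M \<Otimes>\<^sub>M M))"
proof -
 have m: "(%z. (mul a (fst z), mul b (snd z))) \<in> measurable (M \<Otimes>\<^sub>M M) (M \<Otimes>\<^sub>M M)"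
  using ab by (auto intro!: measurable_Pair measurable_compose[OF measurable_fst]
    measurable_compose[OF measurable_snd] mul_left_measurable)
 have fb: "bdd_meas (M \<Otimes>\<^sub>M M) (%z. f (mul a (fst z), mul b (snd z)))"
  by (rule bdd_meas_compose[OF f m])
 have sec: "(%y. f (x, y)) \<in> borel_measurable M" if "x \<in> space M" for x
  using bdd_meas_measurable[OF f] that by measurable
 have "(\<integral>z. f (mul a (fst z), mul b (snd z)) \<partial>(M \<Otimes>\<^sub>M M)) =
   (\<integral>x. (\<integral>y. f (mul a x, mul b y) \<partial>M) \<partial>M)"
  by (subst integral_pair_iterated[OF fb]) simp
 also have "... = (\<integral>x. (\<integral>y. f (mul a x, y) \<partial>M) \<partial>M)"
  by (intro Bochner_Integration.integral_cong refl integral_mul ab sec mul_closed)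
 also have "... = (\<integral>x. (\<integral>y. f (x, y) \<partial>M) \<partial>M)"
  by (rule integral_mul[OF ab(1), where f="%x. (\<integral>y. f (x, y) \<partial>M)"])
   (use bdd_meas_measurable[OF f] in measurable)
 also have "... = (\<integral>z. f z \<partial>(M \<Otimes>\<^sub>M M))"
  by (subst integral_pair_iterated[OF f]) simp
 finally show ?thesis .
qed

text \<open>
 The map \<open>(u, v) \<mapsto> (u v, u / v)\<close> preserves the square of the Haar measure: averaging over the
 translations of the target, each of which lifts to a translation of the source.
\<close>

lemma duplication:
 assumes f: "bdd_meas (M \<Otimes>\<^sub>M M) f"
 shows "(\<integral>z. f z \<partial>(M \<Otimes>\<^sub>M M)) =
  (\<integral>z. f (mul (fst z) (snd z), mul (fst z) (iv (snd z))) \<partial>(M \<Otimes>\<^sub>M M))"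
proof -
 let ?P = "M \<Otimes>\<^sub>M M"
 define \<Psi> where "\<Psi> z = (mul (fst z) (snd z), mul (fst z) (iv (snd z)))" for z
 have m1: "(%z. mul (fst z) (iv (snd z))) \<in> measurable ?P M"
  using measurable_compose[OF _ mul_measurable, of "%z. (fst z, iv (snd z))" ?P]
  by (simp add: iv_measurable measurable_Pair measurable_compose[OF measurable_snd iv_measurable])
 have m\<Psi>: "\<Psi> \<in> measurable ?P ?P"
  unfolding \<Psi>_def using mul_measurable m1 by (rule measurable_Pair)
 interpret PP: pair_prob_space ?P ?P ..
 define T where "T w = (mul (fst (fst w)) (fst (snd w)), mul (snd (fst w)) (snd (snd w)))" for w :: "('g \<times> 'g) \<times> ('g \<times> 'g)"
 have mT: "T \<in> measurable (?P \<Otimes>\<^sub>M ?P) ?P"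
  unfolding T_def
  using measurable_compose[OF _ mul_measurable, of "%w. (fst (fst w), fst (snd w))" "?P \<Otimes>\<^sub>M ?P"]
   measurable_compose[OF _ mul_measurable, of "%w. (snd (fst w), snd (snd w))" "?P \<Otimes>\<^sub>M ?P"]
  by (intro measurable_Pair) simp_all
 \<comment> \<open>\<open>G (z, y)\<close> is \<open>f\<close> at the product of y and
   \<open>\<Psi> z\<close>. Integrating over y first removes \<open>\<Psi> z\<close> by invariance
   (\<open>B\<close>); integrating over z first removes y by \<open>halving\<close>
   (\<open>A\<close>).\<close>
 define G where "G w = f (T (snd w, \<Psi> (fst w)))" for w
 have mG: "(%w. T (snd w, \<Psi> (fst w))) \<in> measurable (?P \<Otimes>\<^sub>M ?P) ?P"
  by (intro measurable_compose[OF _ mT] measurable_Pair measurable_snd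
    measurable_compose[OF measurable_fst m\<Psi>])
 have GB: "bdd_meas (?P \<Otimes>\<^sub>M ?P) G"
  unfolding G_def by (rule bdd_meas_compose[OF f mG])
 have b\<Psi>: "bdd_meas ?P (%z. f (\<Psi> z))" by (rule bdd_meas_compose[OF f m\<Psi>])
 have A: "(\<integral>z. G (z, y) \<partial>?P) = (\<integral>z. f (\<Psi> z) \<partial>?P)" if y: "y \<in> space ?P" for y
 proof -
  obtain y1 y2 where yy: "y = (y1, y2)" "y1 \<in> space M" "y2 \<in> space M"
   using y by (auto simp: space_pair_measure)
  obtain a b where ab: "a \<in> space M" "b \<in> space M"
   and eq: "\<And>u v. u \<in> space M ==> v \<in> space M ==>
    mul y1 (mul u v) = mul (mul a u) (mul b v) \<and>
    mul y2 (mul u (iv v)) = mul (mul a u) (iv (mul b v))"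
   using halving[OF yy(2,3)] by blast
  have "(\<integral>z. G (z, y) \<partial>?P) = (\<integral>z. f (\<Psi> (mul a (fst z), mul b (snd z))) \<partial>?P)"
   by (intro Bochner_Integration.integral_cong refl)
    (auto simp: G_def T_def \<Psi>_def yy(1) space_pair_measure eq)
  also have "... = (\<integral>z. f (\<Psi> z) \<partial>?P)"
   by (rule integral_pair_mul[OF b\<Psi> ab])
  finally show ?thesis .
 qed
 have B: "(\<integral>y. G (z, y) \<partial>?P) = (\<integral>y. f y \<partial>?P)" if z: "z \<in> space ?P" for z
 proof -
  have zz: "fst z \<in> space M" "snd z \<in> space M" using z by (auto simp: space_pair_measure)
  have c: "fst (\<Psi> z) \<in> space M" "snd (\<Psi> z) \<in> space M"
   unfolding \<Psi>_def using zz by (auto intro: mul_closed iv_closed)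
  have "(\<integral>y. G (z, y) \<partial>?P) = (\<integral>y. f (mul (fst (\<Psi> z)) (fst y), mul (snd (\<Psi> z)) (snd y)) \<partial>?P)"
   by (intro Bochner_Integration.integral_cong refl)
    (auto simp: G_def T_def space_pair_measure c mul_commute)
  also have "... = (\<integral>y. f y \<partial>?P)" by (rule integral_pair_mul[OF f c])
  finally show ?thesis .
 qed
 have "(\<integral>y. f y \<partial>?P) = (\<integral>z. (\<integral>y. G (z, y) \<partial>?P) \<partial>?P)"
  using B by (simp add: P.prob_space cong: Bochner_Integration.integral_cong)
 also have "... = (\<integral>y. (\<integral>z. G (z, y) \<partial>?P) \<partial>?P)"
  using PP.Fubini_integral[of "%z y. G (z, y)"] PP.P.bdd_meas_integrable[OF GB] by simp
 also have "... = (\<integral>z. f (\<Psi> z) \<partial>?P)"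
  using A by (simp add: P.prob_space cong: Bochner_Integration.integral_cong)
 finally show ?thesis unfolding \<Psi>_def .
qed

text \<open>The locale states no inverse law, so compatibility with \<open>iv\<close> is made part
  of the notion.\<close>

definition character :: "('g => complex) => bool" where
 "character \<xi> \<longleftrightarrow> \<xi> \<in> borel_measurable M \<and> (\<forall>x\<in>space M. norm (\<xi> x) = 1) \<and>
   (\<forall>x\<in>space M. \<forall>y\<in>space M. \<xi> (mul x y) = \<xi> x * \<xi> y) \<and> (\<forall>x\<in>space M. \<xi> (iv x) = cnj (\<xi> x))"

lemma character_mult: "character \<xi> ==> character \<psi> ==> character (%x. \<xi> x * \<psi> x)"
 unfolding character_def by (auto simp: norm_mult)

lemma character_cnj: "character \<xi> ==> character (%x. cnj (\<xi> x))"
 unfolding character_def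
 by (auto intro!: measurable_compose[OF _ borel_measurable_continuous_onI[of cnj]] continuous_intros)

lemma character_one: "character (%x. 1)"
 unfolding character_def by auto

lemma character_prod: "(\<And>i. i \<in> I ==> character (\<xi> i)) ==> character (%x. \<Prod>i\<in>I. \<xi> i x)"
 by (induction I rule: infinite_finite_induct) (auto intro: character_one character_mult)

lemma bdd_meas_Re_character:
 assumes "character \<xi>" "norm c = 1" shows "bdd_meas M (%x. Re (c * \<xi> x))"
proof (rule bdd_measI[where C=1])
 have "\<xi> \<in> borel_measurable M" using assms unfolding character_def by blast
 then show "(%x. Re (c * \<xi> x)) \<in> borel_measurable M" by measurable
 show "\<bar>Re (c * \<xi> x)\<bar> <= 1" if "x \<in> space M" for x
  using assms that abs_Re_le_cmod[of "c * \<xi> x"] unfolding character_def by (simp add: norm_mult)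
qed

lemma bdd_meas_Im_character:
 assumes "character \<xi>" "norm c = 1" shows "bdd_meas M (%x. Im (c * \<xi> x))"
proof (rule bdd_measI[where C=1])
 have "\<xi> \<in> borel_measurable M" using assms unfolding character_def by blast
 then show "(%x. Im (c * \<xi> x)) \<in> borel_measurable M" by measurable
 show "\<bar>Im (c * \<xi> x)\<bar> <= 1" if "x \<in> space M" for x
  using assms that abs_Im_le_cmod[of "c * \<xi> x"] unfolding character_def by (simp add: norm_mult)
qed

lemmas bdd_meas_character = bdd_meas_Re_character[of _ 1, simplified] bdd_meas_Im_character[of _ 1, simplified]

text \<open>Orthogonality of characters: translation by \<open>a\<close> multiplies the complex
  integral by \<open>\<xi> a\<close>, which differs from 1. Real and imaginary part are followed
  separately and reassembled at the end.\<close>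

lemma integral_Re_character_zero:
 assumes \<xi>: "character \<xi>" and a: "a \<in> space M" "\<xi> a \<noteq> 1"
 shows "(\<integral>x. Re (\<xi> x) \<partial>M) = 0"
proof -
 have m: "\<xi> \<in> borel_measurable M" using \<xi> unfolding character_def by blast
 let ?r = "\<integral>x. Re (\<xi> x) \<partial>M" and ?s = "\<integral>x. Im (\<xi> x) \<partial>M"
 note ints = bdd_meas_integrable[OF bdd_meas_character(1)[OF \<xi>]]
  bdd_meas_integrable[OF bdd_meas_character(2)[OF \<xi>]]
 have hom: "\<xi> (mul a x) = \<xi> a * \<xi> x" if "x \<in> space M" for x
  using \<xi> a that unfolding character_def by blast
 have "?r = (\<integral>x. Re (\<xi> (mul a x)) \<partial>M)"
  by (rule integral_mul[OF a(1), symmetric]) (use m in measurable)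
 also have "... = (\<integral>x. Re (\<xi> a) * Re (\<xi> x) - Im (\<xi> a) * Im (\<xi> x) \<partial>M)"
  by (intro Bochner_Integration.integral_cong refl) (simp add: hom)
 finally have 1: "?r = Re (\<xi> a) * ?r - Im (\<xi> a) * ?s" using ints by simp
 have "?s = (\<integral>x. Im (\<xi> (mul a x)) \<partial>M)"
  by (rule integral_mul[OF a(1), symmetric]) (use m in measurable)
 also have "... = (\<integral>x. Re (\<xi> a) * Im (\<xi> x) + Im (\<xi> a) * Re (\<xi> x) \<partial>M)"
  by (intro Bochner_Integration.integral_cong refl) (simp add: hom)
 finally have 2: "?s = Re (\<xi> a) * ?s + Im (\<xi> a) * ?r" using ints by simp
 have "Complex ?r ?s = \<xi> a * Complex ?r ?s"
  using 1 2 by (simp add: complex_eq_iff)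
 then have "(1 - \<xi> a) * Complex ?r ?s = 0" by (simp add: algebra_simps)
 then have "Complex ?r ?s = 0" using a by simp
 then show ?thesis by (simp add: complex_eq_iff)
qed

lemma integral_Re_character_nonneg:
 assumes "character \<xi>" shows "(\<integral>x. Re (\<xi> x) \<partial>M) \<ge> 0"
proof (cases "\<forall>x\<in>space M. \<xi> x = 1")
 case True
 then have "(\<integral>x. Re (\<xi> x) \<partial>M) = (\<integral>x. 1 \<partial>M)" by (intro Bochner_Integration.integral_cong) auto
 then show ?thesis by simp
next
 case False
 then show ?thesis using integral_Re_character_zero[OF assms] by fastforce
qed

lemma integral_pair_product:
 assumes "bdd_meas M f" "bdd_meas M g"
 shows "(\<integral>z. f (fst z) * g (snd z) \<partial>(M \<Otimes>\<^sub>M M)) = (\<integral>x. f x \<partial>M) * (\<integral>x. g x \<partial>M)"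
 by (subst integral_pair_iterated) (auto intro!: bdd_meas_intros assms)

text \<open>Unit phases in the couplings and in the observable can only lower the expectation. A
  square root d of each phase is shared evenly by the two variables after duplication: the
  difference of the observables becomes a product of two imaginary parts, and the sum of the two
  energies a sum of products of real parts with nonnegative coefficients, which is the situation of
  \<open>reflection_positive\<close>. The phases later come from a frozen flow on the torus.\<close>

lemma ginibre_phase:
 assumes \<xi>: "character \<xi>" and \<xi>i: "\<And>i. i \<in> I ==> character (\<phi> i)"
  and b: "\<And>i. i \<in> I ==> b i \<ge> 0" and c: "norm c = 1" and ci: "\<And>i. i \<in> I ==> norm (k i) = 1"
 shows "(\<integral>x. Re (c * \<xi> x) * exp (\<Sum>i\<in>I. b i * Re (k i * \<phi> i x)) \<partial>M) *
   (\<integral>x. exp (\<Sum>i\<in>I. b i * Re (\<phi> i x)) \<partial>M)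
  <= (\<integral>x. Re (\<xi> x) * exp (\<Sum>i\<in>I. b i * Re (\<phi> i x)) \<partial>M) *
   (\<integral>x. exp (\<Sum>i\<in>I. b i * Re (k i * \<phi> i x)) \<partial>M)"
proof -
 define A where "A x = exp (\<Sum>i\<in>I. b i * Re (\<phi> i x))" for x
 define Ak where "Ak x = exp (\<Sum>i\<in>I. b i * Re (k i * \<phi> i x))" for x
 have bA: "bdd_meas M A" "bdd_meas M Ak"
  unfolding A_def Ak_def
  by (intro bdd_meas_intros bdd_meas_character bdd_meas_Re_character \<xi>i ci; assumption)+
 have bR: "bdd_meas M (%x. Re (\<xi> x))" "bdd_meas M (%x. Re (c * \<xi> x))"
  by (intro bdd_meas_character bdd_meas_Re_character \<xi> c)+
 define f where "f z = (Re (\<xi> (snd z)) - Re (c * \<xi> (fst z))) * (Ak (fst z) * A (snd z))" for z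
 have bf: "bdd_meas (M \<Otimes>\<^sub>M M) f"
  unfolding f_def by (intro bdd_meas_intros bR bA)
 define w where "w = csqrt c"
 define wi where "wi i = csqrt (k i)" for i
 have w: "norm w = 1" "w * w = c"
  unfolding w_def using c by (auto simp: power2_eq_square[symmetric])
 have wi: "norm (wi i) = 1" "wi i * wi i = k i" if "i \<in> I" for i
  unfolding wi_def using ci[OF that] by (auto simp: power2_eq_square[symmetric])
 have id: "Re (d * d * (p * q)) + Re (p * cnj q) = 2 * Re (d * p) * Re (d * q)"
   "Re (p * cnj q) - Re (d * d * (p * q)) = 2 * Im (d * p) * Im (d * q)" if "norm d = 1" for d p q :: complex
 proof -
  have d: "d * cnj d = 1"
   using that by (metis complex_norm_square of_real_1 power_one)
  have e: "p * cnj q = (d * p) * cnj (d * q)"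
  proof -
   have "(d * p) * cnj (d * q) = (d * cnj d) * (p * cnj q)" by (simp only: complex_cnj_mult ac_simps)
   then show ?thesis using d by simp
  qed
  have e2: "d * d * (p * q) = (d * p) * (d * q)" by (simp only: ac_simps)
  have "Re (X * Y) + Re (X * cnj Y) = 2 * Re X * Re Y" "Re (X * cnj Y) - Re (X * Y) = 2 * Im X * Im Y" for X Y
   by simp_all
  then show "Re (d * d * (p * q)) + Re (p * cnj q) = 2 * Re (d * p) * Re (d * q)"
   "Re (p * cnj q) - Re (d * d * (p * q)) = 2 * Im (d * p) * Im (d * q)"
   unfolding e e2 by blast+
 qed
 have hom: "\<psi> (mul u v) = \<psi> u * \<psi> v" "\<psi> (mul u (iv v)) = \<psi> u * cnj (\<psi> v)"
  if "character \<psi>" "u \<in> space M" "v \<in> space M" for \<psi> u v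
  using that iv_closed[of v] unfolding character_def by auto
 have "(\<integral>z. f z \<partial>(M \<Otimes>\<^sub>M M)) = (\<integral>z. f (mul (fst z) (snd z), mul (fst z) (iv (snd z))) \<partial>(M \<Otimes>\<^sub>M M))"
  by (rule duplication[OF bf])
 also have "... = (\<integral>z. (sqrt 2 * Im (w * \<xi> (fst z))) * (sqrt 2 * Im (w * \<xi> (snd z))) *
   exp (\<Sum>i\<in>I. (sqrt (2 * b i) * Re (wi i * \<phi> i (fst z))) * (sqrt (2 * b i) * Re (wi i * \<phi> i (snd z)))) \<partial>(M \<Otimes>\<^sub>M M))"
 proof (intro Bochner_Integration.integral_cong refl)
  fix z assume "z \<in> space (M \<Otimes>\<^sub>M M)"
  then have z: "fst z \<in> space M" "snd z \<in> space M" by (auto simp: space_pair_measure)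
  have 1: "Re (\<xi> (mul (fst z) (iv (snd z)))) - Re (c * \<xi> (mul (fst z) (snd z))) =
    (sqrt 2 * Im (w * \<xi> (fst z))) * (sqrt 2 * Im (w * \<xi> (snd z)))"
  proof -
   have "(sqrt 2 * Im (w * \<xi> (fst z))) * (sqrt 2 * Im (w * \<xi> (snd z))) =
    (sqrt 2 * sqrt 2) * Im (w * \<xi> (fst z)) * Im (w * \<xi> (snd z))" by (simp only: ac_simps)
   also have "... = 2 * Im (w * \<xi> (fst z)) * Im (w * \<xi> (snd z))" by (simp only: real_sqrt_mult_self abs_numeral)
   also have "... = Re (\<xi> (fst z) * cnj (\<xi> (snd z))) - Re (c * (\<xi> (fst z) * \<xi> (snd z)))"
    using id(2)[OF w(1), of "\<xi> (fst z)" "\<xi> (snd z)"] unfolding w(2) by simp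
   finally show ?thesis
    unfolding hom[OF \<xi> z] by simp
  qed
  have 2: "Ak (mul (fst z) (snd z)) * A (mul (fst z) (iv (snd z))) =
    exp (\<Sum>i\<in>I. (sqrt (2 * b i) * Re (wi i * \<phi> i (fst z))) * (sqrt (2 * b i) * Re (wi i * \<phi> i (snd z))))"
   unfolding Ak_def A_def exp_add[symmetric] sum.distrib[symmetric]
  proof (intro arg_cong[where f=exp] sum.cong refl)
   fix i assume i: "i \<in> I"
   have "(sqrt (2 * b i) * Re (wi i * \<phi> i (fst z))) * (sqrt (2 * b i) * Re (wi i * \<phi> i (snd z))) =
    (sqrt (2 * b i) * sqrt (2 * b i)) * Re (wi i * \<phi> i (fst z)) * Re (wi i * \<phi> i (snd z))"
    by (simp only: ac_simps)
   also have "... = b i * (2 * Re (wi i * \<phi> i (fst z)) * Re (wi i * \<phi> i (snd z)))"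
    using b[OF i] by simp
   also have "... = b i * (Re (k i * (\<phi> i (fst z) * \<phi> i (snd z))) + Re (\<phi> i (fst z) * cnj (\<phi> i (snd z))))"
    using id(1)[OF wi(1)[OF i], of "\<phi> i (fst z)" "\<phi> i (snd z)"] wi(2)[OF i] by simp
   finally show "b i * Re (k i * \<phi> i (mul (fst z) (snd z))) + b i * Re (\<phi> i (mul (fst z) (iv (snd z)))) =
     (sqrt (2 * b i) * Re (wi i * \<phi> i (fst z))) * (sqrt (2 * b i) * Re (wi i * \<phi> i (snd z)))"
    using hom[OF \<xi>i[OF i] z] by (simp only: distrib_left)
  qed
  show "f (mul (fst z) (snd z), mul (fst z) (iv (snd z))) =
   (sqrt 2 * Im (w * \<xi> (fst z))) * (sqrt 2 * Im (w * \<xi> (snd z))) *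
   exp (\<Sum>i\<in>I. (sqrt (2 * b i) * Re (wi i * \<phi> i (fst z))) * (sqrt (2 * b i) * Re (wi i * \<phi> i (snd z))))"
   unfolding f_def fst_conv snd_conv by (simp only: 1 2)
 qed
 also have "... \<ge> 0"
  by (intro reflection_positive bdd_meas_cmult bdd_meas_Im_character bdd_meas_Re_character \<xi> \<xi>i w wi)
 finally have "0 <= (\<integral>z. f z \<partial>(M \<Otimes>\<^sub>M M))" .
 also have "... = (\<integral>z. Ak (fst z) * (Re (\<xi> (snd z)) * A (snd z)) - (Re (c * \<xi> (fst z)) * Ak (fst z)) * A (snd z) \<partial>(M \<Otimes>\<^sub>M M))"
  unfolding f_def by (intro Bochner_Integration.integral_cong refl) (simp add: algebra_simps)
 also have "... = (\<integral>z. Ak (fst z) * (Re (\<xi> (snd z)) * A (snd z)) \<partial>(M \<Otimes>\<^sub>M M)) -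
   (\<integral>z. (Re (c * \<xi> (fst z)) * Ak (fst z)) * A (snd z) \<partial>(M \<Otimes>\<^sub>M M))"
  by (intro Bochner_Integration.integral_diff P.bdd_meas_integrable bdd_meas_intros bR bA)
 also have "... = (\<integral>x. Ak x \<partial>M) * (\<integral>x. Re (\<xi> x) * A x \<partial>M) - (\<integral>x. Re (c * \<xi> x) * Ak x \<partial>M) * (\<integral>x. A x \<partial>M)"
  by (subst (1 2) integral_pair_product) (intro bdd_meas_intros bR bA refl)+
 finally show ?thesis unfolding A_def Ak_def by (simp add: mult.commute)
qed

text \<open>After duplication a Re (u v) + b Re (u / v) equals (a + b) Re u Re v + (b - a) Im u Im
  v, and both coefficients are nonnegative when 0 <= a <= b. The boolean in the index of
  \<open>h\<close> distinguishes these two squares.\<close>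

lemma ginibre_mono:
 assumes \<xi>: "character \<xi>" and \<xi>i: "\<And>i. i \<in> I ==> character (\<phi> i)"
  and a: "\<And>i. i \<in> I ==> 0 <= a i" and b: "\<And>i. i \<in> I ==> a i <= b i" and fin: "finite I"
 shows "(\<integral>x. Re (\<xi> x) * exp (\<Sum>i\<in>I. a i * Re (\<phi> i x)) \<partial>M) *
   (\<integral>x. exp (\<Sum>i\<in>I. b i * Re (\<phi> i x)) \<partial>M)
  <= (\<integral>x. Re (\<xi> x) * exp (\<Sum>i\<in>I. b i * Re (\<phi> i x)) \<partial>M) *
   (\<integral>x. exp (\<Sum>i\<in>I. a i * Re (\<phi> i x)) \<partial>M)"
proof -
 define A where "A x = exp (\<Sum>i\<in>I. a i * Re (\<phi> i x))" for x
 define B where "B x = exp (\<Sum>i\<in>I. b i * Re (\<phi> i x))" for x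
 have bA: "bdd_meas M A" "bdd_meas M B"
  unfolding A_def B_def
  by (intro bdd_meas_intros bdd_meas_character \<xi>i; assumption)+
 have bR: "bdd_meas M (%x. Re (\<xi> x))"
  by (intro bdd_meas_character \<xi>)
 define f where "f z = (Re (\<xi> (snd z)) - Re (\<xi> (fst z))) * (A (fst z) * B (snd z))" for z
 have bf: "bdd_meas (M \<Otimes>\<^sub>M M) f"
  unfolding f_def by (intro bdd_meas_intros bR bA)
 define h where "h j x = (if snd j then sqrt (a (fst j) + b (fst j)) * Re (\<phi> (fst j) x)
   else sqrt (b (fst j) - a (fst j)) * Im (\<phi> (fst j) x))" for j :: "_ \<times> bool" and x
 have bh: "bdd_meas M (h j)" if "j \<in> I \<times> UNIV" for j
  using that unfolding h_def by (cases j; cases "snd j") (auto intro!: bdd_meas_cmult bdd_meas_character \<xi>i)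
 have hom: "\<psi> (mul u v) = \<psi> u * \<psi> v" "\<psi> (mul u (iv v)) = \<psi> u * cnj (\<psi> v)"
  if "character \<psi>" "u \<in> space M" "v \<in> space M" for \<psi> u v
  using that iv_closed[of v] unfolding character_def by auto
 have "(\<integral>z. f z \<partial>(M \<Otimes>\<^sub>M M)) = (\<integral>z. f (mul (fst z) (snd z), mul (fst z) (iv (snd z))) \<partial>(M \<Otimes>\<^sub>M M))"
  by (rule duplication[OF bf])
 also have "... = (\<integral>z. (sqrt 2 * Im (\<xi> (fst z))) * (sqrt 2 * Im (\<xi> (snd z))) *
   exp (\<Sum>j\<in>I \<times> UNIV. h j (fst z) * h j (snd z)) \<partial>(M \<Otimes>\<^sub>M M))"
 proof (intro Bochner_Integration.integral_cong refl)
  fix z assume "z \<in> space (M \<Otimes>\<^sub>M M)"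
  then have z: "fst z \<in> space M" "snd z \<in> space M" by (auto simp: space_pair_measure)
  have 1: "Re (\<xi> (mul (fst z) (iv (snd z)))) - Re (\<xi> (mul (fst z) (snd z))) =
    (sqrt 2 * Im (\<xi> (fst z))) * (sqrt 2 * Im (\<xi> (snd z)))"
  proof -
   have "(sqrt 2 * Im (\<xi> (fst z))) * (sqrt 2 * Im (\<xi> (snd z))) =
    (sqrt 2 * sqrt 2) * Im (\<xi> (fst z)) * Im (\<xi> (snd z))" by (simp only: ac_simps)
   then show ?thesis
    using hom[OF \<xi> z] by simp
  qed
  have 2: "A (mul (fst z) (snd z)) * B (mul (fst z) (iv (snd z))) =
    exp (\<Sum>j\<in>I \<times> UNIV. h j (fst z) * h j (snd z))"
  proof -
   have split: "(\<Sum>j\<in>I \<times> UNIV. h j (fst z) * h j (snd z)) = (\<Sum>i\<in>I. \<Sum>s\<in>UNIV. h (i, s) (fst z) * h (i, s) (snd z))"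
    by (simp add: sum.cartesian_product case_prod_unfold)
   show ?thesis unfolding split A_def B_def exp_add[symmetric] sum.distrib[symmetric]
  proof (intro arg_cong[where f=exp] sum.cong refl)
   fix i assume i: "i \<in> I"
   have "(\<Sum>s\<in>UNIV. h (i, s) (fst z) * h (i, s) (snd z)) =
    (sqrt (a i + b i) * sqrt (a i + b i)) * Re (\<phi> i (fst z)) * Re (\<phi> i (snd z)) +
    (sqrt (b i - a i) * sqrt (b i - a i)) * Im (\<phi> i (fst z)) * Im (\<phi> i (snd z))"
    by (simp only: h_def UNIV_bool sum.insert finite.intros) (simp add: ac_simps)
   also have "... = (a i + b i) * Re (\<phi> i (fst z)) * Re (\<phi> i (snd z)) +
    (b i - a i) * Im (\<phi> i (fst z)) * Im (\<phi> i (snd z))"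
    using a[OF i] b[OF i] by simp
   finally show "a i * Re (\<phi> i (mul (fst z) (snd z))) + b i * Re (\<phi> i (mul (fst z) (iv (snd z)))) =
     (\<Sum>s\<in>UNIV. h (i, s) (fst z) * h (i, s) (snd z))"
    using hom[OF \<xi>i[OF i] z] by (simp add: algebra_simps)
  qed
  qed
  show "f (mul (fst z) (snd z), mul (fst z) (iv (snd z))) =
   (sqrt 2 * Im (\<xi> (fst z))) * (sqrt 2 * Im (\<xi> (snd z))) * exp (\<Sum>j\<in>I \<times> UNIV. h j (fst z) * h j (snd z))"
   unfolding f_def fst_conv snd_conv by (simp only: 1 2)
 qed
 also have "... \<ge> 0"
  by (intro reflection_positive bdd_meas_cmult bdd_meas_character \<xi> bh)
 finally have "0 <= (\<integral>z. f z \<partial>(M \<Otimes>\<^sub>M M))" .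
 also have "... = (\<integral>z. A (fst z) * (Re (\<xi> (snd z)) * B (snd z)) - (Re (\<xi> (fst z)) * A (fst z)) * B (snd z) \<partial>(M \<Otimes>\<^sub>M M))"
  unfolding f_def by (intro Bochner_Integration.integral_cong refl) (simp add: algebra_simps)
 also have "... = (\<integral>z. A (fst z) * (Re (\<xi> (snd z)) * B (snd z)) \<partial>(M \<Otimes>\<^sub>M M)) -
   (\<integral>z. (Re (\<xi> (fst z)) * A (fst z)) * B (snd z) \<partial>(M \<Otimes>\<^sub>M M))"
  by (intro Bochner_Integration.integral_diff P.bdd_meas_integrable bdd_meas_intros bR bA)
 also have "... = (\<integral>x. A x \<partial>M) * (\<integral>x. Re (\<xi> x) * B x \<partial>M) - (\<integral>x. Re (\<xi> x) * A x \<partial>M) * (\<integral>x. B x \<partial>M)"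
  by (subst (1 2) integral_pair_product) (intro bdd_meas_intros bR bA refl)+
 finally show ?thesis unfolding A_def B_def by (simp add: mult.commute)
qed

end

section \<open>The product of circles\<close>

definition circle_measure :: "complex measure" where
 "circle_measure = distr (uniform_measure lborel {0..<2 * pi}) (restrict_space borel (sphere 0 1)) cis"

lemma sets_circle_measure[measurable_cong]: "sets circle_measure = sets (restrict_space borel (sphere 0 1))"
 by (simp add: circle_measure_def)

lemma space_circle_measure: "space circle_measure = sphere 0 1"
 by (simp add: circle_measure_def space_restrict_space)

lemma cis_measurable: "cis \<in> measurable lborel (restrict_space borel (sphere 0 1))"
 by (rule measurable_restrict_space2) (auto intro!: borel_measurable_continuous_onI continuous_intros)

lemma emeasure_circle_measure:
 assumes A: "A \<in> sets circle_measure"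
 shows "emeasure circle_measure A =
  (\<integral>\<^sup>+t. indicator A (cis t) * indicator {0..<2*pi} t \<partial>lborel) / ennreal (2 * pi)"
proof -
 have m: "cis \<in> measurable (uniform_measure lborel {0..<2 * pi}) (restrict_space borel (sphere 0 1))"
  using cis_measurable by (simp add: measurable_def)
 have "cis -` A \<inter> space lborel \<in> sets lborel"
  using measurable_sets[OF cis_measurable] A by (simp add: sets_circle_measure)
 then have s: "cis -` A \<in> sets borel" by simp
 have "emeasure circle_measure A = emeasure (uniform_measure lborel {0..<2 * pi}) (cis -` A)"
  unfolding circle_measure_def using A
  by (subst emeasure_distr[OF m]) (auto simp: sets_circle_measure)
 also have "... = emeasure lborel ({0..<2 * pi} \<inter> cis -` A) / ennreal (2 * pi)"
  using s by (subst emeasure_uniform_measure) auto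
 also have "emeasure lborel ({0..<2 * pi} \<inter> cis -` A) = (\<integral>\<^sup>+t. indicator ({0..<2 * pi} \<inter> cis -` A) t \<partial>lborel)"
  using s by (subst nn_integral_indicator) auto
 also have "... = (\<integral>\<^sup>+t. indicator A (cis t) * indicator {0..<2*pi} t \<partial>lborel)"
  by (intro nn_integral_cong) (auto split: split_indicator)
 finally show ?thesis .
qed

interpretation circle: prob_space circle_measure
proof -
 have m: "cis \<in> measurable (uniform_measure lborel {0..<2 * pi}) (restrict_space borel (sphere 0 1))"
  using cis_measurable by (simp add: measurable_def)
 show "prob_space circle_measure"
  unfolding circle_measure_def
  by (intro prob_space.prob_space_distr[OF _ m] prob_space_uniform_measure) auto
qed

lemma indicator_cis_measurable:
 assumes A: "A \<in> sets circle_measure"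
 shows "(%t. indicator A (cis t) :: ennreal) \<in> borel_measurable lborel"
proof -
 have "cis -` A \<inter> space lborel \<in> sets lborel"
  using measurable_sets[OF cis_measurable] A by (simp add: sets_circle_measure)
 then have "(indicator (cis -` A) :: real => ennreal) \<in> borel_measurable lborel" by simp
 moreover have "(%t. indicator A (cis t) :: ennreal) = indicator (cis -` A)"
  by (auto simp: indicator_def fun_eq_iff)
 ultimately show ?thesis by simp
qed

lemma mult_measurable_circle:
 assumes "norm w = 1" shows "(*) w \<in> measurable circle_measure circle_measure"
proof -
 have "(%z. w * z) \<in> measurable (restrict_space borel (sphere 0 1)) (restrict_space borel (sphere 0 1))"
  using assms by (intro measurable_restrict_space2 measurable_restrict_space1)
   (auto simp: norm_mult space_restrict_space)
 then show ?thesis by (simp cong: measurable_cong_sets add: sets_circle_measure)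
qed

lemma cnj_measurable_circle: "cnj \<in> measurable circle_measure circle_measure"
proof -
 have "cnj \<in> measurable (restrict_space borel (sphere 0 1)) (restrict_space borel (sphere 0 1))"
  by (intro measurable_restrict_space2 measurable_restrict_space1 borel_measurable_continuous_onI)
   (auto simp: space_restrict_space intro!: continuous_intros)
 then show ?thesis by (simp cong: measurable_cong_sets add: sets_circle_measure)
qed

text \<open>With the angle of \<open>w\<close> taken in [0, 2 pi), the shifted interval overshoots 2
  pi in a single piece, which periodicity of \<open>cis\<close> moves back to the start.\<close>

lemma circle_rotation:
 assumes "norm w = 1" shows "distr circle_measure circle_measure ((*) w) = circle_measure"
proof (rule measure_eqI)
 fix A assume "A \<in> sets (distr circle_measure circle_measure ((*) w))"
 then have A: "A \<in> sets circle_measure" by simp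
 define a where "a = Arg2pi w"
 have a: "0 <= a" "a < 2 * pi" "w = cis a"
  unfolding a_def using Arg2pi[of w] assms by (auto simp: cis_conv_exp is_Arg_def)
 have mA: "(%t. indicator A (cis t) :: ennreal) \<in> borel_measurable borel"
  using indicator_cis_measurable[OF A] by simp
 let ?B = "(*) w -` A \<inter> space circle_measure"
 have B: "?B \<in> sets circle_measure"
  using measurable_sets[OF mult_measurable_circle[OF assms] A] .
 have "(\<integral>\<^sup>+t. indicator ?B (cis t) * indicator {0..<2*pi} t \<partial>lborel) =
   (\<integral>\<^sup>+t. indicator A (cis (a + 1 * t)) * indicator {a..<a+2*pi} (a + 1 * t) \<partial>lborel)"
  by (intro nn_integral_cong) (auto simp: a(3) cis_mult space_circle_measure split: split_indicator)
 also have "... = (\<integral>\<^sup>+t. indicator A (cis t) * indicator {a..<a+2*pi} t \<partial>lborel)"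
  using nn_integral_real_affine[of "%t. indicator A (cis t) * indicator {a..<a+2*pi} t" 1 a] mA
  by simp
 also have "... = (\<integral>\<^sup>+t. indicator A (cis t) * indicator {a..<2*pi} t + indicator A (cis t) * indicator {2*pi..<a+2*pi} t \<partial>lborel)"
  using a by (intro nn_integral_cong) (auto split: split_indicator)
 also have "... = (\<integral>\<^sup>+t. indicator A (cis t) * indicator {a..<2*pi} t \<partial>lborel) +
   (\<integral>\<^sup>+t. indicator A (cis t) * indicator {2*pi..<a+2*pi} t \<partial>lborel)"
  using mA by (intro nn_integral_add) auto
 also have "(\<integral>\<^sup>+t. indicator A (cis t) * indicator {2*pi..<a+2*pi} t \<partial>lborel) =
  (\<integral>\<^sup>+t. indicator A (cis (2*pi + 1 * t)) * indicator {2*pi..<a+2*pi} (2*pi + 1 * t) \<partial>lborel)"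
  using nn_integral_real_affine[of "%t. indicator A (cis t) * indicator {2*pi..<a+2*pi} t" 1 "2*pi"] mA
  by simp
 also have "... = (\<integral>\<^sup>+t. indicator A (cis t) * indicator {0..<a} t \<partial>lborel)"
  by (intro nn_integral_cong) (auto simp: cis_mult[symmetric] split: split_indicator)
 also have "(\<integral>\<^sup>+t. indicator A (cis t) * indicator {a..<2*pi} t \<partial>lborel) + ... =
  (\<integral>\<^sup>+t. indicator A (cis t) * indicator {a..<2*pi} t + indicator A (cis t) * indicator {0..<a} t \<partial>lborel)"
  using mA by (intro nn_integral_add[symmetric]) auto
 also have "... = (\<integral>\<^sup>+t. indicator A (cis t) * indicator {0..<2*pi} t \<partial>lborel)"
  using a by (intro nn_integral_cong) (auto split: split_indicator)
 finally show "emeasure (distr circle_measure circle_measure ((*) w)) A = emeasure circle_measure A"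
  using A B mult_measurable_circle[OF assms]
  by (simp add: emeasure_distr emeasure_circle_measure)
qed simp

lemma circle_cnj: "distr circle_measure circle_measure cnj = circle_measure"
proof (rule measure_eqI)
 fix A assume "A \<in> sets (distr circle_measure circle_measure cnj)"
 then have A: "A \<in> sets circle_measure" by simp
 have mA: "(%t. indicator A (cis t) :: ennreal) \<in> borel_measurable borel"
  using indicator_cis_measurable[OF A] by simp
 let ?B = "cnj -` A \<inter> space circle_measure"
 have B: "?B \<in> sets circle_measure"
  using measurable_sets[OF cnj_measurable_circle A] .
 have "(\<integral>\<^sup>+t. indicator ?B (cis t) * indicator {0..<2*pi} t \<partial>lborel) =
   (\<integral>\<^sup>+t. indicator A (cis (2 * pi + (-1) * t)) * indicator {0..<2*pi} (2 * pi + (-1) * t) \<partial>lborel)"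
 proof (rule nn_integral_cong_AE)
  \<comment> \<open>The reflection t -> 2 pi - t maps [0, 2 pi) to (0, 2 pi]; the endpoints are the
    exceptional null set.\<close>
  show "AE t in lborel. indicator ?B (cis t) * (indicator {0..<2*pi} t :: ennreal) =
   indicator A (cis (2 * pi + (-1) * t)) * indicator {0..<2*pi} (2 * pi + (-1) * t)"
   using AE_lborel_singleton[of 0] AE_lborel_singleton[of "2*pi"]
  proof eventually_elim
   case (elim t)
   have "cis (2 * pi + (-1) * t) = cnj (cis t)"
    using cis_mult[of "2 * pi" "- t"] by (simp add: cis_cnj)
   then show ?case using elim
    by (auto simp: space_circle_measure split: split_indicator)
  qed
 qed
 also have "... = (\<integral>\<^sup>+t. indicator A (cis t) * indicator {0..<2*pi} t \<partial>lborel)"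
  using nn_integral_real_affine[of "%t. indicator A (cis t) * indicator {0..<2*pi} t" "-1" "2*pi"] mA
  by simp
 finally show "emeasure (distr circle_measure circle_measure cnj) A = emeasure circle_measure A"
  using A B cnj_measurable_circle
  by (simp add: emeasure_distr emeasure_circle_measure)
qed simp

text \<open>Every index carries a spin, even when an energy involves finitely many of them. One
  measure thus serves all volumes, and changing the volume only changes the density.\<close>

definition spin_space :: "('i => complex) measure" where
 "spin_space = Pi\<^sub>M UNIV (%_. circle_measure)"

interpretation spin_product: product_prob_space "%_. circle_measure" "UNIV :: 'i set" ..

lemma sets_spin_space[measurable_cong]: "sets spin_space = sets (Pi\<^sub>M UNIV (%_. circle_measure))"
 by (simp add: spin_space_def)

lemma space_spin_space: "space spin_space = {th. \<forall>x. norm (th x) = 1}"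
 by (auto simp: spin_space_def space_PiM space_circle_measure PiE_def Pi_def)

interpretation spin: prob_space "spin_space :: ('i => complex) measure"
 unfolding spin_space_def by (rule prob_space_PiM) unfold_locales

lemma spin_coordinate_circle: "(%th. th x) \<in> measurable spin_space circle_measure"
 unfolding spin_space_def by (rule measurable_component_singleton) simp

lemma spin_coordinate[measurable]: "(%th. th x) \<in> borel_measurable spin_space"
proof -
 have "(%z. z) \<in> measurable circle_measure borel"
  using measurable_restrict_space1[of "%z. z" borel borel "sphere 0 1"]
  by (simp cong: measurable_cong_sets add: sets_circle_measure)
 from measurable_compose[OF spin_coordinate_circle this] show ?thesis .
qed

lemma measurable_into_circle:
 assumes "f \<in> borel_measurable M" "\<And>x. x \<in> space M ==> norm (f x) = 1"
 shows "f \<in> measurable M circle_measure"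
proof -
 have "f \<in> measurable M (restrict_space borel (sphere 0 1))"
  using assms by (intro measurable_restrict_space2) auto
 then show ?thesis by (simp cong: measurable_cong_sets add: sets_circle_measure)
qed

lemma measurable_into_spin_space:
 assumes "\<And>i. (%x. f x i) \<in> borel_measurable M" "\<And>i x. x \<in> space M ==> norm (f x i) = 1"
 shows "f \<in> measurable M spin_space"
 unfolding spin_space_def
 by (rule measurable_PiM_single')
   (use assms in \<open>auto intro!: measurable_into_circle simp: space_circle_measure PiE_def Pi_def\<close>)

lemma spin_space_eqI:
 assumes s: "sets N = sets (spin_space :: ('i => complex) measure)"
  and eq: "\<And>J X. finite J ==> (\<And>j. j \<in> J ==> X j \<in> sets circle_measure) ==>
   emeasure N {th\<in>space spin_space. \<forall>j\<in>J. th j \<in> X j} = (\<Prod>j\<in>J. emeasure circle_measure (X j))"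
 shows "N = (spin_space :: ('i => complex) measure)"
 unfolding spin_space_def
proof (rule spin_product.PiM_eq)
 show "sets N = sets (Pi\<^sub>M UNIV (%_. circle_measure))" using s by (simp add: sets_spin_space)
 fix J :: "'i set" and F assume J: "finite J" "\<And>j. j \<in> J ==> F j \<in> sets circle_measure"
 have "prod_emb UNIV (%_. circle_measure) J (Pi\<^sub>E J F) = {th\<in>space (spin_space :: ('i => complex) measure). \<forall>j\<in>J. th j \<in> F j}"
  by (auto simp: prod_emb_def spin_space_def space_PiM PiE_iff)
 then show "emeasure N (prod_emb UNIV (%_. circle_measure) J (Pi\<^sub>E J F)) = (\<Prod>j\<in>J. emeasure circle_measure (F j))"
  using eq[OF J] by simp
qed

lemma spin_box_sets:
 assumes "finite J" "\<And>j. j \<in> J ==> X j \<in> sets circle_measure"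
 shows "{th\<in>space (spin_space :: ('i => complex) measure). \<forall>j\<in>J. th j \<in> X j} \<in> sets spin_space"
proof (rule sets.sets_Collect_finite_All[OF _ assms(1)])
 fix j assume "j \<in> J"
 from measurable_sets[OF spin_coordinate_circle assms(2)[OF this], of j]
 show "{th\<in>space (spin_space :: ('i => complex) measure). th j \<in> X j} \<in> sets spin_space"
  by (simp add: vimage_def Int_def conj_commute)
qed

lemma emeasure_spin_box:
 assumes "finite J" "\<And>j. j \<in> J ==> X j \<in> sets circle_measure"
 shows "emeasure (spin_space :: ('i => complex) measure) {th\<in>space spin_space. \<forall>j\<in>J. th j \<in> X j} =
  (\<Prod>j\<in>J. emeasure circle_measure (X j))"
 unfolding spin_space_def
 by (rule spin_product.emeasure_PiM_Collect) (use assms in auto)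

text \<open>Two independent fields, read off along injections, are merged into one.\<close>

lemma spin_merge_measurable:
 "(%z i. if i \<in> A then fst z (\<rho> i) else snd z (\<kappa> i)) \<in> measurable (spin_space \<Otimes>\<^sub>M spin_space) spin_space"
proof (rule measurable_into_spin_space)
 fix i
 show "(%z. if i \<in> A then fst z (\<rho> i) else snd z (\<kappa> i)) \<in> borel_measurable (spin_space \<Otimes>\<^sub>M spin_space)"
  by (cases "i \<in> A") (auto intro!: measurable_compose[OF measurable_fst] measurable_compose[OF measurable_snd])
qed (auto simp: space_pair_measure space_spin_space)

lemma spin_merge:
 fixes \<rho> :: "'i => 'j" and \<kappa> :: "'i => 'k"
 assumes inj: "inj_on \<rho> A" "inj_on \<kappa> (- A)"
 shows "distr (spin_space \<Otimes>\<^sub>M spin_space) spin_space (%z i. if i \<in> A then fst z (\<rho> i) else snd z (\<kappa> i)) = spin_space"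
proof (rule spin_space_eqI)
 let ?m = "%z i. if i \<in> A then fst z (\<rho> i) else snd z (\<kappa> i)"
 fix J :: "'i set" and X assume J: "finite J" and X: "\<And>j. j \<in> J ==> X j \<in> sets circle_measure"
 let ?P = "spin_space \<Otimes>\<^sub>M (spin_space :: ('k => complex) measure) :: (('j => complex) \<times> ('k => complex)) measure"
 interpret pp: pair_prob_space "spin_space :: ('j => complex) measure" "spin_space :: ('k => complex) measure" ..
 define B1 where "B1 = {th\<in>space (spin_space :: ('j => complex) measure). \<forall>j\<in>\<rho> ` (J \<inter> A). th j \<in> X (the_inv_into A \<rho> j)}"
 define B2 where "B2 = {th\<in>space (spin_space :: ('k => complex) measure). \<forall>j\<in>\<kappa> ` (J - A). th j \<in> X (the_inv_into (-A) \<kappa> j)}"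
 have sB: "{th\<in>space (spin_space :: ('i => complex) measure). \<forall>j\<in>J. th j \<in> X j} \<in> sets spin_space"
  using J X by (rule spin_box_sets)
 have x1: "emeasure circle_measure (X (the_inv_into A \<rho> (\<rho> i))) = emeasure circle_measure (X i)" if "i \<in> J \<inter> A" for i
  using that inj by (simp add: the_inv_into_f_f)
 have x2: "emeasure circle_measure (X (the_inv_into (-A) \<kappa> (\<kappa> i))) = emeasure circle_measure (X i)" if "i \<in> J - A" for i
  using that inj by (simp add: the_inv_into_f_f)
 have e1: "emeasure spin_space B1 = (\<Prod>j\<in>J \<inter> A. emeasure circle_measure (X j))"
 proof -
  have "emeasure spin_space B1 = (\<Prod>j\<in>\<rho> ` (J \<inter> A). emeasure circle_measure (X (the_inv_into A \<rho> j)))"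
   unfolding B1_def using J X inj by (intro emeasure_spin_box) (auto simp: the_inv_into_f_f)
  also have "... = (\<Prod>j\<in>J \<inter> A. emeasure circle_measure (X (the_inv_into A \<rho> (\<rho> j))))"
   by (subst prod.reindex) (auto intro: inj_on_subset[OF inj(1)])
  finally show ?thesis by (simp add: x1)
 qed
 have e2: "emeasure spin_space B2 = (\<Prod>j\<in>J - A. emeasure circle_measure (X j))"
 proof -
  have "emeasure spin_space B2 = (\<Prod>j\<in>\<kappa> ` (J - A). emeasure circle_measure (X (the_inv_into (-A) \<kappa> j)))"
   unfolding B2_def using J X inj by (intro emeasure_spin_box) (auto simp: the_inv_into_f_f)
  also have "... = (\<Prod>j\<in>J - A. emeasure circle_measure (X (the_inv_into (-A) \<kappa> (\<kappa> j))))"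
   by (subst prod.reindex) (auto intro: inj_on_subset[OF inj(2)])
  finally show ?thesis by (simp add: x2)
 qed
 have s1: "B1 \<in> sets spin_space" unfolding B1_def
  using J X inj by (intro spin_box_sets) (auto simp: the_inv_into_f_f)
 have s2: "B2 \<in> sets spin_space" unfolding B2_def
  using J X inj by (intro spin_box_sets) (auto simp: the_inv_into_f_f)
 have pre: "?m -` {th\<in>space spin_space. \<forall>j\<in>J. th j \<in> X j} \<inter> space ?P = B1 \<times> B2"
 proof (rule set_eqI)
  fix z :: "('j => complex) \<times> ('k => complex)"
  have "(\<forall>j\<in>\<rho> ` (J \<inter> A). fst z j \<in> X (the_inv_into A \<rho> j)) \<longleftrightarrow> (\<forall>i\<in>J \<inter> A. fst z (\<rho> i) \<in> X i)"
   using inj by (auto simp: the_inv_into_f_f)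
  moreover have "(\<forall>j\<in>\<kappa> ` (J - A). snd z j \<in> X (the_inv_into (-A) \<kappa> j)) \<longleftrightarrow> (\<forall>i\<in>J - A. snd z (\<kappa> i) \<in> X i)"
   using inj by (auto simp: the_inv_into_f_f)
  ultimately show "z \<in> ?m -` {th\<in>space spin_space. \<forall>j\<in>J. th j \<in> X j} \<inter> space ?P \<longleftrightarrow> z \<in> B1 \<times> B2"
   by (cases z) (auto simp: B1_def B2_def space_pair_measure space_spin_space)
 qed
 have "emeasure (distr ?P spin_space ?m) {th\<in>space spin_space. \<forall>j\<in>J. th j \<in> X j} = emeasure ?P (B1 \<times> B2)"
  by (subst emeasure_distr[OF spin_merge_measurable sB]) (simp only: pre)
 also have "... = (\<Prod>j\<in>J \<inter> A. emeasure circle_measure (X j)) * (\<Prod>j\<in>J - A. emeasure circle_measure (X j))"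
  using s1 s2 by (simp add: spin.emeasure_pair_measure_Times e1 e2)
 also have "... = (\<Prod>j\<in>J. emeasure circle_measure (X j))"
  using prod.Int_Diff[OF J, of "%j. emeasure circle_measure (X j)" A] by simp
 finally show "emeasure (distr ?P spin_space ?m) {th\<in>space spin_space. \<forall>j\<in>J. th j \<in> X j} = (\<Prod>j\<in>J. emeasure circle_measure (X j))" .
qed simp

lemma spin_map:
 assumes f: "\<And>i. f i \<in> measurable circle_measure circle_measure" "\<And>i. distr circle_measure circle_measure (f i) = circle_measure"
 shows "distr spin_space spin_space (%th i. f i (th i)) = (spin_space :: ('i => complex) measure)"
  and "(%th i. f i (th i)) \<in> measurable spin_space (spin_space :: ('i => complex) measure)"
proof -
 let ?m = "%th i. f i (th i)"
 show m: "?m \<in> measurable spin_space (spin_space :: ('i => complex) measure)"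
  unfolding spin_space_def
 proof (rule measurable_PiM_single')
  show "(%x. f i (x i)) \<in> measurable (Pi\<^sub>M UNIV (%_. circle_measure)) circle_measure" for i
   using measurable_compose[OF spin_coordinate_circle f(1)] unfolding spin_space_def .
  show "(%th i. f i (th i)) \<in> space (Pi\<^sub>M UNIV (%_. circle_measure)) \<rightarrow> UNIV \<rightarrow>\<^sub>E space circle_measure"
   using measurable_space[OF f(1)] by (auto simp: space_PiM)
 qed
 show "distr spin_space spin_space ?m = (spin_space :: ('i => complex) measure)"
 proof (rule spin_space_eqI)
  fix J :: "'i set" and X assume J: "finite J" and X: "\<And>j. j \<in> J ==> X j \<in> sets circle_measure"
  have sB: "{th\<in>space (spin_space :: ('i => complex) measure). \<forall>j\<in>J. th j \<in> X j} \<in> sets spin_space"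
   using J X by (rule spin_box_sets)
  have "?m -` {th\<in>space spin_space. \<forall>j\<in>J. th j \<in> X j} \<inter> space spin_space =
    {th\<in>space spin_space. \<forall>j\<in>J. th j \<in> (f j -` X j \<inter> space circle_measure)}"
   using measurable_space[OF m] by (auto simp: space_spin_space space_circle_measure)
  then have "emeasure (distr spin_space spin_space ?m) {th\<in>space spin_space. \<forall>j\<in>J. th j \<in> X j} =
   emeasure spin_space {th\<in>space (spin_space :: ('i => complex) measure). \<forall>j\<in>J. th j \<in> (f j -` X j \<inter> space circle_measure)}"
   by (subst emeasure_distr[OF m sB]) simp
  also have "... = (\<Prod>j\<in>J. emeasure circle_measure (f j -` X j \<inter> space circle_measure))"
   using X by (intro emeasure_spin_box J measurable_sets[OF f(1)])
  also have "... = (\<Prod>j\<in>J. emeasure circle_measure (X j))"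
   using X f by (intro prod.cong refl) (metis emeasure_distr)
  finally show "emeasure (distr spin_space spin_space ?m) {th\<in>space spin_space. \<forall>j\<in>J. th j \<in> X j} =
   (\<Prod>j\<in>J. emeasure circle_measure (X j))" .
 qed simp
qed

lemma spin_mul_measurable:
 "(%z i. fst z i * snd z i) \<in> measurable (spin_space \<Otimes>\<^sub>M spin_space) spin_space"
 by (rule measurable_into_spin_space)
   (auto simp: space_pair_measure space_spin_space norm_mult
    intro!: borel_measurable_times measurable_compose[OF measurable_fst] measurable_compose[OF measurable_snd])

interpretation spin: ginibre_group "spin_space :: ('i => complex) measure" "%a th i. a i * th i" "%th i. cnj (th i)"
proof
 show "(%z i. fst z i * snd z i) \<in> measurable (spin_space \<Otimes>\<^sub>M spin_space) (spin_space :: ('i => complex) measure)"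
  by (rule spin_mul_measurable)
 show "(%th i. cnj (th i)) \<in> measurable spin_space (spin_space :: ('i => complex) measure)"
  by (rule spin_map(2)) (auto intro: cnj_measurable_circle circle_cnj)
 fix x y :: "'i => complex" assume x: "x \<in> space spin_space"
 show "distr spin_space spin_space (%th i. x i * th i) = spin_space"
  using x by (intro spin_map(1)) (auto simp: space_spin_space intro: mult_measurable_circle circle_rotation)
 assume y: "y \<in> space spin_space"
 show "(%i. x i * y i) = (%i. y i * x i)" by (simp add: mult.commute)
 \<comment> \<open>A coordinatewise square root of x y; the relation a b = x then forces b.\<close>
 define a b where "a i = csqrt (x i * y i)" and "b i = x i * cnj (a i)" for i
 have a: "a i * a i = x i * y i" "norm (a i) = 1" for i
  using x y by (auto simp: a_def power2_eq_square[symmetric] space_spin_space norm_mult)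
 then have c: "a i * cnj (a i) = 1" "x i * cnj (x i) = 1" for i
  using x by (metis complex_norm_square of_real_1 power_one, simp add: space_spin_space)
    (metis complex_norm_square of_real_1 power_one)
 have 1: "a i * b i = x i" for i using c(1)[of i] by (simp add: b_def algebra_simps)
 have 2: "a i * cnj (b i) = y i" for i
 proof -
  have "a i * cnj (b i) = (a i * a i) * cnj (x i)" by (simp add: b_def algebra_simps)
  also have "... = (x i * cnj (x i)) * y i" unfolding a(1) by (simp add: algebra_simps)
  finally show ?thesis by (simp add: c(2))
 qed
 show "\<exists>a\<in>space spin_space. \<exists>b\<in>space spin_space. \<forall>u\<in>space spin_space. \<forall>v\<in>space spin_space.
  (%i. x i * (u i * v i)) = (%i. a i * u i * (b i * v i)) \<and>
  (%i. y i * (u i * cnj (v i))) = (%i. a i * u i * cnj (b i * v i))"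
 proof (intro bexI ballI conjI ext)
  fix u v i
  show "x i * (u i * v i) = a i * u i * (b i * v i)" unfolding 1[of i, symmetric] by (simp only: ac_simps)
  show "y i * (u i * cnj (v i)) = a i * u i * cnj (b i * v i)"
   unfolding 2[of i, symmetric] complex_cnj_mult by (simp only: ac_simps)
 next
  show "a \<in> space spin_space" "b \<in> space spin_space"
   using a x by (auto simp: space_spin_space b_def norm_mult)
 qed
qed

lemma spin_character_coordinate: "spin.character (%th. th x)"
 unfolding spin.character_def by (auto simp: space_spin_space)

lemmas spin_character_intros = spin_character_coordinate spin.character_mult spin.character_cnj
 spin.character_one spin.character_prod

lemma spin_integral_cnj:
 fixes f :: "('i => complex) => real"
 assumes "f \<in> borel_measurable spin_space"
 shows "(\<integral>th. f (%i. cnj (th i)) \<partial>spin_space) = (\<integral>th. f th \<partial>spin_space)"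
proof -
 have "(\<integral>th. f th \<partial>spin_space) = (\<integral>th. f th \<partial>distr spin_space spin_space (%th i. cnj (th i)))"
  by (subst spin_map(1)) (auto intro: cnj_measurable_circle circle_cnj)
 also have "... = (\<integral>th. f (%i. cnj (th i)) \<partial>spin_space)"
  by (rule integral_distr[OF spin_map(2) assms]) (auto intro: cnj_measurable_circle circle_cnj)
 finally show ?thesis ..
qed

lemma spin_reindex:
 fixes f :: "('i => complex) => real" and T :: "'i => 'i"
 assumes T: "inj T" and f: "f \<in> borel_measurable spin_space"
 shows "(\<integral>th. f (%i. th (T i)) \<partial>spin_space) = (\<integral>th. f th \<partial>spin_space)"
proof -
 have m: "(%th i. th (T i)) \<in> measurable spin_space spin_space"
  by (rule measurable_into_spin_space) (auto simp: space_spin_space)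
 have "distr spin_space spin_space (%th i. th (T i)) = (spin_space :: ('i => complex) measure)"
  using distr_PiM_reindex[of UNIV "%_. circle_measure" T UNIV] T
  unfolding spin_space_def by (simp add: circle.prob_space_axioms restrict_UNIV)
 then show ?thesis using integral_distr[OF m f] by simp
qed

section \<open>Correlations of components\<close>

definition mono :: "('k => 'a => real) => 'k list => 'a => real" where
 "mono g ks z = prod_list (map (%k. g k z) ks)"

lemma mono_simps [simp]:
 "mono g [] z = 1" "mono g (k # ks) z = g k z * mono g ks z"
 "mono g (ks @ ls) z = mono g ks z * mono g ls z"
 by (simp_all add: mono_def)

inductive nonneg_poly :: "('k => 'a => real) => ('a => real) => bool" for g where
 zero: "nonneg_poly g (%_. 0)"
| step: "c \<ge> 0 ==> nonneg_poly g f ==> nonneg_poly g (%z. c * mono g ks z + f z)"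

lemma nonneg_poly_add:
 assumes "nonneg_poly g f" "nonneg_poly g h" shows "nonneg_poly g (%z. f z + h z)"
 using assms(1)
proof induction
 case zero then show ?case using assms(2) by simp
next
 case (step c f ks)
 from nonneg_poly.step[OF step(1,3), of ks] show ?case by (simp add: add.assoc)
qed

lemma nonneg_poly_mono_mult:
 assumes "nonneg_poly g f" "c \<ge> 0" shows "nonneg_poly g (%z. c * mono g ks z * f z)"
 using assms(1)
proof induction
 case zero then show ?case using nonneg_poly.zero by simp
next
 case (step d f ls)
 from nonneg_poly.step[OF mult_nonneg_nonneg[OF assms(2) step(1)] step(3), of "ks @ ls"]
 show ?case by (simp add: algebra_simps)
qed

lemma nonneg_poly_mult:
 assumes "nonneg_poly g f" "nonneg_poly g h" shows "nonneg_poly g (%z. f z * h z)"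
 using assms(1)
proof induction
 case zero then show ?case using nonneg_poly.zero by simp
next
 case (step c f ks)
 from nonneg_poly_add[OF nonneg_poly_mono_mult[OF assms(2) step(1), of ks] step(3)]
 show ?case by (simp add: algebra_simps)
qed

lemma nonneg_poly_const: "c \<ge> 0 ==> nonneg_poly g (%_. c)"
 using nonneg_poly.step[OF _ nonneg_poly.zero, of c g "[]"] by simp

lemma nonneg_poly_gen: "nonneg_poly g (g k)"
 using nonneg_poly.step[OF _ nonneg_poly.zero, of 1 g "[k]"] by simp

lemma nonneg_poly_sum:
 "(\<And>i. i \<in> I ==> nonneg_poly g (f i)) ==> nonneg_poly g (%z. \<Sum>i\<in>I. f i z)"
 by (induction I rule: infinite_finite_induct) (auto intro: nonneg_poly.zero nonneg_poly_add)

lemma nonneg_poly_power: "nonneg_poly g f ==> nonneg_poly g (%z. f z ^ n)"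
 by (induction n) (auto intro: nonneg_poly_const nonneg_poly_mult)

text \<open>The head of the list occurs again further on. Removing both occurrences splits off a
  square and leaves a shorter list in which all counts are still even.\<close>

lemma mono_even_nonneg:
 assumes "\<And>k. even (count_list ks k)" shows "mono g ks z \<ge> 0"
 using assms
proof (induction "length ks" arbitrary: ks rule: less_induct)
 case less
 show ?case
 proof (cases ks)
  case (Cons k ls)
  then have "odd (count_list ls k)" using less.prems[of k] by simp
  then have "count_list ls k \<noteq> 0" by presburger
  then have "k \<in> set ls" by (simp add: count_list_0_iff)
  then obtain as bs where ls: "ls = as @ k # bs" by (meson split_list)
  have "even (count_list (as @ bs) j)" for j
   using less.prems[of j] by (auto simp: Cons ls split: if_splits)
  then have "mono g (as @ bs) z \<ge> 0" by (intro less.hyps) (auto simp: Cons ls)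
  then have "(g k z)\<^sup>2 * mono g (as @ bs) z \<ge> 0" by simp
  then show ?thesis by (simp add: Cons ls power2_eq_square algebra_simps)
 qed simp
qed

text \<open>A generator with odd exponent makes the monomial change sign under the measure
  preserving flip of that generator, so its integral is 0; a monomial with even exponents only is
  pointwise nonnegative.\<close>

lemma (in prob_space) nonneg_poly_integral:
 assumes f: "nonneg_poly g f" and g: "\<And>k. bdd_meas M (g k)"
  and flip: "\<And>k f. bdd_meas M f ==> (\<integral>z. f (T k z) \<partial>M) = (\<integral>z. f z \<partial>M)"
  and eq: "\<And>k l z. z \<in> space M ==> g l (T k z) = (if l = k then - g l z else g l z)"
 shows "(\<integral>z. f z \<partial>M) \<ge> 0" and "bdd_meas M f"
proof -
 have bm: "bdd_meas M (mono g ks)" for ks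
 proof (induction ks)
  case Nil
  have "mono g [] = (%_. 1)" by (simp add: fun_eq_iff)
  then show ?case by (simp add: bdd_meas_const)
 next
  case (Cons k ks)
  have "mono g (k # ks) = (%z. g k z * mono g ks z)" by (simp add: fun_eq_iff)
  then show ?case using bdd_meas_mult[OF g Cons] by simp
 qed
 have "(\<integral>z. mono g ks z \<partial>M) \<ge> 0" for ks
 proof (cases "\<forall>k. even (count_list ks k)")
  case True
  then show ?thesis by (intro integral_nonneg_AE AE_I2) (auto intro: mono_even_nonneg)
 next
  case False
  then obtain k where k: "odd (count_list ks k)" by blast
  have "mono g ls (T k z) = (-1) ^ count_list ls k * mono g ls z" if "z \<in> space M" for ls z
   using that by (induction ls) (auto simp: eq)
  then have "(\<integral>z. mono g ks (T k z) \<partial>M) = (\<integral>z. - mono g ks z \<partial>M)"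
   using k by (intro Bochner_Integration.integral_cong) auto
  then show ?thesis using flip[OF bm, of ks k] by simp
 qed
 then have "(\<integral>z. f z \<partial>M) \<ge> 0 \<and> bdd_meas M f"
  using f
 proof (induction rule: nonneg_poly.induct[OF f])
  case 1 then show ?case by (simp add: bdd_meas_const)
 next
  case (2 c f ks)
  then have "bdd_meas M f" "0 <= (\<integral>z. f z \<partial>M)" by auto
  then show ?case using 2 bm[of ks]
   by (auto simp: bdd_meas_integrable intro!: bdd_meas_arith)
 qed
 then show "(\<integral>z. f z \<partial>M) \<ge> 0" "bdd_meas M f" by auto
qed

lemma (in prob_space) integral_pair_preserving:
 fixes f :: "'a \<times> 'a => real"
 assumes S: "S \<in> measurable M M" "distr M M S = M" and T: "T \<in> measurable M M" "distr M M T = M"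
  and f: "f \<in> borel_measurable (M \<Otimes>\<^sub>M M)"
 shows "(\<integral>z. f (S (fst z), T (snd z)) \<partial>(M \<Otimes>\<^sub>M M)) = (\<integral>z. f z \<partial>(M \<Otimes>\<^sub>M M))"
proof -
 have "sigma_finite_measure (distr M M T)" using T sigma_finite_measure_axioms by simp
 from pair_measure_distr[OF S(1) T(1) this]
 have *: "M \<Otimes>\<^sub>M M = distr (M \<Otimes>\<^sub>M M) (M \<Otimes>\<^sub>M M) (%(x, y). (S x, T y))"
  using S T by simp
 have m: "(%(x, y). (S x, T y)) \<in> measurable (M \<Otimes>\<^sub>M M) (M \<Otimes>\<^sub>M M)"
  using S T by measurable
 show ?thesis
  using integral_distr[OF m f] *[symmetric] by (simp add: case_prod_unfold)
qed

type_synonym 'i spin = "'i => complex"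

definition spin_part :: "'i \<times> bool \<times> bool => 'i spin \<times> 'i spin => real" where
 "spin_part k z = (if fst (snd k) then Re else Im) ((if snd (snd k) then fst z else snd z) (fst k))"

text \<open>Reflection of one spin in a coordinate axis: minus the conjugate negates the real part
  and keeps the imaginary part, the conjugate does the opposite.\<close>

definition spin_flip :: "'i => bool => 'i => complex => complex" where
 "spin_flip x c i w = (if i = x then (if c then (-1) * cnj w else cnj w) else w)"

lemma spin_flip_preserving:
 "spin_flip x c i \<in> measurable circle_measure circle_measure" (is ?thesis_a)
 "distr circle_measure circle_measure (spin_flip x c i) = circle_measure" (is ?thesis_b)
proof -
 have neg: "(%w. (-1) * cnj w) \<in> measurable circle_measure circle_measure"
  using measurable_compose[OF cnj_measurable_circle mult_measurable_circle[of "-1"]] by simp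
 have "distr circle_measure circle_measure (%w. (-1) * cnj w) =
  distr (distr circle_measure circle_measure cnj) circle_measure ((*) (-1))"
  by (subst distr_distr[OF mult_measurable_circle cnj_measurable_circle]) (auto simp: comp_def)
 then have negd: "distr circle_measure circle_measure (%w. (-1) * cnj w) = circle_measure"
  by (simp add: circle_cnj circle_rotation[of "-1"])
 have *: "spin_flip x c i = (if i = x then if c then (%w. (-1) * cnj w) else cnj else (%w. w))"
  by (auto simp: spin_flip_def fun_eq_iff)
 show ?thesis_a
  unfolding * using neg cnj_measurable_circle by (auto simp del: mult_minus1)
 show ?thesis_b
  unfolding * using negd circle_cnj distr_id[of circle_measure] by (auto simp: id_def simp del: mult_minus1)
qed

lemma bdd_meas_spin:
 "bdd_meas spin_space (%th. Re (th x))" "bdd_meas spin_space (%th. Im (th x))"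
 by (rule spin.bdd_meas_character spin_character_intros)+

lemma bdd_meas_spin_part: "bdd_meas (spin_space \<Otimes>\<^sub>M spin_space) (spin_part k)"
proof -
 have "spin_part k = (if snd (snd k) then (%z. (if fst (snd k) then Re else Im) (fst z (fst k)))
  else (%z. (if fst (snd k) then Re else Im) (snd z (fst k))))"
  by (auto simp: spin_part_def fun_eq_iff)
 then show ?thesis
  by (cases "snd (snd k)"; cases "fst (snd k)")
   (simp_all add: bdd_meas_fst bdd_meas_snd bdd_meas_spin
    bdd_meas_fst[of _ "%th. Re (th _)"] bdd_meas_fst[of _ "%th. Im (th _)"]
    bdd_meas_snd[of _ "%th. Re (th _)"] bdd_meas_snd[of _ "%th. Im (th _)"])
qed

lemma spin_poly_integral:
 assumes "nonneg_poly spin_part f"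
 shows "(\<integral>z. f z \<partial>(spin_space \<Otimes>\<^sub>M spin_space)) \<ge> 0" (is ?thesis_a)
  and "bdd_meas (spin_space \<Otimes>\<^sub>M spin_space) (f :: 'i spin \<times> 'i spin => real)"
proof -
 define T :: "'i \<times> bool \<times> bool => 'i spin \<times> 'i spin => 'i spin \<times> 'i spin" where
  "T k z = ((if snd (snd k) then (%i. spin_flip (fst k) (fst (snd k)) i (fst z i)) else fst z),
       (if snd (snd k) then snd z else (%i. spin_flip (fst k) (fst (snd k)) i (snd z i))))" for k z
 have id: "(%th. th) \<in> measurable spin_space spin_space" "distr spin_space spin_space (%th. th) = (spin_space :: 'i spin measure)"
  using distr_id[of "spin_space :: 'i spin measure"] by (simp_all add: id_def)
 have flip: "(\<integral>z. f (T k z) \<partial>(spin_space \<Otimes>\<^sub>M spin_space)) = (\<integral>z. f z \<partial>(spin_space \<Otimes>\<^sub>M spin_space))"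
  if "bdd_meas (spin_space \<Otimes>\<^sub>M spin_space) f" for f k
 proof -
  note sf = spin_map[of "spin_flip (fst k) (fst (snd k))", OF spin_flip_preserving]
  show ?thesis
   using spin.integral_pair_preserving[OF sf(2,1) id bdd_meas_measurable[OF that]]
    spin.integral_pair_preserving[OF id sf(2,1) bdd_meas_measurable[OF that]]
   unfolding T_def by (cases "snd (snd k)") simp_all
 qed
 have eq: "spin_part l (T k z) = (if l = k then - spin_part l z else spin_part l z)" for k l z
  by (cases l; cases k) (auto simp: spin_part_def T_def spin_flip_def)
 interpret P: pair_prob_space "spin_space :: 'i spin measure" "spin_space :: 'i spin measure" ..
 show ?thesis_a "bdd_meas (spin_space \<Otimes>\<^sub>M spin_space) f"
  by (rule spin.P.nonneg_poly_integral[OF assms bdd_meas_spin_part, of T]; use flip eq in blast)+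
qed

text \<open>
 In the variables \<open>(u, v)\<close> with \<open>\<theta> = u / v\<close> and \<open>\<theta>' = u v\<close>, the sums and differences of the
 coordinates of the two fields (with \<open>Re \<theta> - Re \<theta>'\<close> but \<open>Im \<theta>' - Im \<theta>\<close>) are monomials in the
 coordinates of \<open>u\<close> and \<open>v\<close> with positive coefficients.
\<close>

definition ferro :: "('i spin \<times> 'i spin => real) => bool" where
 "ferro f \<longleftrightarrow> nonneg_poly spin_part
   (%z. f (%i. fst z i * snd z i, %i. fst z i * cnj (snd z i)))"

lemma ferro_add: "ferro f ==> ferro g ==> ferro (%z. f z + g z)"
 and ferro_mult: "ferro f ==> ferro g ==> ferro (%z. f z * g z)"
 and ferro_const: "c \<ge> 0 ==> ferro (%z. c)"
 and ferro_sum: "(\<And>i. i \<in> I ==> ferro (h i)) ==> ferro (%z. \<Sum>i\<in>I. h i z)"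
 unfolding ferro_def
 by (auto intro: nonneg_poly_add nonneg_poly_mult nonneg_poly_const nonneg_poly_sum)

lemma ferro_Re_diff: "ferro (%z. Re (snd z x) - Re (fst z x))"
 and ferro_Re_add: "ferro (%z. Re (snd z x) + Re (fst z x))"
 and ferro_Im_diff: "ferro (%z. Im (fst z x) - Im (snd z x))"
 and ferro_Im_add: "ferro (%z. Im (fst z x) + Im (snd z x))"
proof -
 have *: "nonneg_poly spin_part (%z. 2 * (spin_part k z * spin_part l z))" for k l
  by (intro nonneg_poly_mult nonneg_poly_const nonneg_poly_gen) simp
 show "ferro (%z. Re (snd z x) - Re (fst z x))"
  unfolding ferro_def using *[of "(x, False, True)" "(x, False, False)"] by (simp add: spin_part_def algebra_simps)
 show "ferro (%z. Re (snd z x) + Re (fst z x))"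
  unfolding ferro_def using *[of "(x, True, True)" "(x, True, False)"] by (simp add: spin_part_def algebra_simps)
 show "ferro (%z. Im (fst z x) - Im (snd z x))"
  unfolding ferro_def using *[of "(x, True, True)" "(x, False, False)"] by (simp add: spin_part_def algebra_simps)
 show "ferro (%z. Im (fst z x) + Im (snd z x))"
  unfolding ferro_def using *[of "(x, False, True)" "(x, True, False)"] by (simp add: spin_part_def algebra_simps)
qed

text \<open>In the duplicated variables \<open>f\<close> times any power of \<open>E\<close> is a
  polynomial with nonnegative coefficients in real and imaginary parts, so that every term of the
  exponential series has a nonnegative integral.\<close>

lemma ferro_integral:
 assumes f: "ferro f" "bdd_meas (spin_space \<Otimes>\<^sub>M spin_space) f"
  and E: "ferro E" "bdd_meas (spin_space \<Otimes>\<^sub>M spin_space) E"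
 shows "(\<integral>z. f z * exp (E z) \<partial>(spin_space \<Otimes>\<^sub>M spin_space)) \<ge> 0"
proof -
 let ?d = "%z :: 'a spin \<times> 'a spin. (%i. fst z i * snd z i, %i. fst z i * cnj (snd z i))"
 have "(\<integral>z. f z * exp (E z) \<partial>(spin_space \<Otimes>\<^sub>M spin_space)) =
  (\<integral>z. f (?d z) * exp (E (?d z)) \<partial>(spin_space \<Otimes>\<^sub>M spin_space))"
  by (rule spin.duplication) (intro bdd_meas_arith assms)
 also have "... \<ge> 0"
  using assms(1,3) unfolding ferro_def
  by (intro spin.P.integral_mult_exp_nonneg spin_poly_integral nonneg_poly_mult nonneg_poly_power)
 finally show ?thesis .
qed

definition bond :: "'i spin => 'i \<times> 'i => complex" where
 "bond th b = th (fst b) * cnj (th (snd b))"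

lemma bond_character: "spin.character (%th. bond th b)"
 unfolding bond_def by (intro spin_character_intros)

lemma Re_bond: "Re (bond th b) = Re (th (fst b)) * Re (th (snd b)) + Im (th (fst b)) * Im (th (snd b))"
 by (simp add: bond_def)

lemma bdd_meas_bond: "bdd_meas spin_space (%th. Re (bond th b))" "bdd_meas spin_space (%th. Im (bond th b))"
 by (intro spin.bdd_meas_character bond_character)+

text \<open>Bonds are ordered pairs, and a set closed under reversal counts each undirected bond
  twice. This is why the inverse temperature enters below as \<open>c\<close> equal to half of
  it.\<close>

definition xy_energy :: "real => ('i \<times> 'i) set => 'i spin => real" where
 "xy_energy c F th = (\<Sum>b\<in>F. c * Re (bond th b))"

lemma bdd_meas_xy_energy: "bdd_meas spin_space (xy_energy c F)"
 unfolding xy_energy_def by (intro bdd_meas_arith bdd_meas_bond)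

text \<open>Polarisation: x y + x' y' is half of (x + x') (y + y') + (x - x') (y - y'). Differences
  occur in pairs only, so the opposite sign conventions of \<open>ferro\<close> for real and
  imaginary parts are compatible with the energy.\<close>

lemma ferro_energy:
 assumes "c \<ge> 0" shows "ferro (%z. xy_energy c F (fst z) + xy_energy c F (snd z))"
proof -
 have b: "ferro (%z. c * Re (bond (fst z) b) + c * Re (bond (snd z) b))" for b :: "'a \<times> 'a"
 proof -
  obtain p q where b: "b = (p, q)" by force
  have "ferro (%z. (c/2) * ((Re (snd z p) + Re (fst z p)) * (Re (snd z q) + Re (fst z q)) +
    (Re (snd z p) - Re (fst z p)) * (Re (snd z q) - Re (fst z q)) +
    ((Im (fst z p) + Im (snd z p)) * (Im (fst z q) + Im (snd z q)) +
    (Im (fst z p) - Im (snd z p)) * (Im (fst z q) - Im (snd z q)))))"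
   using assms by (intro ferro_add ferro_mult ferro_const ferro_Re_diff ferro_Re_add ferro_Im_diff ferro_Im_add) auto
  moreover have "(c/2) * ((Re (snd z p) + Re (fst z p)) * (Re (snd z q) + Re (fst z q)) +
    (Re (snd z p) - Re (fst z p)) * (Re (snd z q) - Re (fst z q)) +
    ((Im (fst z p) + Im (snd z p)) * (Im (fst z q) + Im (snd z q)) +
    (Im (fst z p) - Im (snd z p)) * (Im (fst z q) - Im (snd z q)))) =
    c * Re (bond (fst z) b) + c * Re (bond (snd z) b)" for z :: "'a spin \<times> 'a spin"
   unfolding Re_bond b by (simp add: field_simps)
  ultimately show ?thesis by (simp only:)
 qed
 show ?thesis
  unfolding xy_energy_def sum.distrib[symmetric] by (intro ferro_sum b)
qed

text \<open>\<open>ferro\<close> takes differences of the two copies in opposite directions for real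
  and for imaginary parts. Hence the product of the two increments, of the real product from the
  first copy to the second and of the imaginary product backwards, has nonnegative mean, and this
  says that the two products are negatively correlated.\<close>

lemma xy_opposite_components:
 assumes c: "c \<ge> 0"
 shows "(\<integral>th. Re (th p) * Re (th q) * (Im (th r) * Im (th s)) * exp (xy_energy c F th) \<partial>spin_space) *
   (\<integral>th. exp (xy_energy c F th) \<partial>spin_space)
  <= (\<integral>th. Re (th p) * Re (th q) * exp (xy_energy c F th) \<partial>spin_space) *
   (\<integral>th. Im (th r) * Im (th s) * exp (xy_energy c F th) \<partial>spin_space)"
proof -
 let ?P = "spin_space \<Otimes>\<^sub>M spin_space :: ('a spin \<times> 'a spin) measure"
 let ?x = "%th. Re (th p) * Re (th q)" and ?y = "%th :: 'a spin. Im (th r) * Im (th s)"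
 let ?e = "%th. exp (xy_energy c F th)"
 define f where "f z = (1/2) * ((Re (snd z p) - Re (fst z p)) * (Re (snd z q) + Re (fst z q)) +
   (Re (snd z p) + Re (fst z p)) * (Re (snd z q) - Re (fst z q))) *
  ((1/2) * ((Im (fst z r) - Im (snd z r)) * (Im (fst z s) + Im (snd z s)) +
   (Im (fst z r) + Im (snd z r)) * (Im (fst z s) - Im (snd z s))))" for z :: "'a spin \<times> 'a spin"
 have f: "ferro f"
  unfolding f_def
  by (intro ferro_add ferro_mult ferro_const ferro_Re_diff ferro_Re_add ferro_Im_diff ferro_Im_add) auto
 have bf: "bdd_meas ?P f"
  unfolding f_def by (intro bdd_meas_arith bdd_meas_fst[OF bdd_meas_spin(1)] bdd_meas_fst[OF bdd_meas_spin(2)]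
   bdd_meas_snd[OF bdd_meas_spin(1)] bdd_meas_snd[OF bdd_meas_spin(2)])
 note b = bdd_meas_spin bdd_meas_xy_energy
 have bx: "bdd_meas spin_space ?x" "bdd_meas spin_space ?y" "bdd_meas spin_space ?e"
  "bdd_meas spin_space (%th. ?x th * ?y th * ?e th)" "bdd_meas spin_space (%th. ?x th * ?e th)" "bdd_meas spin_space (%th. ?y th * ?e th)"
  by (intro bdd_meas_arith b)+
 have "0 <= (\<integral>z. f z * exp (xy_energy c F (fst z) + xy_energy c F (snd z)) \<partial>?P)"
  by (rule ferro_integral[OF f bf ferro_energy[OF c]
    bdd_meas_add[OF bdd_meas_fst[OF bdd_meas_xy_energy] bdd_meas_snd[OF bdd_meas_xy_energy]]])
 also have "... = (\<integral>z. (((?y (fst z) * ?e (fst z)) * (?x (snd z) * ?e (snd z)) +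
   (?x (fst z) * ?e (fst z)) * (?y (snd z) * ?e (snd z))) - ?e (fst z) * (?x (snd z) * ?y (snd z) * ?e (snd z)))
   - (?x (fst z) * ?y (fst z) * ?e (fst z)) * ?e (snd z) \<partial>?P)"
 proof (intro Bochner_Integration.integral_cong refl)
  fix z
  have f': "f z = (?x (snd z) - ?x (fst z)) * (?y (fst z) - ?y (snd z))"
   unfolding f_def by (simp add: field_simps)
  show "f z * exp (xy_energy c F (fst z) + xy_energy c F (snd z)) = (((?y (fst z) * ?e (fst z)) * (?x (snd z) * ?e (snd z)) +
   (?x (fst z) * ?e (fst z)) * (?y (snd z) * ?e (snd z))) - ?e (fst z) * (?x (snd z) * ?y (snd z) * ?e (snd z)))
   - (?x (fst z) * ?y (fst z) * ?e (fst z)) * ?e (snd z)"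
   unfolding f' exp_add by (simp add: algebra_simps)
 qed
 also have "... = (\<integral>th. ?y th * ?e th \<partial>spin_space) * (\<integral>th. ?x th * ?e th \<partial>spin_space) +
   (\<integral>th. ?x th * ?e th \<partial>spin_space) * (\<integral>th. ?y th * ?e th \<partial>spin_space) -
   (\<integral>th. ?e th \<partial>spin_space) * (\<integral>th. ?x th * ?y th * ?e th \<partial>spin_space) -
   (\<integral>th. ?x th * ?y th * ?e th \<partial>spin_space) * (\<integral>th. ?e th \<partial>spin_space)"
 proof -
  note fs = bdd_meas_fst[where N=spin_space] and sn = bdd_meas_snd[where M=spin_space]
  have i: "integrable ?P (%z. (?y (fst z) * ?e (fst z)) * (?x (snd z) * ?e (snd z)))"
   "integrable ?P (%z. (?x (fst z) * ?e (fst z)) * (?y (snd z) * ?e (snd z)))"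
   "integrable ?P (%z. ?e (fst z) * (?x (snd z) * ?y (snd z) * ?e (snd z)))"
   "integrable ?P (%z. (?x (fst z) * ?y (fst z) * ?e (fst z)) * ?e (snd z))"
   using spin.P.bdd_meas_integrable[OF bdd_meas_mult[OF fs[OF bx(6)] sn[OF bx(5)]]]
    spin.P.bdd_meas_integrable[OF bdd_meas_mult[OF fs[OF bx(5)] sn[OF bx(6)]]]
    spin.P.bdd_meas_integrable[OF bdd_meas_mult[OF fs[OF bx(3)] sn[OF bx(4)]]]
    spin.P.bdd_meas_integrable[OF bdd_meas_mult[OF fs[OF bx(4)] sn[OF bx(3)]]] .
  show ?thesis
   unfolding spin.integral_pair_product[OF bx(6,5), symmetric] spin.integral_pair_product[OF bx(5,6), symmetric]
    spin.integral_pair_product[OF bx(3,4), symmetric] spin.integral_pair_product[OF bx(4,3), symmetric]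
   by (simp only: Bochner_Integration.integral_diff Bochner_Integration.integral_add i
     Bochner_Integration.integrable_add Bochner_Integration.integrable_diff)
 qed
 finally show ?thesis by (simp add: mult.commute)
qed

text \<open>A field in the direction of the real axis decreases the correlations of the imaginary parts.\<close>

lemma xy_field_Im:
 fixes p q r s :: 'i and a :: "'k => 'i"
 assumes c: "c \<ge> 0" and d: "\<And>i. i \<in> I ==> d i \<ge> 0"
 shows "(\<integral>th. Im (th p) * Im (th q) * Im (th r) * Im (th s) * exp (xy_energy c F th + (\<Sum>i\<in>I. d i * Re (th (a i)))) \<partial>spin_space) *
   (\<integral>th. exp (xy_energy c F th) \<partial>spin_space)
  <= (\<integral>th. Im (th p) * Im (th q) * Im (th r) * Im (th s) * exp (xy_energy c F th) \<partial>spin_space) *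
   (\<integral>th. exp (xy_energy c F th + (\<Sum>i\<in>I. d i * Re (th (a i)))) \<partial>spin_space)"
proof -
 let ?P = "spin_space \<Otimes>\<^sub>M spin_space :: ('i spin \<times> 'i spin) measure"
 let ?y = "%th :: 'i spin. Im (th p) * Im (th q) * Im (th r) * Im (th s)"
 let ?h = "%th :: 'i spin. \<Sum>i\<in>I. d i * Re (th (a i))"
 let ?e = "%th. exp (xy_energy c F th)" and ?k = "%th. exp (xy_energy c F th + ?h th)"
 \<comment> \<open>Differences and sums of the two copies are propagated together, since f g - f' g'
   is half of (f - f') (g + g') + (f + f') (g - g'), and similarly with the sign changed.\<close>
 have step: "ferro (%z. f (fst z) * g (fst z) - f (snd z) * g (snd z)) \<and> ferro (%z. f (fst z) * g (fst z) + f (snd z) * g (snd z))"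
  if "ferro (%z. f (fst z) - f (snd z)) \<and> ferro (%z. f (fst z) + f (snd z))"
    "ferro (%z. g (fst z) - g (snd z)) \<and> ferro (%z. g (fst z) + g (snd z))" for f g :: "'i spin => real"
 proof -
  have "ferro (%z. (1/2) * ((f (fst z) - f (snd z)) * (g (fst z) + g (snd z)) + (f (fst z) + f (snd z)) * (g (fst z) - g (snd z))))"
   "ferro (%z. (1/2) * ((f (fst z) + f (snd z)) * (g (fst z) + g (snd z)) + (f (fst z) - f (snd z)) * (g (fst z) - g (snd z))))"
   by (intro ferro_add ferro_mult ferro_const that[THEN conjunct1] that[THEN conjunct2]; simp)+
  then show ?thesis by (simp add: algebra_simps)
 qed
 have one: "ferro (%z. Im (fst z x) - Im (snd z x)) \<and> ferro (%z. Im (fst z x) + Im (snd z x))" for x :: 'i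
  by (rule conjI[OF ferro_Im_diff ferro_Im_add])
 have f: "ferro (%z. ?y (fst z) - ?y (snd z))"
  by (rule step[OF step[OF step[OF one one] one] one, THEN conjunct1])
 \<comment> \<open>Only the second copy feels the field. Twice its real part is the sum of the two
   real parts plus the difference taken in the direction that \<open>ferro\<close> allows.\<close>
 have E: "ferro (%z. (xy_energy c F (fst z) + xy_energy c F (snd z)) + ?h (snd z))"
 proof (rule ferro_add[OF ferro_energy[OF c] ferro_sum])
  fix i assume "i \<in> I"
  then have "ferro (%z. (d i / 2) * ((Re (snd z (a i)) + Re (fst z (a i))) + (Re (snd z (a i)) - Re (fst z (a i)))))"
   using d by (intro ferro_add ferro_mult ferro_const ferro_Re_diff ferro_Re_add) auto
  then show "ferro (%z. d i * Re (snd z (a i)))" by (simp add: algebra_simps)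
 qed
 note b = bdd_meas_spin bdd_meas_xy_energy
 have bh: "bdd_meas spin_space ?h" "bdd_meas spin_space ?y" by (intro bdd_meas_arith b)+
 have bx: "bdd_meas spin_space (%th. ?y th * ?e th)" "bdd_meas spin_space ?k" "bdd_meas spin_space ?e"
  "bdd_meas spin_space (%th. ?y th * ?k th)"
  by (intro bdd_meas_arith b)+
 have "0 <= (\<integral>z. (?y (fst z) - ?y (snd z)) * exp ((xy_energy c F (fst z) + xy_energy c F (snd z)) + ?h (snd z)) \<partial>?P)"
  by (rule ferro_integral[OF f bdd_meas_diff[OF bdd_meas_fst[OF bh(2)] bdd_meas_snd[OF bh(2)]] E
    bdd_meas_add[OF bdd_meas_add[OF bdd_meas_fst[OF bdd_meas_xy_energy] bdd_meas_snd[OF bdd_meas_xy_energy]]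
     bdd_meas_snd[OF bh(1)]]])
 also have "... = (\<integral>z. (?y (fst z) * ?e (fst z)) * ?k (snd z) - ?e (fst z) * (?y (snd z) * ?k (snd z)) \<partial>?P)"
  by (intro Bochner_Integration.integral_cong refl) (simp add: exp_add algebra_simps)
 also have "... = (\<integral>th. ?y th * ?e th \<partial>spin_space) * (\<integral>th. ?k th \<partial>spin_space) -
   (\<integral>th. ?e th \<partial>spin_space) * (\<integral>th. ?y th * ?k th \<partial>spin_space)"
  unfolding spin.integral_pair_product[OF bx(1,2), symmetric] spin.integral_pair_product[OF bx(3,4), symmetric]
  using spin.P.bdd_meas_integrable[OF bdd_meas_mult[OF bdd_meas_fst[OF bx(1)] bdd_meas_snd[OF bx(2)]]]
   spin.P.bdd_meas_integrable[OF bdd_meas_mult[OF bdd_meas_fst[OF bx(3)] bdd_meas_snd[OF bx(4)]]]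
  by (rule Bochner_Integration.integral_diff)
 finally show ?thesis by (simp add: mult.commute)
qed

section \<open>The free XY model\<close>

definition xy_mean :: "real => ('i \<times> 'i) set => ('i spin => real) => real" where
 "xy_mean c F G = (\<integral>th. G th * exp (xy_energy c F th) \<partial>spin_space) / (\<integral>th. exp (xy_energy c F th) \<partial>spin_space)"

lemma xy_partition_pos: "(\<integral>th. exp (xy_energy c F th) \<partial>spin_space) > 0"
 by (rule spin.bdd_meas_exp_pos[OF bdd_meas_xy_energy])

lemma xy_weighted_integrable:
 "bdd_meas spin_space G ==> integrable spin_space (%th. G th * exp (xy_energy c F th))"
 by (intro spin.bdd_meas_integrable bdd_meas_arith bdd_meas_xy_energy)

lemma xy_mean_add:
 assumes "bdd_meas spin_space G" "bdd_meas spin_space H"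
 shows "xy_mean c F (%th. G th + H th) = xy_mean c F G + xy_mean c F H"
 using assms[THEN xy_weighted_integrable]
 by (simp add: xy_mean_def distrib_right add_divide_distrib)

lemma xy_mean_cmult: "xy_mean c F (%th. k * G th) = k * xy_mean c F G"
 by (simp add: xy_mean_def mult.assoc)

lemma xy_mean_minus: "xy_mean c F (%th. - G th) = - xy_mean c F G"
 by (simp add: xy_mean_def)

lemma xy_mean_diff:
 assumes "bdd_meas spin_space G" "bdd_meas spin_space H"
 shows "xy_mean c F (%th. G th - H th) = xy_mean c F G - xy_mean c F H"
 using assms[THEN xy_weighted_integrable]
 by (simp add: xy_mean_def left_diff_distrib diff_divide_distrib)

lemma xy_mean_sum:
 assumes "\<And>i. i \<in> I ==> bdd_meas spin_space (G i)"
 shows "xy_mean c F (%th. \<Sum>i\<in>I. G i th) = (\<Sum>i\<in>I. xy_mean c F (G i))"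
 using assms
proof (induction I rule: infinite_finite_induct)
 case (insert x I)
 then show ?case by (simp add: xy_mean_add bdd_meas_sum)
qed (simp_all add: xy_mean_def)

lemma xy_mean_const: "xy_mean c F (%th. k) = k"
 using xy_partition_pos[of c F] by (simp add: xy_mean_def)

lemma xy_mean_nonneg: "(\<And>th. G th \<ge> 0) ==> xy_mean c F G \<ge> 0"
 using xy_partition_pos[of c F]
 by (auto simp: xy_mean_def intro!: divide_nonneg_pos integral_nonneg_AE)

lemma xy_mean_le_one:
 assumes "bdd_meas spin_space G" "\<And>th. th \<in> space spin_space ==> G th <= 1"
 shows "xy_mean c F G <= 1"
proof -
 have "(\<integral>th. G th * exp (xy_energy c F th) \<partial>spin_space) <= (\<integral>th. 1 * exp (xy_energy c F th) \<partial>spin_space)"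
  by (intro integral_mono xy_weighted_integrable assms bdd_meas_const mult_right_mono) auto
 then show ?thesis using xy_partition_pos[of c F] by (simp add: xy_mean_def)
qed

lemma xy_mean_character_le_one: "spin.character \<xi> ==> xy_mean c F (%th. Re (\<xi> th)) <= 1"
 by (rule xy_mean_le_one[OF spin.bdd_meas_character(1)])
  (auto simp: spin.character_def intro: order.trans[OF complex_Re_le_cmod])

text \<open>A missing bond is a bond with coupling 0, so this is monotonicity in the
  couplings.\<close>

lemma xy_mean_mono:
 assumes \<xi>: "spin.character \<xi>" and c: "c \<ge> 0" and F: "F \<subseteq> F'" "finite F'"
 shows "xy_mean c F (%th. Re (\<xi> th)) <= xy_mean c F' (%th. Re (\<xi> th))"
proof -
 let ?a = "%b. if b \<in> F then c else 0"
 have e: "xy_energy c F th = (\<Sum>b\<in>F'. ?a b * Re (bond th b))" for th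
  unfolding xy_energy_def using F by (intro sum.mono_neutral_cong_left) auto
 have "(\<integral>th. Re (\<xi> th) * exp (\<Sum>b\<in>F'. ?a b * Re (bond th b)) \<partial>spin_space) * (\<integral>th. exp (\<Sum>b\<in>F'. c * Re (bond th b)) \<partial>spin_space)
  <= (\<integral>th. Re (\<xi> th) * exp (\<Sum>b\<in>F'. c * Re (bond th b)) \<partial>spin_space) * (\<integral>th. exp (\<Sum>b\<in>F'. ?a b * Re (bond th b)) \<partial>spin_space)"
  by (rule spin.ginibre_mono) (use c \<xi> F in \<open>auto intro: bond_character\<close>)
 then show ?thesis
  using xy_partition_pos[of c F] xy_partition_pos[of c F'] unfolding xy_mean_def e[symmetric] xy_energy_def[symmetric]
  by (simp add: field_simps)
qed

text \<open>Without bonds the mean is a Haar integral of a character, which is nonnegative; adding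
  bonds increases it.\<close>

lemma xy_mean_character_nonneg:
 assumes "spin.character \<xi>" "c \<ge> 0" "finite F" shows "xy_mean c F (%th. Re (\<xi> th)) \<ge> 0"
proof -
 have "0 <= xy_mean c {} (%th. Re (\<xi> th))"
  using spin.integral_Re_character_nonneg[OF assms(1)] by (simp add: xy_mean_def xy_energy_def)
 also have "... <= xy_mean c F (%th. Re (\<xi> th))" by (rule xy_mean_mono) (use assms in auto)
 finally show ?thesis .
qed

text \<open>A global rotation preserves every bond and negates the character. Asking for the value
  -1 keeps the argument within real parts.\<close>

lemma xy_mean_charged:
 assumes \<xi>: "spin.character \<xi>" and w: "norm w = 1" "\<xi> (%_. w) = -1"
 shows "xy_mean c F (%th. Re (\<xi> th)) = 0"
proof -
 have sp: "(%_. w) \<in> space spin_space" using w by (simp add: space_spin_space)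
 have "bond (%i. w * th i) b = (w * cnj w) * bond th b" for th :: "'a spin" and b
  by (simp add: bond_def algebra_simps)
 then have e: "xy_energy c F (%i. w * th i) = xy_energy c F th" for th
  using w by (simp add: xy_energy_def complex_norm_square[symmetric])
 have m: "\<xi> (%i. w * th i) = - \<xi> th" if "th \<in> space spin_space" for th
  using \<xi> sp w that unfolding spin.character_def by auto
 have bm: "bdd_meas spin_space (%th. Re (\<xi> th) * exp (xy_energy c F th))"
  by (intro bdd_meas_arith spin.bdd_meas_character \<xi> bdd_meas_xy_energy)
 have "(\<integral>th. Re (\<xi> th) * exp (xy_energy c F th) \<partial>spin_space) =
  (\<integral>th. Re (\<xi> (%i. w * th i)) * exp (xy_energy c F (%i. w * th i)) \<partial>spin_space)"
  by (rule spin.integral_mul[OF sp bdd_meas_measurable[OF bm], symmetric])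
 also have "... = (\<integral>th. - (Re (\<xi> th) * exp (xy_energy c F th)) \<partial>spin_space)"
  by (intro Bochner_Integration.integral_cong refl) (simp add: e m)
 finally show ?thesis by (simp add: xy_mean_def)
qed

lemma xy_mean_reindex:
 fixes T :: "'i => 'i"
 assumes T: "inj T" and G: "bdd_meas spin_space G"
 shows "xy_mean c (map_prod T T ` F) (%th. G (%i. th (T i))) = xy_mean c F G"
proof -
 have e: "xy_energy c (map_prod T T ` F) th = xy_energy c F (%i. th (T i))" for th
 proof -
  have "inj_on (map_prod T T) F" by (rule inj_onI) (auto simp: inj_eq[OF T])
  then show ?thesis unfolding xy_energy_def by (simp add: sum.reindex bond_def)
 qed
 have bm: "bdd_meas spin_space (%th. G th * exp (xy_energy c F th))" "bdd_meas spin_space (%th. exp (xy_energy c F th))"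
  by (intro bdd_meas_arith G bdd_meas_xy_energy)+
 show ?thesis
  unfolding xy_mean_def e
  using spin_reindex[OF T bdd_meas_measurable[OF bm(1)]] spin_reindex[OF T bdd_meas_measurable[OF bm(2)]] by simp
qed

text \<open>The three neutral characters of four spins with charges \<open>\<plusminus>1\<close>.\<close>

definition chi4 :: "'i => 'i => 'i => 'i => 'i spin => complex" where
 "chi4 a b d e th = th a * th b * cnj (th d) * cnj (th e)"

definition chi2 :: "'i => 'i => 'i spin => complex" where
 "chi2 a b th = th a * cnj (th b)"

lemma chi_character: "spin.character (chi4 a b d e)" "spin.character (chi2 a b)"
 unfolding chi4_def[abs_def] chi2_def[abs_def] by (intro spin_character_intros)+

lemma bdd_meas_chi: "bdd_meas spin_space (%th. Re (chi4 a b d e th))" "bdd_meas spin_space (%th. Re (chi2 a b th))"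
 by (intro spin.bdd_meas_character chi_character)+

text \<open>Of the sixteen sign patterns of four charges, taken up to conjugation, five are not
  neutral: total charge 2 for \<open>k < 4\<close> and 4 for \<open>k = 4\<close>.\<close>

definition charged4 :: "'i => 'i => 'i => 'i => nat => 'i spin => complex" where
 "charged4 p q p' q' k th = [th p * cnj (th q) * th p' * th q', cnj (th p) * th q * th p' * th q',
   th p * th q * th p' * cnj (th q'), th p * th q * cnj (th p') * th q', th p * th q * th p' * th q'] ! k"

lemma charged4_character: "k < 5 ==> spin.character (charged4 p q p' q' k)"
proof -
 assume "k < 5"
 then consider "k = 0" | "k = 1" | "k = 2" | "k = 3" | "k = 4" by linarith
 then show ?thesis
  by cases (simp_all add: charged4_def[abs_def], (intro spin_character_intros)+)
qed

lemma components_expand: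
 "Re (th p) * Re (th q) * (Im (th p') * Im (th q')) = (1/8) * (Re (chi4 p p' q q' th) + Re (chi4 p q' p' q th) - Re (chi4 p q p' q' th)
   + (- Re (charged4 p q p' q' 0 th) - Re (charged4 p q p' q' 1 th) + Re (charged4 p q p' q' 2 th)
   + Re (charged4 p q p' q' 3 th) - Re (charged4 p q p' q' 4 th)))" (is ?thesis_a)
 "Im (th p) * Im (th q) * Im (th p') * Im (th q') = (1/8) * (Re (chi4 p p' q q' th) + Re (chi4 p q' p' q th) + Re (chi4 p q p' q' th)
   + (- Re (charged4 p q p' q' 0 th) - Re (charged4 p q p' q' 1 th) - Re (charged4 p q p' q' 2 th)
   - Re (charged4 p q p' q' 3 th) + Re (charged4 p q p' q' 4 th)))" (is ?thesis_b)
proof -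
 define a b d e where "a = th p" and "b = th q" and "d = th p'" and "e = th q'"
 have RR: "Re z * Re w = (Re (z * w) + Re (z * cnj w)) / 2" and II: "Im z * Im w = (Re (z * cnj w) - Re (z * w)) / 2" for z w
  by (simp_all add: field_simps)
 have "Re (a * cnj b * cnj (d * e)) = Re (cnj (a * cnj b * cnj (d * e)))" by (rule cnj.simps(1)[symmetric])
 also have "... = Re (cnj a * b * d * e)" by (simp only: complex_cnj_mult complex_cnj_cnj ac_simps)
 finally have conj: "Re (a * cnj b * cnj (d * e)) = Re (cnj a * b * d * e)" .
 have chi: "chi4 p p' q q' th = a * cnj b * (d * cnj e)" "chi4 p q' p' q th = a * cnj b * cnj (d * cnj e)"
  "chi4 p q p' q' th = a * b * cnj (d * e)"
  unfolding chi4_def a_def b_def d_def e_def complex_cnj_mult complex_cnj_cnj by (simp_all only: ac_simps)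
 have ch: "charged4 p q p' q' 0 th = a * cnj b * (d * e)" "charged4 p q p' q' 1 th = cnj a * b * d * e"
  "charged4 p q p' q' 2 th = a * b * (d * cnj e)" "charged4 p q p' q' 3 th = a * b * cnj (d * cnj e)"
  "charged4 p q p' q' 4 th = a * b * (d * e)"
  unfolding charged4_def a_def b_def d_def e_def complex_cnj_mult complex_cnj_cnj
  by (simp_all add: eval_nat_numeral mult.assoc)
 have pr: "Re (a * cnj b) * Re (d * cnj e) = (Re (chi4 p p' q q' th) + Re (chi4 p q' p' q th)) / 2"
  "Re (a * cnj b) * Re (d * e) = (Re (charged4 p q p' q' 0 th) + Re (charged4 p q p' q' 1 th)) / 2"
  "Re (a * b) * Re (d * cnj e) = (Re (charged4 p q p' q' 2 th) + Re (charged4 p q p' q' 3 th)) / 2"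
  "Re (a * b) * Re (d * e) = (Re (charged4 p q p' q' 4 th) + Re (chi4 p q p' q' th)) / 2"
  unfolding chi ch RR[of "a * _"] conj by (rule refl)+
 have lin: "X = ((c2 + c3) / 2 - (c4 + y) / 2 + (z + w) / 2 - (c0 + c1) / 2) / 4 ==>
   X = (1/8) * (z + w - y + (- c0 - c1 + c2 + c3 - c4))"
  "X = ((z + w) / 2 - (c0 + c1) / 2 - (c2 + c3) / 2 + (c4 + y) / 2) / 4 ==>
   X = (1/8) * (z + w + y + (- c0 - c1 - c2 - c3 + c4))" for X c0 c1 c2 c3 c4 y z w :: real
  by (simp_all add: field_simps)
 have gen: "((u + v) / 2) * ((w - x) / 2) = (u * w - u * x + v * w - v * x) / 4"
  "((u - v) / 2) * ((w - x) / 2) = (u * w - u * x - v * w + v * x) / 4" for u v w x :: real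
  by (simp_all add: field_simps)
 have "Re a * Re b * (Im d * Im e) = (Re (a * b) * Re (d * cnj e) - Re (a * b) * Re (d * e)
   + Re (a * cnj b) * Re (d * cnj e) - Re (a * cnj b) * Re (d * e)) / 4"
  unfolding RR[of a b] II[of d e] gen by (rule refl)
 then show ?thesis_a
  unfolding pr unfolding a_def b_def d_def e_def by (rule lin)
 have "Im a * Im b * (Im d * Im e) = (Re (a * cnj b) * Re (d * cnj e) - Re (a * cnj b) * Re (d * e)
   - Re (a * b) * Re (d * cnj e) + Re (a * b) * Re (d * e)) / 4"
  unfolding II[of a b] II[of d e] gen by (rule refl)
 then show ?thesis_b
  unfolding pr unfolding a_def b_def d_def e_def mult.assoc by (rule lin)
qed

lemma charged4_mean: "k < 5 ==> xy_mean c F (%th. Re (charged4 p q p' q' k th)) = 0"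
proof -
 assume k: "k < 5"
 \<comment> \<open>The power of \<open>w\<close> given by the total charge, 2 or 4, has to be
   -1.\<close>
 define w where "w = (if k = 4 then cis (pi/4) else \<i>)"
 consider "k = 0" | "k = 1" | "k = 2" | "k = 3" | "k = 4" using k by linarith
 then have "charged4 p q p' q' k (%_. w) = -1"
  by cases (simp_all add: charged4_def w_def cis_mult mult.assoc)
 then show ?thesis
  by (intro xy_mean_charged[OF charged4_character[OF k], of w]) (auto simp: w_def)
qed

lemma bdd_meas_charged4: "k < 5 ==> bdd_meas spin_space (%th. Re (charged4 p q p' q' k th))"
 by (intro spin.bdd_meas_character charged4_character)

lemma xy_mean_components:
 "xy_mean c F (%th. Re (th p) * Re (th q) * (Im (th p') * Im (th q'))) =
  (xy_mean c F (%th. Re (chi4 p p' q q' th)) + xy_mean c F (%th. Re (chi4 p q' p' q th)) - xy_mean c F (%th. Re (chi4 p q p' q' th))) / 8" (is ?thesis_a)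
 "xy_mean c F (%th. Im (th p) * Im (th q) * Im (th p') * Im (th q')) =
  (xy_mean c F (%th. Re (chi4 p p' q q' th)) + xy_mean c F (%th. Re (chi4 p q' p' q th)) + xy_mean c F (%th. Re (chi4 p q p' q' th))) / 8" (is ?thesis_b)
proof -
 have gen: "xy_mean c F (%th. (1/8) * (A th + B th + s * C th + (- D0 th - D1 th + t * D2 th + t * D3 th + u * D4 th))) =
  (1/8) * (xy_mean c F A + xy_mean c F B + s * xy_mean c F C + (- xy_mean c F D0 - xy_mean c F D1 + t * xy_mean c F D2 + t * xy_mean c F D3 + u * xy_mean c F D4))"
  if "bdd_meas spin_space A" "bdd_meas spin_space B" "bdd_meas spin_space C" "bdd_meas spin_space D0" "bdd_meas spin_space D1"
   "bdd_meas spin_space D2" "bdd_meas spin_space D3" "bdd_meas spin_space D4" for A B C D0 D1 D2 D3 D4 :: "'a spin => real" and s t u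
  using that
  by (simp only: xy_mean_add xy_mean_diff xy_mean_minus xy_mean_cmult bdd_meas_add bdd_meas_diff bdd_meas_minus bdd_meas_cmult)
 note g = gen[OF bdd_meas_chi(1) bdd_meas_chi(1) bdd_meas_chi(1) bdd_meas_charged4[of 0 p q p' q'] bdd_meas_charged4[of 1 p q p' q']
  bdd_meas_charged4[of 2 p q p' q'] bdd_meas_charged4[of 3 p q p' q'] bdd_meas_charged4[of 4 p q p' q'], unfolded charged4_mean]
 show ?thesis_a
  using g[where s="-1" and t=1 and u="-1", of p p' q q' p q' p' q p q p' q']
  by (simp add: components_expand charged4_mean)
 show ?thesis_b
  using g[where s=1 and t="-1" and u=1, of p p' q q' p q' p' q p q p' q']
  by (simp add: components_expand charged4_mean)
qed

lemma xy_mean_two_components: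
 "xy_mean c F (%th. Re (th p) * Re (th q)) = xy_mean c F (%th. Re (chi2 p q th)) / 2" (is ?thesis_a)
 "xy_mean c F (%th. Im (th p) * Im (th q)) = xy_mean c F (%th. Re (chi2 p q th)) / 2" (is ?thesis_b)
proof -
 have ch: "spin.character (%th. th p * th q)" by (intro spin_character_intros)
 have z: "xy_mean c F (%th. Re (th p * th q)) = 0"
  by (rule xy_mean_charged[OF ch, of \<i>]) auto
 have 1: "Re (th p) * Re (th q) = (1/2) * (Re (chi2 p q th) + Re (th p * th q))"
  and 2: "Im (th p) * Im (th q) = (1/2) * (Re (chi2 p q th) - Re (th p * th q))" for th :: "'a spin"
  by (simp_all add: chi2_def)
 note b = bdd_meas_chi(2)[of p q] spin.bdd_meas_character(1)[OF ch]
 show ?thesis_a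
  unfolding 1 xy_mean_cmult xy_mean_add[OF b] z by simp
 show ?thesis_b
  unfolding 2 xy_mean_cmult xy_mean_diff[OF b] z by simp
qed

text \<open>The left side is the correlation of the sines of the bonds (p, p') and (q, q').
  Expanding real and imaginary parts into characters, \<open>xy_opposite_components\<close> becomes
  an inequality between the neutral characters alone, and moving one of them to the other side gives
  the claim.\<close>

lemma xy_four_point_bound:
 assumes "c \<ge> 0"
 shows "(xy_mean c F (%th. Re (chi4 p q' p' q th)) - xy_mean c F (%th. Re (chi4 p q p' q' th))) / 2
  <= xy_mean c F (%th. Re (chi2 p q th)) * xy_mean c F (%th. Re (chi2 p' q' th))
   - xy_mean c F (%th. Re (chi4 p p' q q' th)) / 2"
proof -
 have "xy_mean c F (%th. Re (th p) * Re (th q) * (Im (th p') * Im (th q')))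
  <= xy_mean c F (%th. Re (th p) * Re (th q)) * xy_mean c F (%th. Im (th p') * Im (th q'))"
 proof -
  have "X / Z <= (A / Z) * (B / Z)" if "X * Z <= A * B" "Z > 0" for X Z A B :: real
  proof -
   have "X / Z = (X * Z) / (Z * Z)" using that by simp
   also have "... <= (A * B) / (Z * Z)" using that by (intro divide_right_mono) auto
   finally show ?thesis by simp
  qed
  from this[OF xy_opposite_components[OF assms, of p q p' q' F] xy_partition_pos[of c F]]
  show ?thesis unfolding xy_mean_def .
 qed
 then show ?thesis unfolding xy_mean_components xy_mean_two_components by simp
qed

text \<open>Given the spins fixed by \<open>R\<close>, the two halves interact only through bonds
  joining a site to its own mirror image. Such a bond contributes a sum of products of one function
  evaluated on both halves, so the conditional integral is of the form treated by
  \<open>reflection_positive\<close>. Mirrors through sites and through midpoints of bonds are both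
  covered.\<close>

lemma xy_reflection_positive:
 fixes R :: "'i => 'i"
 assumes c: "c \<ge> 0" and F: "finite F" and R: "\<And>x. R (R x) = x" and LR: "L \<inter> R ` L = {}"
  and mid: "\<And>x. x \<notin> L ==> x \<notin> R ` L ==> R x = x"
  and sym: "\<And>x y. (x, y) \<in> F ==> (R x, R y) \<in> F"
  and cross: "\<And>x y. (x, y) \<in> F ==> (x \<in> L \<and> y \<in> R ` L) \<or> (x \<in> R ` L \<and> y \<in> L) ==> y = R x"
  and g: "bdd_meas spin_space g" and loc: "\<And>th th'. (\<And>x. x \<notin> R ` L ==> th x = th' x) ==> g th = g th'"
 shows "xy_mean c F (%th. g th * g (%x. th (R x))) \<ge> 0"
proof -
 let ?P = "spin_space \<Otimes>\<^sub>M spin_space :: ('i spin \<times> 'i spin) measure"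
 define M where "M = - (L \<union> R ` L)"
 have injR: "inj R" by (metis R injI)
 have RL: "R x \<in> R ` L \<longleftrightarrow> x \<in> L" "R x \<in> L \<longleftrightarrow> x \<in> R ` L" for x
  using R by (metis image_iff)+
 have RM: "x \<in> M ==> R x = x" for x using mid by (auto simp: M_def)
 \<comment> \<open>Independent fields are assembled into one: \<open>m2\<close> reads the left half
   from the first field and, through \<open>R\<close>, the right half from the second;
   \<open>m1\<close> adds the spins on the mirror.\<close>
 define m1 where "m1 z i = (if i \<in> M then fst z i else snd z i)" for z :: "'i spin \<times> 'i spin" and i
 define m2 where "m2 z i = (if i \<in> L then fst z i else snd z (R i))" for z :: "'i spin \<times> 'i spin" and i
 have m1: "m1 \<in> measurable ?P spin_space" "distr ?P spin_space m1 = spin_space"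
  using spin_merge_measurable[of M "%i. i" "%i. i"] spin_merge[of "%i. i" M "%i. i"]
  by (simp_all add: m1_def[abs_def])
 have m2: "m2 \<in> measurable ?P spin_space" "distr ?P spin_space m2 = spin_space"
  using spin_merge_measurable[of L "%i. i" R] spin_merge[of "%i. i" L R] injR
  by (simp_all add: m2_def[abs_def] inj_on_subset)
 \<comment> \<open>The bonds are sorted into those touching the left half but not the right (bonds
   to the mirror included), their mirror images \<open>FB\<close>, the crossing ones, and those
   within the mirror.\<close>
 define FA where "FA = {b\<in>F. (fst b \<in> L \<or> snd b \<in> L) \<and> fst b \<notin> R ` L \<and> snd b \<notin> R ` L}"
 define FC where "FC = {b\<in>F. (fst b \<in> L \<and> snd b \<in> R ` L) \<or> (fst b \<in> R ` L \<and> snd b \<in> L)}"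
 define FM where "FM = {b\<in>F. fst b \<in> M \<and> snd b \<in> M}"
 define FB where "FB = map_prod R R ` FA"
 have FB: "FB = {b\<in>F. (fst b \<in> R ` L \<or> snd b \<in> R ` L) \<and> fst b \<notin> L \<and> snd b \<notin> L}"
 proof (rule set_eqI)
  fix b :: "'i \<times> 'i"
  obtain x y where b: "b = (x, y)" by force
  have "b \<in> FB \<longleftrightarrow> (R x, R y) \<in> FA"
  proof
   assume "b \<in> FB" then show "(R x, R y) \<in> FA" by (auto simp: FB_def b R)
  next
   assume "(R x, R y) \<in> FA"
   then have "map_prod R R (R x, R y) \<in> FB" unfolding FB_def by blast
   then show "b \<in> FB" by (simp add: b R)
  qed
  moreover have "(R x, R y) \<in> F \<longleftrightarrow> (x, y) \<in> F" using sym R by metis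
  ultimately show "b \<in> FB \<longleftrightarrow> b \<in> {b\<in>F. (fst b \<in> R ` L \<or> snd b \<in> R ` L) \<and> fst b \<notin> L \<and> snd b \<notin> L}"
   by (simp add: FA_def RL b)
 qed
 have fin: "finite FA" "finite FB" "finite FC" "finite FM"
  using F unfolding FB by (simp_all add: FA_def FC_def FM_def)
 have F_eq: "F = FM \<union> (FA \<union> (FB \<union> FC))" and disj: "FM \<inter> (FA \<union> (FB \<union> FC)) = {}" "FA \<inter> (FB \<union> FC) = {}" "FB \<inter> FC = {}"
  unfolding FB using LR by (auto simp: FA_def FC_def FM_def M_def)
 define half where "half \<omega> u = (%x. if x \<in> L then u x else \<omega> x)" for \<omega> u :: "'i spin"
 define E where "E \<omega> u = (\<Sum>b\<in>FA. c * Re (bond (half \<omega> u) b))" for \<omega> u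
 define X where "X b = (if fst b \<in> L then fst b else snd b)" for b :: "'i \<times> 'i"
 \<comment> \<open>\<open>X\<close> picks the left end of a crossing bond, the boolean picks a
   component, and \<open>sqrt c\<close> shares the coupling between the two factors.\<close>
 define h where "h j u = sqrt c * (if snd j then Re (u (X (fst j))) else Im (u (X (fst j))))" for j :: "('i \<times> 'i) \<times> bool" and u :: "'i spin"
 define em where "em \<omega> = (\<Sum>b\<in>FM. c * Re (bond \<omega> b))" for \<omega> :: "'i spin"
 define f where "f th = g th * g (%x. th (R x)) * exp (xy_energy c F th)" for th
 have mR: "(%th x. th (R x)) \<in> measurable spin_space spin_space"
  by (rule measurable_into_spin_space) (auto simp: space_spin_space)
 have bf: "bdd_meas spin_space f"
  unfolding f_def by (intro bdd_meas_arith g bdd_meas_xy_energy bdd_meas_compose[OF g mR])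
 have key: "f (m1 (\<omega>, m2 z)) = exp (em \<omega>) * ((g (half \<omega> (fst z)) * exp (E \<omega> (fst z))) * (g (half \<omega> (snd z)) * exp (E \<omega> (snd z))) *
   exp (\<Sum>j\<in>FC \<times> UNIV. h j (fst z) * h j (snd z)))" for \<omega> z
 proof -
  define \<Theta> where "\<Theta> = m1 (\<omega>, m2 z)"
  have T: "\<Theta> x = (if x \<in> L then fst z x else if x \<in> R ` L then snd z (R x) else \<omega> x)" for x
   by (auto simp: \<Theta>_def m1_def m2_def M_def)
  have g1: "g \<Theta> = g (half \<omega> (fst z))"
   by (rule loc) (auto simp: T half_def)
  have g2: "g (%x. \<Theta> (R x)) = g (half \<omega> (snd z))"
  proof (rule loc)
   fix x assume x: "x \<notin> R ` L"
   show "\<Theta> (R x) = half \<omega> (snd z) x"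
    using x LR mid[of x] by (auto simp: T half_def RL R)
  qed
  have eM: "(\<Sum>b\<in>FM. c * Re (bond \<Theta> b)) = em \<omega>"
   unfolding em_def by (intro sum.cong refl) (auto simp: FM_def M_def bond_def T)
  have eA: "(\<Sum>b\<in>FA. c * Re (bond \<Theta> b)) = E \<omega> (fst z)"
   unfolding E_def by (intro sum.cong refl) (auto simp: FA_def bond_def T half_def)
  have eB: "(\<Sum>b\<in>FB. c * Re (bond \<Theta> b)) = E \<omega> (snd z)"
  proof -
   have "(\<Sum>b\<in>FB. c * Re (bond \<Theta> b)) = (\<Sum>b\<in>FA. c * Re (bond \<Theta> (map_prod R R b)))"
   proof -
    have "inj_on (map_prod R R) FA" by (rule inj_onI) (auto simp: inj_eq[OF injR])
    then show ?thesis unfolding FB_def by (simp add: sum.reindex)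
   qed
   also have "... = E \<omega> (snd z)"
    unfolding E_def
   proof (intro sum.cong refl)
    fix b assume b: "b \<in> FA"
    have "\<Theta> (R x) = half \<omega> (snd z) x" if "x \<notin> R ` L" for x
     using that LR mid[of x] by (auto simp: T half_def RL R)
    then show "c * Re (bond \<Theta> (map_prod R R b)) = c * Re (bond (half \<omega> (snd z)) b)"
     using b by (auto simp: FA_def bond_def)
   qed
   finally show ?thesis .
  qed
  have eC: "(\<Sum>b\<in>FC. c * Re (bond \<Theta> b)) = (\<Sum>j\<in>FC \<times> UNIV. h j (fst z) * h j (snd z))"
  proof -
   have "(\<Sum>j\<in>FC \<times> UNIV. h j (fst z) * h j (snd z)) = (\<Sum>b\<in>FC. \<Sum>s\<in>UNIV. h (b, s) (fst z) * h (b, s) (snd z))"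
    by (simp add: sum.cartesian_product case_prod_unfold)
   also have "... = (\<Sum>b\<in>FC. c * Re (bond \<Theta> b))"
   proof (intro sum.cong refl)
    fix b assume b: "b \<in> FC"
    obtain x y where xy: "b = (x, y)" by force
    have "(\<Sum>s\<in>UNIV. h (b, s) (fst z) * h (b, s) (snd z)) =
     (sqrt c * sqrt c) * (Re (fst z (X b)) * Re (snd z (X b)) + Im (fst z (X b)) * Im (snd z (X b)))"
     by (simp only: h_def UNIV_bool sum.insert finite.intros)
      (simp add: algebra_simps del: real_sqrt_mult_self real_sqrt_abs2)
    also have "... = c * Re (bond \<Theta> b)"
    proof -
     have y: "y = R x" using b cross[of x y] by (auto simp: FC_def xy)
     have "(x \<in> L \<and> y \<in> R ` L) \<or> (x \<in> R ` L \<and> y \<in> L)" using b by (auto simp: FC_def xy)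
     then show ?thesis using LR c by (auto simp: X_def xy bond_def T y R RL algebra_simps)
    qed
    finally show "(\<Sum>s\<in>UNIV. h (b, s) (fst z) * h (b, s) (snd z)) = c * Re (bond \<Theta> b)" .
   qed
   finally show ?thesis ..
  qed
  have "xy_energy c F \<Theta> = em \<omega> + (E \<omega> (fst z) + (E \<omega> (snd z) + (\<Sum>j\<in>FC \<times> UNIV. h j (fst z) * h j (snd z))))"
   unfolding xy_energy_def
   by (subst F_eq) (simp add: sum.union_disjoint fin disj eM eA eB eC)
  then show ?thesis
   unfolding f_def \<Theta>_def[symmetric] g1 g2 by (simp add: exp_add algebra_simps)
 qed
 have inner: "(\<integral>z. f (m1 (\<omega>, m2 z)) \<partial>?P) \<ge> 0" if \<omega>: "\<omega> \<in> space spin_space" for \<omega>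
 proof -
  have mh: "half \<omega> \<in> measurable spin_space spin_space"
  proof (rule measurable_into_spin_space)
   fix i show "(%u. half \<omega> u i) \<in> borel_measurable spin_space"
    unfolding half_def by (cases "i \<in> L") auto
  qed (use \<omega> in \<open>auto simp: half_def space_spin_space\<close>)
  have bE: "bdd_meas spin_space (E \<omega>)"
   unfolding E_def by (intro bdd_meas_sum bdd_meas_cmult bdd_meas_compose[OF bdd_meas_bond(1) mh])
  have bh: "bdd_meas spin_space (h j)" for j
   unfolding h_def by (cases "snd j") (simp_all add: bdd_meas_cmult bdd_meas_spin)
  have "0 <= (\<integral>z. (g (half \<omega> (fst z)) * exp (E \<omega> (fst z))) * (g (half \<omega> (snd z)) * exp (E \<omega> (snd z))) *
   exp (\<Sum>j\<in>FC \<times> UNIV. h j (fst z) * h j (snd z)) \<partial>?P)"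
   by (rule spin.reflection_positive[of "%u. g (half \<omega> u) * exp (E \<omega> u)"])
    (intro bdd_meas_mult bdd_meas_exp bE bdd_meas_compose[OF g mh] bh)+
  then show ?thesis unfolding key by simp
 qed
 have bf1: "bdd_meas ?P (%z. f (m1 z))" by (rule bdd_meas_compose[OF bf m1(1)])
 have "(\<integral>th. f th \<partial>spin_space) = (\<integral>z. f (m1 z) \<partial>?P)"
  using integral_distr[OF m1(1) bdd_meas_measurable[OF bf]] m1(2) by simp
 also have "... = (\<integral>\<omega>. (\<integral>w. f (m1 (\<omega>, w)) \<partial>spin_space) \<partial>spin_space)"
  by (rule spin.integral_pair_iterated[OF bf1])
 also have "... = (\<integral>\<omega>. (\<integral>z. f (m1 (\<omega>, m2 z)) \<partial>?P) \<partial>spin_space)"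
 proof (intro Bochner_Integration.integral_cong refl)
  fix \<omega> :: "'i spin" assume \<omega>: "\<omega> \<in> space spin_space"
  have "(%w. f (m1 (\<omega>, w))) \<in> borel_measurable spin_space"
   using measurable_compose[OF measurable_Pair1'[OF \<omega>] bdd_meas_measurable[OF bf1]] .
  from integral_distr[OF m2(1) this]
  show "(\<integral>w. f (m1 (\<omega>, w)) \<partial>spin_space) = (\<integral>z. f (m1 (\<omega>, m2 z)) \<partial>?P)"
   using m2(2) by simp
 qed
 also have "... \<ge> 0" by (intro integral_nonneg_AE AE_I2 inner)
 finally show ?thesis
  unfolding xy_mean_def f_def using xy_partition_pos[of c F] by simp
qed

section \<open>Pinned fields and the Mermin-Wagner estimate\<close>

text \<open>The boundary condition is put into the energy and not into the measure: spins outside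
  \<open>B\<close> stay independent and uniform, but the energy sees the value 1 in their
  place.\<close>

definition pin :: "'i set => 'i spin => 'i spin" where
 "pin B th x = (if x \<in> B then th x else 1)"

lemma pin_measurable: "pin B \<in> measurable spin_space spin_space"
proof (rule measurable_into_spin_space)
 fix i show "(%th. pin B th i) \<in> borel_measurable spin_space"
  unfolding pin_def by (cases "i \<in> B") auto
qed (auto simp: pin_def space_spin_space)

lemma pinned_bond_character: "spin.character (%th. bond (pin B th) b)"
 by (cases "fst b \<in> B"; cases "snd b \<in> B") (simp_all add: bond_def pin_def spin_character_intros)

definition pinned_energy :: "real => 'i set => ('i \<times> 'i) set => 'i spin => real" where
 "pinned_energy c B D th = xy_energy c D (pin B th)"

lemma bdd_meas_pinned_energy: "bdd_meas spin_space (pinned_energy c B D)"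
 unfolding pinned_energy_def[abs_def] by (rule bdd_meas_compose[OF bdd_meas_xy_energy pin_measurable])

definition pinned_mean :: "real => 'i set => ('i \<times> 'i) set => ('i spin => real) => real" where
 "pinned_mean c B D G = (\<integral>th. G th * exp (pinned_energy c B D th) \<partial>spin_space) /
   (\<integral>th. exp (pinned_energy c B D th) \<partial>spin_space)"

lemma pinned_partition_pos: "(\<integral>th. exp (pinned_energy c B D th) \<partial>spin_space) > 0"
 by (rule spin.bdd_meas_exp_pos[OF bdd_meas_pinned_energy])

lemma one_minus_cos_le: "1 - cos t <= t\<^sup>2 / 2" for t :: real
proof -
 have "1 - cos t = 2 * (sin (t / 2))\<^sup>2"
  using cos_double_sin[of "t / 2"] by simp
 also have "(sin (t / 2))\<^sup>2 <= (t / 2)\<^sup>2"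
  using abs_sin_x_le_abs_x[of "t / 2"] by (simp add: abs_le_square_iff[symmetric])
 finally show ?thesis by (simp add: power2_eq_square)
qed

text \<open>
 Comparing the measure with its image under the rotation by \<open>a\<close>: the Hellinger distance of the two
 is controlled by the Dirichlet energy of \<open>a\<close>, the first order term vanishing by the symmetry
 \<open>\<theta> \<mapsto> -\<theta>\<close>, while the character changes sign.
\<close>

lemma mermin_wagner:
 fixes a :: "'i => real"
 assumes c: "c \<ge> 0" and \<xi>: "spin.character \<xi>" and flip: "\<xi> (%x. cis (a x)) = -1"
  and supp: "\<And>x. x \<notin> B ==> a x = 0" and \<delta>: "\<delta> > 0"
  and en: "c / 2 * (\<Sum>b\<in>D. (a (fst b) - a (snd b))\<^sup>2) <= \<delta>\<^sup>2"
 shows "\<bar>pinned_mean c B D (%th. Re (\<xi> th))\<bar> <= 2 * \<delta>"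
proof -
 define S where "S = pinned_energy c B D"
 define K where "K x = cis (a x)" for x
 define Sk where "Sk th = S (%i. K i * th i)" for th
 define W where "W th = exp (S th)" for th
 define Wk where "Wk th = exp (Sk th)" for th
 \<comment> \<open>The geometric mean of the weights \<open>W\<close> and \<open>Wk\<close>. With
   \<open>I\<close> its integral, \<open>2 * Z - 2 * I\<close> is the squared Hellinger distance, up
   to normalisation.\<close>
 define V where "V th = exp ((S th + Sk th) / 2)" for th
 define Z where "Z = (\<integral>th. W th \<partial>spin_space)"
 define et where "et = c / 2 * (\<Sum>b\<in>D. (a (fst b) - a (snd b))\<^sup>2)"
 have K: "K \<in> space spin_space" by (simp add: K_def space_spin_space)
 have mK: "(%th i. K i * th i) \<in> measurable spin_space spin_space"
  by (rule spin.mul_left_measurable[OF K])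
 have bS: "bdd_meas spin_space S" unfolding S_def by (rule bdd_meas_pinned_energy)
 have bSk: "bdd_meas spin_space Sk" unfolding Sk_def by (rule bdd_meas_compose[OF bS mK])
 have bW: "bdd_meas spin_space W" "bdd_meas spin_space Wk" "bdd_meas spin_space V"
  unfolding W_def Wk_def V_def by (intro bdd_meas_arith bS bSk)+
 note iW = bW[THEN spin.bdd_meas_integrable]
 have b\<xi>: "bdd_meas spin_space (%th. Re (\<xi> th))" by (rule spin.bdd_meas_character[OF \<xi>])
 have Z: "Z > 0" unfolding Z_def W_def S_def by (rule pinned_partition_pos)
 have Zk: "(\<integral>th. Wk th \<partial>spin_space) = Z"
  unfolding Z_def Wk_def Sk_def W_def[symmetric]
  by (rule spin.integral_mul[OF K bdd_meas_measurable[OF bW(1)]])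
 have rot: "bond (pin B (%i. K i * th i)) b = cis (a (fst b) - a (snd b)) * bond (pin B th) b" for th b
 proof -
  have p: "pin B (%i. K i * th i) x = cis (a x) * pin B th x" for x
   using supp[of x] by (simp add: pin_def K_def)
  have "cis (a (fst b)) * cnj (cis (a (snd b))) = cis (a (fst b) - a (snd b))"
   by (simp add: cis_cnj cis_mult)
  then show ?thesis unfolding bond_def p by (simp add: algebra_simps flip: cis_cnj)
 qed
 have diff: "Sk th - S th = (\<Sum>b\<in>D. c * (cos (a (fst b) - a (snd b)) - 1) * Re (bond (pin B th) b)
   - c * sin (a (fst b) - a (snd b)) * Im (bond (pin B th) b))" for th
  unfolding Sk_def S_def pinned_energy_def xy_energy_def rot sum_subtractf[symmetric]
  by (intro sum.cong refl) (simp add: algebra_simps)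
 have brR: "bdd_meas spin_space (%th. Re (bond (pin B th) b))"
  and brI: "bdd_meas spin_space (%th. Im (bond (pin B th) b))" for b
  by (rule bdd_meas_compose[OF bdd_meas_bond(1) pin_measurable], rule bdd_meas_compose[OF bdd_meas_bond(2) pin_measurable])
 \<comment> \<open>Conjugation of all spins preserves the weight because the pinned value 1 is
   real.\<close>
 have odd: "(\<integral>th. W th * Im (bond (pin B th) b) \<partial>spin_space) = 0" for b
 proof -
  have pc: "pin B (%i. cnj (th i)) x = cnj (pin B th x)" for th x by (simp add: pin_def)
  have "S (%i. cnj (th i)) = S th" for th
   by (simp add: S_def pinned_energy_def xy_energy_def bond_def pc)
  moreover have "Im (bond (pin B (%i. cnj (th i))) b) = - Im (bond (pin B th) b)" for th
   by (simp add: bond_def pc)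
  moreover have "(\<integral>th. W (%i. cnj (th i)) * Im (bond (pin B (%i. cnj (th i))) b) \<partial>spin_space) =
   (\<integral>th. W th * Im (bond (pin B th) b) \<partial>spin_space)"
   by (rule spin_integral_cnj[OF bdd_meas_measurable[OF bdd_meas_mult[OF bW(1) brI]]])
  ultimately show ?thesis by (simp add: W_def)
 qed
 have norm1: "Re (bond (pin B th) b) <= 1" if "th \<in> space spin_space" for th b
  using that pinned_bond_character[of B b] complex_Re_le_cmod[of "bond (pin B th) b"]
  by (auto simp: spin.character_def)
 have first: "(\<integral>th. W th * (Sk th - S th) \<partial>spin_space) \<ge> - et * Z"
 proof -
  have "(\<integral>th. W th * (Sk th - S th) \<partial>spin_space) = (\<integral>th. (\<Sum>b\<in>D. c * (cos (a (fst b) - a (snd b)) - 1) * (W th * Re (bond (pin B th) b))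
   - c * sin (a (fst b) - a (snd b)) * (W th * Im (bond (pin B th) b))) \<partial>spin_space)"
   unfolding diff by (intro Bochner_Integration.integral_cong refl) (simp add: sum_distrib_left algebra_simps)
  also have "... = (\<Sum>b\<in>D. \<integral>th. c * (cos (a (fst b) - a (snd b)) - 1) * (W th * Re (bond (pin B th) b))
   - c * sin (a (fst b) - a (snd b)) * (W th * Im (bond (pin B th) b)) \<partial>spin_space)"
   by (intro Bochner_Integration.integral_sum spin.bdd_meas_integrable bdd_meas_arith bW brR brI)
  also have "... = (\<Sum>b\<in>D. c * (cos (a (fst b) - a (snd b)) - 1) * (\<integral>th. W th * Re (bond (pin B th) b) \<partial>spin_space))"
   using spin.bdd_meas_integrable[OF bdd_meas_mult[OF bW(1) brR]] spin.bdd_meas_integrable[OF bdd_meas_mult[OF bW(1) brI]]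
   by (simp add: odd)
  also have "... \<ge> (\<Sum>b\<in>D. - (c / 2 * (a (fst b) - a (snd b))\<^sup>2) * Z)"
  proof (rule sum_mono)
   fix b
   let ?t = "a (fst b) - a (snd b)"
   have le: "(\<integral>th. W th * Re (bond (pin B th) b) \<partial>spin_space) <= Z"
    unfolding Z_def
   proof (rule integral_mono)
    fix th :: "'i spin" assume "th \<in> space spin_space"
    then show "W th * Re (bond (pin B th) b) <= W th"
     using mult_left_mono[OF norm1[of th b], of "W th"] by (simp add: W_def)
   qed (intro spin.bdd_meas_integrable bdd_meas_mult bW brR)+
   have "- (c / 2 * ?t\<^sup>2) * Z <= c * (cos ?t - 1) * Z"
   proof (rule mult_right_mono)
    show "- (c / 2 * ?t\<^sup>2) <= c * (cos ?t - 1)"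
     using mult_left_mono[OF one_minus_cos_le[of ?t] c] by (simp add: algebra_simps)
   qed (use Z in simp)
   also have "... <= c * (cos ?t - 1) * (\<integral>th. W th * Re (bond (pin B th) b) \<partial>spin_space)"
    using c by (intro mult_left_mono_neg[OF le] mult_nonneg_nonpos) auto
   finally show "- (c / 2 * ?t\<^sup>2) * Z <= c * (cos ?t - 1) * (\<integral>th. W th * Re (bond (pin B th) b) \<partial>spin_space)" .
  qed
  also have "(\<Sum>b\<in>D. - (c / 2 * (a (fst b) - a (snd b))\<^sup>2) * Z) = - et * Z"
   unfolding et_def by (simp add: sum_distrib_left sum_distrib_right sum_negf)
  finally show ?thesis .
 qed
 define I where "I = (\<integral>th. V th \<partial>spin_space)"
 have V: "V th = W th * exp ((Sk th - S th) / 2)" for th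
  by (simp add: V_def W_def exp_add[symmetric] field_simps)
 \<comment> \<open>The tangent bound exp t >= 1 + t at half the energy difference;
   \<open>first\<close> controls the mean of its linear term.\<close>
 have "Z - et / 2 * Z <= I"
 proof -
  have "Z - et / 2 * Z <= (\<integral>th. W th + (1/2) * (W th * (Sk th - S th)) \<partial>spin_space)"
   using first spin.bdd_meas_integrable[OF bdd_meas_mult[OF bW(1) bdd_meas_diff[OF bSk bS]]] iW(1)
   by (simp add: Z_def)
  also have "... <= I"
   unfolding I_def
  proof (rule integral_mono)
   fix th
   have "W th * (1 + (Sk th - S th) / 2) <= W th * exp ((Sk th - S th) / 2)"
    by (intro mult_left_mono exp_ge_add_one_self) (simp add: W_def)
   then show "W th + (1/2) * (W th * (Sk th - S th)) <= V th" unfolding V by (simp add: field_simps)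
  qed (intro spin.bdd_meas_integrable bdd_meas_arith bW bS bSk)+
  finally show ?thesis .
 qed
 then have "2 * Z - 2 * I <= et * Z" by (simp add: field_simps)
 also have "et * Z <= \<delta>\<^sup>2 * Z"
  using en[folded et_def] Z by (intro mult_right_mono) auto
 finally have I1: "2 * Z - 2 * I <= \<delta>\<^sup>2 * Z" .
 have sq: "V th * V th = W th * Wk th" for th
  by (simp add: V_def W_def Wk_def exp_add[symmetric])
 have I2: "I <= Z"
 proof -
  have "I <= (\<integral>th. (W th + Wk th) / 2 \<partial>spin_space)"
   unfolding I_def
  proof (rule integral_mono)
   fix th
   have "V th = sqrt (W th * Wk th)"
    unfolding sq[symmetric] by (simp add: V_def)
   also have "... <= (W th + Wk th) / 2"
    by (rule arith_geo_mean_sqrt) (simp_all add: W_def Wk_def)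
   finally show "V th <= (W th + Wk th) / 2" .
  qed (intro spin.bdd_meas_integrable bdd_meas_arith bW)+
  also have "... = Z" using iW Zk by (simp add: Z_def)
  finally show ?thesis .
 qed
 have neg: "\<xi> (%i. K i * th i) = - \<xi> th" if "th \<in> space spin_space" for th
  using \<xi> K flip that unfolding spin.character_def K_def by auto
 have "(\<integral>th. Re (\<xi> th) * W th \<partial>spin_space) = (\<integral>th. Re (\<xi> (%i. K i * th i)) * W (%i. K i * th i) \<partial>spin_space)"
  by (rule spin.integral_mul[OF K bdd_meas_measurable[OF bdd_meas_mult[OF b\<xi> bW(1)]], symmetric])
 also have "... = (\<integral>th. - (Re (\<xi> th) * Wk th) \<partial>spin_space)"
  by (intro Bochner_Integration.integral_cong refl) (simp add: neg W_def Wk_def Sk_def)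
 finally have "2 * (\<integral>th. Re (\<xi> th) * W th \<partial>spin_space) = (\<integral>th. Re (\<xi> th) * W th - Re (\<xi> th) * Wk th \<partial>spin_space)"
  using spin.bdd_meas_integrable[OF bdd_meas_mult[OF b\<xi> bW(1)]] spin.bdd_meas_integrable[OF bdd_meas_mult[OF b\<xi> bW(2)]]
  by simp
 then have "2 * \<bar>\<integral>th. Re (\<xi> th) * W th \<partial>spin_space\<bar> <= (\<integral>th. \<bar>Re (\<xi> th) * W th - Re (\<xi> th) * Wk th\<bar> \<partial>spin_space)"
  using integral_abs_bound[of spin_space "%th. Re (\<xi> th) * W th - Re (\<xi> th) * Wk th"] by linarith
 also have "... <= (\<integral>th. (1 / (2 * \<delta>)) * (W th + Wk th - 2 * V th) + (\<delta> / 2) * (W th + Wk th + 2 * V th) \<partial>spin_space)"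
 proof (rule integral_mono)
  fix th :: "'i spin" assume th: "th \<in> space spin_space"
  define p q where "p = exp (S th / 2)" and "q = exp (Sk th / 2)"
  have pq: "W th = p * p" "Wk th = q * q" "V th = p * q"
   by (simp_all add: p_def q_def W_def Wk_def V_def exp_add[symmetric] add_divide_distrib)
  have pos: "p > 0" "q > 0" by (simp_all add: p_def q_def)
  have "\<bar>Re (\<xi> th)\<bar> <= 1"
   using \<xi> th abs_Re_le_cmod[of "\<xi> th"] by (auto simp: spin.character_def)
  then have "\<bar>Re (\<xi> th) * W th - Re (\<xi> th) * Wk th\<bar> <= 1 * \<bar>W th - Wk th\<bar>"
   unfolding right_diff_distrib[symmetric] abs_mult by (intro mult_right_mono) auto
  also have "... = \<bar>p - q\<bar> * (p + q)"
  proof -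
   have "p * p - q * q = (p - q) * (p + q)" by (simp add: algebra_simps)
   then show ?thesis using pos unfolding pq by (simp add: abs_mult)
  qed
  \<comment> \<open>Young's inequality, weighted so that the Hellinger term, of order
    \<open>\<delta>\<^sup>2\<close>, and the term of order 1 balance.\<close>
  also have "... <= (1 / (2 * \<delta>)) * (p - q)\<^sup>2 + (\<delta> / 2) * (p + q)\<^sup>2"
  proof -
   have "0 <= (\<bar>p - q\<bar> - \<delta> * (p + q))\<^sup>2 / (2 * \<delta>)" using \<delta> by simp
   also have "... = (1 / (2 * \<delta>)) * (p - q)\<^sup>2 + (\<delta> / 2) * (p + q)\<^sup>2 - \<bar>p - q\<bar> * (p + q)"
    using \<delta> by (simp add: power2_diff power_mult_distrib field_simps) (simp add: power2_eq_square algebra_simps)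
   finally show ?thesis by simp
  qed
  also have "... = (1 / (2 * \<delta>)) * (W th + Wk th - 2 * V th) + (\<delta> / 2) * (W th + Wk th + 2 * V th)"
   unfolding pq by (simp add: power2_eq_square algebra_simps)
  finally show "\<bar>Re (\<xi> th) * W th - Re (\<xi> th) * Wk th\<bar> <= ..." .
 qed (intro spin.bdd_meas_integrable bdd_meas_arith bW b\<xi>)+
 also have "... = (1 / (2 * \<delta>)) * (2 * Z - 2 * I) + (\<delta> / 2) * (2 * Z + 2 * I)"
  using iW Zk by (simp add: Z_def I_def)
 also have "... <= (1 / (2 * \<delta>)) * (\<delta>\<^sup>2 * Z) + (\<delta> / 2) * (4 * Z)"
  using \<delta> I1 I2 by (intro add_mono mult_left_mono) auto
 also have "... <= 4 * \<delta> * Z"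
  using \<delta> Z by (simp add: power2_eq_square field_simps)
 finally have "\<bar>\<integral>th. Re (\<xi> th) * W th \<partial>spin_space\<bar> <= 2 * \<delta> * Z" by (simp add: mult_ac)
 then show ?thesis
  using Z unfolding pinned_mean_def W_def S_def Z_def by (simp add: field_simps)
qed

text \<open>A field along the real axis lowers the correlation of four imaginary parts, which is one
  eighth of the sum of the three neutral characters up to charged terms. Pinning can only raise each
  neutral character, so the two unwanted ones cancel in the right direction and leave an upper bound
  for the third. The factor 5 counts the charged characters.\<close>

lemma pinned_four_point_bound:
 assumes c: "c \<ge> 0" and D: "finite D" and pts: "p \<in> B" "q \<in> B" "p' \<in> B" "q' \<in> B"
  and F: "F = {b\<in>D. fst b \<in> B \<and> snd b \<in> B}"
  and small: "\<And>k. k < 5 ==> \<bar>pinned_mean c B D (%th. Re (charged4 p q p' q' k th))\<bar> <= \<epsilon>"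
 shows "pinned_mean c B D (%th. Re (chi4 p p' q q' th)) <= xy_mean c F (%th. Re (chi4 p p' q q' th)) + 5 * \<epsilon>"
proof -
 let ?W = "%th. exp (pinned_energy c B D th)"
 define Z where "Z = (\<integral>th. ?W th \<partial>spin_space)"
 have Z: "Z > 0" unfolding Z_def by (rule pinned_partition_pos)
 have finF: "finite F" using D F by simp
 have mono: "xy_mean c F (%th. Re (\<xi> th)) <= pinned_mean c B D (%th. Re (\<xi> th))" if \<xi>: "spin.character \<xi>" for \<xi>
 proof -
  let ?a = "%b. if b \<in> F then c else 0"
  have e: "xy_energy c F th = (\<Sum>b\<in>D. ?a b * Re (bond (pin B th) b))" for th
   unfolding xy_energy_def using D F
   by (intro sum.mono_neutral_cong_left) (auto simp: bond_def pin_def)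
  have "(\<integral>th. Re (\<xi> th) * exp (\<Sum>b\<in>D. ?a b * Re (bond (pin B th) b)) \<partial>spin_space) * (\<integral>th. exp (\<Sum>b\<in>D. c * Re (bond (pin B th) b)) \<partial>spin_space)
   <= (\<integral>th. Re (\<xi> th) * exp (\<Sum>b\<in>D. c * Re (bond (pin B th) b)) \<partial>spin_space) * (\<integral>th. exp (\<Sum>b\<in>D. ?a b * Re (bond (pin B th) b)) \<partial>spin_space)"
   by (rule spin.ginibre_mono) (use c \<xi> D in \<open>auto intro: pinned_bond_character\<close>)
  then show ?thesis
   using xy_partition_pos[of c F] pinned_partition_pos[of c B D]
   unfolding xy_mean_def pinned_mean_def e[symmetric] xy_energy_def[symmetric] pinned_energy_def[symmetric]
   by (simp add: field_simps)
 qed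
 \<comment> \<open>A bond with exactly one end in \<open>B\<close> acts on this end,
   \<open>en b\<close>, as a field along the real axis; bonds outside \<open>B\<close> contribute
   the constant \<open>k\<close>.\<close>
 define I where "I = {b\<in>D. (fst b \<in> B) \<noteq> (snd b \<in> B)}"
 define en where "en b = (if fst b \<in> B then fst b else snd b)" for b :: "'a \<times> 'a"
 define k where "k = (\<Sum>b\<in>{b\<in>D. fst b \<notin> B \<and> snd b \<notin> B}. c)"
 have split: "pinned_energy c B D th = (xy_energy c F th + (\<Sum>b\<in>I. c * Re (th (en b)))) + k" for th
 proof -
  have eq: "D = (F \<union> I) \<union> {b\<in>D. fst b \<notin> B \<and> snd b \<notin> B}" unfolding F I_def by auto
  have d: "F \<inter> I = {}" "(F \<union> I) \<inter> {b\<in>D. fst b \<notin> B \<and> snd b \<notin> B} = {}" unfolding F I_def by auto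
  have fi: "finite I" "finite {b\<in>D. fst b \<notin> B \<and> snd b \<notin> B}" using D by (auto simp: I_def)
  have "pinned_energy c B D th = (\<Sum>b\<in>F. c * Re (bond (pin B th) b)) + (\<Sum>b\<in>I. c * Re (bond (pin B th) b))
   + (\<Sum>b\<in>{b\<in>D. fst b \<notin> B \<and> snd b \<notin> B}. c * Re (bond (pin B th) b))"
   unfolding pinned_energy_def xy_energy_def
   by (subst eq) (simp only: sum.union_disjoint finF fi d finite_UnI)
  moreover have "(\<Sum>b\<in>F. c * Re (bond (pin B th) b)) = xy_energy c F th"
   unfolding xy_energy_def by (intro sum.cong refl) (auto simp: F bond_def pin_def)
  moreover have "(\<Sum>b\<in>I. c * Re (bond (pin B th) b)) = (\<Sum>b\<in>I. c * Re (th (en b)))"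
   by (intro sum.cong refl) (auto simp: I_def bond_def pin_def en_def)
  moreover have "(\<Sum>b\<in>{b\<in>D. fst b \<notin> B \<and> snd b \<notin> B}. c * Re (bond (pin B th) b)) = k"
   unfolding k_def by (intro sum.cong refl) (auto simp: bond_def pin_def)
  ultimately show ?thesis by simp
 qed
 let ?y = "%th. Im (th p) * Im (th q) * Im (th p') * Im (th q')"
 let ?h = "%th. exp (xy_energy c F th + (\<Sum>b\<in>I. c * Re (th (en b))))"
 have W: "?W th = exp k * ?h th" for th unfolding split exp_add by (simp add: mult.commute)
 have "(\<integral>th. ?y th * ?h th \<partial>spin_space) * (\<integral>th. exp (xy_energy c F th) \<partial>spin_space)
   <= (\<integral>th. ?y th * exp (xy_energy c F th) \<partial>spin_space) * (\<integral>th. ?h th \<partial>spin_space)"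
  by (rule xy_field_Im) (use c in auto)
 then have "exp k * ((\<integral>th. ?y th * ?h th \<partial>spin_space) * (\<integral>th. exp (xy_energy c F th) \<partial>spin_space))
   <= exp k * ((\<integral>th. ?y th * exp (xy_energy c F th) \<partial>spin_space) * (\<integral>th. ?h th \<partial>spin_space))"
  by (rule mult_left_mono) simp
 moreover have "(\<integral>th. ?y th * ?W th \<partial>spin_space) = exp k * (\<integral>th. ?y th * ?h th \<partial>spin_space)"
 proof -
  have "(\<integral>th. ?y th * ?W th \<partial>spin_space) = (\<integral>th. exp k * (?y th * ?h th) \<partial>spin_space)"
   unfolding W by (intro Bochner_Integration.integral_cong refl) (simp only: ac_simps)
  then show ?thesis by simp
 qed
 moreover have "Z = exp k * (\<integral>th. ?h th \<partial>spin_space)" unfolding Z_def W by simp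
 ultimately have "(\<integral>th. ?y th * ?W th \<partial>spin_space) * (\<integral>th. exp (xy_energy c F th) \<partial>spin_space)
   <= (\<integral>th. ?y th * exp (xy_energy c F th) \<partial>spin_space) * Z" by (simp add: mult_ac)
 then have main: "pinned_mean c B D ?y <= xy_mean c F ?y"
  using xy_partition_pos[of c F] Z unfolding pinned_mean_def xy_mean_def Z_def[symmetric]
  by (simp add: field_simps)
 have ip: "integrable spin_space (%th. G th * ?W th)" if "bdd_meas spin_space G" for G
  by (intro spin.bdd_meas_integrable bdd_meas_arith that bdd_meas_pinned_energy)
 let ?ch = "%k. pinned_mean c B D (%th. Re (charged4 p q p' q' k th))"
 have "pinned_mean c B D ?y = (pinned_mean c B D (%th. Re (chi4 p p' q q' th)) + pinned_mean c B D (%th. Re (chi4 p q' p' q th))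
   + pinned_mean c B D (%th. Re (chi4 p q p' q' th)) + (- ?ch 0 - ?ch 1 - ?ch 2 - ?ch 3 + ?ch 4)) / 8"
 proof -
  have "(\<integral>th. ?y th * ?W th \<partial>spin_space) = (\<integral>th. (Re (chi4 p p' q q' th) * ?W th + Re (chi4 p q' p' q th) * ?W th + Re (chi4 p q p' q' th) * ?W th
   + (- (Re (charged4 p q p' q' 0 th) * ?W th) - Re (charged4 p q p' q' 1 th) * ?W th - Re (charged4 p q p' q' 2 th) * ?W th
   - Re (charged4 p q p' q' 3 th) * ?W th + Re (charged4 p q p' q' 4 th) * ?W th)) / 8 \<partial>spin_space)"
   unfolding components_expand(2) by (intro Bochner_Integration.integral_cong refl) (simp add: algebra_simps)
  also have "... = ((\<integral>th. Re (chi4 p p' q q' th) * ?W th \<partial>spin_space) + (\<integral>th. Re (chi4 p q' p' q th) * ?W th \<partial>spin_space) + (\<integral>th. Re (chi4 p q p' q' th) * ?W th \<partial>spin_space)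
   + (- (\<integral>th. Re (charged4 p q p' q' 0 th) * ?W th \<partial>spin_space) - (\<integral>th. Re (charged4 p q p' q' 1 th) * ?W th \<partial>spin_space) - (\<integral>th. Re (charged4 p q p' q' 2 th) * ?W th \<partial>spin_space)
   - (\<integral>th. Re (charged4 p q p' q' 3 th) * ?W th \<partial>spin_space) + (\<integral>th. Re (charged4 p q p' q' 4 th) * ?W th \<partial>spin_space))) / 8"
   using ip[OF bdd_meas_chi(1)] ip[OF bdd_meas_charged4] by simp
  finally show ?thesis
   unfolding pinned_mean_def by (simp add: add_divide_distrib diff_divide_distrib)
 qed
 moreover have "xy_mean c F ?y = (xy_mean c F (%th. Re (chi4 p p' q q' th)) + xy_mean c F (%th. Re (chi4 p q' p' q th)) + xy_mean c F (%th. Re (chi4 p q p' q' th))) / 8"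
  by (rule xy_mean_components(2))
 ultimately show ?thesis
  using main mono[OF chi_character(1), of p q' p' q] mono[OF chi_character(1), of p q p' q']
   small[of 0] small[of 1] small[of 2] small[of 3] small[of 4]
  by simp
qed

section \<open>The infinite volume limit\<close>

definition rad :: "site => nat" where
 "rad x = nat (max \<bar>fst x\<bar> \<bar>snd x\<bar>)"

definition square :: "nat => site set" where
 "square R = {x. rad x <= R}"

lemma square_eq: "square R = {- int R..int R} \<times> {- int R..int R}"
 by (auto simp: square_def rad_def)

lemma finite_square [simp]: "finite (square R)"
 by (simp add: square_eq)

lemma mem_square: "x \<in> square R \<longleftrightarrow> \<bar>fst x\<bar> <= int R \<and> \<bar>snd x\<bar> <= int R"
 by (auto simp: square_def rad_def)

lemma square_mono: "m <= n ==> square m \<subseteq> square n"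
 by (auto simp: square_def)

lemma finite_subset_square: "finite A ==> \<exists>R. A \<subseteq> square R"
proof (induction A rule: finite_induct)
 case (insert x A)
 then obtain R where "A \<subseteq> square R" by blast
 then have "insert x A \<subseteq> square (max R (rad x))" by (force simp: square_def)
 then show ?case by blast
qed simp

lemma Z2_edges_iff: "(p, q) \<in> Z2_edges \<longleftrightarrow>
 q \<in> {(fst p + 1, snd p), (fst p - 1, snd p), (fst p, snd p + 1), (fst p, snd p - 1)}"
 by (cases p; cases q) (auto simp: Z2_edges_def)

lemma rad_neighbour: "(p, q) \<in> Z2_edges ==> rad q <= Suc (rad p) \<and> rad p <= Suc (rad q)"
 by (auto simp: Z2_edges_iff rad_def)

lemma Z2_edges_sym: "(p, q) \<in> Z2_edges ==> (q, p) \<in> Z2_edges"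
 by (auto simp: Z2_edges_def abs_minus_commute)

lemma card_sphere: "r > 0 ==> real (card {x. rad x = r}) <= 12 * real r"
proof -
 assume r: "r > 0"
 have "{x. rad x = r} \<subseteq> {int r, - int r} \<times> {- int r..int r} \<union> {- int r..int r} \<times> {int r, - int r}"
  by (auto simp: rad_def max_def split: if_splits)
 then have "card {x. rad x = r} <= card ({int r, - int r} \<times> {- int r..int r} \<union> {- int r..int r} \<times> {int r, - int r})"
  by (intro card_mono) auto
 also have "... <= card ({int r, - int r} \<times> {- int r..int r}) + card ({- int r..int r} \<times> {int r, - int r})"
  by (rule card_Un_le)
 also have "... = 4 * (2 * r + 1)" using r by (simp add: card_cartesian_product)
 also have "... <= 12 * r" using r by simp
 finally show ?thesis by (simp flip: of_nat_le_iff)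
qed

text \<open>The lattice is recurrent: a logarithmic cutoff has small Dirichlet energy.\<close>

lemma logarithmic_cutoff:
 fixes \<epsilon> :: real
 assumes "\<epsilon> > 0"
 shows "\<exists>R a. (\<forall>x\<in>square n. a x = 1) \<and> (\<forall>x. x \<notin> square R --> a x = (0::real)) \<and> n <= R \<and>
  (\<forall>D. finite D \<and> D \<subseteq> Z2_edges --> (\<Sum>b\<in>D. (a (fst b) - a (snd b))\<^sup>2) <= \<epsilon>)"
proof -
 \<comment> \<open>96 = 2 * 4 * 12: the two ends of a bond, the four neighbours of a site, and the
   constant of \<open>card_sphere\<close>.\<close>
 have "eventually (%R. harm R \<ge> (harm n :: real) + 96 / \<epsilon> + 1) sequentially"
  using harm_at_top unfolding filterlim_at_top by blast
 then obtain R where R: "(harm R :: real) \<ge> harm n + 96 / \<epsilon> + 1" by (auto simp: eventually_sequentially)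
 define L where "L = (harm R - harm n :: real)"
 have L: "L > 0" "96 / L <= \<epsilon>"
 proof -
  have "L \<ge> 96 / \<epsilon> + 1" using R by (simp add: L_def)
  moreover have "96 / \<epsilon> > 0" using assms by simp
  ultimately show "L > 0" by linarith
  have "96 / \<epsilon> <= L" using \<open>L \<ge> 96 / \<epsilon> + 1\<close> by linarith
  then show "96 / L <= \<epsilon>" using assms \<open>L > 0\<close> by (simp add: field_simps)
 qed
 have nR: "n <= R"
 proof (rule ccontr)
  assume "\<not> n <= R"
  then have "(harm R :: real) <= harm n" by (intro harm_mono) simp
  then show False using L by (simp add: L_def)
 qed
 \<comment> \<open>With harmonic numbers in place of the logarithm, the increment at radius r is
   exactly 1 / (r L) between the two radii.\<close>
 define \<phi> where "\<phi> r = max 0 (min 1 (1 - (harm r - harm n) / L))" for r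
 \<comment> \<open>The squared increment across a bond is charged to the end that is farther from
   the origin.\<close>
 define g where "g x = (if n < rad x \<and> rad x <= R then (1 / (real (rad x) * L))\<^sup>2 else 0)" for x
 have \<phi>0: "\<phi> r = 0" if "r \<ge> R" for r
 proof -
  have "harm R <= (harm r :: real)" using that by (rule harm_mono)
  then have "(harm r - harm n) / L \<ge> 1" using L by (simp add: L_def field_simps)
  then show ?thesis by (simp add: \<phi>_def)
 qed
 have \<phi>1: "\<phi> r = 1" if "r <= n" for r
 proof -
  have "harm r <= (harm n :: real)" using that by (rule harm_mono)
  then have "(harm r - harm n) / L <= 0" using L by (simp add: divide_nonpos_pos)
  then show ?thesis by (simp add: \<phi>_def)
 qed
 have step: "(\<phi> r - \<phi> (Suc r))\<^sup>2 <= (if n < Suc r \<and> Suc r <= R then (1 / (real (Suc r) * L))\<^sup>2 else 0)" for r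
 proof (cases "n < Suc r \<and> Suc r <= R")
  case True
  have "\<bar>\<phi> r - \<phi> (Suc r)\<bar> <= \<bar>(harm (Suc r) - harm n) / L - (harm r - harm n) / L\<bar>"
   unfolding \<phi>_def by linarith
  also have "(harm (Suc r) - harm n) / L - (harm r - harm n) / L = 1 / (real (Suc r) * L)"
   by (simp add: harm_Suc divide_simps) (use L in \<open>simp add: field_simps\<close>)
  finally have "\<bar>\<phi> r - \<phi> (Suc r)\<bar> <= 1 / (real (Suc r) * L)" using L by simp
  then have "\<bar>\<phi> r - \<phi> (Suc r)\<bar>\<^sup>2 <= (1 / (real (Suc r) * L))\<^sup>2" by (intro power_mono) auto
  then show ?thesis using True by simp
 next
  case False
  then have "Suc r <= n \<or> R <= r" by linarith
  then show ?thesis using \<phi>0[of r] \<phi>0[of "Suc r"] \<phi>1[of r] \<phi>1[of "Suc r"] by auto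
 qed
 have g0: "g x \<ge> 0" for x by (simp add: g_def)
 have edge: "(\<phi> (rad (fst b)) - \<phi> (rad (snd b)))\<^sup>2 <= g (fst b) + g (snd b)" if b: "b \<in> Z2_edges" for b
 proof -
  obtain p q where pq: "b = (p, q)" by (cases b)
  have "rad q = rad p \<or> rad q = Suc (rad p) \<or> rad p = Suc (rad q)"
   using rad_neighbour[of p q] b pq by auto
  then consider "rad q = rad p" | "rad q = Suc (rad p)" | "rad p = Suc (rad q)" by blast
  then show ?thesis
  proof cases
   case 1 then show ?thesis using g0[of p] g0[of q] by (simp add: pq)
  next
   case 2
   have "(\<phi> (rad p) - \<phi> (rad q))\<^sup>2 <= g q" using step[of "rad p"] unfolding g_def 2 by simp
   then show ?thesis using g0[of p] by (simp add: pq)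
  next
   case 3
   have "(\<phi> (rad q) - \<phi> (rad p))\<^sup>2 <= g p" using step[of "rad q"] unfolding g_def 3 by simp
   then show ?thesis using g0[of q] by (simp add: pq power2_commute)
  qed
 qed
 have sumg: "(\<Sum>x\<in>A. g x) <= 12 / L" if A: "finite A" for A
 proof -
  have "(\<Sum>x\<in>A. g x) <= (\<Sum>x\<in>A \<union> square R. g x)"
   using A g0 by (intro sum_mono2) auto
  also have "... = (\<Sum>x\<in>square R - square n. g x)"
  proof (rule sum.mono_neutral_right)
   show "finite (A \<union> square R)" using A by simp
  qed (auto simp: g_def square_def)
  also have "... = (\<Sum>r\<in>{n<..R}. \<Sum>x\<in>{x\<in>square R - square n. rad x = r}. g x)"
  proof (rule sum.group[symmetric])
   show "finite (square R - square n)" by simp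
  qed (auto simp: square_def)
  also have "... <= (\<Sum>r\<in>{n<..R}. 12 * real r * (1 / (real r * L))\<^sup>2)"
  proof (rule sum_mono)
   fix r assume r: "r \<in> {n<..R}"
   have "{x\<in>square R - square n. rad x = r} = {x. rad x = r}" using r by (auto simp: square_def)
   then have "(\<Sum>x\<in>{x\<in>square R - square n. rad x = r}. g x) = (\<Sum>x\<in>{x. rad x = r}. (1 / (real r * L))\<^sup>2)"
    using r by (intro sum.cong) (auto simp: g_def)
   also have "... = real (card {x. rad x = r}) * (1 / (real r * L))\<^sup>2" by simp
   also have "... <= 12 * real r * (1 / (real r * L))\<^sup>2"
    using r by (intro mult_right_mono card_sphere) auto
   finally show "(\<Sum>x\<in>{x\<in>square R - square n. rad x = r}. g x) <= 12 * real r * (1 / (real r * L))\<^sup>2" .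
  qed
  also have "... = (\<Sum>r\<in>{n<..R}. 12 / L\<^sup>2 * inverse (real r))"
   using L by (intro sum.cong refl) (auto simp: power2_eq_square field_simps)
  also have "... = 12 / L\<^sup>2 * L"
  proof -
   have "(\<Sum>r\<in>{n<..R}. inverse (real r)) = L"
   proof -
    have "{1..R} = {1..n} \<union> {n<..R}" using nR by auto
    then have "(harm R :: real) = harm n + (\<Sum>r\<in>{n<..R}. inverse (real r))"
     unfolding harm_def by (simp only:) (rule sum.union_disjoint, auto)
    then show ?thesis by (simp add: L_def)
   qed
   then show ?thesis unfolding sum_distrib_left[symmetric] by simp
  qed
  also have "... = 12 / L" using L by (simp add: power2_eq_square)
  finally show ?thesis .
 qed
 have half: "(\<Sum>b\<in>D. g (fst b)) <= 4 * (12 / L)" if D: "finite D" "D \<subseteq> Z2_edges" for D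
 proof -
  let ?N = "%p :: site. {(fst p + 1, snd p), (fst p - 1, snd p), (fst p, snd p + 1), (fst p, snd p - 1)}"
  have "D \<subseteq> Sigma (fst ` D) ?N"
  proof
   fix b assume b: "b \<in> D"
   obtain p q where pq: "b = (p, q)" by (cases b)
   have "(p, q) \<in> Z2_edges" using b pq D(2) by blast
   then have "q \<in> ?N p" unfolding Z2_edges_iff .
   then show "b \<in> Sigma (fst ` D) ?N" using b pq by force
  qed
  then have "(\<Sum>b\<in>D. g (fst b)) <= (\<Sum>b\<in>Sigma (fst ` D) ?N. g (fst b))"
   using D g0 by (intro sum_mono2) auto
  also have "... = (\<Sum>p\<in>fst ` D. \<Sum>q\<in>?N p. g p)"
   using D by (subst sum.Sigma) (auto simp: case_prod_unfold)
  also have "... <= (\<Sum>p\<in>fst ` D. 4 * g p)"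
  proof (rule sum_mono)
   fix p
   have "card (?N p) <= 4"
    using card_length[of "[(fst p + 1, snd p), (fst p - 1, snd p), (fst p, snd p + 1), (fst p, snd p - 1)]"] by simp
   then have "real (card (?N p)) * g p <= 4 * g p" using g0 by (intro mult_right_mono) auto
   then show "(\<Sum>q\<in>?N p. g p) <= 4 * g p" by simp
  qed
  also have "... <= 4 * (12 / L)"
   unfolding sum_distrib_left[symmetric] using sumg[of "fst ` D"] D by (intro mult_left_mono) auto
  finally show ?thesis .
 qed
 have "(\<Sum>b\<in>D. (\<phi> (rad (fst b)) - \<phi> (rad (snd b)))\<^sup>2) <= \<epsilon>" if D: "finite D" "D \<subseteq> Z2_edges" for D
 proof -
  have sw: "(\<Sum>b\<in>D. g (snd b)) = (\<Sum>b\<in>prod.swap ` D. g (fst b))"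
   by (subst sum.reindex) (auto simp: inj_on_def)
  have "prod.swap ` D \<subseteq> Z2_edges" using D by (auto intro: Z2_edges_sym)
  then have "(\<Sum>b\<in>D. g (fst b)) + (\<Sum>b\<in>D. g (snd b)) <= 4 * (12 / L) + 4 * (12 / L)"
   unfolding sw using D by (intro add_mono half) auto
  moreover have "(\<Sum>b\<in>D. (\<phi> (rad (fst b)) - \<phi> (rad (snd b)))\<^sup>2) <= (\<Sum>b\<in>D. g (fst b)) + (\<Sum>b\<in>D. g (snd b))"
   unfolding sum.distrib[symmetric] using D by (intro sum_mono edge) auto
  ultimately show ?thesis using L by simp
 qed
 note en = this
 show ?thesis
 proof (intro exI[of _ R] exI[of _ "%x. \<phi> (rad x)"] conjI ballI allI impI)
  show "\<phi> (rad x) = 1" if "x \<in> square n" for x by (rule \<phi>1) (use that in \<open>simp add: square_def\<close>)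
  show "\<phi> (rad x) = 0" if "x \<notin> square R" for x by (rule \<phi>0) (use that in \<open>simp add: square_def\<close>)
 qed (use en nR in blast)+
qed

text \<open>The square is chosen before \<open>D\<close>, so the error is uniform in the ambient
  graph; this allows the torus to grow while the square stays fixed.\<close>

lemma pinned_four_point_limit:
 assumes c: "c \<ge> 0" and \<epsilon>: "\<epsilon> > 0"
 shows "\<exists>R. {p, q, p', q'} \<subseteq> square R \<and> (\<forall>D. finite D \<and> D \<subseteq> Z2_edges -->
  pinned_mean c (square R) D (%th. Re (chi4 p p' q q' th)) <=
  xy_mean c {b\<in>D. fst b \<in> square R \<and> snd b \<in> square R} (%th. Re (chi4 p p' q q' th)) + \<epsilon>)"
proof -
 have "finite {p, q, p', q'}" by simp
 from finite_subset_square[OF this] obtain n where n: "{p, q, p', q'} \<subseteq> square n" ..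
 \<comment> \<open>Each of the five charged characters costs \<open>2 * \<delta>\<close>. In the
   next denominator pi / 2 bounds the rotation angle, and the summand 1 keeps it positive when
   \<open>c\<close> is 0.\<close>
 define \<delta> where "\<delta> = \<epsilon> / 10"
 define \<epsilon>' where "\<epsilon>' = \<delta>\<^sup>2 / (c / 2 * (pi/2)\<^sup>2 + 1)"
 have k: "c / 2 * (pi/2)\<^sup>2 + 1 > 0" using c by (intro add_nonneg_pos) auto
 then have e': "\<epsilon>' > 0" using \<epsilon> by (simp add: \<epsilon>'_def \<delta>_def)
 from logarithmic_cutoff[OF e', of n] obtain R a where a1: "\<forall>x\<in>square n. a x = 1"
  and a0: "\<forall>x. x \<notin> square R --> a x = (0::real)" and nR: "n <= R"
  and en': "\<forall>D. finite D \<and> D \<subseteq> Z2_edges --> (\<Sum>b\<in>D. (a (fst b) - a (snd b))\<^sup>2) <= \<epsilon>'"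
  by (elim exE conjE)
 have en: "(\<Sum>b\<in>D. (a (fst b) - a (snd b))\<^sup>2) <= \<epsilon>'" if "finite D" "D \<subseteq> Z2_edges" for D
  using en' that by simp
 have pts: "p \<in> square R" "q \<in> square R" "p' \<in> square R" "q' \<in> square R"
  using subset_trans[OF n square_mono[OF nR]] by simp_all
 have ap: "a p = 1" "a q = 1" "a p' = 1" "a q' = 1" using a1 n by simp_all
 have "pinned_mean c (square R) D (%th. Re (chi4 p p' q q' th)) <=
  xy_mean c {b\<in>D. fst b \<in> square R \<and> snd b \<in> square R} (%th. Re (chi4 p p' q q' th)) + 5 * (2 * \<delta>)"
  if D: "finite D" "D \<subseteq> Z2_edges" for D
 proof (rule pinned_four_point_bound[OF c D(1) pts refl])
  fix k :: nat assume k5: "k < 5"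
  \<comment> \<open>The cutoff equals 1 at the four points, so rotating by \<open>t\<close> times
    the cutoff multiplies a character by \<open>cis\<close> of \<open>t\<close> times its charge,
    which is to be pi.\<close>
  define t where "t = (if k = 4 then pi / 4 else pi / 2)"
  have t: "0 <= t" "t <= pi / 2" by (auto simp: t_def)
  consider "k = 0" | "k = 1" | "k = 2" | "k = 3" | "k = 4" using k5 by linarith
  then have flip: "charged4 p q p' q' k (%x. cis (t * a x)) = -1"
   by cases (simp_all add: charged4_def ap t_def cis_mult mult.assoc eval_nat_numeral)
  have "c / 2 * (\<Sum>b\<in>D. (t * a (fst b) - t * a (snd b))\<^sup>2) = c / 2 * t\<^sup>2 * (\<Sum>b\<in>D. (a (fst b) - a (snd b))\<^sup>2)"
   by (simp add: sum_distrib_left right_diff_distrib[symmetric] power_mult_distrib mult.assoc)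
  also have "... <= c / 2 * (pi/2)\<^sup>2 * \<epsilon>'"
   using c t en[OF D] by (intro mult_mono power_mono mult_nonneg_nonneg sum_nonneg) auto
  also have "... <= (c / 2 * (pi/2)\<^sup>2 + 1) * \<epsilon>'" using e' by (simp add: algebra_simps)
  also have "... = \<delta>\<^sup>2" using k by (simp add: \<epsilon>'_def)
  finally have E: "c / 2 * (\<Sum>b\<in>D. (t * a (fst b) - t * a (snd b))\<^sup>2) <= \<delta>\<^sup>2" .
  show "\<bar>pinned_mean c (square R) D (%th. Re (charged4 p q p' q' k th))\<bar> <= 2 * \<delta>"
   by (rule mermin_wagner[OF c charged4_character[OF k5] flip _ _ E]) (use a0 \<epsilon> in \<open>auto simp: \<delta>_def\<close>)
 qed
 moreover have "5 * (2 * \<delta>) = \<epsilon>" by (simp add: \<delta>_def)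
 ultimately show ?thesis using pts by (intro exI[of _ R] conjI allI impI) simp_all
qed

text \<open>For characters the means increase with the volume, so the supremum over all finite
  volumes is the limit along every exhaustion. It inherits the symmetries of the lattice, because
  they permute the finite volumes.\<close>

definition xy_lim :: "real => (site spin => complex) => real" where
 "xy_lim c \<xi> = (SUP F\<in>{F. finite F \<and> F \<subseteq> Z2_edges}. xy_mean c F (%th. Re (\<xi> th)))"

lemma xy_lim_upper:
 assumes "spin.character \<xi>" "finite F" "F \<subseteq> Z2_edges"
 shows "xy_mean c F (%th. Re (\<xi> th)) <= xy_lim c \<xi>"
 unfolding xy_lim_def
proof (rule cSUP_upper)
 show "F \<in> {F. finite F \<and> F \<subseteq> Z2_edges}" using assms by simp
 show "bdd_above ((%F. xy_mean c F (%th. Re (\<xi> th))) ` {F. finite F \<and> F \<subseteq> Z2_edges})"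
  by (rule bdd_aboveI2[where M=1]) (rule xy_mean_character_le_one[OF assms(1)])
qed

lemma xy_lim_least:
 assumes "\<And>F. finite F ==> F \<subseteq> Z2_edges ==> xy_mean c F (%th. Re (\<xi> th)) <= K"
 shows "xy_lim c \<xi> <= K"
 unfolding xy_lim_def
proof (rule cSUP_least)
 show "{F. finite F \<and> F \<subseteq> Z2_edges} \<noteq> ({} :: (site \<times> site) set set)" by (auto intro: exI[of _ "{}"])
qed (simp add: assms)

lemma xy_lim_nonneg:
 assumes "spin.character \<xi>" "c \<ge> 0" shows "xy_lim c \<xi> \<ge> 0"
 using xy_mean_character_nonneg[OF assms, of "{}"] xy_lim_upper[OF assms(1), of "{}" c] by simp

lemma xy_lim_tendsto:
 assumes \<xi>: "spin.character \<xi>" and c: "c \<ge> 0"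
  and F: "\<And>n. finite (F n)" "\<And>n. F n \<subseteq> Z2_edges"
  and ex: "\<And>b. b \<in> Z2_edges ==> eventually (%n. b \<in> F n) sequentially"
 shows "(%n. xy_mean c (F n) (%th. Re (\<xi> th))) \<longlonglongrightarrow> xy_lim c \<xi>"
proof (rule order_tendstoI)
 fix y assume "xy_lim c \<xi> < y"
 then show "eventually (%n. xy_mean c (F n) (%th. Re (\<xi> th)) < y) sequentially"
  by (intro always_eventually allI order.strict_trans1[OF xy_lim_upper[OF \<xi> F]])
next
 fix y assume y: "y < xy_lim c \<xi>"
 let ?S = "{F. finite F \<and> F \<subseteq> Z2_edges}"
 have "bdd_above ((%F. xy_mean c F (%th. Re (\<xi> th))) ` ?S)"
  by (rule bdd_aboveI2[where M=1]) (rule xy_mean_character_le_one[OF \<xi>])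
 moreover have "?S \<noteq> ({} :: (site \<times> site) set set)" by (auto intro: exI[of _ "{}"])
 ultimately obtain G where "G \<in> ?S" and G3: "y < xy_mean c G (%th. Re (\<xi> th))"
  using y unfolding xy_lim_def by (subst (asm) less_cSUP_iff) (assumption | erule bexE | rule that)+
 then have G: "finite G" "G \<subseteq> Z2_edges" by simp_all
 have "eventually (%n. \<forall>b\<in>G. b \<in> F n) sequentially"
  using G ex by (intro eventually_ball_finite[OF G(1)]) blast
 then show "eventually (%n. y < xy_mean c (F n) (%th. Re (\<xi> th))) sequentially"
 proof eventually_elim
  case (elim n)
  then have "G \<subseteq> F n" by blast
  from order.strict_trans2[OF G3 xy_mean_mono[OF \<xi> c this F(1)]] show ?case .
 qed
qed

lemma xy_lim_reindex:
 assumes T: "inj T" and \<xi>: "spin.character \<xi>"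
  and inv: "\<And>x. S (T x) = x" "\<And>x. T (S x) = x"
  and edges: "map_prod T T ` Z2_edges \<subseteq> Z2_edges" "map_prod S S ` Z2_edges \<subseteq> Z2_edges"
 shows "xy_lim c (%th. \<xi> (%i. th (T i))) = xy_lim c \<xi>"
proof -
 let ?F = "{F. finite F \<and> F \<subseteq> Z2_edges}"
 have eq: "xy_mean c (map_prod T T ` F) (%th. Re (\<xi> (%i. th (T i)))) = xy_mean c F (%th. Re (\<xi> th))" for F
  by (rule xy_mean_reindex[OF T spin.bdd_meas_character(1)[OF \<xi>]])
 have "(%F. map_prod T T ` F) ` ?F = ?F"
 proof (rule set_eqI)
  fix F :: "(site \<times> site) set"
  show "F \<in> (%F. map_prod T T ` F) ` ?F \<longleftrightarrow> F \<in> ?F"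
  proof
   assume "F \<in> (%F. map_prod T T ` F) ` ?F" then show "F \<in> ?F"
    using order.trans[OF image_mono edges(1)] by blast
  next
   assume F: "F \<in> ?F"
   have "map_prod T T ` (map_prod S S ` F) = F" by (simp add: image_image map_prod_def inv case_prod_unfold)
   moreover have "map_prod S S ` F \<in> ?F" using F order.trans[OF image_mono edges(2)] by blast
   ultimately show "F \<in> (%F. map_prod T T ` F) ` ?F" by (intro image_eqI[where x="map_prod S S ` F"]) simp_all
  qed
 qed
 then have "xy_lim c (%th. \<xi> (%i. th (T i))) = (SUP F\<in>(%F. map_prod T T ` F) ` ?F. xy_mean c F (%th. Re (\<xi> (%i. th (T i)))))"
  by (simp add: xy_lim_def)
 also have "... = xy_lim c \<xi>"
  unfolding xy_lim_def image_image eq ..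
 finally show ?thesis .
qed

lemma xy_lim_shift:
 assumes "spin.character \<xi>" shows "xy_lim c (%th. \<xi> (%i. th (i + v))) = xy_lim c \<xi>"
proof (rule xy_lim_reindex[where S="%x. x - v", OF _ assms])
 show "inj (%x. x + v)" by (simp add: inj_def)
qed (auto simp: Z2_edges_def)

lemma xy_lim_swap:
 assumes "spin.character \<xi>" shows "xy_lim c (%th. \<xi> (%i. th (prod.swap i))) = xy_lim c \<xi>"
proof (rule xy_lim_reindex[where S=prod.swap, OF _ assms])
 show "inj (prod.swap :: site => site)" by (rule inj_swap)
qed (auto simp: Z2_edges_def)

section \<open>Spin fields of divergence free flows\<close>

definition face_bond :: "site \<times> site => site \<times> site" where
 "face_bond e = (right_face (fst e) (snd e), left_face (fst e) (snd e))"

lemma face_bond_simps: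
 "face_bond ((a, b), (a + 1, b)) = ((a, b - 1), (a, b))"
 "face_bond ((a, b), (a, b + 1)) = ((a, b), (a - 1, b))"
 "face_bond ((a + 1, b), (a, b)) = ((a, b), (a, b - 1))"
 "face_bond ((a, b + 1), (a, b)) = ((a - 1, b), (a, b))"
 by (simp_all add: face_bond_def right_face_def left_face_def)

lemma face_bond_swap: "face_bond (w, v) = prod.swap (face_bond (v, w))"
 by (simp add: face_bond_def left_face_def)

lemma Z2_edges_cases:
 assumes "e \<in> Z2_edges"
 obtains a b where "e = ((a, b), (a + 1, b))" | a b where "e = ((a, b), (a, b + 1))"
  | a b where "e = ((a + 1, b), (a, b))" | a b where "e = ((a, b + 1), (a, b))"
proof -
 obtain a b a' b' where e: "e = ((a, b), (a', b'))" by (metis prod.exhaust)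
 have "\<bar>a' - a\<bar> + \<bar>b' - b\<bar> = 1" using assms e by (simp add: Z2_edges_def)
 then have "a' = a + 1 \<and> b' = b \<or> a = a' + 1 \<and> b' = b \<or> a' = a \<and> b' = b + 1 \<or> a' = a \<and> b = b' + 1" by arith
 then show ?thesis using that e by auto
qed

lemma face_bond_Z2_edges: "e \<in> Z2_edges ==> face_bond e \<in> Z2_edges"
 by (erule Z2_edges_cases) (simp_all add: face_bond_simps Z2_edges_def)

lemma face_bond_surj: "f \<in> Z2_edges ==> \<exists>e\<in>Z2_edges. face_bond e = f"
proof (erule Z2_edges_cases)
 fix a b
 show "\<exists>e\<in>Z2_edges. face_bond e = f" if "f = ((a, b), (a + 1, b))"
  using that face_bond_simps(4)[of "a + 1" b] by (intro bexI[of _ "((a + 1, b + 1), (a + 1, b))"]) (auto simp: Z2_edges_def)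
 show "\<exists>e\<in>Z2_edges. face_bond e = f" if "f = ((a, b), (a, b + 1))"
  using that face_bond_simps(1)[of a "b + 1"] by (intro bexI[of _ "((a, b + 1), (a + 1, b + 1))"]) (auto simp: Z2_edges_def)
 show "\<exists>e\<in>Z2_edges. face_bond e = f" if "f = ((a + 1, b), (a, b))"
  using that face_bond_simps(2)[of "a + 1" b] by (intro bexI[of _ "((a + 1, b), (a + 1, b + 1))"]) (auto simp: Z2_edges_def)
 show "\<exists>e\<in>Z2_edges. face_bond e = f" if "f = ((a, b + 1), (a, b))"
  using that face_bond_simps(3)[of a "b + 1"] by (intro bexI[of _ "((a + 1, b + 1), (a, b + 1))"]) (auto simp: Z2_edges_def)
qed

lemma inj_on_face_bond: "inj_on face_bond Z2_edges"
proof (rule inj_onI)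
 fix e f assume "e \<in> Z2_edges" "f \<in> Z2_edges" "face_bond e = face_bond f"
 then show "e = f"
  by (elim Z2_edges_cases) (simp_all add: face_bond_simps)
qed

lemma bond_swap: "bond th (prod.swap b) = cnj (bond th b)"
 by (simp add: bond_def mult.commute)

lemma neighbours: "{y. (y, (a, b)) \<in> Z2_edges} = {(a - 1, b), (a + 1, b), (a, b - 1), (a, b + 1)}"
 by (auto simp: Z2_edges_def)

lemma prod_neighbours:
 fixes f :: "site => complex"
 shows "(\<Prod>y | (y, (a, b)) \<in> Z2_edges. f y) = f (a - 1, b) * f (a + 1, b) * f (a, b - 1) * f (a, b + 1)"
 unfolding neighbours by (simp add: mult.assoc)

lemma unit_mult_cnj: "norm z = 1 ==> z * cnj z = 1" "norm z = 1 ==> cnj z * z = 1"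
 using complex_norm_square[of z] by (simp_all add: mult.commute)

lemma unit_inverse: "norm z = 1 ==> inverse z = cnj z"
 using unit_mult_cnj(1)[of z] by (simp add: inverse_unique)

text \<open>Going around a vertex, each of the four adjacent faces appears once as the right and
  once as the left face of an incoming edge, so its spin meets its own conjugate.\<close>

lemma d_star_bond:
 assumes th: "\<And>x. norm (th x) = 1"
 shows "(\<Prod>y | (y, x) \<in> Z2_edges. bond th (face_bond (y, x))) = 1"
proof -
 obtain a b where x: "x = (a, b)" by force
 have f: "face_bond ((a - 1, b), (a, b)) = ((a - 1, b - 1), (a - 1, b))"
  "face_bond ((a + 1, b), (a, b)) = ((a, b), (a, b - 1))"
  "face_bond ((a, b - 1), (a, b)) = ((a, b - 1), (a - 1, b - 1))"
  "face_bond ((a, b + 1), (a, b)) = ((a - 1, b), (a, b))"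
  using face_bond_simps(1)[of "a - 1" b] face_bond_simps(3)[of a b] face_bond_simps(2)[of a "b - 1"] face_bond_simps(4)[of a b]
  by simp_all
 have "(\<Prod>y | (y, x) \<in> Z2_edges. bond th (face_bond (y, x))) =
  (th (a - 1, b - 1) * cnj (th (a - 1, b - 1))) * (th (a - 1, b) * cnj (th (a - 1, b))) *
  (th (a, b) * cnj (th (a, b))) * (th (a, b - 1) * cnj (th (a, b - 1)))"
  unfolding x prod_neighbours f bond_def by (simp add: mult_ac)
 then show ?thesis by (simp add: unit_mult_cnj th)
qed

text \<open>A discrete multiplicative antiderivative on the integers with value 1 at 0; to the left
  of 0 inverses are accumulated, written as conjugates.\<close>

definition unit_primitive :: "(int => complex) => int => complex" where
 "unit_primitive f k = (if k \<ge> 0 then \<Prod>i\<in>{0..<k}. f i else \<Prod>i\<in>{k..<0}. cnj (f i))"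

lemma unit_primitive_0: "unit_primitive f 0 = 1"
 by (simp add: unit_primitive_def)

lemma unit_primitive_norm:
 assumes "\<And>i. norm (f i) = 1" shows "norm (unit_primitive f k) = 1"
 by (simp add: unit_primitive_def prod_norm[symmetric] assms)

lemma unit_primitive_step:
 assumes "\<And>i. norm (f i) = 1"
 shows "unit_primitive f (k + 1) = unit_primitive f k * f k"
proof -
 consider "k \<ge> 0" | "k = -1" | "k < -1" by linarith
 then show ?thesis
 proof cases
  case 1
  then have "{0..<k+1} = insert k {0..<k}" by auto
  then show ?thesis using 1 by (simp add: unit_primitive_def)
 next
  case 2
  have "{-1..<0::int} = {-1}" by auto
  then show ?thesis using 2 assms by (simp add: unit_primitive_def unit_mult_cnj)
 next
  case 3
  then have "{k..<0} = insert k {k+1..<0}" by auto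
  then show ?thesis using 3 assms by (simp add: unit_primitive_def) (simp add: mult.commute mult.assoc[symmetric] unit_mult_cnj)
 qed
qed

text \<open>A divergence free unit flow is the gradient of a field on the faces, as long as it is divergence
 free on the column segment joining the axis to the given row.\<close>

lemma discrete_poincare:
 fixes J :: "site form"
 assumes unit: "\<And>e. e \<in> Z2_edges ==> norm (J e) = 1"
  and anti: "\<And>x y. (x, y) \<in> Z2_edges ==> J (y, x) = cnj (J (x, y))"
 obtains et where "\<And>x. norm (et x) = 1" "et (0, 0) = 1"
  "\<And>a b. J ((a, b), (a + 1, b)) = et (a, b - 1) * cnj (et (a, b))"
  "\<And>a b. (\<And>c. min b 0 <= c ==> c <= max b 0 ==> (\<Prod>y | (y, (a, c)) \<in> Z2_edges. J (y, (a, c))) = 1) ==>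
   J ((a, b), (a, b + 1)) = et (a, b) * cnj (et (a - 1, b))"
proof -
 define ea where "ea a b = J ((a, b), (a + 1, b))" for a b
 define no where "no a b = J ((a, b), (a, b + 1))" for a b
 have ue: "norm (ea a b) = 1" "norm (no a b) = 1" for a b
  by (auto simp: ea_def no_def Z2_edges_def intro!: unit)
 \<comment> \<open>The potential is integrated along the row through the origin and then up or down
   each column. The relation for horizontal edges thus holds by construction, as does the one for
   vertical edges on the axis.\<close>
 define et where "et x = unit_primitive (%i. no (i + 1) 0) (fst x) * unit_primitive (%j. cnj (ea (fst x) (j + 1))) (snd x)" for x
 have net: "norm (et x) = 1" for x
  by (simp add: et_def norm_mult unit_primitive_norm ue)
 have v: "et (a, b) = et (a, b - 1) * cnj (ea a b)" for a b
  using unit_primitive_step[of "%j. cnj (ea a (j + 1))" "b - 1"] by (simp add: et_def ue)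
 have h0: "et (a, 0) = et (a - 1, 0) * no a 0" for a
  using unit_primitive_step[of "%i. no (i + 1) 0" "a - 1"] by (simp add: et_def ue unit_primitive_0)
 have E: "ea a b = et (a, b - 1) * cnj (et (a, b))" for a b
 proof -
  have "et (a, b - 1) * cnj (et (a, b)) = (et (a, b - 1) * cnj (et (a, b - 1))) * ea a b"
   unfolding v[of a b] by simp
  then show ?thesis by (simp add: unit_mult_cnj net)
 qed
 have cl: "ea (a - 1) c * cnj (ea a c) * no a (c - 1) * cnj (no a c) = 1"
  if "(\<Prod>y | (y, (a, c)) \<in> Z2_edges. J (y, (a, c))) = 1" for a c
 proof -
  have "J ((a + 1, c), (a, c)) = cnj (ea a c)" "J ((a, c + 1), (a, c)) = cnj (no a c)"
   unfolding ea_def no_def by (rule anti; simp add: Z2_edges_def)+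
  then show ?thesis using that unfolding prod_neighbours by (simp add: ea_def no_def)
 qed
 have column_step: "no a c = et (a, c) * cnj (et (a - 1, c)) \<longleftrightarrow> no a (c - 1) = et (a, c - 1) * cnj (et (a - 1, c - 1))"
  if "(\<Prod>y | (y, (a, c)) \<in> Z2_edges. J (y, (a, c))) = 1" for a c
 proof -
  define u where "u = ea (a - 1) c * cnj (ea a c)"
  have u1: "norm u = 1" by (simp add: u_def norm_mult ue)
  then have u0: "u \<noteq> 0" by auto
  have "et (a, c) * cnj (et (a - 1, c)) = u * (et (a, c - 1) * cnj (et (a - 1, c - 1)))"
   unfolding v[of a c] v[of "a - 1" c] u_def by (simp add: mult_ac)
  moreover have "no a c = u * no a (c - 1)"
  proof -
   have "u * no a (c - 1) * cnj (no a c) = 1" using cl[OF that] unfolding u_def .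
   then have "u * no a (c - 1) * (cnj (no a c) * no a c) = no a c" by (metis mult.assoc mult_1)
   then show ?thesis by (simp add: unit_mult_cnj ue)
  qed
  ultimately show ?thesis using u0 by simp
 qed
 have axis: "no a 0 = et (a, 0) * cnj (et (a - 1, 0))" for a
 proof -
  have "et (a, 0) * cnj (et (a - 1, 0)) = (et (a - 1, 0) * cnj (et (a - 1, 0))) * no a 0"
   unfolding h0[of a] by (simp add: mult_ac)
  then show ?thesis by (simp add: unit_mult_cnj net)
 qed
 have N: "no a b = et (a, b) * cnj (et (a - 1, b))"
  if cl: "\<And>c. min b 0 <= c ==> c <= max b 0 ==> (\<Prod>y | (y, (a, c)) \<in> Z2_edges. J (y, (a, c))) = 1" for a b
 proof (cases "b \<ge> 0")
  case True
  have "no a k = et (a, k) * cnj (et (a - 1, k))" if "0 <= k" "k <= b" for k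
   using that
  proof (induction k rule: int_ge_induct)
   case base show ?case by (rule axis)
  next
   case (step i)
   then show ?case using column_step[OF cl[of "i + 1"]] by auto
  qed
  then show ?thesis using True by blast
 next
  case False
  have "no a k = et (a, k) * cnj (et (a - 1, k))" if "k <= 0" "b <= k" for k
   using that
  proof (induction k rule: int_le_induct)
   case base show ?case by (rule axis)
  next
   case (step i)
   then show ?case using column_step[OF cl[of i]] by auto
  qed
  then show ?thesis using False by auto
 qed
 show thesis
 proof (rule that[of et])
  show "norm (et x) = 1" for x by (rule net)
  show "et (0, 0) = 1" by (simp add: et_def unit_primitive_0)
  show "J ((a, b), (a + 1, b)) = et (a, b - 1) * cnj (et (a, b))" for a b using E by (simp add: ea_def)
  show "J ((a, b), (a, b + 1)) = et (a, b) * cnj (et (a - 1, b))"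
   if "\<And>c. min b 0 <= c ==> c <= max b 0 ==> (\<Prod>y | (y, (a, c)) \<in> Z2_edges. J (y, (a, c))) = 1" for a b
   using N[OF that] by (simp add: no_def)
 qed
qed

text \<open>Antisymmetry reduces the four directions to east and north. The set \<open>E\<close>
  leaves room for flows that are gradients only in part of the plane.\<close>

lemma bond_face_bond_eqI:
 assumes e: "\<And>a b. ((a, b), (a + 1, b)) \<in> E \<or> ((a + 1, b), (a, b)) \<in> E ==> J ((a, b), (a + 1, b)) = et (a, b - 1) * cnj (et (a, b))"
  and n: "\<And>a b. ((a, b), (a, b + 1)) \<in> E \<or> ((a, b + 1), (a, b)) \<in> E ==> J ((a, b), (a, b + 1)) = et (a, b) * cnj (et (a - 1, b))"
  and anti: "\<And>x y. (x, y) \<in> Z2_edges ==> J (y, x) = cnj (J (x, y))"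
  and x: "x \<in> E" "x \<in> Z2_edges"
 shows "J x = bond et (face_bond x)"
 using x(2)
proof (cases rule: Z2_edges_cases)
 case (1 a b) then show ?thesis using e x by (simp add: face_bond_simps bond_def)
next
 case (2 a b) then show ?thesis using n x by (simp add: face_bond_simps bond_def)
next
 case (3 a b)
 have "J x = cnj (J ((a, b), (a + 1, b)))" unfolding 3 by (rule anti) (simp add: Z2_edges_def)
 then show ?thesis using e[of a b] x 3 by (simp add: face_bond_simps bond_def)
next
 case (4 a b)
 have "J x = cnj (J ((a, b), (a, b + 1)))" unfolding 4 by (rule anti) (simp add: Z2_edges_def)
 then show ?thesis using n[of a b] x 4 by (simp add: face_bond_simps bond_def)
qed

lemma H_diamondD:
 assumes "J \<in> H_diamond D"
 shows "J \<in> extensional D" "\<And>e. e \<in> D ==> norm (J e) = 1"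
  "\<And>x y. (x, y) \<in> D ==> J (y, x) = cnj (J (x, y))" "\<And>x. (\<Prod>y | (y, x) \<in> D. J (y, x)) = 1"
proof -
 show "J \<in> extensional D" and n: "\<And>e. e \<in> D ==> norm (J e) = 1"
  using assms by (auto simp: H_diamond_def one_forms_def PiE_iff)
 show "\<And>x y. (x, y) \<in> D ==> J (y, x) = cnj (J (x, y))"
  using assms n unit_inverse by (auto simp: H_diamond_def one_forms_def)
 show "\<And>x. (\<Prod>y | (y, x) \<in> D. J (y, x)) = 1"
  using assms by (auto simp: H_diamond_def d_star_def)
qed

lemma H_diamondI:
 assumes "J \<in> extensional D" "\<And>e. e \<in> D ==> norm (J e) = 1"
  "\<And>x y. (x, y) \<in> D ==> J (y, x) = cnj (J (x, y))" "\<And>x. (\<Prod>y | (y, x) \<in> D. J (y, x)) = 1"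
 shows "J \<in> H_diamond D"
 using assms unit_inverse by (auto simp: H_diamond_def one_forms_def PiE_iff d_star_def)

text \<open>Existence is \<open>discrete_poincare\<close>; uniqueness propagates the value at the
  origin along the axis and then along columns. Together they justify the definite description in
  \<open>spin_field\<close>.\<close>

lemma spin_field_gradient:
 assumes J: "J \<in> H_diamond Z2_edges"
 shows "\<And>u. norm (spin_field J u) = 1" "\<And>e. e \<in> Z2_edges ==> J e = bond (spin_field J) (face_bond e)"
proof -
 define P where "P th \<longleftrightarrow> (\<forall>u. th u \<in> sphere 0 1) \<and> th (0, 0) = 1 \<and>
   (\<forall>(v, v')\<in>Z2_edges. J (v, v') = th (right_face v v') / th (left_face v v'))" for th :: "site => complex"
 note H = H_diamondD[OF J]
 have P_iff: "P th \<longleftrightarrow> (\<forall>u. norm (th u) = 1) \<and> th (0, 0) = 1 \<and> (\<forall>e\<in>Z2_edges. J e = bond th (face_bond e))" for th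
 proof (cases "\<forall>u. norm (th u) = 1")
  case True
  then have "inverse (th u) = cnj (th u)" for u using unit_inverse[of "th u"] by blast
  then show ?thesis by (simp add: P_def bond_def face_bond_def divide_inverse case_prod_unfold)
 next
  case False
  then show ?thesis unfolding P_def by (metis mem_sphere_0)
 qed
 have "\<exists>et. (\<forall>x. norm (et x) = 1) \<and> et (0, 0) = 1 \<and> (\<forall>a b. J ((a, b), (a + 1, b)) = et (a, b - 1) * cnj (et (a, b))) \<and>
  (\<forall>a b. J ((a, b), (a, b + 1)) = et (a, b) * cnj (et (a - 1, b)))"
 proof (rule discrete_poincare[of J, OF H(2,3)])
  fix et :: "site spin"
  assume "\<And>x. norm (et x) = 1" "et (0, 0) = 1" "\<And>a b. J ((a, b), (a + 1, b)) = et (a, b - 1) * cnj (et (a, b))"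
  moreover assume col: "\<And>a b. (\<And>c. min b 0 <= c ==> c <= max b 0 ==> (\<Prod>y | (y, (a, c)) \<in> Z2_edges. J (y, (a, c))) = 1) ==>
   J ((a, b), (a, b + 1)) = et (a, b) * cnj (et (a - 1, b))"
  have "J ((a, b), (a, b + 1)) = et (a, b) * cnj (et (a - 1, b))" for a b
   by (rule col) (rule H(4))
  ultimately show ?thesis by (intro exI[of _ et] conjI allI)
 qed
 then obtain et where et0: "\<forall>x. norm (et x) = 1" "et (0, 0) = 1" "\<forall>a b. J ((a, b), (a + 1, b)) = et (a, b - 1) * cnj (et (a, b))"
  "\<forall>a b. J ((a, b), (a, b + 1)) = et (a, b) * cnj (et (a - 1, b))" by (elim exE conjE)
 have et12: "norm (et x) = 1" "et (0, 0) = 1" for x using et0 by blast+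
 have et3: "J ((a, b), (a + 1, b)) = et (a, b - 1) * cnj (et (a, b))"
  and et4: "J ((a, b), (a, b + 1)) = et (a, b) * cnj (et (a - 1, b))" for a b using et0 by blast+
 note et = et12 et3 et4
 have ex: "P et"
  unfolding P_iff
 proof (intro conjI allI ballI)
  show "J e = bond et (face_bond e)" if "e \<in> Z2_edges" for e
   by (rule bond_face_bond_eqI[where E=UNIV]) (simp_all add: et3 et4 H(3) that)
 qed (rule et12)+
 have uniq: "th = et" if "P th" for th
 proof -
  have t: "\<And>u. norm (th u) = 1" "th (0, 0) = 1" "\<And>e. e \<in> Z2_edges ==> J e = bond th (face_bond e)"
   using that unfolding P_iff by auto
  have cancel: "z = w" if "norm p = 1" "p * cnj z = p * cnj w" for p z w :: complex
  proof -
   have "p \<noteq> 0" using that by auto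
   then show ?thesis using that by simp
  qed
  have cancel': "z = w" if "norm p = 1" "z * cnj p = w * cnj p" for p z w :: complex
  proof -
   have "p \<noteq> 0" using that by auto
   then show ?thesis using that by simp
  qed
  have e1: "th (a, b - 1) * cnj (th (a, b)) = et (a, b - 1) * cnj (et (a, b))" for a b
   using t(3)[of "((a, b), (a + 1, b))"] et(3)[of a b] by (simp add: Z2_edges_def face_bond_simps bond_def)
  have e2: "th (a, b) * cnj (th (a - 1, b)) = et (a, b) * cnj (et (a - 1, b))" for a b
   using t(3)[of "((a, b), (a, b + 1))"] et(4)[of a b] by (simp add: Z2_edges_def face_bond_simps bond_def)
  have h: "th (a, 0) = et (a, 0)" for a
  proof (induction a rule: int_induct[where k=0])
   case base show ?case by (simp add: t(2) et(2))
  next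
   case (step1 i)
   from e2[of "i + 1" 0] step1(2) have "th (i + 1, 0) * cnj (et (i, 0)) = et (i + 1, 0) * cnj (et (i, 0))" by simp
   then show ?case by (rule cancel'[OF et(1)])
  next
   case (step2 i)
   from e2[of i 0] step2(2) have "et (i, 0) * cnj (th (i - 1, 0)) = et (i, 0) * cnj (et (i - 1, 0))" by simp
   then show ?case by (rule cancel[OF et(1)])
  qed
  have "th (a, b) = et (a, b)" for a b
  proof (induction b rule: int_induct[where k=0])
   case base show ?case by (rule h)
  next
   case (step1 i)
   from e1[of a "i + 1"] step1(2) have "et (a, i) * cnj (th (a, i + 1)) = et (a, i) * cnj (et (a, i + 1))" by simp
   then show ?case by (rule cancel[OF et(1)])
  next
   case (step2 i)
   from e1[of a i] step2(2) have "th (a, i - 1) * cnj (et (a, i)) = et (a, i - 1) * cnj (et (a, i))" by simp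
   then show ?case by (rule cancel'[OF et(1)])
  qed
  then show ?thesis by (auto simp: fun_eq_iff)
 qed
 have "spin_field J = et"
  unfolding spin_field_def P_def[symmetric] by (rule the_equality[of P, OF ex uniq])
 then have "P (spin_field J)" using ex by simp
 then show "\<And>u. norm (spin_field J u) = 1" "\<And>e. e \<in> Z2_edges ==> J e = bond (spin_field J) (face_bond e)"
  unfolding P_iff by blast+
qed

text \<open>The ratio of two spins of the same row, as a function of the flow through the edges between them.\<close>

definition row_ratio :: "int => nat => site form => complex" where
 "row_ratio b i J = (\<Prod>j<i. cnj (J ((int j + 1, b), (int j + 1, b + 1))))"

lemma row_ratio_bond:
 assumes "\<And>u. norm (th u) = 1"
  and "\<And>j. j < i ==> J ((int j + 1, b), (int j + 1, b + 1)) = bond th (face_bond ((int j + 1, b), (int j + 1, b + 1)))"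
 shows "row_ratio b i J = chi2 (0, b) (int i, b) th"
proof -
 have "(\<Prod>j<k. cnj (J ((int j + 1, b), (int j + 1, b + 1)))) = th (0, b) * cnj (th (int k, b))" if "k <= i" for k
  using that
 proof (induction k)
  case 0 then show ?case by (simp add: unit_mult_cnj assms(1))
 next
  case (Suc k)
  then have "J ((int k + 1, b), (int k + 1, b + 1)) = th (int k + 1, b) * cnj (th (int k, b))"
   using assms(2)[of k] by (simp add: face_bond_simps bond_def)
  then have "(\<Prod>j<Suc k. cnj (J ((int j + 1, b), (int j + 1, b + 1)))) =
   th (0, b) * (cnj (th (int k, b)) * th (int k, b)) * cnj (th (int k + 1, b))"
   using Suc by (simp add: mult_ac)
  then show ?case by (simp add: unit_mult_cnj assms(1) add.commute)
 qed
 then show ?thesis by (simp add: row_ratio_def chi2_def)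
qed

text \<open>The spin field is given by a description over the whole plane; these identities turn the
  two observables into functions of finitely many edges, to which weak convergence of finite
  marginals applies.\<close>

lemma spin_ratio:
 assumes "J \<in> H_diamond Z2_edges"
 shows "spin_upper J 0 / spin_upper J i = row_ratio 0 i J"
  "(spin_upper J 0 * spin_lower J 0) / (spin_upper J i * spin_lower J i) = row_ratio 0 i J * row_ratio (-1) i J"
proof -
 note g = spin_field_gradient[OF assms]
 have r: "row_ratio b i J = spin_field J (0, b) * cnj (spin_field J (int i, b))" for b
  using row_ratio_bond[of "spin_field J" i J b] g by (simp add: Z2_edges_def chi2_def)
 show "spin_upper J 0 / spin_upper J i = row_ratio 0 i J"
  "(spin_upper J 0 * spin_lower J 0) / (spin_upper J i * spin_lower J i) = row_ratio 0 i J * row_ratio (-1) i J"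
  unfolding r spin_upper_def spin_lower_def
  by (simp_all add: divide_inverse unit_inverse g(1) mult_ac)
qed

section \<open>Flows on the torus\<close>

lemma torus_edges_sym: "(x, y) \<in> torus_edges N ==> (y, x) \<in> torus_edges N"
proof -
 assume "(x, y) \<in> torus_edges N"
 then obtain z where z: "x \<in> torus_box N" "y \<in> torus_box N" "x \<noteq> y" "(x, z) \<in> Z2_edges"
  "fst z mod 2 ^ N = fst y mod 2 ^ N" "snd z mod 2 ^ N = snd y mod 2 ^ N"
  by (auto simp: torus_edges_def)
 define w where "w = y + x - z"
 have "(y, w) \<in> Z2_edges" using z(4) by (auto simp: Z2_edges_def w_def abs_minus_commute)
 moreover have "fst w mod 2 ^ N = fst x mod 2 ^ N"
 proof -
  have "fst w - fst x = fst y - fst z" by (simp add: w_def)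
  moreover have "(2 ^ N) dvd (fst y - fst z)" using z(5) by (simp add: mod_eq_dvd_iff dvd_diff_commute)
  ultimately show ?thesis by (simp add: mod_eq_dvd_iff)
 qed
 moreover have "snd w mod 2 ^ N = snd x mod 2 ^ N"
 proof -
  have "snd w - snd x = snd y - snd z" by (simp add: w_def)
  moreover have "(2 ^ N) dvd (snd y - snd z)" using z(6) by (simp add: mod_eq_dvd_iff dvd_diff_commute)
  ultimately show ?thesis by (simp add: mod_eq_dvd_iff)
 qed
 ultimately show ?thesis using z(1-3) unfolding torus_edges_def by blast
qed

lemma finite_torus_edges: "finite (torus_edges N)"
proof -
 have "torus_box N \<subseteq> {- (2 ^ N)..2 ^ N} \<times> {- (2 ^ N)..2 ^ N}"
  by (auto simp: torus_box_def)
 then have "finite (torus_box N)" by (rule finite_subset) auto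
 moreover have "torus_edges N \<subseteq> torus_box N \<times> torus_box N" by (auto simp: torus_edges_def)
 ultimately show ?thesis using finite_subset by blast
qed

lemma Z2_edges_in_torus:
 "(x, y) \<in> Z2_edges ==> x \<in> torus_box N ==> y \<in> torus_box N ==> (x, y) \<in> torus_edges N"
 by (auto simp: torus_edges_def Z2_edges_def)

lemma square_torus_box: "2 * R < 2 ^ N ==> square R \<subseteq> torus_box N"
proof
 fix x assume R: "2 * R < 2 ^ N" and x: "x \<in> square R"
 have "int (2 * R) < int (2 ^ N)" using R by (simp only: of_nat_less_iff)
 then have "2 * int R < 2 ^ N" by simp
 then show "x \<in> torus_box N" using x by (auto simp: mem_square torus_box_def abs_le_iff)
qed

lemma Z2_edges_square_torus:
 assumes "2 * Suc R < 2 ^ N" "(x, y) \<in> Z2_edges" "x \<in> square R \<or> y \<in> square R"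
 shows "(x, y) \<in> torus_edges N"
proof -
 have "x \<in> square (Suc R)" "y \<in> square (Suc R)"
  using assms(2,3) rad_neighbour[OF assms(2)] by (auto simp: square_def)
 then show ?thesis using square_torus_box[OF assms(1)] Z2_edges_in_torus[OF assms(2)] by blast
qed

text \<open>A torus neighbour is a lattice neighbour up to multiples of the side length. Away from
  the seam both points lie in a window too small to contain distinct congruent coordinates.\<close>

lemma torus_edges_deep:
 assumes deep: "2 * rad x + 4 <= 2 ^ N"
 shows "(y, x) \<in> torus_edges N \<longleftrightarrow> (y, x) \<in> Z2_edges"
proof
 assume "(y, x) \<in> Z2_edges"
 then show "(y, x) \<in> torus_edges N"
  using Z2_edges_square_torus[of "rad x" N y x] deep by (auto simp: square_def)
next
 assume "(y, x) \<in> torus_edges N"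
 then obtain z where z: "y \<in> torus_box N" "(y, z) \<in> Z2_edges"
  "fst z mod 2 ^ N = fst x mod 2 ^ N" "snd z mod 2 ^ N = snd x mod 2 ^ N"
  by (auto simp: torus_edges_def)
 have "int (2 * rad x + 4) <= int (2 ^ N)" using deep by (simp only: of_nat_le_iff)
 then have x: "2 * \<bar>fst x\<bar> + 4 <= 2 ^ N" "2 * \<bar>snd x\<bar> + 4 <= 2 ^ N" by (auto simp: rad_def max_def split: if_splits)
 have zz: "2 * \<bar>fst z\<bar> <= 2 ^ N + 2" "2 * \<bar>snd z\<bar> <= 2 ^ N + 2"
  using z(1,2) by (auto simp: torus_box_def Z2_edges_def)
 have eq: "u = w" if "2 * \<bar>u\<bar> <= 2 ^ N + 2" "2 * \<bar>w\<bar> + 4 <= 2 ^ N" "u mod 2 ^ N = w mod 2 ^ N" for u w :: int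
 proof -
  have "(2 ^ N) dvd (u - w)" using that(3) by (simp add: mod_eq_dvd_iff)
  moreover have "\<bar>u - w\<bar> < 2 ^ N" using that(1,2) by linarith
  ultimately have "u - w = 0" using dvd_imp_le_int[of "u - w" "2 ^ N"] by fastforce
  then show ?thesis by simp
 qed
 have "z = x" using eq[OF zz(1) x(1) z(3)] eq[OF zz(2) x(2) z(4)] by (simp add: prod_eq_iff)
 then show "(y, x) \<in> Z2_edges" using z by simp
qed

text \<open>A step towards the origin never leaves the fundamental domain, so no edge across the
  seam is needed.\<close>

lemma torus_connected:
 assumes x: "x \<in> torus_box N" and base: "P (0, 0)"
  and step: "\<And>x y. P x ==> (x, y) \<in> torus_edges N ==> P y"
 shows "P x"
 using x
proof (induction "nat (\<bar>fst x\<bar> + \<bar>snd x\<bar>)" arbitrary: x rule: less_induct)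
 case less
 obtain a b where x: "x = (a, b)" by (cases x)
 have box: "- (2 ^ N) <= 2 * a" "2 * a < 2 ^ N" "- (2 ^ N) <= 2 * b" "2 * b < 2 ^ N"
  using less.prems by (auto simp: x torus_box_def)
 consider "a > 0" | "a < 0" | "a = 0" "b > 0" | "a = 0" "b < 0" | "a = 0" "b = 0" by linarith
 then show ?case
 proof cases
  case 1
  have "P (a - 1, b)" using 1 box by (intro less.hyps) (auto simp: x torus_box_def)
  moreover have "((a - 1, b), x) \<in> torus_edges N" using 1 box less.prems by (intro Z2_edges_in_torus) (auto simp: Z2_edges_def x torus_box_def)
  ultimately show ?thesis by (rule step)
 next
  case 2
  have "P (a + 1, b)" using 2 box by (intro less.hyps) (auto simp: x torus_box_def)
  moreover have "((a + 1, b), x) \<in> torus_edges N" using 2 box less.prems by (intro Z2_edges_in_torus) (auto simp: Z2_edges_def x torus_box_def)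
  ultimately show ?thesis by (rule step)
 next
  case 3
  have "P (a, b - 1)" using 3 box by (intro less.hyps) (auto simp: x torus_box_def)
  moreover have "((a, b - 1), x) \<in> torus_edges N" using 3 box less.prems by (intro Z2_edges_in_torus) (auto simp: Z2_edges_def x torus_box_def)
  ultimately show ?thesis by (rule step)
 next
  case 4
  have "P (a, b + 1)" using 4 box by (intro less.hyps) (auto simp: x torus_box_def)
  moreover have "((a, b + 1), x) \<in> torus_edges N" using 4 box less.prems by (intro Z2_edges_in_torus) (auto simp: Z2_edges_def x torus_box_def)
  ultimately show ?thesis by (rule step)
 next
  case 5 then show ?thesis using base x by simp
 qed
qed

text \<open>
 Square roots exist edge by edge; the resulting signs of the divergence multiply to \<open>1\<close>, and are
 removed by changing signs along paths to the origin.
\<close>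

lemma H_diamond_torus_root:
 assumes J: "J \<in> H_diamond (torus_edges N)"
 shows "\<exists>K\<in>H_diamond (torus_edges N). \<forall>e\<in>torus_edges N. K e * K e = J e"
proof -
 define D where "D = torus_edges N"
 note H = H_diamondD[OF J, folded D_def]
 have Dsym: "(x, y) \<in> D ==> (y, x) \<in> D" for x y unfolding D_def by (rule torus_edges_sym)
 have irr: "(x, x) \<notin> D" for x by (simp add: D_def torus_edges_def)
 have finD: "finite D" unfolding D_def by (rule finite_torus_edges)
 have finin: "finite {y. (y, x) \<in> D}" for x
  by (rule finite_subset[of _ "fst ` D"]) (use finD in force)+
 \<comment> \<open>The root is chosen for one orientation only, selected by the enumeration of the
   sites, and conjugated for the other; this makes the roots antisymmetric.\<close>
 define k where "k e = (if to_nat (fst e) < to_nat (snd e) then csqrt (J e) else cnj (csqrt (J (prod.swap e))))" for e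
 have lt: "to_nat x < to_nat y \<or> to_nat y < to_nat x" if "(x, y) \<in> D" for x y :: site
  using that irr by (metis linorder_neqE_nat inj_eq[OF inj_to_nat])
 have kk: "k e * k e = J e" "norm (k e) = 1" if "e \<in> D" for e
 proof -
  obtain x y where e: "e = (x, y)" by (cases e)
  have s: "csqrt z * csqrt z = z" for z by (simp add: power2_eq_square[symmetric])
  have "cnj (csqrt (J (y, x))) * cnj (csqrt (J (y, x))) = J (x, y)"
   using H(3)[of y x] Dsym that e s[of "J (y, x)"] unfolding complex_cnj_mult[symmetric] by simp
  then show "k e * k e = J e" by (simp add: k_def e s)
  show "norm (k e) = 1" using H(2) that Dsym e by (auto simp: k_def)
 qed
 have kanti: "k (y, x) = cnj (k (x, y))" if "(x, y) \<in> D" for x y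
  using lt[OF that] by (auto simp: k_def)
 define \<epsilon> where "\<epsilon> x = (\<Prod>y | (y, x) \<in> D. k (y, x))" for x
 have \<epsilon>: "\<epsilon> x = 1 \<or> \<epsilon> x = -1" for x
 proof -
  have "\<epsilon> x * \<epsilon> x = (\<Prod>y | (y, x) \<in> D. J (y, x))"
   unfolding \<epsilon>_def prod.distrib[symmetric] by (intro prod.cong refl) (simp add: kk)
  then have "\<epsilon> x * \<epsilon> x = 1" by (simp add: H(4))
  then show ?thesis by (simp add: power2_eq_1_iff power2_eq_square[symmetric])
 qed
 define V where "V = snd ` D"
 have finV: "finite V" using finD by (simp add: V_def)
 \<comment> \<open>The product of all divergences contains each edge together with its reverse,
   whose values are conjugate.\<close>
 have tot: "(\<Prod>x\<in>V. \<epsilon> x) = 1"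
 proof -
  have S: "(SIGMA x:V. {y. (y, x) \<in> D}) = prod.swap ` D" by (auto simp: V_def image_iff prod.swap_def) force
  have "(\<Prod>x\<in>V. \<epsilon> x) = (\<Prod>(x, y)\<in>prod.swap ` D. k (y, x))"
   unfolding \<epsilon>_def S[symmetric] using finV finin by (subst prod.Sigma) auto
  also have "... = (\<Prod>e\<in>D. k e)"
   by (subst prod.reindex) (auto simp: inj_on_def case_prod_unfold)
  also have "D = {e\<in>D. to_nat (fst e) < to_nat (snd e)} \<union> prod.swap ` {e\<in>D. to_nat (fst e) < to_nat (snd e)}" (is "_ = ?A \<union> ?B")
  proof (rule set_eqI)
   fix e :: "site \<times> site"
   obtain x y where e: "e = (x, y)" by (cases e)
   have "e \<in> ?B \<longleftrightarrow> (y, x) \<in> ?A"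
    unfolding e by (metis (no_types, lifting) image_iff swap_simp swap_swap)
   then show "e \<in> D \<longleftrightarrow> e \<in> ?A \<union> ?B" using lt[of x y] Dsym[of x y] Dsym[of y x] by (auto simp: e)
  qed
  also have "(\<Prod>e\<in>?A \<union> ?B. k e) = (\<Prod>e\<in>?A. k e) * (\<Prod>e\<in>?B. k e)"
   using finD by (intro prod.union_disjoint) auto
  also have "(\<Prod>e\<in>?B. k e) = (\<Prod>e\<in>?A. k (prod.swap e))"
   by (subst prod.reindex) (auto simp: inj_on_def)
  also have "(\<Prod>e\<in>?A. k e) * (\<Prod>e\<in>?A. k (prod.swap e)) = (\<Prod>e\<in>?A. 1)"
   unfolding prod.distrib[symmetric]
  proof (rule prod.cong[OF refl])
   fix e assume "e \<in> ?A"
   then have "e \<in> D" by simp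
   then show "k e * k (prod.swap e) = 1"
    using kanti[of "fst e" "snd e"] kk(2)[of e] by (simp add: prod.swap_def unit_mult_cnj)
  qed
  finally show ?thesis by simp
 qed
 define \<sigma> where "\<sigma> x z = (if z = x then -1 else 1 :: complex)" for x z :: site
 \<comment> \<open>A symmetric choice of signs whose divergence is -1 exactly at x and at the
   origin, or nowhere if these coincide; it is built by flipping the edges of a path.\<close>
 define good where "good x \<longleftrightarrow> (\<exists>s. (\<forall>e\<in>D. s e = 1 \<or> s e = -1) \<and> (\<forall>x y. (x, y) \<in> D --> s (y, x) = s (x, y)) \<and>
  (\<forall>z. (\<Prod>y | (y, z) \<in> D. s (y, z)) = \<sigma> (0, 0) z * \<sigma> x z))" for x
 have good: "good x" if "x \<in> torus_box N" for x
  using that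
 proof (rule torus_connected)
  show "good (0, 0)" unfolding good_def by (intro exI[of _ "%_. 1"]) (auto simp: \<sigma>_def)
 next
  fix x y assume "good x" and xy: "(x, y) \<in> torus_edges N"
  then obtain s where s: "\<forall>e\<in>D. s e = 1 \<or> s e = -1" "\<forall>x y. (x, y) \<in> D --> s (y, x) = s (x, y)"
   "\<And>z. (\<Prod>y | (y, z) \<in> D. s (y, z)) = \<sigma> (0, 0) z * \<sigma> x z" unfolding good_def by blast
  have xyD: "(x, y) \<in> D" "(y, x) \<in> D" using xy Dsym by (auto simp: D_def)
  then have "x \<noteq> y" using irr by blast
  note xyD = xyD this
  define \<tau> where "\<tau> e = (if e = (x, y) \<or> e = (y, x) then -1 else 1 :: complex)" for e
  have \<tau>: "(\<Prod>w | (w, z) \<in> D. \<tau> (w, z)) = \<sigma> x z * \<sigma> y z" for z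
  proof -
   have single: "(\<Prod>w | (w, z) \<in> D. \<tau> (w, z)) = -1" if w0: "(w0, z) \<in> D" "\<And>w. (w, z) = (x, y) \<or> (w, z) = (y, x) \<longleftrightarrow> w = w0" for w0
   proof -
    have "(\<Prod>w | (w, z) \<in> D. \<tau> (w, z)) = (\<Prod>w | (w, z) \<in> D. if w = w0 then -1 else 1)"
     using w0(2) by (intro prod.cong refl) (auto simp: \<tau>_def)
    also have "... = -1" using finin w0(1) by (simp add: prod.delta)
    finally show ?thesis .
   qed
   consider "z = y" | "z = x" | "z \<noteq> x" "z \<noteq> y" by blast
   then show ?thesis
   proof cases
    case 1 then show ?thesis using single[of x] xyD by (auto simp: \<sigma>_def)
   next
    case 2 then show ?thesis using single[of y] xyD by (auto simp: \<sigma>_def)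
   next
    case 3 then show ?thesis by (simp add: \<sigma>_def \<tau>_def)
   qed
  qed
  show "good y" unfolding good_def
  proof (intro exI[of _ "%e. s e * \<tau> e"] conjI ballI allI impI)
   show "s e * \<tau> e = 1 \<or> s e * \<tau> e = -1" if "e \<in> D" for e using s(1) that by (auto simp: \<tau>_def)
   show "s (v, u) * \<tau> (v, u) = s (u, v) * \<tau> (u, v)" if uv: "(u, v) \<in> D" for u v
   proof -
    have "s (v, u) = s (u, v)" using s(2) uv by blast
    moreover have "\<tau> (v, u) = \<tau> (u, v)" by (auto simp: \<tau>_def)
    ultimately show ?thesis by simp
   qed
   fix z
   have "\<sigma> x z * \<sigma> x z = 1" by (simp add: \<sigma>_def)
   moreover have "(\<Prod>w | (w, z) \<in> D. s (w, z) * \<tau> (w, z)) = \<sigma> (0, 0) z * (\<sigma> x z * \<sigma> x z) * \<sigma> y z"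
    unfolding prod.distrib s(3) \<tau> by (simp only: mult_ac)
   ultimately show "(\<Prod>w | (w, z) \<in> D. s (w, z) * \<tau> (w, z)) = \<sigma> (0, 0) z * \<sigma> y z" by simp
  qed
 qed
 have VB: "V \<subseteq> torus_box N" by (auto simp: V_def D_def torus_edges_def)
 define s where "s x = (SOME s. (\<forall>e\<in>D. s e = 1 \<or> s e = -1) \<and> (\<forall>x y. (x, y) \<in> D --> s (y, x) = s (x, y)) \<and>
  (\<forall>z. (\<Prod>y | (y, z) \<in> D. s (y, z)) = \<sigma> (0, 0) z * \<sigma> x z))" for x
 have sQ: "(\<forall>e\<in>D. s x e = 1 \<or> s x e = -1) \<and> (\<forall>u y. (u, y) \<in> D --> s x (y, u) = s x (u, y)) \<and>
  (\<forall>z. (\<Prod>y | (y, z) \<in> D. s x (y, z)) = \<sigma> (0, 0) z * \<sigma> x z)" if "x \<in> V" for x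
  unfolding s_def by (rule someI_ex[OF good[unfolded good_def]]) (use that VB in blast)
 have s: "x \<in> V ==> e \<in> D ==> s x e = 1 \<or> s x e = -1"
  "x \<in> V ==> (u, v) \<in> D ==> s x (v, u) = s x (u, v)"
  "x \<in> V ==> (\<Prod>y | (y, z) \<in> D. s x (y, z)) = \<sigma> (0, 0) z * \<sigma> x z" for x e u v z
  using sQ[of x] by blast+
 \<comment> \<open>Correcting each site of \<open>B\<close> flips the sign there and at the origin.
   By \<open>tot\<close> the number of these sites is even, so the flips at the origin
   cancel.\<close>
 define B where "B = {x\<in>V. \<epsilon> x = -1}"
 have BV: "B \<subseteq> V" "finite B" using finV by (auto simp: B_def)
 have evB: "even (card B)"
 proof -
  have "(\<Prod>x\<in>V. \<epsilon> x) = (\<Prod>x\<in>V. if x \<in> B then -1 else 1)"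
   using \<epsilon> by (intro prod.cong refl) (auto simp: B_def)
  also have "... = (\<Prod>x\<in>B. -1)" using BV finV
   by (simp add: prod.If_cases Int_absorb1)
  also have "... = (-1) ^ card B" by simp
  finally have "(-1 :: complex) ^ card B = 1" using tot by simp
  then show ?thesis by (cases "even (card B)") auto
 qed
 define t where "t e = (\<Prod>x\<in>B. s x e)" for e
 have t1: "t e = 1 \<or> t e = -1" if "e \<in> D" for e
  unfolding t_def using BV(2,1)
 proof (induction B rule: finite_induct)
  case (insert x F)
  then show ?case using s(1)[of x e] that by auto
 qed simp
 have tsym: "t (v, u) = t (u, v)" if "(u, v) \<in> D" for u v
  unfolding t_def
 proof (intro prod.cong refl)
  fix x assume "x \<in> B"
  then show "s x (v, u) = s x (u, v)" using s(2) that BV by blast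
 qed
 have tdiv: "(\<Prod>y | (y, z) \<in> D. t (y, z)) = (if z \<in> B then -1 else 1)" for z
 proof -
  have "(\<Prod>y | (y, z) \<in> D. t (y, z)) = (\<Prod>x\<in>B. \<sigma> (0, 0) z * \<sigma> x z)"
   unfolding t_def using BV by (subst prod.swap) (auto intro!: prod.cong s(3))
  also have "... = \<sigma> (0, 0) z ^ card B * (\<Prod>x\<in>B. if x = z then -1 else 1)"
   by (simp add: prod.distrib \<sigma>_def eq_commute)
  also have "\<sigma> (0, 0) z ^ card B = 1" using evB by (simp add: \<sigma>_def)
  also have "1 * (\<Prod>x\<in>B. if x = z then -1 else (1 :: complex)) = (if z \<in> B then -1 else 1)"
   using BV by (simp add: prod.delta)
  finally show ?thesis .
 qed
 define K where "K = (\<lambda>e\<in>D. k e * t e)"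
 have "K \<in> H_diamond D"
 proof (rule H_diamondI)
  show "K \<in> extensional D" by (simp add: K_def)
  show "norm (K e) = 1" if "e \<in> D" for e using t1[OF that] kk(2)[OF that] that by (auto simp: K_def norm_mult)
  show "K (y, x) = cnj (K (x, y))" if "(x, y) \<in> D" for x y
   using t1[OF that] tsym[OF that] kanti[OF that] that Dsym[OF that] by (auto simp: K_def)
  fix z
  have "(\<Prod>y | (y, z) \<in> D. K (y, z)) = \<epsilon> z * (if z \<in> B then -1 else 1)"
   unfolding \<epsilon>_def tdiv[symmetric] prod.distrib[symmetric] by (intro prod.cong refl) (simp add: K_def)
  moreover have "\<epsilon> z = 1" if "z \<notin> V"
  proof -
   have no: "{y. (y, z) \<in> D} = {}" using that by (force simp: V_def)
   show ?thesis unfolding \<epsilon>_def no by simp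
  qed
  ultimately show "(\<Prod>y | (y, z) \<in> D. K (y, z)) = 1" using \<epsilon>[of z] by (auto simp: B_def)
 qed
 moreover have "K e * K e = J e" if "e \<in> D" for e
 proof -
  have "K e * K e = (k e * k e) * (t e * t e)" using that by (simp add: K_def mult_ac)
  then show ?thesis using t1[OF that] kk(1)[OF that] by auto
 qed
 ultimately show ?thesis unfolding D_def by blast
qed

section \<open>Comparison of the torus with free and pinned fields\<close>

locale torus_haar =
 fixes N :: nat and m :: "site form measure"
 assumes haar: "haar_probability (torus_edges N) m"
begin

abbreviation "D \<equiv> torus_edges N"

sublocale prob_space m using haar by (simp add: haar_probability_def)

lemma space_m: "space m = H_diamond D"
proof -
 have "space m = space (H_diamond_space D)"
  using haar by (intro sets_eq_imp_space_eq) (simp add: haar_probability_def)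
 moreover have "H_diamond D \<subseteq> space (Pi\<^sub>M D (%_. borel))"
  using H_diamondD(1) by (auto simp: space_PiM PiE_def)
 ultimately show ?thesis
  by (auto simp: H_diamond_space_def space_restrict_space)
qed

lemma coordinate_measurable [measurable]: "e \<in> D ==> (%J. J e) \<in> borel_measurable m"
proof -
 assume e: "e \<in> D"
 have s: "sets m = sets (H_diamond_space D)" using haar by (simp add: haar_probability_def)
 have "(%J. J e) \<in> borel_measurable (H_diamond_space D)"
  unfolding H_diamond_space_def using e by (intro measurable_restrict_space1 measurable_component_singleton)
 then show ?thesis using measurable_cong_sets[OF s refl] by blast
qed

lemma measurable_into:
 assumes "\<And>e. e \<in> D ==> (%x. f x e) \<in> borel_measurable M" "\<And>x. x \<in> space M ==> f x \<in> H_diamond D"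
 shows "f \<in> measurable M m"
proof -
 have s: "sets m = sets (H_diamond_space D)" using haar by (simp add: haar_probability_def)
 have "f \<in> measurable M (Pi\<^sub>M D (%_. borel))"
 proof (rule measurable_PiM_single')
  show "f \<in> space M \<rightarrow> (\<Pi>\<^sub>E e\<in>D. space borel)"
  proof
   fix x assume "x \<in> space M"
   from H_diamondD(1)[OF assms(2)[OF this]] show "f x \<in> (\<Pi>\<^sub>E e\<in>D. space borel)" by (simp add: PiE_iff)
  qed
 qed (rule assms(1))
 then have "f \<in> measurable M (H_diamond_space D)"
  unfolding H_diamond_space_def using assms(2) by (intro measurable_restrict_space2) auto
 then show ?thesis using measurable_cong_sets[OF refl s] by blast
qed

definition mulm :: "site form => site form => site form" where
 "mulm K J = (\<lambda>e\<in>D. K e * J e)"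

definition ivm :: "site form => site form" where
 "ivm J = (\<lambda>e\<in>D. cnj (J e))"

lemma mulm_closed: "K \<in> H_diamond D ==> J \<in> H_diamond D ==> mulm K J \<in> H_diamond D"
proof (rule H_diamondI)
 assume K: "K \<in> H_diamond D" and J: "J \<in> H_diamond D"
 note k = H_diamondD[OF K] and j = H_diamondD[OF J]
 show "mulm K J \<in> extensional D" by (simp add: mulm_def)
 show "norm (mulm K J e) = 1" if "e \<in> D" for e using that k j by (simp add: mulm_def norm_mult)
 show "mulm K J (y, x) = cnj (mulm K J (x, y))" if "(x, y) \<in> D" for x y
  using that k(3)[OF that] j(3)[OF that] torus_edges_sym[OF that] by (simp add: mulm_def)
 show "(\<Prod>y | (y, x) \<in> D. mulm K J (y, x)) = 1" for x
  using k(4)[of x] j(4)[of x] by (simp add: mulm_def prod.distrib cong: prod.cong_simp)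
qed

lemma ivm_closed: "J \<in> H_diamond D ==> ivm J \<in> H_diamond D"
proof (rule H_diamondI)
 assume J: "J \<in> H_diamond D"
 note j = H_diamondD[OF J]
 show "ivm J \<in> extensional D" by (simp add: ivm_def)
 show "norm (ivm J e) = 1" if "e \<in> D" for e using that j by (simp add: ivm_def)
 show "ivm J (y, x) = cnj (ivm J (x, y))" if "(x, y) \<in> D" for x y
  using that j(3)[OF that] torus_edges_sym[OF that] by (simp add: ivm_def)
 show "(\<Prod>y | (y, x) \<in> D. ivm J (y, x)) = 1" for x
  using j(4)[of x] by (simp add: ivm_def cnj_prod[symmetric] cong: prod.cong_simp)
qed

text \<open>\<open>halving\<close> is the place where square roots of flows are needed: a is a root
  of x y and b is x / a.\<close>

sublocale G: ginibre_group m mulm ivm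
proof
 show "(%z. mulm (fst z) (snd z)) \<in> measurable (m \<Otimes>\<^sub>M m) m"
 proof (rule measurable_into)
  fix e assume e: "e \<in> D"
  then show "(%z. mulm (fst z) (snd z) e) \<in> borel_measurable (m \<Otimes>\<^sub>M m)"
   by (simp add: mulm_def measurable_compose[OF measurable_fst] measurable_compose[OF measurable_snd])
 qed (auto simp: space_pair_measure space_m mulm_closed)
 show "ivm \<in> measurable m m"
 proof (rule measurable_into)
  fix e assume e: "e \<in> D"
  then have "(%J. ivm J e) = (%J. cnj (J e))" by (simp add: ivm_def)
  then show "(%J. ivm J e) \<in> borel_measurable m"
   using e by (auto intro!: measurable_compose[OF _ borel_measurable_continuous_onI[of cnj]] continuous_intros coordinate_measurable)
 qed (auto simp: space_m ivm_closed)
 fix x y :: "site form" assume x: "x \<in> space m"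
 show "distr m m (mulm x) = m"
  using haar x unfolding haar_probability_def space_m mulm_def[abs_def] by blast
 assume y: "y \<in> space m"
 show "mulm x y = mulm y x" by (simp add: mulm_def mult.commute)
 have "mulm x y \<in> H_diamond D" using x y by (simp add: space_m mulm_closed)
 then obtain a where a: "a \<in> H_diamond D" "\<And>e. e \<in> D ==> a e * a e = x e * y e"
  using H_diamond_torus_root[of "mulm x y" N] by (auto simp: mulm_def)
 define b where "b = mulm x (ivm a)"
 have b: "b \<in> H_diamond D" using x a by (simp add: b_def space_m mulm_closed ivm_closed)
 have 1: "a e * b e = x e" and 2: "a e * cnj (b e) = y e" if e: "e \<in> D" for e
 proof -
  have n: "norm (a e) = 1" "norm (x e) = 1" using H_diamondD(2)[OF a(1) e] H_diamondD(2)[of x D e] x e by (simp_all add: space_m)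
  have be: "b e = x e * cnj (a e)" using e by (simp add: b_def mulm_def ivm_def)
  have "a e * b e = (a e * cnj (a e)) * x e" unfolding be by (simp add: mult_ac)
  then show "a e * b e = x e" by (simp add: unit_mult_cnj n)
  have "a e * cnj (b e) = (a e * a e) * cnj (x e)" unfolding be by (simp add: mult_ac)
  also have "... = (x e * cnj (x e)) * y e" unfolding a(2)[OF e] by (simp add: mult_ac)
  finally show "a e * cnj (b e) = y e" by (simp add: unit_mult_cnj n)
 qed
 show "\<exists>a\<in>space m. \<exists>b\<in>space m. \<forall>u\<in>space m. \<forall>v\<in>space m.
   mulm x (mulm u v) = mulm (mulm a u) (mulm b v) \<and>
   mulm y (mulm u (ivm v)) = mulm (mulm a u) (ivm (mulm b v))"
 proof (rule bexI[of _ a], rule bexI[of _ b], intro ballI conjI)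
  fix u v
  show "mulm x (mulm u v) = mulm (mulm a u) (mulm b v)"
  proof (rule ext)
   fix e show "mulm x (mulm u v) e = mulm (mulm a u) (mulm b v) e"
    using 1[of e, symmetric] by (cases "e \<in> D") (simp_all add: mulm_def)
  qed
  show "mulm y (mulm u (ivm v)) = mulm (mulm a u) (ivm (mulm b v))"
  proof (rule ext)
   fix e show "mulm y (mulm u (ivm v)) e = mulm (mulm a u) (ivm (mulm b v)) e"
    using 2[of e, symmetric] by (cases "e \<in> D") (simp_all add: mulm_def ivm_def)
  qed
 qed (use a b in \<open>auto simp: space_m\<close>)
qed

lemma coordinate_character: "e \<in> D ==> G.character (%J. J e)"
 unfolding G.character_def
proof (intro conjI ballI)
 assume e: "e \<in> D"
 show "(%J. J e) \<in> borel_measurable m" by (rule coordinate_measurable[OF e])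
 show "norm (J e) = 1" if "J \<in> space m" for J using H_diamondD(2)[OF _ e] that by (simp add: space_m)
qed (simp_all add: mulm_def ivm_def)

text \<open>Pinning makes the gradient trivial away from the square, so that it extends by 1 across
  the seam of the torus. These exact forms connect the torus group with spin fields.\<close>

definition gradient :: "nat => site spin => site form" where
 "gradient R th = (\<lambda>e\<in>D. if e \<in> Z2_edges then bond (pin (square R) th) (face_bond e) else 1)"

lemma gradient_closed:
 assumes R: "2 * R + 8 <= 2 ^ N" and th: "\<And>x. norm (th x) = 1"
 shows "gradient R th \<in> H_diamond D"
proof (rule H_diamondI)
 have p: "norm (pin (square R) th x) = 1" for x by (simp add: pin_def th)
 show "gradient R th \<in> extensional D" by (simp add: gradient_def)
 show "norm (gradient R th e) = 1" if "e \<in> D" for e using that by (simp add: gradient_def bond_def norm_mult p)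
 show "gradient R th (y, x) = cnj (gradient R th (x, y))" if "(x, y) \<in> D" for x y
  using that torus_edges_sym[OF that] Z2_edges_sym[of x y] Z2_edges_sym[of y x]
  by (auto simp: gradient_def face_bond_swap[of y x] bond_swap)
 fix x
 show "(\<Prod>y | (y, x) \<in> D. gradient R th (y, x)) = 1"
 proof (cases "2 * rad x + 4 <= 2 ^ N")
  case True
  have "(\<Prod>y | (y, x) \<in> D. gradient R th (y, x)) = (\<Prod>y | (y, x) \<in> Z2_edges. bond (pin (square R) th) (face_bond (y, x)))"
   using torus_edges_deep[OF True] by (intro prod.cong) (auto simp: gradient_def)
  then show ?thesis using d_star_bond[of "pin (square R) th" x] p by simp
 next
  case False
  have "gradient R th (y, x) = 1" if "(y, x) \<in> D" for y
  proof (cases "(y, x) \<in> Z2_edges")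
   case True
   \<comment> \<open>At such a vertex 2^N < 2 rad x + 4, while 2 R + 8 <= 2^N; all faces around it
     are then outside the square, where the pinned field is constant.\<close>
   have far: "rad x \<ge> R + 3" using False R by linarith
   have "rad (fst (face_bond (y, x))) > R" "rad (snd (face_bond (y, x))) > R"
    using far True by (auto elim!: Z2_edges_cases simp: face_bond_simps rad_def)
   then have "fst (face_bond (y, x)) \<notin> square R" "snd (face_bond (y, x)) \<notin> square R" by (auto simp: square_def)
   then show ?thesis using that True by (simp add: gradient_def bond_def pin_def)
  qed (use that in \<open>simp add: gradient_def\<close>)
  then show ?thesis by (simp add: prod.neutral)
 qed
qed

lemma gradient_in_space:
 "2 * R + 8 <= 2 ^ N ==> th \<in> space spin_space ==> gradient R th \<in> space m"
 unfolding space_m space_spin_space by (rule gradient_closed) blast+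

definition inner :: "nat => (site \<times> site) set" where
 "inner R = {e\<in>Z2_edges. fst (face_bond e) \<in> square R \<and> snd (face_bond e) \<in> square R}"

lemma inner_subset: "2 * R + 8 <= 2 ^ N ==> inner R \<subseteq> D"
proof
 fix e assume R: "2 * R + 8 <= 2 ^ N" and e: "e \<in> inner R"
 then have "fst e \<in> square (Suc R)"
  by (auto simp: inner_def elim!: Z2_edges_cases simp: face_bond_simps mem_square)
 then show "e \<in> D"
  using Z2_edges_square_torus[of "Suc R" N "fst e" "snd e"] R e by (auto simp: inner_def)
qed

text \<open>A flow may wind around the torus and then has no global potential. Inside a square it
  has one, as \<open>discrete_poincare\<close> looks at the divergence only on column segments that
  stay in the square.\<close>

lemma closed_gradient:
 assumes R: "2 * R + 8 <= 2 ^ N" and J: "J \<in> H_diamond D"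
 shows "\<exists>et\<in>space spin_space. \<forall>e\<in>inner R. J e = bond et (face_bond e)"
proof -
 define J' where "J' e = (if e \<in> D then J e else 1)" for e
 note H = H_diamondD[OF J]
 have unit: "norm (J' e) = 1" for e by (simp add: J'_def H)
 have anti: "J' (y, x) = cnj (J' (x, y))" for x y
  using H(3)[of x y] torus_edges_sym[of x y N] torus_edges_sym[of y x N] by (auto simp: J'_def)
 have cl: "(\<Prod>y | (y, x) \<in> Z2_edges. J' (y, x)) = 1" if "rad x <= R" for x
 proof -
  have d: "2 * rad x + 4 <= 2 ^ N" using R that by linarith
  have "(\<Prod>y | (y, x) \<in> Z2_edges. J' (y, x)) = (\<Prod>y | (y, x) \<in> D. J (y, x))"
   using torus_edges_deep[OF d] by (intro prod.cong) (auto simp: J'_def)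
  then show ?thesis by (simp add: H(4))
 qed
 show ?thesis
 proof (rule discrete_poincare[of J'])
  fix et :: "site spin"
  assume n: "\<And>x. norm (et x) = 1" and E: "\<And>a b. J' ((a, b), (a + 1, b)) = et (a, b - 1) * cnj (et (a, b))"
   and col: "\<And>a b. (\<And>c. min b 0 <= c ==> c <= max b 0 ==> (\<Prod>y | (y, (a, c)) \<in> Z2_edges. J' (y, (a, c))) = 1) ==>
   J' ((a, b), (a, b + 1)) = et (a, b) * cnj (et (a - 1, b))"
  have "J' e = bond et (face_bond e)" if e: "e \<in> inner R" for e
  proof (rule bond_face_bond_eqI[where E="inner R"])
   fix a b assume ab: "((a, b), (a, b + 1)) \<in> inner R \<or> ((a, b + 1), (a, b)) \<in> inner R"
   then have "(a, b) \<in> square R" by (auto simp: inner_def face_bond_simps)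
   then have "rad (a, c) <= R" if "min b 0 <= c" "c <= max b 0" for c
   proof -
    have "\<bar>c\<bar> <= \<bar>b\<bar>" using that by (auto simp: min_def max_def split: if_splits)
    then have "(a, c) \<in> square R" using \<open>(a, b) \<in> square R\<close> by (auto simp: mem_square)
    then show ?thesis by (simp add: square_def)
   qed
   then show "J' ((a, b), (a, b + 1)) = et (a, b) * cnj (et (a - 1, b))" using col cl by blast
  next
   show "J' ((a, b), (a + 1, b)) = et (a, b - 1) * cnj (et (a, b))" for a b by (rule E)
   show "J' (y, x) = cnj (J' (x, y))" for x y by (rule anti)
   show "e \<in> inner R" "e \<in> Z2_edges" using e by (simp_all add: inner_def)
  qed
  moreover have "J' e = J e" if "e \<in> inner R" for e using that inner_subset[OF R] by (auto simp: J'_def)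
  moreover have "et \<in> space spin_space" using n by (simp add: space_spin_space)
  ultimately show ?thesis by auto
 qed (rule unit, rule anti)
qed

lemma gradient_measurable:
 assumes R: "2 * R + 8 <= 2 ^ N" shows "gradient R \<in> measurable spin_space m"
proof (rule measurable_into)
 fix e assume e: "e \<in> D"
 have "(%th. bond (pin (square R) th) (face_bond e)) \<in> borel_measurable spin_space"
  using pinned_bond_character[of "square R" "face_bond e"] by (simp add: spin.character_def)
 then show "(%th. gradient R th e) \<in> borel_measurable spin_space"
  using e by (simp add: gradient_def)
qed (use gradient_in_space[OF R] in \<open>simp add: space_m\<close>)

text \<open>Each gradient is an element of the group, so multiplying by it preserves the Haar
  measure; this is averaged over a uniform spin field and the order of integration is
  exchanged.\<close>

lemma average_gradient:
 assumes R: "2 * R + 8 <= 2 ^ N" and \<Phi>: "bdd_meas m \<Phi>"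
 shows "(\<integral>J. \<Phi> J \<partial>m) = (\<integral>J. (\<integral>th. \<Phi> (mulm (gradient R th) J) \<partial>spin_space) \<partial>m)" (is ?thesis_a)
  "bdd_meas (spin_space \<Otimes>\<^sub>M m) (%z. \<Phi> (mulm (gradient R (fst z)) (snd z)))"
proof -
 interpret S: pair_prob_space "spin_space :: site spin measure" m ..
 have mm: "(%z. mulm (gradient R (fst z)) (snd z)) \<in> measurable (spin_space \<Otimes>\<^sub>M m) m"
  using measurable_compose[OF _ G.mul_measurable, of "%z. (gradient R (fst z), snd z)" "spin_space \<Otimes>\<^sub>M m"]
   gradient_measurable[OF R] by simp
 show b: "bdd_meas (spin_space \<Otimes>\<^sub>M m) (%z. \<Phi> (mulm (gradient R (fst z)) (snd z)))"
  by (rule bdd_meas_compose[OF \<Phi> mm])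
 have "(\<integral>J. \<Phi> (mulm (gradient R th) J) \<partial>m) = (\<integral>J. \<Phi> J \<partial>m)" if "th \<in> space spin_space" for th
  using that by (intro G.integral_mul bdd_meas_measurable[OF \<Phi>] gradient_in_space[OF R])
 then have "(\<integral>J. \<Phi> J \<partial>m) = (\<integral>th. (\<integral>J. \<Phi> (mulm (gradient R th) J) \<partial>m) \<partial>spin_space)"
  by (simp add: spin.prob_space cong: Bochner_Integration.integral_cong)
 also have "... = (\<integral>J. (\<integral>th. \<Phi> (mulm (gradient R th) J) \<partial>spin_space) \<partial>m)"
  using S.Fubini_integral[of "%th J. \<Phi> (mulm (gradient R th) J)"] S.P.bdd_meas_integrable[OF b]
  by (simp add: case_prod_unfold)
 finally show ?thesis_a .
qed

text \<open>Once the flow is multiplied by a random gradient, its local potential \<open>et\<close>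
  is absorbed by the invariance of the spin measure. Locally, the Haar measure of the torus
  therefore looks like the gradient of independent uniform spins, whatever the flow does
  elsewhere.\<close>

lemma local_integral:
 assumes R: "2 * R + 8 <= 2 ^ N" and \<Phi>: "bdd_meas m \<Phi>"
  and loc: "\<And>J J'. (\<And>e. e \<in> inner R ==> J e = J' e) ==> \<Phi> J = \<Phi> J'"
  and \<Psi>: "bdd_meas spin_space \<Psi>" and eq: "\<And>th. th \<in> space spin_space ==> \<Phi> (%e. bond th (face_bond e)) = \<Psi> th"
 shows "(\<integral>J. \<Phi> J \<partial>m) = (\<integral>th. \<Psi> th \<partial>spin_space)"
proof -
 have "(\<integral>th. \<Phi> (mulm (gradient R th) J) \<partial>spin_space) = (\<integral>th. \<Psi> th \<partial>spin_space)" if J: "J \<in> space m" for J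
 proof -
  have "\<exists>et\<in>space spin_space. \<forall>e\<in>inner R. J e = bond et (face_bond e)"
   using closed_gradient[OF R] J by (simp add: space_m)
  then obtain et where et: "et \<in> space spin_space" "\<And>e. e \<in> inner R ==> J e = bond et (face_bond e)"
   by blast
  have "(\<integral>th. \<Phi> (mulm (gradient R th) J) \<partial>spin_space) = (\<integral>th. \<Psi> (%i. et i * th i) \<partial>spin_space)"
  proof (intro Bochner_Integration.integral_cong refl)
   fix th :: "site spin" assume th: "th \<in> space spin_space"
   have "\<Phi> (mulm (gradient R th) J) = \<Phi> (%e. bond (%i. et i * th i) (face_bond e))"
   proof (rule loc)
    fix e assume e: "e \<in> inner R"
    then have "e \<in> D" "e \<in> Z2_edges" "fst (face_bond e) \<in> square R" "snd (face_bond e) \<in> square R"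
     using inner_subset[OF R] by (auto simp: inner_def)
    then show "mulm (gradient R th) J e = bond (%i. et i * th i) (face_bond e)"
     by (simp add: mulm_def gradient_def et(2)[OF e] bond_def pin_def mult_ac)
   qed
   also have "... = \<Psi> (%i. et i * th i)" by (rule eq) (use spin.mul_closed[OF et(1) th] in simp)
   finally show "\<Phi> (mulm (gradient R th) J) = \<Psi> (%i. et i * th i)" .
  qed
  also have "... = (\<integral>th. \<Psi> th \<partial>spin_space)"
   by (rule spin.integral_mul[OF et(1) bdd_meas_measurable[OF \<Psi>]])
  finally show ?thesis .
 qed
 then show ?thesis
  unfolding average_gradient(1)[OF R \<Phi>] by (simp add: prob_space cong: Bochner_Integration.integral_cong)
qed

definition torus_energy :: "real => (site \<times> site) set => site form => real" where
 "torus_energy c E J = (\<Sum>e\<in>E. c * Re (J e))"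

lemma bdd_meas_torus_energy: "E \<subseteq> D ==> bdd_meas m (torus_energy c E)"
 unfolding torus_energy_def[abs_def]
proof (rule bdd_meas_sum, rule bdd_meas_cmult)
 fix e assume "E \<subseteq> D" "e \<in> E"
 then show "bdd_meas m (%J. Re (J e))"
  by (intro G.bdd_meas_character(1) coordinate_character) blast
qed

definition torus_mean :: "real => (site form => real) => real" where
 "torus_mean c \<Phi> = (\<integral>J. \<Phi> J * exp (torus_energy c D J) \<partial>m) / (\<integral>J. exp (torus_energy c D J) \<partial>m)"

lemma torus_partition_pos: "E \<subseteq> D ==> (\<integral>J. exp (torus_energy c E J) \<partial>m) > 0"
 by (rule bdd_meas_exp_pos[OF bdd_meas_torus_energy])

text \<open>Switching off all couplings on the torus except those dual to \<open>F\<close> lowers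
  the mean of a character; the remaining integrals are local and hence those of the free spin
  field.\<close>

lemma free_le_torus:
 assumes c: "c \<ge> 0" and R: "2 * R + 8 <= 2 ^ N" and F: "F \<subseteq> {b\<in>Z2_edges. fst b \<in> square R \<and> snd b \<in> square R}"
  and X: "G.character X" and loc: "\<And>J J'. (\<And>e. e \<in> inner R ==> J e = J' e) ==> X J = X J'"
  and \<psi>: "spin.character \<psi>" and X\<psi>: "\<And>th. th \<in> space spin_space ==> X (%e. bond th (face_bond e)) = \<psi> th"
 shows "xy_mean c F (%th. Re (\<psi> th)) <= torus_mean c (%J. Re (X J))"
proof -
 define E where "E = {e\<in>Z2_edges. face_bond e \<in> F}"
 have EF: "face_bond ` E = F"
 proof
  show "F \<subseteq> face_bond ` E"
  proof
   fix b assume b: "b \<in> F"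
   then have "b \<in> Z2_edges" using subsetD[OF F] by blast
   then obtain e where "e \<in> Z2_edges" "face_bond e = b" using face_bond_surj by blast
   then show "b \<in> face_bond ` E" using b by (intro image_eqI[of _ _ e]) (simp_all add: E_def)
  qed
 qed (auto simp: E_def)
 have Ei: "E \<subseteq> inner R"
 proof
  fix e assume "e \<in> E"
  then have "e \<in> Z2_edges" "face_bond e \<in> F" by (simp_all add: E_def)
  then show "e \<in> inner R" using subsetD[OF F, of "face_bond e"] by (simp add: inner_def)
 qed
 have ED: "E \<subseteq> D" using Ei inner_subset[OF R] by blast
 have en: "torus_energy c E (%e. bond th (face_bond e)) = xy_energy c F th" for th
 proof -
  have "inj_on face_bond E" by (rule inj_on_subset[OF inj_on_face_bond]) (simp add: E_def)
  then show ?thesis unfolding torus_energy_def xy_energy_def EF[symmetric] by (simp add: sum.reindex)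
 qed
 have eloc: "torus_energy c E J = torus_energy c E J'" if "\<And>e. e \<in> inner R ==> J e = J' e" for J J'
  unfolding torus_energy_def using that Ei by (intro sum.cong refl) auto
 have I1: "(\<integral>J. exp (torus_energy c E J) \<partial>m) = (\<integral>th. exp (xy_energy c F th) \<partial>spin_space)"
 proof (rule local_integral[OF R])
  show "exp (torus_energy c E J) = exp (torus_energy c E J')" if "\<And>e. e \<in> inner R ==> J e = J' e" for J J'
   using eloc[OF that] by simp
 qed (simp_all add: bdd_meas_exp bdd_meas_torus_energy[OF ED] bdd_meas_xy_energy en)
 have I2: "(\<integral>J. Re (X J) * exp (torus_energy c E J) \<partial>m) = (\<integral>th. Re (\<psi> th) * exp (xy_energy c F th) \<partial>spin_space)"
 proof (rule local_integral[OF R])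
  show "Re (X J) * exp (torus_energy c E J) = Re (X J') * exp (torus_energy c E J')" if "\<And>e. e \<in> inner R ==> J e = J' e" for J J'
   using eloc[OF that] loc[OF that] by simp
 qed (simp_all add: bdd_meas_mult bdd_meas_exp bdd_meas_torus_energy[OF ED] bdd_meas_xy_energy en G.bdd_meas_character[OF X]
   spin.bdd_meas_character[OF \<psi>] X\<psi>)
 let ?a = "%e. if e \<in> E then c else 0"
 have e: "torus_energy c E J = (\<Sum>e\<in>D. ?a e * Re (J e))" for J
  unfolding torus_energy_def using ED finite_torus_edges by (intro sum.mono_neutral_cong_left) auto
 have "(\<integral>J. Re (X J) * exp (\<Sum>e\<in>D. ?a e * Re (J e)) \<partial>m) * (\<integral>J. exp (\<Sum>e\<in>D. c * Re (J e)) \<partial>m)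
  <= (\<integral>J. Re (X J) * exp (\<Sum>e\<in>D. c * Re (J e)) \<partial>m) * (\<integral>J. exp (\<Sum>e\<in>D. ?a e * Re (J e)) \<partial>m)"
  by (rule G.ginibre_mono) (use c X in \<open>auto intro: coordinate_character finite_torus_edges\<close>)
 then show ?thesis
  using torus_partition_pos[of D c] torus_partition_pos[OF ED, of c]
  unfolding xy_mean_def torus_mean_def e[symmetric] torus_energy_def[symmetric] I1[symmetric] I2[symmetric]
  by (simp add: field_simps)
qed

text \<open>After averaging over gradients, a fixed flow \<open>J\<close> acts on the spin field
  only through phases in the couplings and in the observable. By \<open>ginibre_phase\<close> the
  phase-free flow 1 maximises the ratio, and for it the energy is that of the pinned field up to a
  constant.\<close>

lemma torus_le_pinned:
 assumes c: "c \<ge> 0" and R: "2 * R + 8 <= 2 ^ N"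
  and X: "G.character X" and loc: "\<And>J J'. (\<And>e. e \<in> inner R ==> J e = J' e) ==> X J = X J'"
  and \<psi>: "spin.character \<psi>" and X\<psi>: "\<And>th. th \<in> space spin_space ==> X (%e. bond th (face_bond e)) = \<psi> th"
  and pin: "\<And>th. \<psi> (pin (square R) th) = \<psi> th"
 shows "torus_mean c (%J. Re (X J)) <= pinned_mean c (square R) (face_bond ` (D \<inter> Z2_edges)) (%th. Re (\<psi> th))"
proof -
 interpret S: pair_prob_space "spin_space :: site spin measure" m ..
 \<comment> \<open>Edges across the seam carry gradient 1 and add a constant to the energy.\<close>
 define k where "k = (\<Sum>e\<in>D - Z2_edges. c)"
 define W where "W th = exp (torus_energy c D (gradient R th))" for th
 have en: "torus_energy c D (gradient R th) = pinned_energy c (square R) (face_bond ` (D \<inter> Z2_edges)) th + k" for th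
 proof -
  have "torus_energy c D (gradient R th) = (\<Sum>e\<in>D \<inter> Z2_edges. c * Re (gradient R th e)) + (\<Sum>e\<in>D - Z2_edges. c * Re (gradient R th e))"
   unfolding torus_energy_def by (rule sum.Int_Diff[OF finite_torus_edges])
  also have "(\<Sum>e\<in>D - Z2_edges. c * Re (gradient R th e)) = k"
   unfolding k_def by (intro sum.cong refl) (auto simp: gradient_def)
  also have "(\<Sum>e\<in>D \<inter> Z2_edges. c * Re (gradient R th e)) = pinned_energy c (square R) (face_bond ` (D \<inter> Z2_edges)) th"
  proof -
   have "inj_on face_bond (D \<inter> Z2_edges)" by (rule inj_on_subset[OF inj_on_face_bond]) simp
   then have "(\<Sum>b\<in>face_bond ` (D \<inter> Z2_edges). c * Re (bond (pin (square R) th) b)) =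
    (\<Sum>e\<in>D \<inter> Z2_edges. c * Re (bond (pin (square R) th) (face_bond e)))" by (simp add: sum.reindex)
   also have "... = (\<Sum>e\<in>D \<inter> Z2_edges. c * Re (gradient R th e))"
    by (rule sum.cong[OF refl]) (simp add: gradient_def)
   finally show ?thesis by (simp add: pinned_energy_def xy_energy_def)
  qed
  finally show ?thesis .
 qed
 have XK: "X (gradient R th) = \<psi> th" if th: "th \<in> space spin_space" for th
 proof -
  have "X (gradient R th) = X (%e. bond (pin (square R) th) (face_bond e))"
   by (rule loc) (use inner_subset[OF R] in \<open>auto simp: gradient_def inner_def\<close>)
  also have "... = \<psi> (pin (square R) th)"
   using th by (intro X\<psi>) (auto simp: space_spin_space pin_def)
  finally show ?thesis by (simp add: pin)
 qed
 have kc: "spin.character (%th. gradient R th e)" if "e \<in> D" for e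
  using that by (cases "e \<in> Z2_edges") (simp_all add: gradient_def pinned_bond_character spin.character_one)
 let ?P = "\<integral>th. W th \<partial>spin_space" and ?Q = "\<integral>th. Re (\<psi> th) * W th \<partial>spin_space"
 have bA: "bdd_meas m (%J. exp (torus_energy c D J))" "bdd_meas m (%J. Re (X J) * exp (torus_energy c D J))"
  by (intro bdd_meas_mult bdd_meas_exp bdd_meas_torus_energy G.bdd_meas_character X order.refl)+
 note av = average_gradient[OF R bA(1)] and av' = average_gradient[OF R bA(2)]
 \<comment> \<open>The flow is frozen: \<open>J e\<close> is the phase of the coupling at e and
   \<open>X J\<close> the phase of the observable. The cross-multiplied form can be integrated over
   \<open>J\<close>.\<close>
 have key: "(\<integral>th. Re (X (mulm (gradient R th) J)) * exp (torus_energy c D (mulm (gradient R th) J)) \<partial>spin_space) * ?P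
  <= ?Q * (\<integral>th. exp (torus_energy c D (mulm (gradient R th) J)) \<partial>spin_space)" if J: "J \<in> space m" for J
 proof -
  have JH: "J \<in> H_diamond D" using J by (simp add: space_m)
  have "(\<integral>th. Re (X J * \<psi> th) * exp (\<Sum>e\<in>D. c * Re (J e * gradient R th e)) \<partial>spin_space) *
   (\<integral>th. exp (\<Sum>e\<in>D. c * Re (gradient R th e)) \<partial>spin_space) <=
   (\<integral>th. Re (\<psi> th) * exp (\<Sum>e\<in>D. c * Re (gradient R th e)) \<partial>spin_space) *
   (\<integral>th. exp (\<Sum>e\<in>D. c * Re (J e * gradient R th e)) \<partial>spin_space)"
   by (rule spin.ginibre_phase) (use c \<psi> kc H_diamondD(2)[OF JH] X J in \<open>auto simp: G.character_def\<close>)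
  moreover have "(\<Sum>e\<in>D. c * Re (J e * gradient R th e)) = torus_energy c D (mulm (gradient R th) J)" for th
   unfolding torus_energy_def by (intro sum.cong refl) (simp add: mulm_def mult.commute)
  moreover have "(\<integral>th. Re (X J * \<psi> th) * exp (torus_energy c D (mulm (gradient R th) J)) \<partial>spin_space) =
   (\<integral>th. Re (X (mulm (gradient R th) J)) * exp (torus_energy c D (mulm (gradient R th) J)) \<partial>spin_space)"
  proof (intro Bochner_Integration.integral_cong refl)
   fix th :: "site spin" assume th: "th \<in> space spin_space"
   then have "gradient R th \<in> space m" by (rule gradient_in_space[OF R])
   then have "X (mulm (gradient R th) J) = \<psi> th * X J" using X J XK[OF th] by (simp add: G.character_def)
   then show "Re (X J * \<psi> th) * exp (torus_energy c D (mulm (gradient R th) J)) =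
    Re (X (mulm (gradient R th) J)) * exp (torus_energy c D (mulm (gradient R th) J))" by (simp add: mult.commute)
  qed
  ultimately show ?thesis by (simp add: W_def torus_energy_def)
 qed
 have i1: "integrable m (%J. \<integral>th. exp (torus_energy c D (mulm (gradient R th) J)) \<partial>spin_space)"
  and i2: "integrable m (%J. \<integral>th. Re (X (mulm (gradient R th) J)) * exp (torus_energy c D (mulm (gradient R th) J)) \<partial>spin_space)"
  using S.integrable_snd[of "%th J. exp (torus_energy c D (mulm (gradient R th) J))"] S.P.bdd_meas_integrable[OF av(2)]
   S.integrable_snd[of "%th J. Re (X (mulm (gradient R th) J)) * exp (torus_energy c D (mulm (gradient R th) J))"] S.P.bdd_meas_integrable[OF av'(2)]
  by (simp_all add: case_prod_unfold)
 have "(\<integral>J. Re (X J) * exp (torus_energy c D J) \<partial>m) * ?P <= ?Q * (\<integral>J. exp (torus_energy c D J) \<partial>m)"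
 proof -
  let ?f = "%J. \<integral>th. Re (X (mulm (gradient R th) J)) * exp (torus_energy c D (mulm (gradient R th) J)) \<partial>spin_space"
  let ?g = "%J. \<integral>th. exp (torus_energy c D (mulm (gradient R th) J)) \<partial>spin_space"
  have "(\<integral>J. ?f J * ?P \<partial>m) <= (\<integral>J. ?Q * ?g J \<partial>m)"
  proof (rule integral_mono)
   show "integrable m (%J. ?f J * ?P)" using i2 by (rule integrable_mult_left)
   show "integrable m (%J. ?Q * ?g J)" using i1 by (rule integrable_mult_right)
  qed (rule key)
  then show ?thesis unfolding av(1) av'(1) integral_mult_left_zero integral_mult_right_zero .
 qed
 moreover have P: "?P > 0"
  unfolding W_def en exp_add using pinned_partition_pos[of c "square R" "face_bond ` (D \<inter> Z2_edges)"] by simp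
 ultimately have "torus_mean c (%J. Re (X J)) <= ?Q / ?P"
  unfolding torus_mean_def using torus_partition_pos[of D c] by (simp add: field_simps)
 also have "?Q / ?P = pinned_mean c (square R) (face_bond ` (D \<inter> Z2_edges)) (%th. Re (\<psi> th))"
  unfolding W_def en exp_add pinned_mean_def mult.assoc[symmetric] by simp
 finally show ?thesis .
qed

end

section \<open>Bounds for the torus limits\<close>

lemma normalised_density_integral:
 assumes "prob_space m" and S: "bdd_meas m S" and G: "G \<in> borel_measurable m"
 shows "(\<integral>x. G x \<partial>normalised_density m (%x. exp (S x))) = (\<integral>x. G x * exp (S x) \<partial>m) / (\<integral>x. exp (S x) \<partial>m)"
proof -
 interpret prob_space m by fact
 define Z where "Z = (\<integral>x. exp (S x) \<partial>m)"
 have Z: "Z > 0" unfolding Z_def by (rule bdd_meas_exp_pos[OF S])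
 have n: "(\<integral>\<^sup>+x. ennreal (exp (S x)) \<partial>m) = ennreal Z"
  unfolding Z_def by (rule nn_integral_eq_integral[OF bdd_meas_integrable[OF bdd_meas_exp[OF S]]]) simp
 have d: "ennreal (exp (S x)) / ennreal Z = ennreal (exp (S x) / Z)" for x
  using Z by (simp add: divide_ennreal)
 have "(\<integral>x. G x \<partial>normalised_density m (%x. exp (S x))) = (\<integral>x. (exp (S x) / Z) *\<^sub>R G x \<partial>m)"
  unfolding normalised_density_def n d
  by (rule integral_density[OF G]) (use Z bdd_meas_measurable[OF S] in auto)
 also have "... = (\<integral>x. G x * exp (S x) / Z \<partial>m)"
  by (intro Bochner_Integration.integral_cong refl) simp
 finally show ?thesis unfolding Z_def[symmetric] by simp
qed

text \<open>\<open>edge_sum\<close> halves the sum over directed edges, which produces the coupling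
  \<open>be / 2\<close>.\<close>

lemma (in torus_haar) spin_measure_integral:
 assumes M: "M = normalised_density m (%J. exp (- edge_sum D (%e. xy_potential be (J e))))"
  and G: "G \<in> borel_measurable m"
 shows "(\<integral>J. G J \<partial>M) = torus_mean (be / 2) G"
proof -
 have e: "- edge_sum D (%e. xy_potential be (J e)) = torus_energy (be / 2) D J" for J
  by (simp add: edge_sum_def xy_potential_def torus_energy_def sum_distrib_left sum_divide_distrib sum_negf)
 show ?thesis
  unfolding M e torus_mean_def
  by (rule normalised_density_integral[OF prob_space_axioms bdd_meas_torus_energy[OF order.refl] G])
qed

definition row_edges :: "nat => (site \<times> site) set" where
 "row_edges i = (%(b, j). ((int j + 1, b), (int j + 1, b + 1))) ` ({0, -1} \<times> {..<i})"

lemma row_edges: "finite (row_edges i)" "row_edges i \<subseteq> Z2_edges"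
 "j < i ==> b \<in> {0, -1} ==> ((int j + 1, b), (int j + 1, b + 1)) \<in> row_edges i"
 by (auto simp: row_edges_def Z2_edges_def image_iff)

text \<open>The flag selects the two-point or the four-point observable, so that one argument serves
  both.\<close>

definition row_obs :: "bool => nat => site form => complex" where
 "row_obs s i J = (if s then row_ratio 0 i J else row_ratio 0 i J * row_ratio (-1) i J)"

definition row_chi :: "bool => nat => site spin => complex" where
 "row_chi s i = (if s then chi2 (0, 0) (int i, 0) else chi4 (0, 0) (0, -1) (int i, 0) (int i, -1))"

lemma row_chi_character: "spin.character (row_chi s i)"
 by (simp add: row_chi_def chi_character)

lemma row_obs_cong: "(\<And>e. e \<in> row_edges i ==> J e = J' e) ==> row_obs s i J = row_obs s i J'"
proof -
 assume *: "\<And>e. e \<in> row_edges i ==> J e = J' e"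
 have "row_ratio b i J = row_ratio b i J'" if "b \<in> {0, -1}" for b
  unfolding row_ratio_def using that by (intro prod.cong refl arg_cong[where f=cnj] * row_edges(3)) auto
 then show ?thesis by (simp add: row_obs_def)
qed

lemma row_obs_spin:
 assumes "th \<in> space spin_space" shows "row_obs s i (%e. bond th (face_bond e)) = row_chi s i th"
proof -
 have n: "norm (th u) = 1" for u using assms unfolding space_spin_space by blast
 have "row_ratio b i (%e. bond th (face_bond e)) = chi2 (0, b) (int i, b) th" for b
  by (rule row_ratio_bond[OF n refl])
 then show ?thesis by (simp add: row_obs_def row_chi_def chi2_def chi4_def mult_ac)
qed

lemma row_edges_square: "e \<in> row_edges i ==> fst (face_bond e) \<in> square (max 1 i) \<and> snd (face_bond e) \<in> square (max 1 i)"
proof -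
 assume "e \<in> row_edges i"
 then obtain b j where "b \<in> {0, -1}" "j < i" and e: "e = ((int j + 1, b), (int j + 1, b + 1))"
  by (auto simp: row_edges_def)
 then show ?thesis
  unfolding e face_bond_simps(2)[of "int j + 1" b] by (auto simp: mem_square)
qed

lemma (in torus_haar) row_obs_character: "row_edges i \<subseteq> D ==> G.character (row_obs s i)"
proof -
 assume R: "row_edges i \<subseteq> D"
 have "G.character (row_ratio b i)" if "b \<in> {0, -1}" for b
  unfolding row_ratio_def[abs_def]
  using R that row_edges(3) by (intro G.character_prod G.character_cnj coordinate_character) auto
 then show ?thesis unfolding row_obs_def[abs_def] by (cases s) (auto intro: G.character_mult)
qed

lemma (in torus_haar) row_inner: "max 1 i <= R ==> row_edges i \<subseteq> inner R"
 unfolding inner_def using row_edges(2) row_edges_square square_mono[of "max 1 i" R] by blast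

lemma torus_limit_expectation:
 assumes \<mu>: "prob_space \<mu>" "sets \<mu> = sets (H_diamond_space Z2_edges)"
  and M: "\<And>N. spin_measure (xy_potential be) (torus_edges N) (M N)" and r: "strict_mono (r :: nat => nat)"
  and conv: "\<And>F. finite F ==> F \<subseteq> Z2_edges ==> weakly_converges (%n. edge_law F (M (r n))) (edge_law F \<mu>)"
 shows "(%n. \<integral>J. Re (row_obs s i J) \<partial>M (r n)) \<longlonglongrightarrow> (\<integral>J. Re (row_obs s i J) \<partial>\<mu>)"
proof -
 let ?F = "row_edges i"
 \<comment> \<open>The marginals live on all complex-valued functions, where the observable is
   unbounded. Clipping it gives a bounded continuous test function and changes nothing on unit
   forms.\<close>
 define g where "g J = max (-1) (min 1 (Re (row_obs s i J)))" for J
 have mrow: "(%J. Re (row_obs s i J)) \<in> borel_measurable (Pi\<^sub>M ?F (%_. borel))"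
 proof -
  have "row_ratio b i \<in> borel_measurable (Pi\<^sub>M ?F (%_. borel))" if "b \<in> {0, -1}" for b
   unfolding row_ratio_def[abs_def] using that
   by (intro borel_measurable_prod measurable_compose[OF _ borel_measurable_continuous_onI[of cnj]]
     measurable_component_singleton row_edges(3) continuous_intros) auto
  then show ?thesis unfolding row_obs_def by (cases s) auto
 qed
 then have mg: "g \<in> borel_measurable (Pi\<^sub>M ?F (%_. borel))" unfolding g_def by measurable
 have cg: "continuous_on A g" for A
 proof -
  have "continuous_on A (row_ratio b i)" for b
   unfolding row_ratio_def[abs_def]
   by (intro continuous_intros continuous_on_subset[OF continuous_on_product_coordinates]) auto
  then show ?thesis unfolding g_def row_obs_def by (cases s) (auto intro!: continuous_intros)
 qed
 have bg: "bounded (g ` A)" for A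
  by (rule boundedI[where B=1]) (auto simp: g_def)
 have lim: "(%n. integral\<^sup>L (edge_law ?F (M (r n))) g) \<longlonglongrightarrow> integral\<^sup>L (edge_law ?F \<mu>) g"
  using conv[OF row_edges(1,2)] cg bg unfolding weakly_converges_def by blast
 have law: "integral\<^sup>L (edge_law ?F \<nu>) g = (\<integral>J. Re (row_obs s i J) \<partial>\<nu>)"
  if mres: "(%J. restrict J ?F) \<in> measurable \<nu> (Pi\<^sub>M ?F (%_. borel))"
   and unit: "\<And>J e. J \<in> space \<nu> ==> e \<in> ?F ==> norm (J e) = 1" for \<nu>
 proof -
  have "integral\<^sup>L (edge_law ?F \<nu>) g = (\<integral>J. g (restrict J ?F) \<partial>\<nu>)"
   unfolding edge_law_def by (rule integral_distr[OF mres mg])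
  also have "... = (\<integral>J. Re (row_obs s i J) \<partial>\<nu>)"
  proof (intro Bochner_Integration.integral_cong refl)
   fix J assume J: "J \<in> space \<nu>"
   have c: "row_obs s i (restrict J ?F) = row_obs s i J" by (rule row_obs_cong) simp
   have n: "norm (row_ratio b i J) = 1" if "b \<in> {0, -1}" for b
    unfolding row_ratio_def prod_norm[symmetric] using that J unit row_edges(3)
    by (intro prod.neutral) auto
   have "norm (row_obs s i J) = 1" by (cases s) (simp_all add: row_obs_def norm_mult n)
   then have "\<bar>Re (row_obs s i J)\<bar> <= 1" using abs_Re_le_cmod[of "row_obs s i J"] by simp
   then show "g (restrict J ?F) = Re (row_obs s i J)" unfolding g_def c by linarith
  qed
  finally show ?thesis .
 qed
 have L\<mu>: "integral\<^sup>L (edge_law ?F \<mu>) g = (\<integral>J. Re (row_obs s i J) \<partial>\<mu>)"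
 proof (rule law)
  have "(%J. restrict J ?F) \<in> measurable (H_diamond_space Z2_edges) (Pi\<^sub>M ?F (%_. borel))"
   unfolding H_diamond_space_def
   by (intro measurable_restrict_space1 measurable_restrict_subset row_edges(2))
  then show "(%J. restrict J ?F) \<in> measurable \<mu> (Pi\<^sub>M ?F (%_. borel))"
   using measurable_cong_sets[OF \<mu>(2) refl] by blast
  have "space \<mu> = space (H_diamond_space Z2_edges)" using \<mu>(2) by (rule sets_eq_imp_space_eq)
  then have "space \<mu> \<subseteq> H_diamond Z2_edges" by (auto simp: H_diamond_space_def space_restrict_space)
  then show "norm (J e) = 1" if "J \<in> space \<mu>" "e \<in> ?F" for J e
   using that row_edges(2) H_diamondD(2) by blast
 qed
 have "eventually (%n. integral\<^sup>L (edge_law ?F (M (r n))) g = (\<integral>J. Re (row_obs s i J) \<partial>M (r n))) sequentially"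
  unfolding eventually_sequentially
 proof (intro exI allI impI)
  fix n assume n: "2 * max 1 i + 8 <= n"
  have "n <= r n" using r by (rule seq_suble)
  have "r n < 2 ^ r n" by (rule less_exp)
  then have big: "2 * max 1 i + 8 <= 2 ^ r n" using n \<open>n <= r n\<close> by linarith
  obtain m where haar: "haar_probability (torus_edges (r n)) m"
   and Mn: "M (r n) = normalised_density m (%J. exp (- edge_sum (torus_edges (r n)) (%e. xy_potential be (J e))))"
   using M unfolding spin_measure_def by blast
  interpret T: torus_haar "r n" m by (rule torus_haar.intro[OF haar])
  have FD: "?F \<subseteq> T.D" using T.row_inner[OF order.refl, of i] T.inner_subset[OF big] by blast
  have sM: "sets (M (r n)) = sets m" "space (M (r n)) = space m" unfolding Mn normalised_density_def by simp_all
  show "integral\<^sup>L (edge_law ?F (M (r n))) g = (\<integral>J. Re (row_obs s i J) \<partial>M (r n))"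
  proof (rule law)
   have "(%J. restrict J ?F) \<in> measurable m (Pi\<^sub>M ?F (%_. borel))"
    using FD by (intro measurable_restrict T.coordinate_measurable) auto
   then show "(%J. restrict J ?F) \<in> measurable (M (r n)) (Pi\<^sub>M ?F (%_. borel))"
    using measurable_cong_sets[OF sM(1) refl] by blast
   show "norm (J e) = 1" if "J \<in> space (M (r n))" "e \<in> ?F" for J e
    using that FD H_diamondD(2) unfolding sM(2) T.space_m by blast
  qed
 qed
 from Lim_transform_eventually[OF lim this] show ?thesis unfolding L\<mu> .
qed

text \<open>The lower bounds hold for every finite free volume and survive the limit and the
  supremum. For the upper bound the pinned square is fixed first; the torus then grows around it and
  the pinned mean is compared with the free one at a cost \<open>\<epsilon>\<close>. Nonnegativity
  of the four-point function is needed for the comparison of the two series.\<close>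

lemma torus_limit_bounds:
 assumes be: "be > 0" and lim: "subsequential_torus_limit (xy_potential be) \<mu>"
 shows "xy_lim (be / 2) (chi2 (0, 0) (int i, 0)) <= two_point \<mu> i" (is ?thesis_a)
  and "0 <= four_point \<mu> i"
  and "four_point \<mu> i <= xy_lim (be / 2) (chi4 (0, 0) (0, -1) (int i, 0) (int i, -1))" (is ?thesis_b)
proof -
 define c where "c = be / 2"
 have c: "c \<ge> 0" using be by (simp add: c_def)
 from lim[unfolded subsequential_torus_limit_def] obtain M r where \<mu>: "prob_space \<mu>" "sets \<mu> = sets (H_diamond_space Z2_edges)"
  and M': "\<forall>N. spin_measure (xy_potential be) (torus_edges N) (M N)" and r: "strict_mono (r :: nat => nat)"
  and conv': "\<forall>F. finite F \<and> F \<subseteq> Z2_edges --> weakly_converges (%n. edge_law F (M (r n))) (edge_law F \<mu>)"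
  by (elim conjE exE)
 have M: "spin_measure (xy_potential be) (torus_edges N) (M N)" for N using M' ..
 have conv: "weakly_converges (%n. edge_law F (M (r n))) (edge_law F \<mu>)" if "finite F" "F \<subseteq> Z2_edges" for F
  using conv' that by simp
 note te = torus_limit_expectation[OF \<mu> M r conv]
 have sp: "space \<mu> \<subseteq> H_diamond Z2_edges"
  using sets_eq_imp_space_eq[OF \<mu>(2)] by (auto simp: H_diamond_space_def space_restrict_space)
 have two: "two_point \<mu> i = (\<integral>J. Re (row_obs True i J) \<partial>\<mu>)"
  unfolding two_point_def row_obs_def
 proof (intro Bochner_Integration.integral_cong refl)
  fix J assume "J \<in> space \<mu>"
  with sp have "J \<in> H_diamond Z2_edges" by blast
  from spin_ratio(1)[OF this] show "Re (spin_upper J 0 / spin_upper J i) = Re (if True then row_ratio 0 i J else row_ratio 0 i J * row_ratio (- 1) i J)"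
   by simp
 qed
 have four: "four_point \<mu> i = (\<integral>J. Re (row_obs False i J) \<partial>\<mu>)"
  unfolding four_point_def row_obs_def
 proof (intro Bochner_Integration.integral_cong refl)
  fix J assume "J \<in> space \<mu>"
  with sp have "J \<in> H_diamond Z2_edges" by blast
  from spin_ratio(2)[OF this] show "Re ((spin_upper J 0 * spin_lower J 0) / (spin_upper J i * spin_lower J i)) = Re (if False then row_ratio 0 i J else row_ratio 0 i J * row_ratio (- 1) i J)"
   by simp
 qed
 have torus: "(\<forall>F\<subseteq>{b\<in>Z2_edges. fst b \<in> square R \<and> snd b \<in> square R}.
    xy_mean c F (%th. Re (row_chi s i th)) <= (\<integral>J. Re (row_obs s i J) \<partial>M (r n))) \<and>
   (\<integral>J. Re (row_obs s i J) \<partial>M (r n)) <= pinned_mean c (square R) (face_bond ` (torus_edges (r n) \<inter> Z2_edges)) (%th. Re (row_chi s i th))"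
  if n: "2 * R + 8 <= n" and R: "max 1 i <= R" for s R n
 proof -
  have "n <= r n" using r by (rule seq_suble)
  have "r n < 2 ^ r n" by (rule less_exp)
  then have big: "2 * R + 8 <= 2 ^ r n" using n \<open>n <= r n\<close> by linarith
  obtain m where haar: "haar_probability (torus_edges (r n)) m"
   and Mn: "M (r n) = normalised_density m (%J. exp (- edge_sum (torus_edges (r n)) (%e. xy_potential be (J e))))"
   using M unfolding spin_measure_def by blast
  interpret T: torus_haar "r n" m by (rule torus_haar.intro[OF haar])
  have FD: "row_edges i \<subseteq> T.D" using T.row_inner[OF R] T.inner_subset[OF big] by blast
  note ch = T.row_obs_character[OF FD, of s]
  have loc: "row_obs s i J = row_obs s i J'" if "\<And>e. e \<in> T.inner R ==> J e = J' e" for J J'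
   using that T.row_inner[OF R] by (intro row_obs_cong) blast
  have E: "(\<integral>J. Re (row_obs s i J) \<partial>M (r n)) = T.torus_mean c (%J. Re (row_obs s i J))"
   unfolding c_def by (rule T.spin_measure_integral[OF Mn bdd_meas_measurable[OF T.G.bdd_meas_character(1)[OF ch]]])
  have pin: "row_chi s i (pin (square R) th) = row_chi s i th" for th
   using R by (simp add: row_chi_def chi2_def chi4_def pin_def mem_square)
  show ?thesis
   unfolding E
   using T.free_le_torus[OF c big _ ch loc row_chi_character row_obs_spin]
    T.torus_le_pinned[OF c big ch loc row_chi_character row_obs_spin pin] by blast
 qed
 have low: "xy_mean c F (%th. Re (row_chi s i th)) <= (\<integral>J. Re (row_obs s i J) \<partial>\<mu>)"
  if F: "finite F" "F \<subseteq> Z2_edges" for F s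
 proof -
  obtain R0 where R0: "fst ` F \<union> snd ` F \<subseteq> square R0" using finite_subset_square[of "fst ` F \<union> snd ` F"] F by auto
  define R where "R = max R0 (max 1 i)"
  have "F \<subseteq> {b\<in>Z2_edges. fst b \<in> square R \<and> snd b \<in> square R}"
   using F R0 square_mono[of R0 R] by (auto simp: R_def)
  then have "\<forall>n\<ge>2 * R + 8. xy_mean c F (%th. Re (row_chi s i th)) <= (\<integral>J. Re (row_obs s i J) \<partial>M (r n))"
   using torus[of R _ s] by (simp add: R_def)
  then show ?thesis by (intro LIMSEQ_le_const[OF te] exI[of _ "2 * R + 8"])
 qed
 show ?thesis_a
  using low[of _ True] unfolding two c_def[symmetric] by (intro xy_lim_least) (simp add: row_chi_def)
 have "0 <= xy_mean c {} (%th. Re (row_chi False i th))" by (rule xy_mean_character_nonneg[OF row_chi_character c]) simp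
 then show "0 <= four_point \<mu> i" using low[of "{}" False] unfolding four by simp
 show ?thesis_b
 proof (rule field_le_epsilon)
  fix \<epsilon> :: real assume \<epsilon>: "\<epsilon> > 0"
  from pinned_four_point_limit[OF c \<epsilon>, of "(0, 0)" "(int i, 0)" "(0, -1)" "(int i, -1)"]
  obtain R where R: "{(0, 0), (int i, 0), (0, -1), (int i, -1)} \<subseteq> square R"
   and pb': "\<forall>D. finite D \<and> D \<subseteq> Z2_edges -->
    pinned_mean c (square R) D (%th. Re (chi4 (0, 0) (0, -1) (int i, 0) (int i, -1) th)) <=
    xy_mean c {b\<in>D. fst b \<in> square R \<and> snd b \<in> square R} (%th. Re (chi4 (0, 0) (0, -1) (int i, 0) (int i, -1) th)) + \<epsilon>"
   by (elim conjE exE)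
  note pb = pb'[rule_format, OF conjI]
  have "\<forall>n\<ge>2 * R + 8. (\<integral>J. Re (row_obs False i J) \<partial>M (r n)) <= xy_lim c (row_chi False i) + \<epsilon>"
  proof (intro allI impI)
   fix n assume n: "2 * R + 8 <= n"
   let ?D = "face_bond ` (torus_edges (r n) \<inter> Z2_edges)"
   have D: "finite ?D" "?D \<subseteq> Z2_edges" using finite_torus_edges face_bond_Z2_edges by auto
   have "(\<integral>J. Re (row_obs False i J) \<partial>M (r n)) <= pinned_mean c (square R) ?D (%th. Re (row_chi False i th))"
    using torus[OF n, of False] R by (simp add: mem_square)
   also have "... <= xy_mean c {b\<in>?D. fst b \<in> square R \<and> snd b \<in> square R} (%th. Re (row_chi False i th)) + \<epsilon>"
    using pb[OF D] by (simp add: row_chi_def)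
   also have "... <= xy_lim c (row_chi False i) + \<epsilon>"
    using D by (intro add_right_mono xy_lim_upper row_chi_character) auto
   finally show "(\<integral>J. Re (row_obs False i J) \<partial>M (r n)) <= xy_lim c (row_chi False i) + \<epsilon>" .
  qed
  then have "(\<integral>J. Re (row_obs False i J) \<partial>\<mu>) <= xy_lim c (row_chi False i) + \<epsilon>"
   by (intro LIMSEQ_le_const2[OF te] exI[of _ "2 * R + 8"])
  then show "four_point \<mu> i <= xy_lim (be / 2) (chi4 (0, 0) (0, -1) (int i, 0) (int i, -1)) + \<epsilon>"
   unfolding four c_def[symmetric] by (simp add: row_chi_def)
 qed
qed

section \<open>The Skellam distribution\<close>

text \<open>The difference of two independent Poisson variables. Its masses are the Bessel weights
  up to the factor exp be, and its characteristic function exp (be (cos t - 1)) is the XY weight of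
  a bond up to a constant: this pair of facts is the duality. The family indexed by booleans allows
  the product rule for \<open>Pi_pmf\<close> to be used.\<close>

definition skellam_pmf :: "real => int pmf" where
 "skellam_pmf be = map_pmf (%f. int (f True) - int (f False)) (Pi_pmf UNIV 0 (%_::bool. poisson_pmf (be / 2)))"

lemma skellam_pair:
 "skellam_pmf be = map_pmf (%(a, b). int a - int b) (pair_pmf (poisson_pmf (be / 2)) (poisson_pmf (be / 2)))"
proof -
 have U: "(UNIV :: bool set) = insert True {False}" by auto
 show ?thesis
  unfolding skellam_pmf_def U
  by (subst Pi_pmf_insert, simp, simp, subst Pi_pmf_singleton)
   (simp add: pair_map_pmf2 pmf.map_comp o_def case_prod_unfold)
qed

lemma skellam_symmetric: "map_pmf uminus (skellam_pmf be) = skellam_pmf be"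
proof -
 have "map_pmf uminus (skellam_pmf be) = map_pmf (%(a, b). int b - int a) (pair_pmf (poisson_pmf (be / 2)) (poisson_pmf (be / 2)))"
  unfolding skellam_pair by (simp add: pmf.map_comp o_def case_prod_unfold)
 also have "... = skellam_pmf be"
  unfolding skellam_pair by (subst (2) pair_commute_pmf) (simp add: pmf.map_comp o_def case_prod_unfold)
 finally show ?thesis .
qed

lemma pmf_skellam_minus: "pmf (skellam_pmf be) (- n) = pmf (skellam_pmf be) n"
proof -
 have "pmf (map_pmf uminus (skellam_pmf be)) (- n) = pmf (skellam_pmf be) n"
  by (rule pmf_map_inj') (simp add: inj_def)
 then show ?thesis by (simp add: skellam_symmetric)
qed

lemma integral_nat_pmf:
 fixes f :: "nat => 'b::{banach, second_countable_topology}"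
 assumes "summable (%n. norm (pmf p n *\<^sub>R f n))" and "(%n. pmf p n *\<^sub>R f n) sums s"
 shows "integrable (measure_pmf p) f" "(\<integral>x. f x \<partial>measure_pmf p) = s"
proof -
 have i: "integrable (count_space UNIV) (%n. pmf p n *\<^sub>R f n)"
  using assms(1) by (simp add: integrable_count_space_nat_iff)
 show "integrable (measure_pmf p) f"
  unfolding measure_pmf_eq_density by (subst integrable_density) (use i in auto)
 have "(\<integral>x. f x \<partial>measure_pmf p) = (\<integral>n. pmf p n *\<^sub>R f n \<partial>count_space UNIV)"
  unfolding measure_pmf_eq_density by (subst integral_density) auto
 then show "(\<integral>x. f x \<partial>measure_pmf p) = s"
  using assms(2) by (simp add: integral_count_space_nat[OF i] sums_unique[symmetric])
qed

text \<open>The Touchard polynomials of degree 0, 1 and 2; the last clause is only meaningful for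
  \<open>k = 2\<close>.\<close>

definition exp_moment :: "nat => 'a::{real_normed_field, banach} => 'a" where
 "exp_moment k x = (if k = 0 then 1 else if k = 1 then x else x + x\<^sup>2)"

lemma exp_moment_sums:
 fixes x :: "'a::{real_normed_field, banach}"
 assumes "k <= 2"
 shows "(%n. of_nat n ^ k * (x ^ n /\<^sub>R fact n)) sums (exp_moment k x * exp x)"
proof -
 have s0: "(%n. x ^ n /\<^sub>R fact n) sums exp x" by (rule exp_converges)
 have st: "of_nat (Suc n) * (x ^ Suc n /\<^sub>R fact (Suc n)) = x * (x ^ n /\<^sub>R fact n)" for n
  by (simp add: scaleR_conv_of_real field_simps del: of_nat_Suc)
 have "(%n. of_nat (Suc n) * (x ^ Suc n /\<^sub>R fact (Suc n))) sums (x * exp x)"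
  unfolding st by (intro sums_mult s0)
 then have s1: "(%n. of_nat n * (x ^ n /\<^sub>R fact n)) sums (x * exp x)"
  using sums_Suc[of "%n. of_nat n * (x ^ n /\<^sub>R fact n)"] by simp
 have e: "(%n. of_nat (Suc n) * of_nat (Suc n) * (x ^ Suc n /\<^sub>R fact (Suc n))) = (%n. x * (of_nat n * (x ^ n /\<^sub>R fact n) + x ^ n /\<^sub>R fact n))"
 proof
  fix n
  have "of_nat (Suc n) * of_nat (Suc n) * (x ^ Suc n /\<^sub>R fact (Suc n)) = of_nat (Suc n) * (x * (x ^ n /\<^sub>R fact n))"
   by (simp only: mult.assoc st)
  then show "of_nat (Suc n) * of_nat (Suc n) * (x ^ Suc n /\<^sub>R fact (Suc n)) = x * (of_nat n * (x ^ n /\<^sub>R fact n) + x ^ n /\<^sub>R fact n)"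
   by (simp add: algebra_simps)
 qed
 have "(%n. of_nat (Suc n) * of_nat (Suc n) * (x ^ Suc n /\<^sub>R fact (Suc n))) sums (x * (x * exp x + exp x))"
  unfolding e by (intro sums_mult sums_add s0 s1)
 then have s2: "(%n. of_nat n * of_nat n * (x ^ n /\<^sub>R fact n)) sums (x * (x * exp x + exp x))"
  using sums_Suc[of "%n. of_nat n * of_nat n * (x ^ n /\<^sub>R fact n)"] by simp
 have "k = 0 \<or> k = 1 \<or> k = 2" using assms by auto
 then show ?thesis using s0 s1 s2 by (auto simp: exp_moment_def power2_eq_square algebra_simps)
qed

lemma poisson_moment:
 assumes "r > 0" "k <= 2"
 shows "integrable (measure_pmf (poisson_pmf r)) (%n. of_nat n ^ k * z ^ n :: complex)"
  "(\<integral>n. of_nat n ^ k * z ^ n \<partial>measure_pmf (poisson_pmf r)) = exp_moment k (r * z) * exp (r * (z - 1))"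
proof -
 let ?f = "%n. of_nat n ^ k * z ^ n :: complex"
 have e: "pmf (poisson_pmf r) n *\<^sub>R ?f n = exp (- of_real r) * (of_nat n ^ k * ((r * z) ^ n /\<^sub>R fact n))" for n
  using assms(1) by (simp add: scaleR_conv_of_real power_mult_distrib exp_of_real[symmetric] field_simps)
 have n: "norm (pmf (poisson_pmf r) n *\<^sub>R ?f n) = exp (- r) * (of_nat n ^ k * ((r * norm z) ^ n /\<^sub>R fact n))" for n
  using assms(1) by (simp add: norm_mult norm_power power_mult_distrib field_simps)
 have "(%n. pmf (poisson_pmf r) n *\<^sub>R ?f n) sums (exp (- of_real r) * (exp_moment k (r * z) * exp (r * z)))"
  unfolding e by (intro sums_mult exp_moment_sums assms)
 moreover have "exp (- of_real r) * (exp_moment k (r * z) * exp (r * z)) = exp_moment k (r * z) * exp (r * (z - 1))"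
  by (simp add: right_diff_distrib exp_diff exp_minus field_simps)
 moreover have "summable (%n. norm (pmf (poisson_pmf r) n *\<^sub>R ?f n))"
  unfolding n by (intro summable_mult sums_summable[OF exp_moment_sums] assms)
 ultimately show "integrable (measure_pmf (poisson_pmf r)) ?f"
  "(\<integral>n. ?f n \<partial>measure_pmf (poisson_pmf r)) = exp_moment k (r * z) * exp (r * (z - 1))"
  using integral_nat_pmf[of "poisson_pmf r" ?f] by auto
qed

lemma integral_prod_Pi_pmf:
 fixes f :: "'a => 'b => complex"
 assumes A: "finite A" and f: "\<And>x. x \<in> A ==> integrable (measure_pmf (p x)) (f x)"
 shows "(\<integral>y. (\<Prod>x\<in>A. f x (y x)) \<partial>measure_pmf (Pi_pmf A d p)) = (\<Prod>x\<in>A. \<integral>v. f x v \<partial>measure_pmf (p x))"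
proof -
 let ?P = "measure_pmf (Pi_pmf A d p)"
 have comp: "p x = map_pmf (%y. y x) (Pi_pmf A d p)" if "x \<in> A" for x
  using Pi_pmf_component[OF A, of x d p] that by simp
 have "(\<integral>y. (\<Prod>x\<in>A. f x (y x)) \<partial>?P) = (\<Prod>x\<in>A. \<integral>y. f x (y x) \<partial>?P)"
 proof (rule prob_space.indep_vars_lebesgue_integral[OF measure_pmf.prob_space_axioms A])
  show "prob_space.indep_vars ?P (%_. borel) (%x y. f x (y x)) A"
   by (rule prob_space.indep_vars_compose2[OF measure_pmf.prob_space_axioms indep_vars_Pi_pmf[OF A]]) simp
  show "integrable ?P (%y. f x (y x))" if "x \<in> A" for x
   using f[OF that] unfolding comp[OF that] by simp
 qed
 also have "... = (\<Prod>x\<in>A. \<integral>v. f x v \<partial>measure_pmf (p x))"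
 proof (rule prod.cong[OF refl])
  fix x assume "x \<in> A"
  have "(\<integral>y. f x (y x) \<partial>?P) = (\<integral>v. f x v \<partial>measure_pmf (map_pmf (%y. y x) (Pi_pmf A d p)))"
   by simp
  then show "(\<integral>y. f x (y x) \<partial>?P) = (\<integral>v. f x v \<partial>measure_pmf (p x))" using comp[OF \<open>x \<in> A\<close>] by simp
 qed
 finally show ?thesis .
qed

lemma poisson_pair_moment:
 assumes "r > 0" "k <= 2" "l <= 2"
 defines "P \<equiv> Pi_pmf UNIV 0 (%_::bool. poisson_pmf r)"
 shows "integrable (measure_pmf P) (%f. (of_nat (f True) ^ k * z ^ f True) * (of_nat (f False) ^ l * w ^ f False) :: complex)" (is "integrable _ ?f")
  "(\<integral>f. (of_nat (f True) ^ k * z ^ f True) * (of_nat (f False) ^ l * w ^ f False) \<partial>measure_pmf P) =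
   exp_moment k (r * z) * exp_moment l (r * w) * exp (r * (z + w - 2))"
proof -
 let ?g = "%b n. if b then of_nat n ^ k * z ^ n else of_nat n ^ l * w ^ n :: complex"
 have f: "?f = (%f. \<Prod>b\<in>UNIV. ?g b (f b))" by (simp add: UNIV_bool mult.commute)
 have i: "integrable (measure_pmf (poisson_pmf r)) (?g b)" for b
  using poisson_moment(1)[OF assms(1,2), of z] poisson_moment(1)[OF assms(1,3), of w] by (cases b) auto
 show "integrable (measure_pmf P) ?f" unfolding f P_def by (rule integrable_prod_Pi_pmf) (use i in auto)
 have "(\<integral>f. ?f f \<partial>measure_pmf P) = (\<Prod>b\<in>UNIV. \<integral>n. ?g b n \<partial>measure_pmf (poisson_pmf r))"
  unfolding f P_def by (rule integral_prod_Pi_pmf) (use i in auto)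
 also have "... = exp_moment k (r * z) * exp_moment l (r * w) * (exp (r * (z - 1)) * exp (r * (w - 1)))"
  by (simp add: UNIV_bool poisson_moment(2)[OF assms(1,2)] poisson_moment(2)[OF assms(1,3)])
 also have "exp (r * (z - 1)) * exp (r * (w - 1)) = exp (r * (z + w - 2))"
  by (simp add: exp_add[symmetric] algebra_simps)
 finally show "(\<integral>f. ?f f \<partial>measure_pmf P) = exp_moment k (r * z) * exp_moment l (r * w) * exp (r * (z + w - 2))" .
qed

text \<open>What remains of the k-fold application of -i d/dt to the characteristic function at
  \<open>z = cis t\<close> after dividing by that function. The first gives a current with a factor
  i, the second has the diagonal term \<open>be * Re z\<close> in addition to the square of the
  first.\<close>

definition skellam_moment :: "real => nat => complex => complex" where
 "skellam_moment be k z = (if k = 0 then 1 else if k = 1 then \<i> * (be * Im z) else of_real (be * Re z - (be * Im z)\<^sup>2))"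

lemma skellam_moments:
 assumes be: "be > 0" and z: "norm z = 1" and k: "k <= 2"
 shows "integrable (measure_pmf (skellam_pmf be)) (%n. of_int n ^ k * z powi n)" (is ?thesis_a)
  "(\<integral>n. of_int n ^ k * z powi n \<partial>measure_pmf (skellam_pmf be)) = skellam_moment be k z * exp (of_real (be * (Re z - 1)))"
proof -
 let ?P = "Pi_pmf UNIV 0 (%_::bool. poisson_pmf (be / 2))"
 let ?w = "cnj z"
 let ?t = "%k l f. (of_nat (f True) ^ k * z ^ f True) * (of_nat (f False) ^ l * ?w ^ f False) :: complex"
 have z0: "z \<noteq> 0" using z by auto
 have inv: "inverse z = ?w" by (rule unit_inverse[OF z])
 have zw: "z powi (int a - int b) = z ^ a * ?w ^ b" for a b
  using z0 by (simp add: power_int_diff power_inverse[symmetric] divide_inverse inv[symmetric])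
 note m = poisson_pair_moment[of "be / 2", OF _ _ _, simplified, OF be, of _ _ z ?w]
 have ex: "exp (complex_of_real be * (z + cnj z - 2) / 2) = exp (of_real (be * (Re z - 1)))"
  by (simp add: complex_add_cnj algebra_simps) (simp add: diff_divide_distrib)
 have sum: "z + cnj z = 2 * of_real (Re z)" and dif: "z - cnj z = \<i> * (2 * of_real (Im z))"
  by (auto simp: complex_eq_iff)
 consider "k = 0" | "k = 1" | "k = 2" using k by linarith
 then have "integrable (measure_pmf ?P) (%f. of_int (int (f True) - int (f False)) ^ k * z powi (int (f True) - int (f False))) \<and>
  (\<integral>f. of_int (int (f True) - int (f False)) ^ k * z powi (int (f True) - int (f False)) \<partial>measure_pmf ?P) =
   skellam_moment be k z * exp (of_real (be * (Re z - 1)))"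
 proof cases
  case 1
  have "(%f. of_int (int (f True) - int (f False)) ^ k * z powi (int (f True) - int (f False))) = ?t 0 0"
   by (simp add: 1 zw)
  then show ?thesis using m(1)[of 0 0] m(2)[of 0 0] by (simp add: 1 skellam_moment_def exp_moment_def ex)
 next
  case 2
  have e: "(%f. of_int (int (f True) - int (f False)) ^ k * z powi (int (f True) - int (f False))) = (%f. ?t 1 0 f - ?t 0 1 f)"
   by (simp add: 2 zw algebra_simps)
  have "be / 2 * z - be / 2 * ?w = be / 2 * (z - ?w)" by (simp only: right_diff_distrib)
  then have c: "be / 2 * z - be / 2 * ?w = \<i> * (be * Im z)" unfolding dif by simp
  have i: "integrable (measure_pmf ?P) (?t 1 0)" "integrable (measure_pmf ?P) (?t 0 1)"
   using m(1)[of 1 0] m(1)[of 0 1] by simp_all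
  have v: "integral\<^sup>L (measure_pmf ?P) (?t 1 0) = (be / 2 * z) * exp (of_real (be * (Re z - 1)))"
   "integral\<^sup>L (measure_pmf ?P) (?t 0 1) = (be / 2 * ?w) * exp (of_real (be * (Re z - 1)))"
   using m(2)[of 1 0] m(2)[of 0 1] by (simp_all add: exp_moment_def ex)
  show ?thesis
   unfolding e Bochner_Integration.integral_diff[OF i] v
   unfolding 2 skellam_moment_def using Bochner_Integration.integrable_diff[OF i] by (simp only: c[symmetric]) (simp add: algebra_simps)
 next
  case 3
  have e: "(%f. of_int (int (f True) - int (f False)) ^ k * z powi (int (f True) - int (f False))) = (%f. ?t 2 0 f - 2 * ?t 1 1 f + ?t 0 2 f)"
   by (simp add: 3 zw algebra_simps power2_eq_square)
  have "(be / 2 * z + (be / 2 * z)\<^sup>2) - 2 * ((be / 2 * z) * (be / 2 * ?w)) + (be / 2 * ?w + (be / 2 * ?w)\<^sup>2) =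
   be / 2 * (z + ?w) + (be / 2 * (z - ?w))\<^sup>2" by algebra
  also have "... = of_real (be * Re z - (be * Im z)\<^sup>2)" unfolding sum dif by (simp add: power_mult_distrib)
  finally have c: "(be / 2 * z + (be / 2 * z)\<^sup>2) - 2 * ((be / 2 * z) * (be / 2 * ?w)) + (be / 2 * ?w + (be / 2 * ?w)\<^sup>2) = of_real (be * Re z - (be * Im z)\<^sup>2)" .
  have i: "integrable (measure_pmf ?P) (?t 2 0)" "integrable (measure_pmf ?P) (?t 1 1)" "integrable (measure_pmf ?P) (?t 0 2)"
   using m(1)[of 2 0] m(1)[of 1 1] m(1)[of 0 2] by simp_all
  have i2: "integrable (measure_pmf ?P) (%f. 2 * ?t 1 1 f)" by (intro integrable_mult_right i)
  have i12: "integrable (measure_pmf ?P) (%f. ?t 2 0 f - 2 * ?t 1 1 f)" by (intro Bochner_Integration.integrable_diff i i2)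
  have v: "integral\<^sup>L (measure_pmf ?P) (?t 2 0) = (be / 2 * z + (be / 2 * z)\<^sup>2) * exp (of_real (be * (Re z - 1)))"
   "integral\<^sup>L (measure_pmf ?P) (?t 1 1) = (be / 2 * z) * (be / 2 * ?w) * exp (of_real (be * (Re z - 1)))"
   "integral\<^sup>L (measure_pmf ?P) (?t 0 2) = (be / 2 * ?w + (be / 2 * ?w)\<^sup>2) * exp (of_real (be * (Re z - 1)))"
   using m(2)[of 2 0] m(2)[of 1 1] m(2)[of 0 2] by (simp_all add: exp_moment_def ex)
  have "integrable (measure_pmf ?P) (%f. ?t 2 0 f - 2 * ?t 1 1 f + ?t 0 2 f)"
   by (intro Bochner_Integration.integrable_add Bochner_Integration.integrable_diff integrable_mult_right i)
  moreover have "(\<integral>f. ?t 2 0 f - 2 * ?t 1 1 f + ?t 0 2 f \<partial>measure_pmf ?P) =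
    integral\<^sup>L (measure_pmf ?P) (?t 2 0) - 2 * integral\<^sup>L (measure_pmf ?P) (?t 1 1) + integral\<^sup>L (measure_pmf ?P) (?t 0 2)"
   by (simp only: Bochner_Integration.integral_add[OF i12 i(3)] Bochner_Integration.integral_diff[OF i(1) i2] integral_mult_right_zero)
  ultimately show ?thesis unfolding e v
   unfolding 3 skellam_moment_def by (simp only: c[symmetric]) (simp add: algebra_simps)
 qed
 then show ?thesis_a
  "(\<integral>n. of_int n ^ k * z powi n \<partial>measure_pmf (skellam_pmf be)) = skellam_moment be k z * exp (of_real (be * (Re z - 1)))"
  unfolding skellam_pmf_def by simp_all
qed

lemma set_pmf_skellam:
 assumes "be > 0" shows "set_pmf (skellam_pmf be) = UNIV"
proof -
 have "n \<in> (%(a, b). int a - int b) ` UNIV" for n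
  by (cases "n \<ge> 0") (auto intro: image_eqI[of _ _ "(nat n, 0)"] image_eqI[of _ _ "(0, nat (- n))"])
 then show ?thesis unfolding skellam_pair using assms by auto
qed

text \<open>Conditioning on the value m of the second Poisson variable gives the Bessel series term
  by term. For m + n < 0 both sides vanish, one as an impossible event and the other at a pole of
  the Gamma function.\<close>

lemma bessel_skellam:
 assumes be: "be > 0" shows "bessel_I n be = exp be * pmf (skellam_pmf be) n"
proof -
 define l where "l = be / 2"
 have l: "l > 0" using be by (simp add: l_def)
 let ?p = "poisson_pmf l"
 let ?f = "%b. pmf (map_pmf (%a. int a - int b) ?p) n"
 have "skellam_pmf be = bind_pmf ?p (%b. map_pmf (%a. int a - int b) ?p)"
  unfolding skellam_pair l_def[symmetric] pair_pmf_def map_pmf_def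
  by (subst bind_commute_pmf) (simp add: bind_assoc_pmf bind_return_pmf)
 then have "pmf (skellam_pmf be) n = (\<integral>b. ?f b \<partial>measure_pmf ?p)" by (simp add: pmf_bind)
 also have "... = (\<Sum>b. pmf ?p b * ?f b)"
 proof -
  have "summable (%b. pmf ?p b)"
   using l summable_mult2[OF summable_exp[of l], of "exp (- l)"] by (simp add: field_simps)
  then have s: "summable (%b. norm (pmf ?p b *\<^sub>R ?f b))"
   by (rule summable_comparison_test') (auto simp: mult_left_le pmf_le_1 simp del: pmf_poisson)
  from integral_nat_pmf(2)[OF this summable_sums[OF summable_norm_cancel[OF s]]] show ?thesis by simp
 qed
 also have "exp be * ... = (\<Sum>b. exp be * (pmf ?p b * ?f b))"
 proof (rule suminf_mult[symmetric])
  have "summable (%b. pmf ?p b)"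
   using l summable_mult2[OF summable_exp[of l], of "exp (- l)"] by (simp add: field_simps)
  then show "summable (%b. pmf ?p b * ?f b)"
   by (rule summable_comparison_test') (auto simp: mult_left_le pmf_le_1 simp del: pmf_poisson)
 qed
 also have "... = bessel_I n be"
  unfolding bessel_I_def
 proof (rule suminf_cong)
  fix m
  show "exp be * (pmf ?p m * ?f m) = (be / 2) powi (2 * int m + n) * rGamma (of_int (int m + n + 1)) / fact m"
  proof (cases "int m + n \<ge> 0")
   case True
   define a where "a = nat (int m + n)"
   have a: "int a = int m + n" using True by (simp add: a_def)
   have "n = int a - int m" using a by simp
   then have f: "?f m = pmf ?p a"
    using pmf_map_inj'[of "%a. int a - int m" ?p a] by (simp add: inj_def del: pmf_poisson)
   have r: "rGamma (of_int (int m + n + 1) :: real) = inverse (fact a)"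
   proof -
    have "of_int (int m + n + 1) = (1 + real a :: real)" using arg_cong[OF a, of real_of_int] by simp
    then show ?thesis by (simp only: rGamma_inverse_Gamma Gamma_fact)
   qed
   have p: "(be / 2) powi (2 * int m + n) = l ^ m * l ^ a"
   proof -
    have "2 * int m + n = int (m + a)" using a by simp
    then show ?thesis by (simp only: power_int_of_nat power_add l_def)
   qed
   have e: "exp be = exp l * exp l" by (simp add: l_def exp_add[symmetric])
   show ?thesis unfolding f r p e using l by (simp add: exp_minus field_simps)
  next
   case False
   have "n \<notin> range (%a. int a - int m)" using False by auto
   then have "?f m = 0" unfolding pmf_eq_0_set_pmf set_map_pmf by blast
   moreover have "rGamma (of_int (int m + n + 1) :: real) = 0"
   proof -
    have "of_int (int m + n + 1) \<in> (\<int>\<^sub>\<le>\<^sub>0 :: real set)" using False by (intro nonpos_Ints_of_int) simp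
    then show ?thesis by (simp only: rGamma_eq_zero_iff)
   qed
   ultimately show ?thesis by simp
  qed
 qed
 finally show ?thesis ..
qed

section \<open>Height functions and their duality\<close>

text \<open>One representative, pointing east or north, of each undirected edge; independent
  increments are placed on these.\<close>

definition pos_edges :: "site set => (site \<times> site) set" where
 "pos_edges La = {(x, y) \<in> incident_edges La. y = (fst x + 1, snd x) \<or> y = (fst x, snd x + 1)}"

lemma pos_edges_cases:
 assumes "e \<in> pos_edges La" shows "\<exists>x y. e = ((x, y), (x + 1, y)) \<or> e = ((x, y), (x, y + 1))"
proof -
 obtain a b q where e: "e = ((a, b), q)" by (metis prod.exhaust)
 then have "q = (a + 1, b) \<or> q = (a, b + 1)" using assms by (simp add: pos_edges_def)
 then show ?thesis using e by blast
qed

lemma Z2_edges_pos: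
 "(x, y) \<in> Z2_edges \<longleftrightarrow> (y = (fst x + 1, snd x) \<or> y = (fst x, snd x + 1)) \<or> (x = (fst y + 1, snd y) \<or> x = (fst y, snd y + 1))"
 by (cases x; cases y) (auto simp: Z2_edges_def)

lemma incident_edges_swap: "(x, y) \<in> incident_edges La \<longleftrightarrow> (y, x) \<in> incident_edges La"
 by (auto simp: incident_edges_def intro: Z2_edges_sym)

lemma incident_pos_edges: "incident_edges La = pos_edges La \<union> prod.swap ` pos_edges La" (is ?thesis_a) "pos_edges La \<inter> prod.swap ` pos_edges La = {}" (is ?thesis_b)
proof -
 show ?thesis_a
 proof (intro equalityI subsetI)
  fix e assume e: "e \<in> incident_edges La"
  obtain x y where xy: "e = (x, y)" by (cases e)
  have "(y, x) \<in> incident_edges La" using e incident_edges_swap xy by blast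
  moreover have "(x, y) \<in> Z2_edges" using e by (simp add: xy incident_edges_def)
  ultimately have "(x, y) \<in> pos_edges La \<or> (y, x) \<in> pos_edges La"
   using e unfolding xy Z2_edges_pos pos_edges_def by blast
  then show "e \<in> pos_edges La \<union> prod.swap ` pos_edges La" unfolding xy by force
 next
  fix e assume "e \<in> pos_edges La \<union> prod.swap ` pos_edges La"
  then show "e \<in> incident_edges La" using incident_edges_swap by (auto simp: pos_edges_def)
 qed
 show ?thesis_b by (auto simp: pos_edges_def)
qed

lemma finite_incident_edges: "finite La ==> finite (incident_edges La)"
proof -
 assume f: "finite La"
 let ?S = "SIGMA x:La. {y. (y, x) \<in> Z2_edges}"
 have "incident_edges La \<subseteq> ?S \<union> prod.swap ` ?S"
 proof
  fix e assume e: "e \<in> incident_edges La"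
  obtain x y where xy: "e = (x, y)" by (cases e)
  have z: "(x, y) \<in> Z2_edges" "x \<in> La \<or> y \<in> La" using e unfolding xy incident_edges_def by simp_all
  from z(2) show "e \<in> ?S \<union> prod.swap ` ?S"
  proof
   assume "x \<in> La"
   then show ?thesis using Z2_edges_sym[OF z(1)] by (simp add: xy)
  next
   assume "y \<in> La"
   then have "(y, x) \<in> ?S" using z(1) by simp
   then have "prod.swap (y, x) \<in> prod.swap ` ?S" by (rule imageI)
   then show ?thesis by (simp add: xy)
  qed
 qed
 moreover have "finite ?S"
 proof (rule finite_SigmaI[OF f])
  show "finite {y. (y, x) \<in> Z2_edges}" for x :: site by (cases x) (simp add: neighbours)
 qed
 ultimately show ?thesis by (meson finite_UnI finite_imageI finite_subset)
qed

lemma finite_pos_edges [simp]: "finite La ==> finite (pos_edges La)"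
 using finite_incident_edges incident_pos_edges(1) by (metis finite_Un)

definition heights :: "site set => (site => int) => (site => int) set" where
 "heights La \<phi> = {h. \<forall>x. x \<notin> La --> h x = \<phi> x}"

definition grad :: "site set => (site => int) => site \<times> site => int" where
 "grad La h e = (if e \<in> pos_edges La then h (snd e) - h (fst e) else 0)"

text \<open>Walking east from any site leaves the finite set eventually, and there both heights are
  given by the boundary condition.\<close>

lemma inj_on_grad:
 assumes La: "finite La" shows "inj_on (grad La) (heights La \<phi>)"
proof (rule inj_onI, rule ext)
 fix h h' and x :: site
 assume h: "h \<in> heights La \<phi>" "h' \<in> heights La \<phi>" and g: "grad La h = grad La h'"
 have off: "h y = h' y" if "y \<notin> La" for y
 proof -
  have "h y = \<phi> y" "h' y = \<phi> y" using h that unfolding heights_def by blast+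
  then show ?thesis by simp
 qed
 obtain a b where x: "x = (a, b)" by (cases x)
 have step: "h (i, b) - h' (i, b) = h (i + 1, b) - h' (i + 1, b)" for i
 proof (cases "((i, b), (i + 1, b)) \<in> pos_edges La")
  case True
  then show ?thesis using fun_cong[OF g, of "((i, b), (i + 1, b))"] by (simp add: grad_def)
 next
  case False
  then have "(i, b) \<notin> La" "(i + 1, b) \<notin> La" by (auto simp: pos_edges_def incident_edges_def Z2_edges_def)
  then show ?thesis using off by simp
 qed
 have const: "h (a, b) - h' (a, b) = h (a + int n, b) - h' (a + int n, b)" for n
 proof (induction n)
  case (Suc n)
  then show ?case using step[of "a + int n"] by (simp add: algebra_simps)
 qed simp
 have "infinite (range (%n. (a + int n, b)))" by (rule range_inj_infinite) (simp add: inj_def)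
 then have "\<not> range (%n. (a + int n, b)) \<subseteq> La" using finite_subset[OF _ La] by metis
 then obtain n where "(a + int n, b) \<notin> La" by auto
 then show "h x = h' x" using const[of n] off by (simp add: x)
qed

definition edge_pmf :: "real => site set => (site \<times> site => int) pmf" where
 "edge_pmf be La = Pi_pmf (pos_edges La) 0 (%_. skellam_pmf be)"

definition height_weight :: "real => site set => (site => int) => real" where
 "height_weight be La h = (\<Prod>e\<in>pos_edges La. pmf (skellam_pmf be) (h (snd e) - h (fst e)))"

text \<open>The Gibbs law as independent Skellam increments conditioned on being the gradient of a
  height function with the prescribed boundary values. The event has positive probability, and the
  height function is recovered by injectivity of the gradient.\<close>

definition gibbs_pmf :: "real => site set => (site => int) => (site => int) pmf" where
 "gibbs_pmf be La \<phi> = map_pmf (inv_into (heights La \<phi>) (grad La)) (cond_pmf (edge_pmf be La) (grad La ` heights La \<phi>))"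

definition gibbs_partition :: "real => site set => (site => int) => real" where
 "gibbs_partition be La \<phi> = measure_pmf.prob (edge_pmf be La) (grad La ` heights La \<phi>)"

context
 fixes be :: real and La :: "site set"
 assumes be: "be > 0" and La: "finite La"
begin

lemma set_edge_pmf: "set_pmf (edge_pmf be La) = {j. \<forall>e. e \<notin> pos_edges La --> j e = 0}"
 unfolding edge_pmf_def using La by (subst set_Pi_pmf) (auto simp: PiE_dflt_def set_pmf_skellam[OF be])

lemma grad_in_edge_pmf: "grad La h \<in> set_pmf (edge_pmf be La)"
 by (simp add: set_edge_pmf grad_def)

lemma grad_heights_nonempty: "set_pmf (edge_pmf be La) \<inter> grad La ` heights La \<phi> \<noteq> {}"
proof -
 have "grad La \<phi> \<in> grad La ` heights La \<phi>" by (rule imageI) (simp add: heights_def)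
 then show ?thesis using grad_in_edge_pmf by blast
qed

lemma pmf_edge_grad: "pmf (edge_pmf be La) (grad La h) = height_weight be La h"
 unfolding edge_pmf_def height_weight_def using La by (subst pmf_Pi') (auto simp: grad_def)

lemma gibbs_partition_pos: "gibbs_partition be La \<phi> > 0"
 unfolding gibbs_partition_def using grad_heights_nonempty[of \<phi>] by (auto intro: measure_pmf_posI)

lemma pmf_gibbs: "pmf (gibbs_pmf be La \<phi>) h = (if h \<in> heights La \<phi> then height_weight be La h / gibbs_partition be La \<phi> else 0)"
proof -
 let ?H = "heights La \<phi>" and ?c = "cond_pmf (edge_pmf be La) (grad La ` heights La \<phi>)"
 note ne = grad_heights_nonempty[of \<phi>]
 have set: "set_pmf ?c \<subseteq> grad La ` ?H" using set_cond_pmf[OF ne] by blast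
 show ?thesis
 proof (cases "h \<in> ?H")
  case True
  then have inv: "inv_into ?H (grad La) (grad La h) = h" by (rule inv_into_f_f[OF inj_on_grad[OF La]])
  have mem: "grad La h \<in> set_pmf ?c" using True grad_in_edge_pmf by (simp add: set_cond_pmf[OF ne])
  have "pmf (gibbs_pmf be La \<phi>) (inv_into ?H (grad La) (grad La h)) = pmf ?c (grad La h)"
   unfolding gibbs_pmf_def by (rule pmf_map_inj[OF inj_on_subset[OF inj_on_inv_into[OF subset_refl] set] mem])
  then show ?thesis using True unfolding inv pmf_cond[OF ne]
   by (simp add: pmf_edge_grad gibbs_partition_def)
 next
  case False
  have "set_pmf (gibbs_pmf be La \<phi>) \<subseteq> ?H" unfolding gibbs_pmf_def using set by (auto intro: inv_into_into)
  then show ?thesis using False by (auto simp: pmf_eq_0_set_pmf)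
 qed
qed

lemma height_weight_pos: "height_weight be La h > 0"
 unfolding height_weight_def by (intro prod_pos) (auto simp: pmf_positive_iff set_pmf_skellam[OF be])

lemma set_gibbs_pmf: "set_pmf (gibbs_pmf be La \<phi>) = heights La \<phi>"
proof (rule set_eqI)
 fix h
 have "height_weight be La h / gibbs_partition be La \<phi> \<noteq> 0"
  using height_weight_pos[of h] gibbs_partition_pos[of \<phi>] by simp
 then show "h \<in> set_pmf (gibbs_pmf be La \<phi>) \<longleftrightarrow> h \<in> heights La \<phi>" by (simp add: set_pmf_iff pmf_gibbs)
qed

end

lemma integral_cond_pmf:
 fixes F :: "'a => real"
 assumes ne: "set_pmf p \<inter> s \<noteq> {}" and F: "integrable (measure_pmf p) F"
 shows "integrable (measure_pmf (cond_pmf p s)) F"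
  "(\<integral>x. F x \<partial>measure_pmf (cond_pmf p s)) = (\<integral>x. F x * indicator s x \<partial>measure_pmf p) / measure_pmf.prob p s" (is ?thesis_a)
proof -
 have e: "pmf (cond_pmf p s) x *\<^sub>R F x = pmf p x *\<^sub>R (F x * indicator s x / measure_pmf.prob p s)" for x
  by (simp add: pmf_cond[OF ne])
 have i: "integrable (measure_pmf p) (%x. F x * indicator s x / measure_pmf.prob p s)"
  by (intro integrable_divide integrable_real_mult_indicator F) simp
 then have "integrable (count_space UNIV) (%x. pmf p x *\<^sub>R (F x * indicator s x / measure_pmf.prob p s))"
  unfolding measure_pmf_eq_density[of p] by (subst (asm) integrable_density) auto
 then show "integrable (measure_pmf (cond_pmf p s)) F"
  unfolding measure_pmf_eq_density[of "cond_pmf p s"] by (subst integrable_density) (auto simp: e[simplified])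
 have "(\<integral>x. F x \<partial>measure_pmf (cond_pmf p s)) = (\<integral>x. pmf p x *\<^sub>R (F x * indicator s x / measure_pmf.prob p s) \<partial>count_space UNIV)"
  unfolding measure_pmf_eq_density[of "cond_pmf p s"] by (subst integral_density) (auto simp: e[simplified])
 also have "... = (\<integral>x. F x * indicator s x / measure_pmf.prob p s \<partial>measure_pmf p)"
  unfolding measure_pmf_eq_density[of p] by (subst integral_density) auto
 finally show ?thesis_a
  by simp
qed

lemma gibbs_expectation:
 fixes F :: "(site \<times> site => int) => real"
 assumes be: "be > 0" and La: "finite La" and F: "integrable (measure_pmf (edge_pmf be La)) F"
 shows "integrable (measure_pmf (gibbs_pmf be La \<phi>)) (%h. F (grad La h))" (is ?thesis_a)
  "(\<integral>h. F (grad La h) \<partial>measure_pmf (gibbs_pmf be La \<phi>)) =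
   (\<integral>j. F j * indicator (grad La ` heights La \<phi>) j \<partial>measure_pmf (edge_pmf be La)) / gibbs_partition be La \<phi>"
proof -
 let ?s = "grad La ` heights La \<phi>" and ?v = "inv_into (heights La \<phi>) (grad La)"
 note ne = grad_heights_nonempty[OF be La, of \<phi>]
 have ae: "AE j in measure_pmf (cond_pmf (edge_pmf be La) ?s). F (grad La (?v j)) = F j"
  unfolding AE_measure_pmf_iff set_cond_pmf[OF ne] by (auto simp: f_inv_into_f)
 note c = integral_cond_pmf[OF ne F]
 show ?thesis_a
  unfolding gibbs_pmf_def integrable_map_pmf_eq using c(1) by (subst integrable_cong_AE[OF _ _ ae]) auto
 show "(\<integral>h. F (grad La h) \<partial>measure_pmf (gibbs_pmf be La \<phi>)) =
   (\<integral>j. F j * indicator ?s j \<partial>measure_pmf (edge_pmf be La)) / gibbs_partition be La \<phi>"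
  unfolding gibbs_pmf_def integral_map_pmf gibbs_partition_def c(2)[symmetric]
  by (rule integral_cong_AE[OF _ _ ae]) auto
qed

definition edge_character :: "site set => (site \<times> site => int) => site spin => complex" where
 "edge_character La j th = (\<Prod>e\<in>pos_edges La. bond th (face_bond e) powi j e)"

lemma bond_face_swap: "bond th (face_bond (prod.swap e)) = cnj (bond th (face_bond e))"
proof -
 obtain v w where e: "e = (v, w)" by (cases e)
 show ?thesis unfolding e by (simp only: swap_simp face_bond_swap[of w v] bond_swap)
qed

lemma norm_bond: "(\<And>x. norm (th x) = 1) ==> norm (bond th b) = 1"
 by (simp add: bond_def norm_mult)

lemma character_power_int: "spin.character \<xi> ==> spin.character (%th. \<xi> th powi n)"
proof -
 assume c: "spin.character \<xi>"
 then have m: "\<xi> \<in> borel_measurable spin_space" by (simp add: spin.character_def)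
 have "(%th. \<xi> th powi n) \<in> borel_measurable spin_space"
  using m by (cases "n \<ge> 0") (simp_all add: power_int_def)
 then show ?thesis
  using c unfolding spin.character_def by (simp add: norm_power_int power_int_mult_distrib complex_cnj_power_int)
qed

lemma edge_character: "spin.character (edge_character La j)"
 unfolding edge_character_def[abs_def] by (intro spin.character_prod character_power_int bond_character)

text \<open>Summation by parts: collecting the factors with the height at y gives the divergence of
  the spin gradient at y, raised to that height, and this divergence is 1.\<close>

lemma edge_character_grad:
 assumes La: "finite La" and h: "h \<in> heights La (%_. 0)" and th: "\<And>x. norm (th x) = 1"
 shows "edge_character La (grad La h) th = 1"
proof -
 let ?b = "%e. bond th (face_bond e)"
 let ?g = "%e. ?b e powi h (snd e)"
 have nb: "norm (?b e) = 1" for e by (rule norm_bond[OF th])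
 have b0: "?b e \<noteq> 0" for e using nb[of e] by auto
 have sw: "?b (prod.swap e) = inverse (?b e)" for e
  unfolding bond_face_swap by (rule unit_inverse[OF nb, symmetric])
 have "edge_character La (grad La h) th = (\<Prod>e\<in>pos_edges La. ?g e * ?g (prod.swap e))"
  unfolding edge_character_def
 proof (rule prod.cong[OF refl])
  fix e assume e: "e \<in> pos_edges La"
  have "?b e powi (h (snd e) - h (fst e)) = ?b e powi h (snd e) * inverse (?b e) powi h (fst e)"
   by (simp only: power_int_diff[OF disjI1[OF b0]] power_int_inverse divide_inverse)
  then show "?b e powi grad La h e = ?g e * ?g (prod.swap e)"
   unfolding sw grad_def using e by simp
 qed
 also have "... = (\<Prod>e\<in>incident_edges La. ?g e)"
  unfolding incident_pos_edges(1) prod.distrib using La incident_pos_edges(2)[of La]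
  by (subst prod.union_disjoint) (auto simp: prod.reindex)
 \<comment> \<open>Edges ending outside the volume drop out, since the height there is 0.\<close>
 also have "... = (\<Prod>e\<in>(%(y, x). (x, y)) ` (SIGMA y:La. {x. (x, y) \<in> Z2_edges}). ?g e)"
 proof (rule prod.mono_neutral_right[OF finite_incident_edges[OF La]])
  show "\<forall>e\<in>incident_edges La - (%(y, x). (x, y)) ` (SIGMA y:La. {x. (x, y) \<in> Z2_edges}). ?g e = 1"
  proof
   fix e assume e: "e \<in> incident_edges La - (%(y, x). (x, y)) ` (SIGMA y:La. {x. (x, y) \<in> Z2_edges})"
   obtain x y where xy: "e = (x, y)" by (cases e)
   have "y \<notin> La"
   proof
    assume "y \<in> La"
    then have "(y, x) \<in> (SIGMA y:La. {x. (x, y) \<in> Z2_edges})" using e by (simp add: xy incident_edges_def)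
    then have "e \<in> (%(y, x). (x, y)) ` (SIGMA y:La. {x. (x, y) \<in> Z2_edges})" unfolding xy by force
    then show False using e by blast
   qed
   then have "h y = 0" using h unfolding heights_def by blast
   then show "?g e = 1" by (simp add: xy)
  qed
 qed (auto simp: incident_edges_def)
 also have "... = (\<Prod>y\<in>La. \<Prod>x | (x, y) \<in> Z2_edges. ?g (x, y))"
 proof -
  have fin: "finite {x. (x, y) \<in> Z2_edges}" for y :: site by (cases y) (simp add: neighbours)
  have "inj_on (%(y, x). (x, y)) (SIGMA y:La. {x. (x, y) \<in> Z2_edges})" by (auto simp: inj_on_def)
  then show ?thesis
   using La fin by (simp add: prod.reindex prod.Sigma) (rule prod.cong, auto)
 qed
 also have "... = (\<Prod>y\<in>La. (\<Prod>x | (x, y) \<in> Z2_edges. ?b (x, y)) powi h y)"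
 proof (rule prod.cong[OF refl])
  fix y
  show "(\<Prod>x | (x, y) \<in> Z2_edges. ?g (x, y)) = (\<Prod>x | (x, y) \<in> Z2_edges. ?b (x, y)) powi h y"
   by (cases y) (simp add: prod_neighbours power_int_mult_distrib)
 qed
 also have "... = 1" by (simp add: d_star_bond[OF th])
 finally show ?thesis .
qed

text \<open>Rotating the spin of the single face with lower left corner (a, b) tests the circulation
  around that face: the character takes the value \<open>w powi n\<close>, where \<open>n\<close> is
  the circulation.\<close>

lemma trivial_edge_character_curl:
 assumes j: "\<And>e. e \<notin> pos_edges La ==> j e = 0" and La: "finite La"
  and triv: "\<And>th. th \<in> space spin_space ==> edge_character La j th = 1"
 shows "j ((a + 1, b), (a + 1, b + 1)) = j ((a, b), (a, b + 1)) + j ((a, b + 1), (a + 1, b + 1)) - j ((a, b), (a + 1, b))"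
proof (rule ccontr)
 let ?B = "((a, b), (a + 1, b))" and ?T = "((a, b + 1), (a + 1, b + 1))"
  and ?L = "((a, b), (a, b + 1))" and ?R = "((a + 1, b), (a + 1, b + 1))"
 define n where "n = j ?L + j ?T - j ?B - j ?R"
 assume "j ?R \<noteq> j ?L + j ?T - j ?B"
 then have n: "n \<noteq> 0" by (simp add: n_def)
 \<comment> \<open>Chosen so that \<open>w powi n\<close> is -1 if the circulation \<open>n\<close>
   is not 0.\<close>
 define w where "w = cis (pi / of_int n)"
 have w: "norm w = 1" by (simp add: w_def)
 have w0: "w \<noteq> 0" using w by auto
 have wi: "cnj w = inverse w" using w by (rule unit_inverse[symmetric])
 define th where "th x = (if x = (a, b) then w else 1)" for x
 have th: "th \<in> space spin_space" by (simp add: space_spin_space th_def w)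
 let ?f = "%e. bond th (face_bond e) powi j e"
 have fb: "face_bond ?T = ((a, b), (a, b + 1))" "face_bond ?R = ((a + 1, b), (a, b))"
  "face_bond ?B = ((a, b - 1), (a, b))" "face_bond ?L = ((a, b), (a - 1, b))"
  using face_bond_simps(1)[of a "b + 1"] face_bond_simps(2)[of "a + 1" b] by (simp_all add: face_bond_simps)
 have "edge_character La j th = (\<Prod>e\<in>{?B, ?T, ?L, ?R}. ?f e)"
  unfolding edge_character_def
 proof (rule prod.mono_neutral_cong)
  show "?f e = 1" if e: "e \<in> pos_edges La - {?B, ?T, ?L, ?R}" for e
  proof -
   have "e \<in> pos_edges La" using e by simp
   from pos_edges_cases[OF this] obtain x y where "e = ((x, y), (x + 1, y)) \<or> e = ((x, y), (x, y + 1))"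
    by (elim exE)
   then have "bond th (face_bond e) = 1"
   proof
    assume "e = ((x, y), (x + 1, y))"
    then show ?thesis using e by (auto simp: face_bond_simps bond_def th_def)
   next
    assume "e = ((x, y), (x, y + 1))"
    then show ?thesis using e by (auto simp: face_bond_simps bond_def th_def)
   qed
   then show ?thesis by simp
  qed
 qed (use La j in auto)
 also have "... = ?f ?B * (?f ?T * (?f ?L * ?f ?R))" by simp
 also have "... = w powi (- j ?B) * (w powi j ?T * (w powi j ?L * w powi (- j ?R)))"
 proof -
  have "bond th (face_bond ?B) = inverse w" "bond th (face_bond ?T) = w" "bond th (face_bond ?L) = w"
   "bond th (face_bond ?R) = inverse w"
   unfolding fb by (simp_all add: bond_def th_def wi)
  then show ?thesis by (simp only: power_int_inverse power_int_minus)
 qed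
 also have "... = w powi (- j ?B + (j ?T + (j ?L + - j ?R)))"
  using w0 by (simp only: power_int_add simp_thms)
 also have "... = w powi n" by (simp add: n_def algebra_simps)
 also have "... = cis pi" using n unfolding w_def by (simp add: cis_power_int)
 finally show False using triv[OF th] by simp
qed

text \<open>Without circulation the increments can be summed from the left of the square. That the
  heights vanish outside the square on the other sides too is where its shape enters.\<close>

lemma trivial_edge_character_grad:
 assumes j: "\<And>e. e \<notin> pos_edges (square R) ==> j e = 0"
  and triv: "\<And>th. th \<in> space spin_space ==> edge_character (square R) j th = 1"
 shows "j \<in> grad (square R) ` heights (square R) (%_. 0)"
proof -
 define jE where "jE a b = j ((a, b), (a + 1, b))" for a b
 define jN where "jN a b = j ((a, b), (a, b + 1))" for a b
 have curl: "jN (a + 1) b = jN a b + jE a (b + 1) - jE a b" for a b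
  using trivial_edge_character_curl[OF j _ triv, of a b] by (simp add: jE_def jN_def)
 have E0: "jE a b = 0" if "\<bar>b\<bar> > int R \<or> a < - int R - 1 \<or> a > int R" for a b
  unfolding jE_def by (rule j) (use that in \<open>auto simp: pos_edges_def incident_edges_def mem_square\<close>)
 have N0: "jN a b = 0" if "\<bar>a\<bar> > int R" for a b
  unfolding jN_def by (rule j) (use that in \<open>auto simp: pos_edges_def incident_edges_def mem_square\<close>)
 define h where "h p = (\<Sum>i\<in>{- int R - 1..<fst p}. jE i (snd p))" for p
 have east: "h (x + 1, y) - h (x, y) = jE x y" for x y
 proof (cases "x \<ge> - int R - 1")
  case True
  then have "{- int R - 1..<x + 1} = insert x {- int R - 1..<x}" by auto
  then show ?thesis by (simp add: h_def)
 qed (simp add: h_def E0)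
 have north: "h (x, y + 1) - h (x, y) = jN x y" for x y
 proof (cases "x \<ge> - int R - 1")
  case True
  then show ?thesis
  proof (induction x rule: int_ge_induct)
   case base
   then show ?case by (simp add: h_def N0)
  next
   case (step x)
   then show ?case using east[of x y] east[of x "y + 1"] curl[of x y] by simp
  qed
 qed (simp add: h_def N0)
 have out: "h (x, y) = 0" if xy: "(x, y) \<notin> square R" for x y
 proof -
  consider "\<bar>y\<bar> > int R" | "x <= - int R - 1" | "x > int R" "\<bar>y\<bar> <= int R" 
  proof -
   have "\<bar>y\<bar> > int R \<or> x <= - int R - 1 \<or> x > int R \<and> \<bar>y\<bar> <= int R" using xy by (simp add: mem_square) linarith
   then show ?thesis using that by blast
  qed
  then show ?thesis
  proof cases
   \<comment> \<open>To the right of the square one descends from the row above it, where the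
     heights are 0, along columns whose increments are 0.\<close>
   case 3
   have "y <= int R + 1" using 3 by auto
   then show ?thesis
   proof (induction y rule: int_le_induct)
    case base
    then show ?case by (simp add: h_def E0)
   next
    case (step y)
    then show ?case using north[of x "y - 1"] N0[of x "y - 1"] 3 by simp
   qed
  qed (simp_all add: h_def E0)
 qed
 have "h \<in> heights (square R) (%_. 0)" using out by (auto simp: heights_def)
 moreover have "j = grad (square R) h"
 proof
  fix e
  show "j e = grad (square R) h e"
  proof (cases "e \<in> pos_edges (square R)")
   case True
   then obtain x y where "e = ((x, y), (x + 1, y)) \<or> e = ((x, y), (x, y + 1))"
    using pos_edges_cases by blast
   then show ?thesis using True east[of x y] north[of x y] by (auto simp: grad_def jE_def jN_def)
  qed (simp add: j grad_def)
 qed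
 ultimately show ?thesis by blast
qed

section \<open>Second moments of the heights\<close>

text \<open>Orthogonality of characters turns the constraint of being a gradient into an integral
  over spins on the faces.\<close>

lemma grad_character_indicator:
 assumes be: "be > 0" and j: "j \<in> set_pmf (edge_pmf be (square R))"
 shows "(\<integral>th. Re (edge_character (square R) j th) \<partial>spin_space) =
  indicator (grad (square R) ` heights (square R) (%_. 0)) j"
proof (cases "j \<in> grad (square R) ` heights (square R) (%_. 0)")
 case True
 have "edge_character (square R) j th = 1" if "th \<in> space spin_space" for th
 proof -
  have "\<And>x. norm (th x) = 1" using that unfolding space_spin_space by blast
  then show ?thesis using True edge_character_grad[OF finite_square] by blast
 qed
 then have "(\<integral>th. Re (edge_character (square R) j th) \<partial>spin_space) = (\<integral>th. 1 \<partial>(spin_space :: site spin measure))"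
  by (intro Bochner_Integration.integral_cong) auto
 then show ?thesis using True by (simp add: spin.prob_space)
next
 case False
 have "\<And>e. e \<notin> pos_edges (square R) ==> j e = 0" using j unfolding set_edge_pmf[OF be finite_square] by blast
 then obtain th where "th \<in> space spin_space" "edge_character (square R) j th \<noteq> 1"
  using False trivial_edge_character_grad[of R j] by blast
 from spin.integral_Re_character_zero[OF edge_character this] show ?thesis using False by simp
qed

lemma edge_character_measurable:
 "(%p. edge_character La (fst p) (snd p)) \<in> borel_measurable (measure_pmf P \<Otimes>\<^sub>M spin_space)"
 unfolding edge_character_def
proof (rule borel_measurable_prod)
 fix e
 have j: "(%p. fst p e) \<in> measurable (measure_pmf P \<Otimes>\<^sub>M (spin_space :: site spin measure)) (count_space UNIV)"
  by (rule measurable_compose[OF measurable_fst]) simp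
 have "(%th. bond th (face_bond e) powi n) \<in> borel_measurable spin_space" for n
  using character_power_int[OF bond_character] unfolding spin.character_def by blast
 then have "(%p. bond (snd p) (face_bond e) powi n) \<in> borel_measurable (measure_pmf P \<Otimes>\<^sub>M spin_space)" for n
  by (rule measurable_compose[OF measurable_snd])
 from measurable_compose_countable[OF this j]
 show "(%p. bond (snd p) (face_bond e) powi fst p e) \<in> borel_measurable (measure_pmf P \<Otimes>\<^sub>M spin_space)" .
qed

lemma edge_character_Re_bound: "th \<in> space spin_space ==> \<bar>Re (edge_character La j th)\<bar> <= 1"
 using edge_character[of La j] abs_Re_le_cmod[of "edge_character La j th"] unfolding spin.character_def by simp

lemma edge_character_fubini:
 fixes F :: "(site \<times> site => int) => real"
 assumes F: "integrable (measure_pmf P) F"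
 shows "(\<integral>j. F j * (\<integral>th. Re (edge_character La j th) \<partial>spin_space) \<partial>measure_pmf P) =
  (\<integral>th. (\<integral>j. F j * Re (edge_character La j th) \<partial>measure_pmf P) \<partial>spin_space)"
proof -
 let ?S = "spin_space :: site spin measure"
 interpret PS: pair_sigma_finite "measure_pmf P" ?S by (intro pair_sigma_finite.intro) unfold_locales
 let ?f = "%j th. F j * Re (edge_character La j th)"
 have m: "case_prod ?f \<in> borel_measurable (measure_pmf P \<Otimes>\<^sub>M ?S)"
 proof -
  have "(%p. Re (edge_character La (fst p) (snd p))) \<in> borel_measurable (measure_pmf P \<Otimes>\<^sub>M ?S)"
   using edge_character_measurable by measurable
  moreover have "(%p. F (fst p)) \<in> borel_measurable (measure_pmf P \<Otimes>\<^sub>M ?S)"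
   by (rule measurable_compose[OF measurable_fst]) simp
  ultimately show ?thesis unfolding case_prod_unfold by (rule borel_measurable_times[rotated])
 qed
 have in2: "integrable ?S (?f j)" for j
  using spin.bdd_meas_integrable[OF spin.bdd_meas_character(1)[OF edge_character]] by simp
 have bound: "\<bar>\<integral>th. norm (?f j th) \<partial>?S\<bar> <= \<bar>F j\<bar>" for j
 proof -
  have "(\<integral>th. norm (?f j th) \<partial>?S) <= (\<integral>th. \<bar>F j\<bar> \<partial>?S)"
  proof (rule integral_mono)
   show "integrable ?S (%th. norm (?f j th))" by (rule integrable_norm[OF in2])
   show "norm (?f j th) <= \<bar>F j\<bar>" if "th \<in> space ?S" for th
    using edge_character_Re_bound[OF that, of La j] by (simp add: abs_mult mult_left_le)
  qed simp
  then show ?thesis by (simp add: spin.prob_space)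
 qed
 have "integrable (measure_pmf P \<Otimes>\<^sub>M ?S) (case_prod ?f)"
 proof (rule PS.Fubini_integrable[OF m])
  show "integrable (measure_pmf P) (%j. \<integral>th. norm (case_prod ?f (j, th)) \<partial>?S)"
   by (rule Bochner_Integration.integrable_bound[OF F]) (use bound in auto)
  show "AE j in measure_pmf P. integrable ?S (%th. case_prod ?f (j, th))" using in2 by simp
 qed
 from PS.Fubini_integral[OF this] show ?thesis by simp
qed

lemma integrable_skellam_moment:
 assumes "be > 0" "k <= 2" shows "integrable (measure_pmf (skellam_pmf be)) (%n. of_int n ^ k :: real)"
proof -
 have "integrable (measure_pmf (skellam_pmf be)) (%n. Re (of_int n ^ k * 1 powi n))"
  by (intro integrable_Re skellam_moments(1)[OF assms(1) _ assms(2)]) simp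
 moreover have "Re (of_int n ^ k * 1 powi n) = of_int n ^ k" for n
  by (simp only: power_int_1_left mult_1_right of_int_power[symmetric]) simp
 ultimately show ?thesis by simp
qed

definition dual_weight :: "real => site set => site spin => real" where
 "dual_weight be La th = exp (\<Sum>e\<in>pos_edges La. be * (Re (bond th (face_bond e)) - 1))"

text \<open>With the constraint written as a spin integral and the integrals exchanged, the edges
  are independent for each spin field, and every edge contributes a twisted Skellam moment.\<close>

lemma dual_moment:
 assumes be: "be > 0" and k: "\<And>e. k e <= 2"
 shows "integrable (measure_pmf (edge_pmf be (square R))) (%j. \<Prod>e\<in>pos_edges (square R). of_int (j e) ^ k e :: real)"
  "(\<integral>j. (\<Prod>e\<in>pos_edges (square R). of_int (j e) ^ k e) * indicator (grad (square R) ` heights (square R) (%_. 0)) j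
    \<partial>measure_pmf (edge_pmf be (square R))) =
   (\<integral>th. Re (\<Prod>e\<in>pos_edges (square R). skellam_moment be (k e) (bond th (face_bond e))) * dual_weight be (square R) th \<partial>spin_space)"
proof -
 let ?E = "pos_edges (square R)" and ?J = "edge_pmf be (square R)"
 let ?F = "%j. \<Prod>e\<in>?E. of_int (j e) ^ k e :: real"
 let ?b = "%th e. bond th (face_bond e)"
 show F: "integrable (measure_pmf ?J) ?F"
  unfolding edge_pmf_def by (intro integrable_prod_Pi_pmf integrable_skellam_moment be k) simp
 have inner: "(\<integral>j. ?F j * Re (edge_character (square R) j th) \<partial>measure_pmf ?J) =
   Re (\<Prod>e\<in>?E. skellam_moment be (k e) (?b th e)) * dual_weight be (square R) th" if th: "th \<in> space spin_space" for th
 proof -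
  have nb: "norm (?b th e) = 1" for e by (rule norm_bond) (use th in \<open>unfold space_spin_space, blast\<close>)
  let ?t = "%e n. of_int n ^ k e * ?b th e powi n"
  have t: "?F j * Re (edge_character (square R) j th) = Re (\<Prod>e\<in>?E. ?t e (j e))" for j
  proof -
   have p: "(\<Prod>e\<in>?E. ?t e (j e)) = of_real (?F j) * edge_character (square R) j th"
    by (simp add: prod.distrib edge_character_def)
   have "Re (of_real r * z) = r * Re z" for r z by simp
   then show ?thesis unfolding p by (rule sym)
  qed
  have i: "integrable (measure_pmf (skellam_pmf be)) (?t e)" for e by (rule skellam_moments(1)[OF be nb k])
  have "(\<integral>j. ?F j * Re (edge_character (square R) j th) \<partial>measure_pmf ?J) = Re (\<integral>j. (\<Prod>e\<in>?E. ?t e (j e)) \<partial>measure_pmf ?J)"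
   unfolding t edge_pmf_def by (rule integral_Re, rule integrable_prod_Pi_pmf) (use i in auto)
  also have "(\<integral>j. (\<Prod>e\<in>?E. ?t e (j e)) \<partial>measure_pmf ?J) = (\<Prod>e\<in>?E. \<integral>n. ?t e n \<partial>measure_pmf (skellam_pmf be))"
   unfolding edge_pmf_def by (rule integral_prod_Pi_pmf) (use i in auto)
  also have "... = (\<Prod>e\<in>?E. skellam_moment be (k e) (?b th e) * exp (of_real (be * (Re (?b th e) - 1))))"
   by (intro prod.cong refl skellam_moments(2)[OF be nb k])
  also have "... = (\<Prod>e\<in>?E. skellam_moment be (k e) (?b th e)) * of_real (dual_weight be (square R) th)"
   by (simp only: prod.distrib dual_weight_def exp_sum[OF finite_pos_edges[OF finite_square]] of_real_prod exp_of_real)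
  finally show ?thesis by simp
 qed
 have "(\<integral>j. ?F j * indicator (grad (square R) ` heights (square R) (%_. 0)) j \<partial>measure_pmf ?J) =
   (\<integral>j. ?F j * (\<integral>th. Re (edge_character (square R) j th) \<partial>spin_space) \<partial>measure_pmf ?J)"
  by (rule integral_cong_AE) (auto simp: AE_measure_pmf_iff grad_character_indicator[OF be])
 also have "... = (\<integral>th. Re (\<Prod>e\<in>?E. skellam_moment be (k e) (?b th e)) * dual_weight be (square R) th \<partial>spin_space)"
  unfolding edge_character_fubini[OF F] by (rule Bochner_Integration.integral_cong[OF refl inner])
 finally show "(\<integral>j. ?F j * indicator (grad (square R) ` heights (square R) (%_. 0)) j \<partial>measure_pmf ?J) =
   (\<integral>th. Re (\<Prod>e\<in>?E. skellam_moment be (k e) (?b th e)) * dual_weight be (square R) th \<partial>spin_space)" .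
qed

definition dual_bonds :: "nat => (site \<times> site) set" where
 "dual_bonds R = face_bond ` incident_edges (square R)"

lemma dual_bonds_Z2: "dual_bonds R \<subseteq> Z2_edges" "finite (dual_bonds R)"
 using face_bond_Z2_edges finite_incident_edges[OF finite_square] by (auto simp: dual_bonds_def incident_edges_def)

text \<open>The dual bonds contain both orientations, whence \<open>be / 2\<close>; the constant
  factor cancels in all quotients.\<close>

lemma dual_weight_energy:
 "dual_weight be (square R) th = exp (xy_energy (be / 2) (dual_bonds R) th) * exp (- be * card (pos_edges (square R)))"
proof -
 let ?E = "pos_edges (square R)"
 have inj: "inj_on face_bond (incident_edges (square R))"
  by (rule inj_on_subset[OF inj_on_face_bond]) (auto simp: incident_edges_def)
 let ?r = "%e. be / 2 * Re (bond th (face_bond e))"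
 have sw: "?r (prod.swap e) = ?r e" for e unfolding bond_face_swap by simp
 have "xy_energy (be / 2) (dual_bonds R) th = (\<Sum>e\<in>incident_edges (square R). ?r e)"
  unfolding xy_energy_def dual_bonds_def by (simp add: sum.reindex[OF inj])
 also have "... = (\<Sum>e\<in>?E. ?r e) + (\<Sum>e\<in>prod.swap ` ?E. ?r e)"
  unfolding incident_pos_edges(1) using incident_pos_edges(2) by (intro sum.union_disjoint) auto
 also have "(\<Sum>e\<in>prod.swap ` ?E. ?r e) = (\<Sum>e\<in>?E. ?r e)"
  by (subst sum.reindex) (simp_all only: o_def sw inj_swap)
 also have "(\<Sum>e\<in>?E. ?r e) + (\<Sum>e\<in>?E. ?r e) = (\<Sum>e\<in>?E. be * Re (bond th (face_bond e)))"
  by (simp add: sum.distrib[symmetric])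
 also have "... = (\<Sum>e\<in>?E. be * (Re (bond th (face_bond e)) - 1)) + be * card ?E"
  by (simp add: right_diff_distrib sum_subtractf)
 finally show ?thesis unfolding dual_weight_def exp_add[symmetric] by simp
qed

lemma gibbs_partition_dual:
 assumes "be > 0"
 shows "gibbs_partition be (square R) (%_. 0) = (\<integral>th. dual_weight be (square R) th \<partial>spin_space)"
 using dual_moment(2)[OF assms, of "%_. 0" R]
 by (simp add: gibbs_partition_def skellam_moment_def)

definition edge_diff :: "(site => int) => site \<times> site => real" where
 "edge_diff h e = of_int (h (snd e) - h (fst e))"

definition edge_current :: "site spin => site \<times> site => real" where
 "edge_current th e = Im (bond th (face_bond e))"

text \<open>Two distinct edges each contribute a first moment, and the product of the two factors i
  gives the minus sign. For equal edges the second moment adds the diagonal term.\<close>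

lemma zero_boundary_covariance:
 assumes be: "be > 0" and e: "e \<in> pos_edges (square R)" "e' \<in> pos_edges (square R)"
 shows "integrable (measure_pmf (gibbs_pmf be (square R) (%_. 0))) (%h. edge_diff h e * edge_diff h e')" (is ?thesis_a)
  "(\<integral>h. edge_diff h e * edge_diff h e' \<partial>measure_pmf (gibbs_pmf be (square R) (%_. 0))) =
   (if e = e' then be * xy_mean (be / 2) (dual_bonds R) (%th. Re (bond th (face_bond e))) else 0)
   - be\<^sup>2 * xy_mean (be / 2) (dual_bonds R) (%th. edge_current th e * edge_current th e')"
proof -
 let ?E = "pos_edges (square R)" and ?J = "edge_pmf be (square R)" and ?c = "be / 2"
 let ?b = "%th e. bond th (face_bond e)"
 \<comment> \<open>The exponent is 2 when both edges coincide, which selects the second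
   moment.\<close>
 let ?k = "%x. (if x = e then 1 else 0) + (if x = e' then 1 else (0 :: nat))"
 let ?F = "%j. \<Prod>x\<in>?E. of_int (j x) ^ ?k x :: real"
 have k: "?k x <= 2" for x by simp
 have fin: "finite ?E" by simp
 have F: "?F j = of_int (j e) * of_int (j e')" for j
 proof -
  have "?F j = (\<Prod>x\<in>?E. (if x = e then of_int (j x) else 1) * (if x = e' then of_int (j x) else 1))"
   by (rule prod.cong) auto
  then show ?thesis using e by (simp add: prod.distrib)
 qed
 have d: "edge_diff h e * edge_diff h e' = ?F (grad (square R) h)" for h
  unfolding F using e by (simp add: edge_diff_def grad_def)
 define q where "q th = (if e = e' then be * Re (?b th e) else 0) - be\<^sup>2 * (edge_current th e * edge_current th e')" for th
 have q: "Re (\<Prod>x\<in>?E. skellam_moment be (?k x) (?b th x)) = q th" for th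
 proof (cases "e = e'")
  case True
  have "(\<Prod>x\<in>?E. skellam_moment be (?k x) (?b th x)) = (\<Prod>x\<in>?E. if x = e then of_real (be * Re (?b th x) - (be * Im (?b th x))\<^sup>2) else 1)"
   using True by (intro prod.cong) (auto simp: skellam_moment_def)
  also have "... = of_real (be * Re (?b th e) - (be * Im (?b th e))\<^sup>2)" using e by simp
  finally show ?thesis using True by (simp add: q_def edge_current_def power2_eq_square)
 next
  case False
  have "(\<Prod>x\<in>?E. skellam_moment be (?k x) (?b th x)) = (\<Prod>x\<in>?E. (if x = e then \<i> * (be * Im (?b th x)) else 1) * (if x = e' then \<i> * (be * Im (?b th x)) else 1))"
   using False by (intro prod.cong) (auto simp: skellam_moment_def)
  also have "... = \<i> * (be * Im (?b th e)) * (\<i> * (be * Im (?b th e')))" using e by (simp add: prod.distrib)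
  finally show ?thesis using False by (simp add: q_def edge_current_def power2_eq_square)
 qed
 note dm = dual_moment[OF be, of ?k R, OF k]
 note ge = gibbs_expectation[OF be finite_square dm(1), of "%_. 0"]
 show ?thesis_a
  unfolding d by (rule ge(1))
 have "(\<integral>h. edge_diff h e * edge_diff h e' \<partial>measure_pmf (gibbs_pmf be (square R) (%_. 0))) =
   (\<integral>th. q th * dual_weight be (square R) th \<partial>spin_space) / (\<integral>th. dual_weight be (square R) th \<partial>spin_space)"
  unfolding d ge(2) dm(2) q gibbs_partition_dual[OF be] ..
 also have "... = xy_mean ?c (dual_bonds R) q"
  unfolding dual_weight_energy xy_mean_def by (simp add: mult.assoc[symmetric])
 also have "... = (if e = e' then be * xy_mean ?c (dual_bonds R) (%th. Re (?b th e)) else 0)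
   - be\<^sup>2 * xy_mean ?c (dual_bonds R) (%th. edge_current th e * edge_current th e')"
 proof -
  have b: "bdd_meas spin_space (%th. edge_current th e * edge_current th e')" unfolding edge_current_def by (intro bdd_meas_mult bdd_meas_bond)
  have b': "bdd_meas spin_space (%th. if e = e' then be * Re (?b th e) else 0)"
   by (cases "e = e'") (auto intro!: bdd_meas_cmult bdd_meas_bond bdd_meas_const)
  show ?thesis
   unfolding q_def xy_mean_diff[OF b' bdd_meas_cmult[OF b]] xy_mean_cmult
   by (cases "e = e'") (simp_all add: xy_mean_cmult xy_mean_const)
 qed
 finally show "(\<integral>h. edge_diff h e * edge_diff h e' \<partial>measure_pmf (gibbs_pmf be (square R) (%_. 0))) =
   (if e = e' then be * xy_mean ?c (dual_bonds R) (%th. Re (?b th e)) else 0)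
   - be\<^sup>2 * xy_mean ?c (dual_bonds R) (%th. edge_current th e * edge_current th e')" .
qed

lemma zero_boundary_square_sum:
 assumes be: "be > 0" and S: "S \<subseteq> pos_edges (square R)"
 defines "P \<equiv> gibbs_pmf be (square R) (%_. 0)"
 shows "integrable (measure_pmf P) (%h. (\<Sum>e\<in>S. edge_diff h e)\<^sup>2)" (is ?thesis_a)
  "(\<integral>h. (\<Sum>e\<in>S. edge_diff h e)\<^sup>2 \<partial>measure_pmf P) = (\<Sum>e\<in>S. \<Sum>e'\<in>S. \<integral>h. edge_diff h e * edge_diff h e' \<partial>measure_pmf P)"
  "(\<integral>h. (\<Sum>e\<in>S. edge_diff h e)\<^sup>2 \<partial>measure_pmf P) <= be * card S" (is ?thesis_b)
proof -
 have fin: "finite S" using S finite_pos_edges[OF finite_square] finite_subset by blast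
 have sq: "(\<Sum>e\<in>S. edge_diff h e)\<^sup>2 = (\<Sum>e\<in>S. \<Sum>e'\<in>S. edge_diff h e * edge_diff h e')" for h
  by (simp add: power2_eq_square sum_product)
 have i: "integrable (measure_pmf P) (%h. edge_diff h e * edge_diff h e')" if "e \<in> S" "e' \<in> S" for e e'
  unfolding P_def using zero_boundary_covariance(1)[OF be] S that by blast
 show ?thesis_a
  unfolding sq by (intro Bochner_Integration.integrable_sum i)
 show 2: "(\<integral>h. (\<Sum>e\<in>S. edge_diff h e)\<^sup>2 \<partial>measure_pmf P) = (\<Sum>e\<in>S. \<Sum>e'\<in>S. \<integral>h. edge_diff h e * edge_diff h e' \<partial>measure_pmf P)"
  unfolding sq by (simp add: Bochner_Integration.integral_sum Bochner_Integration.integrable_sum i)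
 let ?m = "xy_mean (be / 2) (dual_bonds R)"
 have "(\<Sum>e\<in>S. \<Sum>e'\<in>S. \<integral>h. edge_diff h e * edge_diff h e' \<partial>measure_pmf P) =
   (\<Sum>e\<in>S. \<Sum>e'\<in>S. (if e = e' then be * ?m (%th. Re (bond th (face_bond e))) else 0) - be\<^sup>2 * ?m (%th. edge_current th e * edge_current th e'))"
  unfolding P_def using S by (intro sum.cong refl zero_boundary_covariance(2)[OF be]) auto
 also have "... = (\<Sum>e\<in>S. be * ?m (%th. Re (bond th (face_bond e)))) - be\<^sup>2 * (\<Sum>e\<in>S. \<Sum>e'\<in>S. ?m (%th. edge_current th e * edge_current th e'))"
  using fin by (simp add: sum_subtractf sum.delta' sum_distrib_left)
 also have "(\<Sum>e\<in>S. \<Sum>e'\<in>S. ?m (%th. edge_current th e * edge_current th e')) = ?m (%th. (\<Sum>e\<in>S. edge_current th e)\<^sup>2)"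
 proof -
  have b: "bdd_meas spin_space (%th. edge_current th e * edge_current th e')" for e e'
   unfolding edge_current_def by (intro bdd_meas_mult bdd_meas_bond)
  show ?thesis
   by (simp only: power2_eq_square sum_product xy_mean_sum[OF b] xy_mean_sum[OF bdd_meas_sum[OF b]])
 qed
 also have "(\<Sum>e\<in>S. be * ?m (%th. Re (bond th (face_bond e)))) - be\<^sup>2 * ... <= (\<Sum>e\<in>S. be * 1) - 0"
  using be by (intro diff_mono sum_mono mult_left_mono xy_mean_character_le_one bond_character mult_nonneg_nonneg xy_mean_nonneg) auto
 finally show ?thesis_b
  unfolding 2 by (simp add: mult.commute)
qed

section \<open>Variance of height differences\<close>

lemma eventually_pos_edges:
 assumes "e = ((a, b), (a + 1, b)) \<or> e = ((a, b), (a, b + 1))"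
 shows "eventually (%R. e \<in> pos_edges (square R)) sequentially"
proof (rule eventually_sequentiallyI)
 fix R assume "rad (a, b) <= R"
 then show "e \<in> pos_edges (square R)"
  using assms by (auto simp: pos_edges_def incident_edges_def square_def Z2_edges_def)
qed

lemma eventually_dual_bonds:
 assumes "b \<in> Z2_edges" shows "eventually (%R. b \<in> dual_bonds R) sequentially"
proof -
 obtain e where e: "e \<in> Z2_edges" "face_bond e = b" using face_bond_surj[OF assms] by blast
 show ?thesis
 proof (rule eventually_sequentiallyI)
  fix R assume "rad (fst e) <= R"
  then have "e \<in> incident_edges (square R)" using e(1) by (auto simp: incident_edges_def square_def)
  then show "b \<in> dual_bonds R" using e(2) unfolding dual_bonds_def by blast
 qed
qed

lemma xy_lim_cnj: "xy_lim c (%th. cnj (\<xi> th)) = xy_lim c \<xi>"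
 by (simp add: xy_lim_def)

section \<open>Covariances in infinite volume and the variance along rows\<close>

definition current_covariance :: "real => site \<times> site => site \<times> site => real" where
 "current_covariance c e e' = (xy_lim c (%th. bond th (face_bond e) * cnj (bond th (face_bond e'))) -
   xy_lim c (%th. bond th (face_bond e) * bond th (face_bond e'))) / 2"

definition edge_covariance :: "real => site \<times> site => site \<times> site => real" where
 "edge_covariance be e e' = (if e = e' then be * xy_lim (be / 2) (%th. bond th (face_bond e)) else 0) -
   be\<^sup>2 * current_covariance (be / 2) e e'"

lemma xy_mean_current:
 "xy_mean c F (%th. edge_current th e * edge_current th e') =
  (xy_mean c F (%th. Re (bond th (face_bond e) * cnj (bond th (face_bond e')))) -
   xy_mean c F (%th. Re (bond th (face_bond e) * bond th (face_bond e')))) / 2"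
proof -
 have ch: "spin.character (%th. bond th (face_bond e) * cnj (bond th (face_bond e')))"
  "spin.character (%th. bond th (face_bond e) * bond th (face_bond e'))"
  by (intro spin.character_mult spin.character_cnj bond_character)+
 have "edge_current th e * edge_current th e' = (1 / 2) * (Re (bond th (face_bond e) * cnj (bond th (face_bond e'))) -
   Re (bond th (face_bond e) * bond th (face_bond e')))" for th
  by (simp add: edge_current_def)
 then show ?thesis
  by (simp only: xy_mean_cmult xy_mean_diff[OF spin.bdd_meas_character(1)[OF ch(1)] spin.bdd_meas_character(1)[OF ch(2)]])
qed

lemma zero_boundary_covariance_limit:
 assumes be: "be > 0"
  and e: "eventually (%R. e \<in> pos_edges (square R)) sequentially" "eventually (%R. e' \<in> pos_edges (square R)) sequentially"
 shows "(%R. \<integral>h. edge_diff h e * edge_diff h e' \<partial>measure_pmf (gibbs_pmf be (square R) (%_. 0)))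
  \<longlonglongrightarrow> edge_covariance be e e'"
proof -
 have lim: "(%R. xy_mean (be / 2) (dual_bonds R) (%th. Re (\<xi> th))) \<longlonglongrightarrow> xy_lim (be / 2) \<xi>"
  if "spin.character \<xi>" for \<xi>
  using be that by (intro xy_lim_tendsto dual_bonds_Z2 eventually_dual_bonds) auto
 have "(%R. (if e = e' then be * xy_mean (be / 2) (dual_bonds R) (%th. Re (bond th (face_bond e))) else 0)
   - be\<^sup>2 * xy_mean (be / 2) (dual_bonds R) (%th. edge_current th e * edge_current th e')) \<longlonglongrightarrow> edge_covariance be e e'"
  unfolding edge_covariance_def xy_mean_current current_covariance_def
 proof (intro tendsto_diff tendsto_mult tendsto_const tendsto_divide lim spin.character_mult spin.character_cnj bond_character)
  show "(%R. if e = e' then be * xy_mean (be / 2) (dual_bonds R) (%th. Re (bond th (face_bond e))) else 0) \<longlonglongrightarrow>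
   (if e = e' then be * xy_lim (be / 2) (%th. bond th (face_bond e)) else 0)"
   by (cases "e = e'") (auto intro!: tendsto_mult lim bond_character)
 qed auto
 then show ?thesis
 proof (rule Lim_transform_eventually)
  show "eventually (%R. (if e = e' then be * xy_mean (be / 2) (dual_bonds R) (%th. Re (bond th (face_bond e))) else 0)
   - be\<^sup>2 * xy_mean (be / 2) (dual_bonds R) (%th. edge_current th e * edge_current th e') =
   (\<integral>h. edge_diff h e * edge_diff h e' \<partial>measure_pmf (gibbs_pmf be (square R) (%_. 0)))) sequentially"
   using e by eventually_elim (rule zero_boundary_covariance(2)[OF be, symmetric])
 qed
qed

definition row_edge :: "int => int => site \<times> site" where
 "row_edge b i = ((i, b), (i + 1, b))"

definition column_edge :: "int => int => site \<times> site" where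
 "column_edge a i = ((a, i), (a, i + 1))"

lemma bond_row_edge: "bond th (face_bond (row_edge b i)) = th (i, b - 1) * cnj (th (i, b))"
 and bond_column_edge: "bond th (face_bond (column_edge a i)) = th (a, i) * cnj (th (a - 1, i))"
 by (simp_all add: row_edge_def column_edge_def face_bond_simps bond_def)

lemma current_covariance_commute: "current_covariance c e e' = current_covariance c e' e"
proof -
 have "xy_lim c (%th. bond th (face_bond e) * cnj (bond th (face_bond e'))) =
   xy_lim c (%th. cnj (bond th (face_bond e) * cnj (bond th (face_bond e'))))"
  by (rule xy_lim_cnj[symmetric])
 then show ?thesis by (simp add: current_covariance_def mult.commute)
qed

lemma current_covariance_row_shift:
 "current_covariance c (row_edge b (i + x)) (row_edge b (j + x)) = current_covariance c (row_edge 0 i) (row_edge 0 j)"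
proof -
 have b: "bond (%y. th (y + (x, b))) (face_bond (row_edge 0 i)) = bond th (face_bond (row_edge b (i + x)))" for th i
  unfolding bond_row_edge by simp
 have ch: "spin.character (%th. bond th (face_bond (row_edge 0 i)) * cnj (bond th (face_bond (row_edge 0 j))))"
  "spin.character (%th. bond th (face_bond (row_edge 0 i)) * bond th (face_bond (row_edge 0 j)))"
  by (intro spin.character_mult spin.character_cnj bond_character)+
 show ?thesis
  unfolding current_covariance_def
   xy_lim_shift[OF ch(1), where c=c and v="(x, b)", symmetric] xy_lim_shift[OF ch(2), where c=c and v="(x, b)", symmetric] b ..
qed

text \<open>Exchanging the coordinates maps rows to columns and reverses the dual bonds; the
  resulting conjugation is invisible in real parts.\<close>

lemma current_covariance_column:
 "current_covariance c (column_edge a i) (column_edge a j) = current_covariance c (row_edge a i) (row_edge a j)"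
proof -
 have sw: "bond (%x. th (prod.swap x)) (face_bond (row_edge a i)) = cnj (bond th (face_bond (column_edge a i)))" for th i
  unfolding bond_row_edge bond_column_edge by (simp add: mult.commute)
 have "xy_lim c (%th. cnj (bond th (face_bond (column_edge a i)) * cnj (bond th (face_bond (column_edge a j))))) =
   xy_lim c (%th. bond th (face_bond (row_edge a i)) * cnj (bond th (face_bond (row_edge a j))))"
  using xy_lim_swap[of "%th. bond th (face_bond (row_edge a i)) * cnj (bond th (face_bond (row_edge a j)))" c]
  by (simp only: sw spin.character_mult spin.character_cnj bond_character complex_cnj_mult)
 moreover have "xy_lim c (%th. cnj (bond th (face_bond (column_edge a i)) * bond th (face_bond (column_edge a j)))) =
   xy_lim c (%th. bond th (face_bond (row_edge a i)) * bond th (face_bond (row_edge a j)))"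
  using xy_lim_swap[of "%th. bond th (face_bond (row_edge a i)) * bond th (face_bond (row_edge a j))" c]
  by (simp only: sw spin.character_mult spin.character_cnj bond_character complex_cnj_mult)
 ultimately show ?thesis unfolding current_covariance_def xy_lim_cnj by simp
qed

lemma xy_lim_edges:
 "xy_lim c (%th. bond th (face_bond (row_edge b i))) = xy_lim c (%th. bond th (face_bond (row_edge 0 0)))"
 "xy_lim c (%th. bond th (face_bond (column_edge b i))) = xy_lim c (%th. bond th (face_bond (row_edge 0 0)))" (is ?thesis_a)
proof -
 show 1: "xy_lim c (%th. bond th (face_bond (row_edge b i))) = xy_lim c (%th. bond th (face_bond (row_edge 0 0)))" for b i
  using xy_lim_shift[OF bond_character[of "face_bond (row_edge 0 0)"], where c=c and v="(i, b)"] by (simp add: bond_row_edge)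
 have sw: "bond (%x. th (prod.swap x)) (face_bond (row_edge b i)) = cnj (bond th (face_bond (column_edge b i)))" for th
  unfolding bond_row_edge bond_column_edge by (simp add: mult.commute)
 have "xy_lim c (%th. cnj (bond th (face_bond (column_edge b i)))) = xy_lim c (%th. bond th (face_bond (row_edge b i)))"
  using xy_lim_swap[OF bond_character[of "face_bond (row_edge b i)"], where c=c] by (simp only: sw)
 then show ?thesis_a
  unfolding xy_lim_cnj 1[of b i] .
qed

definition row_current :: "real => nat => real" where
 "row_current c k = current_covariance c (row_edge 0 0) (row_edge 0 (int k))"

definition row_covariance :: "real => nat => nat => real" where
 "row_covariance be i j = (if i = j then be * xy_lim (be / 2) (%th. bond th (face_bond (row_edge 0 0))) else 0) -
   be\<^sup>2 * row_current (be / 2) (nat \<bar>int i - int j\<bar>)"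

lemma current_covariance_row:
 "current_covariance c (row_edge b (x + int i)) (row_edge b (x + int j)) = row_current c (nat \<bar>int i - int j\<bar>)"
proof (cases "i <= j")
 case True
 then show ?thesis
  using current_covariance_row_shift[of c b 0 "x + int i" "int j - int i"] by (simp add: row_current_def add.commute)
next
 case False
 then show ?thesis
  using current_covariance_row_shift[of c b 0 "x + int j" "int i - int j"]
  unfolding current_covariance_commute[of c "row_edge b (x + int i)"] by (simp add: row_current_def add.commute)
qed

lemma edge_covariance_row:
 "edge_covariance be (row_edge b (x + int i)) (row_edge b (x + int j)) = row_covariance be i j"
 "edge_covariance be (column_edge b (x + int i)) (column_edge b (x + int j)) = row_covariance be i j"
 unfolding edge_covariance_def row_covariance_def current_covariance_column current_covariance_row
  xy_lim_edges(1)[of "be / 2" b "x + int i"] xy_lim_edges(2)[of "be / 2" b "x + int i"]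
 by (simp_all add: row_edge_def column_edge_def)

definition row_variance :: "real => nat => real" where
 "row_variance be n = (\<Sum>i<n. \<Sum>j<n. row_covariance be i j)"

lemma path_variance_limit:
 assumes be: "be > 0" and inj: "inj f"
  and ev: "\<And>i. eventually (%R. f i \<in> pos_edges (square R)) sequentially"
  and cov: "\<And>i j. edge_covariance be (f i) (f j) = row_covariance be i j"
  and d: "\<And>h. d h = (\<Sum>i<n. edge_diff h (f i))"
 shows "eventually (%R. integrable (measure_pmf (gibbs_pmf be (square R) (%_. 0))) (%h. (d h)\<^sup>2)) sequentially" (is ?int)
  "(%R. \<integral>h. (d h)\<^sup>2 \<partial>measure_pmf (gibbs_pmf be (square R) (%_. 0))) \<longlonglongrightarrow> row_variance be n" (is ?lim)
proof -
 let ?S = "f ` {..<n}"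
 have inj': "inj_on f {..<n}" using inj by (rule inj_on_subset) simp
 have d': "d h = (\<Sum>e\<in>?S. edge_diff h e)" for h using d by (simp add: sum.reindex[OF inj'])
 have "eventually (%R. \<forall>i\<in>{..<n}. f i \<in> pos_edges (square R)) sequentially"
  by (rule eventually_ball_finite) (use ev in auto)
 then have S: "eventually (%R. ?S \<subseteq> pos_edges (square R)) sequentially" by (rule eventually_mono) blast
 show ?int
  unfolding d' using S by eventually_elim (rule zero_boundary_square_sum(1)[OF be])
 have "(%R. \<Sum>i<n. \<Sum>j<n. \<integral>h. edge_diff h (f i) * edge_diff h (f j) \<partial>measure_pmf (gibbs_pmf be (square R) (%_. 0)))
   \<longlonglongrightarrow> row_variance be n"
  unfolding row_variance_def cov[symmetric]
  by (intro tendsto_sum zero_boundary_covariance_limit[OF be] ev)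
 then show ?lim
 proof (rule Lim_transform_eventually)
  show "eventually (%R. (\<Sum>i<n. \<Sum>j<n. \<integral>h. edge_diff h (f i) * edge_diff h (f j) \<partial>measure_pmf (gibbs_pmf be (square R) (%_. 0))) =
    (\<integral>h. (d h)\<^sup>2 \<partial>measure_pmf (gibbs_pmf be (square R) (%_. 0)))) sequentially"
   using S
  proof eventually_elim
   case (elim R)
   show ?case unfolding d' zero_boundary_square_sum(2)[OF be elim] by (simp add: sum.reindex[OF inj'])
  qed
 qed
qed

lemma row_telescope:
 "real_of_int (h (x + int n, b) - h (x, b)) = (\<Sum>i<n. edge_diff h (row_edge b (x + int i)))"
 "real_of_int (h (b, x + int n) - h (b, x)) = (\<Sum>i<n. edge_diff h (column_edge b (x + int i)))"
proof (induction n)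
 case (Suc n)
 {
  case 1
  have e: "x + int (Suc n) = x + int n + 1" by simp
  show ?case unfolding e using Suc.IH(1) by (simp add: edge_diff_def row_edge_def)
 next
  case 2
  have e: "x + int (Suc n) = x + int n + 1" by simp
  show ?case unfolding e using Suc.IH(2) by (simp add: edge_diff_def column_edge_def)
 }
qed simp_all

lemma eventually_row_edge:
 "eventually (%R. row_edge b i \<in> pos_edges (square R)) sequentially"
 "eventually (%R. column_edge b i \<in> pos_edges (square R)) sequentially"
 unfolding row_edge_def column_edge_def
 by (rule eventually_pos_edges[OF disjI1[OF refl]], rule eventually_pos_edges[OF disjI2[OF refl]])

lemma row_variance_limit:
 assumes be: "be > 0"
 shows "eventually (%R. integrable (measure_pmf (gibbs_pmf be (square R) (%_. 0))) (%h. (real_of_int (h (x + int n, b) - h (x, b)))\<^sup>2)) sequentially" (is ?thesis_a)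
  "(%R. \<integral>h. (real_of_int (h (x + int n, b) - h (x, b)))\<^sup>2 \<partial>measure_pmf (gibbs_pmf be (square R) (%_. 0))) \<longlonglongrightarrow> row_variance be n" (is ?thesis_b)
  "eventually (%R. integrable (measure_pmf (gibbs_pmf be (square R) (%_. 0))) (%h. (real_of_int (h (b, x + int n) - h (b, x)))\<^sup>2)) sequentially" (is ?thesis_c)
  "(%R. \<integral>h. (real_of_int (h (b, x + int n) - h (b, x)))\<^sup>2 \<partial>measure_pmf (gibbs_pmf be (square R) (%_. 0))) \<longlonglongrightarrow> row_variance be n" (is ?thesis_d)
proof -
 have inj: "inj (%i. row_edge b (x + int i))" "inj (%i. column_edge b (x + int i))"
  by (auto simp: inj_def row_edge_def column_edge_def)
 note r = path_variance_limit[OF be inj(1) eventually_row_edge(1) edge_covariance_row(1) row_telescope(1)]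
 note c = path_variance_limit[OF be inj(2) eventually_row_edge(2) edge_covariance_row(2) row_telescope(2)]
 show ?thesis_a
  by (rule r(1))
 show ?thesis_b
  by (rule r(2))
 show ?thesis_c
  by (rule c(1))
 show ?thesis_d
  by (rule c(2))
qed

text \<open>Each increment is replaced by the one in row r and two vertical legs; the m identities
  are added and squared, and Cauchy-Schwarz is used for the legs only. The sum over the rows stays
  inside one square, so that their joint variance bound can be applied.\<close>

lemma averaged_rows_inequality:
 fixes X :: real and Y :: real and U V :: "nat => real"
 assumes r: "\<And>r. r < m ==> X = Z r + (U r - V r)" and m: "m > 0"
 shows "(real m)\<^sup>2 * X\<^sup>2 <= 2 * (\<Sum>r<m. Z r)\<^sup>2 + 4 * real m * (\<Sum>r<m. (U r)\<^sup>2 + (V r)\<^sup>2)"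
proof -
 let ?W = "\<Sum>r<m. U r - V r"
 have two: "(p + q)\<^sup>2 <= 2 * p\<^sup>2 + 2 * q\<^sup>2" "(p - q)\<^sup>2 <= 2 * p\<^sup>2 + 2 * q\<^sup>2" for p q :: real
  using zero_le_power2[of "p - q"] zero_le_power2[of "p + q"] by (simp_all add: power2_eq_square algebra_simps)
 have "real m * X = (\<Sum>r<m. X)" by simp
 also have "... = (\<Sum>r<m. Z r + (U r - V r))" by (intro sum.cong refl r) simp
 finally have "(real m * X)\<^sup>2 = ((\<Sum>r<m. Z r) + ?W)\<^sup>2" by (simp add: sum.distrib)
 also have "... <= 2 * (\<Sum>r<m. Z r)\<^sup>2 + 2 * ?W\<^sup>2" by (rule two)
 also have "?W\<^sup>2 <= (\<Sum>r<m. (U r - V r)\<^sup>2) * real m"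
  using Cauchy_Schwarz_ineq_sum[of "%r. U r - V r" "%_. 1" "{..<m}"] by simp
 also have "(\<Sum>r<m. (U r - V r)\<^sup>2) * real m <= (\<Sum>r<m. 2 * (U r)\<^sup>2 + 2 * (V r)\<^sup>2) * real m"
  by (intro mult_right_mono sum_mono two) simp
 also have "(\<Sum>r<m. 2 * (U r)\<^sup>2 + 2 * (V r)\<^sup>2) * real m = 2 * real m * (\<Sum>r<m. (U r)\<^sup>2 + (V r)\<^sup>2)"
  by (simp add: sum_distrib_left sum_distrib_right algebra_simps)
 finally show ?thesis by (simp add: power_mult_distrib)
qed

text \<open>The m rows form one set of m n edges, so their sum has variance at most be m n and their
  average only be n / m; each leg costs at most be m. Growth is sublinear because m is at
  disposal.\<close>

lemma row_variance_upper:
 assumes be: "be > 0" and m: "m > 0"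
 shows "row_variance be n <= be * (2 * real n / real m + 8 * real m)"
proof -
 let ?P = "%R. measure_pmf (gibbs_pmf be (square R) (%_. 0))"
 let ?X = "%h :: site => int. real_of_int (h (0 + int n, 0) - h (0, 0))"
 let ?rows = "(%(r, i). row_edge (int r) (0 + int i)) ` ({..<m} \<times> {..<n})"
 let ?leg = "%a r. (%i. column_edge a (0 + int i)) ` {..<r}"
 have inj: "inj_on (%(r, i). row_edge (int r) (0 + int i)) ({..<m} \<times> {..<n})" "inj_on (%i. column_edge a (0 + int i)) {..<r}" for a r
  by (auto simp: inj_on_def row_edge_def column_edge_def)
 let ?Z = "%h :: site => int. %r. real_of_int (h (0 + int n, int r) - h (0, int r))"
 let ?U = "%a. %h :: site => int. %r. real_of_int (h (a, 0 + int r) - h (a, 0))"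
 have Z: "(\<Sum>r<m. ?Z h r) = (\<Sum>e\<in>?rows. edge_diff h e)" for h
  unfolding row_telescope(1) by (subst sum.reindex[OF inj(1)]) (simp add: sum.cartesian_product o_def case_prod_unfold)
 have U: "?U a h r = (\<Sum>e\<in>?leg a r. edge_diff h e)" for a h r
  unfolding row_telescope(2) by (simp add: sum.reindex[OF inj(2), simplified])
 have ev: "eventually (%R. ?rows \<union> (\<Union>a\<in>{0, int n}. ?leg a m) \<subseteq> pos_edges (square R)) sequentially"
 proof -
  have "eventually (%R. \<forall>e\<in>?rows \<union> (\<Union>a\<in>{0, int n}. ?leg a m). e \<in> pos_edges (square R)) sequentially"
  proof (rule eventually_ball_finite)
   show "\<forall>e\<in>?rows \<union> (\<Union>a\<in>{0, int n}. ?leg a m). eventually (%R. e \<in> pos_edges (square R)) sequentially"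
    using eventually_row_edge by auto
  qed auto
  then show ?thesis by (rule eventually_mono) blast
 qed
 have "eventually (%R. (\<integral>h. (?X h)\<^sup>2 \<partial>?P R) <= be * (2 * real n / real m + 8 * real m)) sequentially"
  using ev row_variance_limit(1)[OF be, of 0 n 0]
 proof eventually_elim
  case (elim R)
  have rows: "?rows \<subseteq> pos_edges (square R)" using elim(1) by blast
  have leg: "?leg a r \<subseteq> pos_edges (square R)" if "a \<in> {0, int n}" "r < m" for a r
  proof -
   have "?leg a r \<subseteq> ?leg a m" using that by (intro image_mono) auto
   then show ?thesis using elim(1) that(1) by blast
  qed
  have cardY: "card ?rows = m * n" by (simp only: card_image[OF inj(1)] card_cartesian_product card_lessThan)
  have cardU: "card (?leg a r) = r" for a r by (simp only: card_image[OF inj(2)] card_lessThan)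
  have iY: "integrable (?P R) (%h. (\<Sum>r<m. ?Z h r)\<^sup>2)" unfolding Z by (rule zero_boundary_square_sum(1)[OF be rows])
  have bY: "(\<integral>h. (\<Sum>r<m. ?Z h r)\<^sup>2 \<partial>?P R) <= be * real (m * n)"
   using zero_boundary_square_sum(3)[OF be rows] unfolding Z cardY .
  have iU: "integrable (?P R) (%h. (?U a h r)\<^sup>2)" if "a \<in> {0, int n}" "r < m" for a r
   unfolding U by (rule zero_boundary_square_sum(1)[OF be leg[OF that]])
  have bU: "(\<integral>h. (?U a h r)\<^sup>2 \<partial>?P R) <= be * real m" if "a \<in> {0, int n}" "r < m" for a r
  proof -
   have "(\<integral>h. (?U a h r)\<^sup>2 \<partial>?P R) <= be * real r"
    using zero_boundary_square_sum(3)[OF be leg[OF that]] unfolding U cardU .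
   also have "... <= be * real m" using be that by (intro mult_left_mono) auto
   finally show ?thesis .
  qed
  have zin: "0 \<in> {0, int n}" "int n \<in> {0, int n}" by auto
  have iUV: "integrable (?P R) (%h. (?U 0 h r)\<^sup>2 + (?U (int n) h r)\<^sup>2)" if "r < m" for r
   by (rule Bochner_Integration.integrable_add[OF iU[OF zin(1) that] iU[OF zin(2) that]])
  have iV: "integrable (?P R) (%h. \<Sum>r<m. (?U 0 h r)\<^sup>2 + (?U (int n) h r)\<^sup>2)"
   by (rule Bochner_Integration.integrable_sum, rule iUV) (simp only: lessThan_iff)
  have bV: "(\<integral>h. (\<Sum>r<m. (?U 0 h r)\<^sup>2 + (?U (int n) h r)\<^sup>2) \<partial>?P R) <= (\<Sum>r<m. be * real m + be * real m)"
  proof -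
   have "(\<integral>h. (\<Sum>r<m. (?U 0 h r)\<^sup>2 + (?U (int n) h r)\<^sup>2) \<partial>?P R) = (\<Sum>r<m. \<integral>h. (?U 0 h r)\<^sup>2 + (?U (int n) h r)\<^sup>2 \<partial>?P R)"
    by (rule Bochner_Integration.integral_sum, rule iUV) (simp only: lessThan_iff)
   also have "... <= (\<Sum>r<m. be * real m + be * real m)"
   proof (rule sum_mono)
    fix r assume "r \<in> {..<m}"
    then have r: "r < m" by simp
    show "(\<integral>h. (?U 0 h r)\<^sup>2 + (?U (int n) h r)\<^sup>2 \<partial>?P R) <= be * real m + be * real m"
     unfolding Bochner_Integration.integral_add[OF iU[OF zin(1) r] iU[OF zin(2) r]]
     by (rule add_mono[OF bU[OF zin(1) r] bU[OF zin(2) r]])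
   qed
   finally show ?thesis .
  qed
  have "(\<integral>h. (real m)\<^sup>2 * (?X h)\<^sup>2 \<partial>?P R) <= (\<integral>h. 2 * (\<Sum>r<m. ?Z h r)\<^sup>2 + 4 * real m * (\<Sum>r<m. (?U 0 h r)\<^sup>2 + (?U (int n) h r)\<^sup>2) \<partial>?P R)"
  proof (rule integral_mono)
   show "integrable (?P R) (%h. (real m)\<^sup>2 * (?X h)\<^sup>2)" using elim(2) by (rule integrable_mult_right)
   show "integrable (?P R) (%h. 2 * (\<Sum>r<m. ?Z h r)\<^sup>2 + 4 * real m * (\<Sum>r<m. (?U 0 h r)\<^sup>2 + (?U (int n) h r)\<^sup>2))"
    by (intro Bochner_Integration.integrable_add integrable_mult_right iY iV)
   fix h :: "site => int"
   show "(real m)\<^sup>2 * (?X h)\<^sup>2 <= 2 * (\<Sum>r<m. ?Z h r)\<^sup>2 + 4 * real m * (\<Sum>r<m. (?U 0 h r)\<^sup>2 + (?U (int n) h r)\<^sup>2)"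
    by (rule averaged_rows_inequality[where X="?X h" and Z="?Z h" and U="?U 0 h" and V="?U (int n) h", OF _ m]) simp
  qed
  also have "... = 2 * (\<integral>h. (\<Sum>r<m. ?Z h r)\<^sup>2 \<partial>?P R) + 4 * real m * (\<integral>h. (\<Sum>r<m. (?U 0 h r)\<^sup>2 + (?U (int n) h r)\<^sup>2) \<partial>?P R)"
   by (simp only: Bochner_Integration.integral_add[OF integrable_mult_right[OF iY] integrable_mult_right[OF iV]] integral_mult_right_zero)
  also have "... <= 2 * (be * real (m * n)) + 4 * real m * (\<Sum>r<m. be * real m + be * real m)"
   by (intro add_mono mult_left_mono bY bV) auto
  also have "... = (real m)\<^sup>2 * (be * (2 * real n / real m + 8 * real m))"
   using m by (simp add: field_simps power2_eq_square)
  finally have "(real m)\<^sup>2 * (\<integral>h. (?X h)\<^sup>2 \<partial>?P R) <= (real m)\<^sup>2 * (be * (2 * real n / real m + 8 * real m))"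
   by (simp only: integral_mult_right_zero)
  then show ?case using m by (simp only: mult_le_cancel_left_pos zero_less_power of_nat_0_less_iff)
 qed
 then have "eventually (%R. (\<integral>h. (?X h)\<^sup>2 \<partial>?P R) <= be * (2 * real n / real m + 8 * real m)) sequentially" .
 from tendsto_upperbound[OF row_variance_limit(2)[OF be, of 0 n 0] this] show ?thesis by simp
qed

text \<open>Adding one edge to the path adds its variance and twice its covariances with the earlier
  edges, which by stationarity depend on the distance only.\<close>

lemma row_variance_increments:
 "row_variance be n = (\<Sum>j<n. row_covariance be 0 0 - 2 * be\<^sup>2 * (\<Sum>k<j. row_current (be / 2) (Suc k)))"
proof (induction n)
 case (Suc n)
 have sym: "row_covariance be i j = row_covariance be j i" for i j
  by (simp add: row_covariance_def abs_minus_commute)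
 have diag: "row_covariance be n n = row_covariance be 0 0" by (simp add: row_covariance_def)
 have "(\<Sum>i<n. row_covariance be i n) = (\<Sum>i<n. - (be\<^sup>2 * row_current (be / 2) (Suc (n - Suc i))))"
 proof (rule sum.cong[OF refl])
  fix i assume "i \<in> {..<n}"
  then have "nat \<bar>int i - int n\<bar> = Suc (n - Suc i)" by auto
  then show "row_covariance be i n = - (be\<^sup>2 * row_current (be / 2) (Suc (n - Suc i)))"
   using \<open>i \<in> {..<n}\<close> by (simp add: row_covariance_def)
 qed
 also have "... = (\<Sum>i<n. - (be\<^sup>2 * row_current (be / 2) (Suc i)))"
  by (rule sum.nat_diff_reindex)
 finally have cross: "(\<Sum>i<n. row_covariance be i n) = - be\<^sup>2 * (\<Sum>k<n. row_current (be / 2) (Suc k))"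
  by (simp add: sum_negf sum_distrib_left)
 have "row_variance be (Suc n) = row_variance be n + 2 * (\<Sum>i<n. row_covariance be i n) + row_covariance be n n"
 proof -
  have "(\<Sum>j<n. row_covariance be n j) = (\<Sum>i<n. row_covariance be i n)" by (rule sum.cong[OF refl sym])
  then show ?thesis by (simp add: row_variance_def sum.distrib)
 qed
 then show ?case using Suc unfolding cross diag by (simp add: algebra_simps)
qed (simp add: row_variance_def)

text \<open>The increments g j decrease because \<open>s\<close> is nonnegative, and sublinear
  growth leaves them no positive limit. Hence g j is at most \<open>\<kappa>\<close> times the tail
  of \<open>s\<close> from j on; in the sum over j each \<open>s k\<close> is counted at most k + 1
  times, which is the first moment.\<close>

lemma concave_variance_bounded:
 fixes s :: "nat => real"
 assumes s: "\<And>k. s k \<ge> 0" and \<kappa>: "\<kappa> \<ge> 0" and B: "\<And>n. (\<Sum>k<n. real (Suc k) * s k) <= B"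
  and up: "\<And>n m. m > 0 ==> (\<Sum>j<n. D - \<kappa> * (\<Sum>k<j. s k)) <= be * (2 * real n / real m + 8 * real m)"
 shows "(\<Sum>j<n. D - \<kappa> * (\<Sum>k<j. s k)) <= \<kappa> * B"
proof -
 define g where "g j = D - \<kappa> * (\<Sum>k<j. s k)" for j
 \<comment> \<open>The difference g j - g K is a multiple of the part of the tail between j and
   K.\<close>
 have split: "g j = g K + \<kappa> * (\<Sum>k<K. if j <= k then s k else 0)" if "j <= K" for j K
 proof -
  have "(\<Sum>k<K. if j <= k then s k else 0) = (\<Sum>k\<in>{j..<K}. s k)"
   by (simp add: sum.If_cases) (rule sum.cong, auto)
  moreover have "(\<Sum>k<K. s k) = (\<Sum>k<j. s k) + (\<Sum>k\<in>{j..<K}. s k)"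
   using sum.atLeastLessThan_concat[of 0 j K s] that by (simp add: lessThan_atLeast0)
  ultimately show ?thesis by (simp add: g_def algebra_simps)
 qed
 have mono: "g K <= g j" if "j <= K" for j K
 proof -
  have "0 <= \<kappa> * (\<Sum>k<K. if j <= k then s k else 0)" using s \<kappa> by (intro mult_nonneg_nonneg sum_nonneg) auto
  then show ?thesis using split[OF that] by simp
 qed
 \<comment> \<open>By monotonicity K + 1 copies of g K are at most the sum of the first K + 1
   increments, to which the sublinear bound applies.\<close>
 have gK: "g K <= be * (2 * inverse (real m) + 8 * real m * inverse (real (Suc K)))" if m: "m > 0" for K m
 proof -
  have "real (Suc K) * g K = (\<Sum>j<Suc K. g K)" by simp
  also have "... <= (\<Sum>j<Suc K. g j)" by (intro sum_mono mono) auto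
  also have "... <= be * (2 * real (Suc K) / real m + 8 * real m)" using up[OF m, of "Suc K"] by (simp only: g_def)
  also have "... = real (Suc K) * (be * (2 * inverse (real m) + 8 * real m * inverse (real (Suc K))))"
  proof -
   have "S * (be * (2 * i + 8 * real m * t)) = be * (2 * S * i + 8 * real m * (S * t))" for S i t :: real
    by (simp add: algebra_simps)
   moreover have "real (Suc K) * inverse (real (Suc K)) = 1" by simp
   ultimately show ?thesis by (simp only: divide_inverse mult_1_right)
  qed
  finally show ?thesis by (simp only: mult_le_cancel_left_pos of_nat_0_less_iff zero_less_Suc)
 qed
 have main: "(\<Sum>j<n. g j) <= real n * g K + \<kappa> * B" if K: "n <= K" for K
 proof -
  have "(\<Sum>j<n. g j) = (\<Sum>j<n. g K + \<kappa> * (\<Sum>k<K. if j <= k then s k else 0))"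
   by (intro sum.cong refl split) (use K in auto)
  also have "... = real n * g K + \<kappa> * (\<Sum>j<n. \<Sum>k<K. if j <= k then s k else 0)"
   by (simp add: sum.distrib sum_distrib_left)
  also have "(\<Sum>j<n. \<Sum>k<K. if j <= k then s k else 0) = (\<Sum>k<K. \<Sum>j<n. if j <= k then s k else 0)"
   by (rule sum.swap)
  also have "... <= (\<Sum>k<K. real (Suc k) * s k)"
  proof (rule sum_mono)
   fix k
   have "(\<Sum>j<n. if j <= k then s k else 0) = real (card ({..<n} \<inter> {j. j <= k})) * s k"
    by (simp add: sum.If_cases)
   also have "card ({..<n} \<inter> {j. j <= k}) <= card {..k}" by (rule card_mono) auto
   then have "real (card ({..<n} \<inter> {j. j <= k})) * s k <= real (Suc k) * s k"
    using s by (intro mult_right_mono) auto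
   finally show "(\<Sum>j<n. if j <= k then s k else 0) <= real (Suc k) * s k" .
  qed
  also have "... <= B" by (rule B)
  finally show ?thesis using \<kappa> by (simp add: mult_left_mono)
 qed
 \<comment> \<open>The order of limits matters: first K tends to infinity with the number of rows
   fixed, then the number of rows does.\<close>
 have lim: "(\<Sum>j<n. g j) <= real n * (be * (2 * inverse (real (Suc M)))) + \<kappa> * B" for M
 proof (rule LIMSEQ_le_const)
  show "(%K. real n * (be * (2 * inverse (real (Suc M)) + 8 * real (Suc M) * inverse (real (Suc K)))) + \<kappa> * B)
    \<longlonglongrightarrow> real n * (be * (2 * inverse (real (Suc M)))) + \<kappa> * B"
  proof -
   have "(%K. real n * (be * (2 * inverse (real (Suc M)) + 8 * real (Suc M) * inverse (real (Suc K)))) + \<kappa> * B)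
    \<longlonglongrightarrow> real n * (be * (2 * inverse (real (Suc M)) + 8 * real (Suc M) * 0)) + \<kappa> * B"
    by (intro tendsto_add tendsto_mult tendsto_const LIMSEQ_inverse_real_of_nat)
   then show ?thesis by simp
  qed
  show "\<exists>N. \<forall>K\<ge>N. (\<Sum>j<n. g j) <= real n * (be * (2 * inverse (real (Suc M)) + 8 * real (Suc M) * inverse (real (Suc K)))) + \<kappa> * B"
  proof (intro exI allI impI)
   fix K assume "n <= K"
   have "real n * g K <= real n * (be * (2 * inverse (real (Suc M)) + 8 * real (Suc M) * inverse (real (Suc K))))"
    by (intro mult_left_mono gK) auto
   then show "(\<Sum>j<n. g j) <= real n * (be * (2 * inverse (real (Suc M)) + 8 * real (Suc M) * inverse (real (Suc K)))) + \<kappa> * B"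
    using main[OF \<open>n <= K\<close>] by linarith
  qed
 qed
 have "(\<Sum>j<n. g j) <= real n * (be * (2 * 0)) + \<kappa> * B"
 proof (rule LIMSEQ_le_const)
  show "(%M. real n * (be * (2 * inverse (real (Suc M)))) + \<kappa> * B) \<longlonglongrightarrow> real n * (be * (2 * 0)) + \<kappa> * B"
   by (intro tendsto_add tendsto_mult tendsto_const LIMSEQ_inverse_real_of_nat)
 qed (use lim in blast)
 then show ?thesis by (simp add: g_def)
qed

text \<open>Two points are joined by a horizontal and a vertical segment; the sum of two increments
  bounded by C in mean square is bounded by 4 C, independently of the distance.\<close>

lemma height_variance_bounded:
 assumes be: "be > 0" and s: "\<And>k. row_current (be / 2) (Suc k) \<ge> 0"
  and B: "\<And>n. (\<Sum>k<n. real (Suc k) * row_current (be / 2) (Suc k)) <= B"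
 shows "\<exists>C. \<forall>x y. eventually (%R. integrable (measure_pmf (gibbs_pmf be (square R) (%_. 0))) (%h. (real_of_int (h y - h x))\<^sup>2) \<and>
  (\<integral>h. (real_of_int (h y - h x))\<^sup>2 \<partial>measure_pmf (gibbs_pmf be (square R) (%_. 0))) <= C) sequentially"
proof -
 let ?P = "%R. measure_pmf (gibbs_pmf be (square R) (%_. 0))"
 \<comment> \<open>The summand 1 makes the bound strict, so that it passes from the limit to all
   large volumes.\<close>
 define C where "C = 2 * be\<^sup>2 * B + 1"
 have V: "row_variance be n < C" for n
 proof -
  have "row_variance be n <= 2 * be\<^sup>2 * B"
   unfolding row_variance_increments
  proof (rule concave_variance_bounded[OF s _ B])
   show "(\<Sum>j<n. row_covariance be 0 0 - 2 * be\<^sup>2 * (\<Sum>k<j. row_current (be / 2) (Suc k))) <= be * (2 * real n / real m + 8 * real m)"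
    if "m > 0" for n m
    using row_variance_upper[OF be that, of n] unfolding row_variance_increments .
  qed simp
  then show ?thesis by (simp add: C_def)
 qed
 define good where "good d \<longleftrightarrow> eventually (%R. integrable (?P R) (%h. (real_of_int (d h))\<^sup>2) \<and> (\<integral>h. (real_of_int (d h))\<^sup>2 \<partial>?P R) <= C) sequentially" for d
 have good_neg: "good (%h. - d h)" if "good d" for d using that by (simp add: good_def)
 have up: "good (%h. h (x + int n, b) - h (x, b))" "good (%h. h (b, x + int n) - h (b, x))" for x n b
  unfolding good_def
  by (rule eventually_mono[OF eventually_conj[OF order_tendstoD(2)[OF row_variance_limit(2)[OF be, of x n b] V] row_variance_limit(1)[OF be, of x n b]]],
    simp)
   (rule eventually_mono[OF eventually_conj[OF order_tendstoD(2)[OF row_variance_limit(4)[OF be, of b x n] V] row_variance_limit(3)[OF be, of b x n]]],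
    simp)
 have row: "good (%h. h (y, b) - h (x, b))" and col: "good (%h. h (b, y) - h (b, x))" for x y b
 proof -
  have "good (%h. h (y, b) - h (x, b)) \<and> good (%h. h (b, y) - h (b, x))"
  proof (cases "x <= y")
   case True
   then show ?thesis using up(1)[of x "nat (y - x)" b] up(2)[of b x "nat (y - x)"] by simp
  next
   case False
   then show ?thesis
    using good_neg[OF up(1)[of y "nat (x - y)" b]] good_neg[OF up(2)[of b y "nat (x - y)"]] by simp
  qed
  then show "good (%h. h (y, b) - h (x, b))" "good (%h. h (b, y) - h (b, x))" by auto
 qed
 have sum: "eventually (%R. integrable (?P R) (%h. (real_of_int (d h + d' h))\<^sup>2) \<and> (\<integral>h. (real_of_int (d h + d' h))\<^sup>2 \<partial>?P R) <= 4 * C) sequentially"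
  if "good d" "good d'" for d d'
  using that unfolding good_def
 proof eventually_elim
  case (elim R)
  have le: "(real_of_int (d h + d' h))\<^sup>2 <= 2 * (real_of_int (d h))\<^sup>2 + 2 * (real_of_int (d' h))\<^sup>2" for h
   using zero_le_power2[of "real_of_int (d h) - real_of_int (d' h)"] by (simp add: power2_eq_square algebra_simps)
  have i2: "integrable (?P R) (%h. 2 * (real_of_int (d h))\<^sup>2)" "integrable (?P R) (%h. 2 * (real_of_int (d' h))\<^sup>2)"
   using elim by (auto intro: integrable_mult_right)
  have i: "integrable (?P R) (%h. 2 * (real_of_int (d h))\<^sup>2 + 2 * (real_of_int (d' h))\<^sup>2)"
   by (intro Bochner_Integration.integrable_add i2)
  have j: "integrable (?P R) (%h. (real_of_int (d h + d' h))\<^sup>2)"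
   by (rule Bochner_Integration.integrable_bound[OF i]) (use le in \<open>auto intro!: AE_I2 simp del: of_int_add\<close>)
  have "(\<integral>h. (real_of_int (d h + d' h))\<^sup>2 \<partial>?P R) <= (\<integral>h. 2 * (real_of_int (d h))\<^sup>2 + 2 * (real_of_int (d' h))\<^sup>2 \<partial>?P R)"
   by (intro integral_mono i j le)
  also have "... = 2 * (\<integral>h. (real_of_int (d h))\<^sup>2 \<partial>?P R) + 2 * (\<integral>h. (real_of_int (d' h))\<^sup>2 \<partial>?P R)"
   by (simp only: Bochner_Integration.integral_add[OF i2] integral_mult_right_zero)
  also have "... <= 4 * C" using elim by simp
  finally show ?case using j by blast
 qed
 show ?thesis
 proof (intro exI allI)
  fix x y :: site
  obtain a b a' b' where xy: "x = (a, b)" "y = (a', b')" by (metis prod.exhaust)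
  have "(h (a', b) - h (a, b)) + (h (a', b') - h (a', b)) = h y - h x" for h :: "site => int" by (simp add: xy)
  then show "eventually (%R. integrable (?P R) (%h. (real_of_int (h y - h x))\<^sup>2) \<and> (\<integral>h. (real_of_int (h y - h x))\<^sup>2 \<partial>?P R) <= 4 * C) sequentially"
   using sum[OF row[of a' b a] col[of a' b' b]] by simp
 qed
qed

section \<open>Averages of shifted height laws\<close>

text \<open>Gibbs laws are compared up to normalisation; the total masses force the constant to be
  1.\<close>

lemma pmf_eq_proportional:
 assumes "\<And>x. pmf p x = K * pmf q x" shows "p = q"
proof -
 have "1 = infsetsum (pmf p) UNIV" using infsetsum_pmf_eq_1[of p UNIV] by simp
 also have "... = infsetsum (%x. K * pmf q x) UNIV" by (rule infsetsum_cong) (simp_all add: assms)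
 also have "... = K * infsetsum (pmf q) UNIV" by (rule infsetsum_cmult_right, rule pmf_abs_summable)
 also have "... = K" using infsetsum_pmf_eq_1[of q UNIV] by simp
 finally show ?thesis using assms by (intro pmf_eqI) simp
qed

lemma pos_edges_mono: "La \<subseteq> La' ==> pos_edges La \<subseteq> pos_edges La'"
 by (auto simp: pos_edges_def incident_edges_def)

lemma pos_edges_shift: "pos_edges ((%y. y + z) ` La) = map_prod (%y. y + z) (%y. y + z) ` pos_edges La"
proof -
 have sub: "map_prod (%y. y + z) (%y. y + z) ` pos_edges La \<subseteq> pos_edges ((%y. y + z) ` La)" for z La
 proof
  fix e assume "e \<in> map_prod (%y. y + z) (%y. y + z) ` pos_edges La"
  then obtain x y where e: "e = (x + z, y + z)" "(x, y) \<in> pos_edges La" by auto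
  have "(x + z, y + z) \<in> Z2_edges" using e(2) by (simp add: pos_edges_def incident_edges_def Z2_edges_def)
  then show "e \<in> pos_edges ((%y. y + z) ` La)"
  proof -
   have "x + z \<in> (%y. y + z) ` La \<or> y + z \<in> (%y. y + z) ` La"
    using e(2) by (auto simp: pos_edges_def incident_edges_def)
   moreover have "y + z = (fst (x + z) + 1, snd (x + z)) \<or> y + z = (fst (x + z), snd (x + z) + 1)"
    using e(2) by (auto simp: pos_edges_def prod_eq_iff)
   ultimately show ?thesis using \<open>(x + z, y + z) \<in> Z2_edges\<close> unfolding e(1) pos_edges_def incident_edges_def by simp
  qed
 qed
 show ?thesis
 proof (rule equalityI[OF _ sub])
  show "pos_edges ((%y. y + z) ` La) \<subseteq> map_prod (%y. y + z) (%y. y + z) ` pos_edges La"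
  proof
   fix e assume e: "e \<in> pos_edges ((%y. y + z) ` La)"
   have "map_prod (%y. y + - z) (%y. y + - z) e \<in> pos_edges ((%y. y + - z) ` (%y. y + z) ` La)"
    using sub[of "- z" "(%y. y + z) ` La"] e by blast
   then have "map_prod (%y. y + - z) (%y. y + - z) e \<in> pos_edges La" by (simp add: image_image)
   then have "map_prod (%y. y + z) (%y. y + z) (map_prod (%y. y + - z) (%y. y + - z) e) \<in> map_prod (%y. y + z) (%y. y + z) ` pos_edges La"
    by (rule imageI)
   then show "e \<in> map_prod (%y. y + z) (%y. y + z) ` pos_edges La" by (cases e) simp
  qed
 qed
qed

lemma square_nonempty: "square L \<noteq> {}" and card_square: "card (square L) = (2 * L + 1)\<^sup>2"
proof -
 have "(0, 0) \<in> square L" by (simp add: mem_square)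
 then show "square L \<noteq> {}" by blast
 have "nat (int L + 1 + int L) = 2 * L + 1" by simp
 then show "card (square L) = (2 * L + 1)\<^sup>2"
  by (simp add: square_eq card_cartesian_product power2_eq_square)
qed

text \<open>The square and its translate have the same size inside a common larger square, and each
  of the two sums differs from the sum over the larger square by at most the number of extra
  sites.\<close>

lemma square_shift_difference:
 assumes f: "\<And>z. 0 <= f z \<and> f z <= (1 :: real)"
 shows "\<bar>(\<Sum>z\<in>square L. f (a + z)) - (\<Sum>z\<in>square L. f z)\<bar> <= real (card (square (L + rad a))) - real (card (square L))"
proof -
 let ?S = "square L" and ?A = "(%z. a + z) ` square L" and ?B = "square (L + rad a)"
 have inj: "inj_on (%z. a + z) ?S" by simp
 have A: "?A \<subseteq> ?B" by (auto simp: mem_square rad_def)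
 have S: "?S \<subseteq> ?B" by (rule square_mono) simp
 have r: "(\<Sum>z\<in>?S. f (a + z)) = (\<Sum>z\<in>?A. f z)" by (simp add: sum.reindex[OF inj])
 have cA: "card ?A = card ?S" by (rule card_image[OF inj])
 have ub: "(\<Sum>z\<in>X. f z) <= (\<Sum>z\<in>?B. f z) \<and> (\<Sum>z\<in>?B. f z) <= (\<Sum>z\<in>X. f z) + (real (card ?B) - real (card ?S))"
  if X: "X \<subseteq> ?B" "card X = card ?S" for X
 proof -
  have fX: "finite X" using X finite_subset[OF _ finite_square] by blast
  have d: "(\<Sum>z\<in>?B. f z) = (\<Sum>z\<in>?B - X. f z) + (\<Sum>z\<in>X. f z)" by (rule sum.subset_diff[OF X(1)]) simp
  have "0 <= (\<Sum>z\<in>?B - X. f z)" using f by (intro sum_nonneg) blast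
  moreover have "(\<Sum>z\<in>?B - X. f z) <= (\<Sum>z\<in>?B - X. 1)" using f by (intro sum_mono) blast
  moreover have "(\<Sum>z\<in>?B - X. (1 :: real)) = real (card ?B) - real (card ?S)"
   using card_Diff_subset[OF fX X(1)] card_mono[OF finite_square X(1)] X(2) by (simp add: of_nat_diff)
  ultimately show ?thesis using d by linarith
 qed
 show ?thesis unfolding r using ub[OF A cA] ub[OF S refl] by linarith
qed

context
 fixes be :: real assumes be: "be > 0"
begin

lemma gibbs_pmf_cond:
 assumes La: "finite La" and La': "La' \<subseteq> La" and k: "k \<in> heights La \<phi>"
 shows "cond_pmf (gibbs_pmf be La \<phi>) {h. \<forall>x. x \<notin> La' --> h x = k x} = gibbs_pmf be La' k"
proof -
 let ?s = "{h. \<forall>x. x \<notin> La' --> h x = k x}"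
 have f': "finite La'" using La La' finite_subset by blast
 have sub: "h \<in> heights La \<phi>" if "h \<in> ?s" for h
  unfolding heights_def
 proof (intro CollectI allI impI)
  fix x assume "x \<notin> La"
  then have "h x = k x" "k x = \<phi> x" using that k La' unfolding heights_def by blast+
  then show "h x = \<phi> x" by simp
 qed
 have ne: "set_pmf (gibbs_pmf be La \<phi>) \<inter> ?s \<noteq> {}"
  unfolding set_gibbs_pmf[OF be La] using k by blast
 define W where "W = (\<Prod>e\<in>pos_edges La - pos_edges La'. pmf (skellam_pmf be) (k (snd e) - k (fst e)))"
 have wt: "height_weight be La h = W * height_weight be La' h" if h: "h \<in> ?s" for h
 proof -
  have "height_weight be La h = (\<Prod>e\<in>pos_edges La - pos_edges La'. pmf (skellam_pmf be) (h (snd e) - h (fst e))) * height_weight be La' h"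
   unfolding height_weight_def by (rule prod.subset_diff) (use La La' pos_edges_mono in auto)
  also have "(\<Prod>e\<in>pos_edges La - pos_edges La'. pmf (skellam_pmf be) (h (snd e) - h (fst e))) = W"
   unfolding W_def
  proof (rule prod.cong[OF refl])
   fix e assume "e \<in> pos_edges La - pos_edges La'"
   then have "fst e \<notin> La'" "snd e \<notin> La'" by (auto simp: pos_edges_def incident_edges_def)
   then have "h (fst e) = k (fst e)" "h (snd e) = k (snd e)" using h by blast+
   then show "pmf (skellam_pmf be) (h (snd e) - h (fst e)) = pmf (skellam_pmf be) (k (snd e) - k (fst e))" by simp
  qed
  finally show ?thesis .
 qed
 have s: "?s = heights La' k" by (simp add: heights_def)
 let ?K = "W * gibbs_partition be La' k / (gibbs_partition be La \<phi> * measure_pmf.prob (gibbs_pmf be La \<phi>) ?s)"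
 show ?thesis
 proof (rule pmf_eq_proportional)
  fix h
  show "pmf (cond_pmf (gibbs_pmf be La \<phi>) ?s) h = ?K * pmf (gibbs_pmf be La' k) h"
  proof (cases "h \<in> ?s")
   case True
   have "h \<in> heights La' k" using True unfolding s .
   then show ?thesis
    using True sub[OF True] gibbs_partition_pos[OF be f', of k]
    unfolding pmf_cond[OF ne] pmf_gibbs[OF be La] pmf_gibbs[OF be f'] wt[OF True] by simp
  next
   case False
   then have nh: "h \<notin> heights La' k" unfolding s .
   show ?thesis unfolding pmf_cond[OF ne] pmf_gibbs[OF be f'] if_not_P[OF False] if_not_P[OF nh] by simp
  qed
 qed
qed

text \<open>Agreeing off the smaller volume is an equivalence relation, and resampling within the
  classes by the conditional law preserves the law.\<close>

lemma gibbs_pmf_consistent: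
 assumes La: "finite La" and La': "La' \<subseteq> La"
 shows "bind_pmf (gibbs_pmf be La \<phi>) (gibbs_pmf be La') = gibbs_pmf be La \<phi>"
proof -
 let ?P = "gibbs_pmf be La \<phi>" and ?R = "%k h. \<forall>x. x \<notin> La' --> h x = k x"
 have "bind_pmf ?P (gibbs_pmf be La') = bind_pmf ?P (%k. cond_pmf ?P {h. ?R k h})"
  by (rule bind_pmf_cong[OF refl]) (simp only: set_gibbs_pmf[OF be La] gibbs_pmf_cond[OF La La'])
 also have "... = ?P"
 proof (rule bind_cond_pmf_cancel)
  show "measure ?P {y. ?R x y} = measure ?P {x. ?R x y}" if "?R x y" for x y
  proof -
   have "{z. ?R x z} = {z. ?R z y}" using that by auto
   then show ?thesis by simp
  qed
 qed auto
 finally show ?thesis .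
qed

lemma gibbs_pmf_shift:
 assumes La: "finite La"
 shows "gibbs_pmf be La (%y. \<phi> (y + z) - c) = map_pmf (%h y. h (y + z) - c) (gibbs_pmf be ((%y. y + z) ` La) \<phi>)"
proof -
 let ?L = "(%y. y + z) ` La" and ?T = "%h y. h (y + z) - (c :: int)" and ?S = "%k y. k (y - z) + (c :: int)"
 let ?K = "gibbs_partition be ?L \<phi> / gibbs_partition be La (?T \<phi>)"
 have L: "finite ?L" using La by simp
 have injT: "inj ?T"
 proof (rule injI, rule ext)
  fix h h' and y :: site assume "?T h = ?T h'"
  from fun_cong[OF this, of "y - z"] show "h y = h' y" by simp
 qed
 have wt: "height_weight be ?L (?S k) = height_weight be La k" for k
 proof -
  have "inj_on (map_prod (%y. y + z) (%y. y + z)) (pos_edges La)" by (auto simp: inj_on_def)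
  then show ?thesis unfolding height_weight_def pos_edges_shift by (simp add: prod.reindex)
 qed
 have mem: "?S k \<in> heights ?L \<phi> \<longleftrightarrow> k \<in> heights La (?T \<phi>)" for k
 proof
  assume a: "?S k \<in> heights ?L \<phi>"
  show "k \<in> heights La (?T \<phi>)" unfolding heights_def
  proof (intro CollectI allI impI)
   fix x assume "x \<notin> La"
   then have "x + z \<notin> ?L" by auto
   then have "?S k (x + z) = \<phi> (x + z)" using a unfolding heights_def by blast
   then show "k x = \<phi> (x + z) - c" by simp
  qed
 next
  assume a: "k \<in> heights La (?T \<phi>)"
  show "?S k \<in> heights ?L \<phi>" unfolding heights_def
  proof (intro CollectI allI impI)
   fix x assume "x \<notin> ?L"
   then have "x - z \<notin> La" by (metis diff_add_cancel imageI)
   then have "k (x - z) = ?T \<phi> (x - z)" using a unfolding heights_def by blast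
   then show "?S k x = \<phi> x" by simp
  qed
 qed
 show ?thesis
 proof (rule pmf_eq_proportional)
  fix k
  have "pmf (map_pmf ?T (gibbs_pmf be ?L \<phi>)) (?T (?S k)) = pmf (gibbs_pmf be ?L \<phi>) (?S k)"
   by (rule pmf_map_inj'[OF injT])
  moreover have "?T (?S k) = k" by simp
  ultimately have "pmf (map_pmf ?T (gibbs_pmf be ?L \<phi>)) k = pmf (gibbs_pmf be ?L \<phi>) (?S k)" by simp
  then show "pmf (gibbs_pmf be La (?T \<phi>)) k = ?K * pmf (map_pmf ?T (gibbs_pmf be ?L \<phi>)) k"
   using gibbs_partition_pos[OF be L, of \<phi>]
   by (simp only: pmf_gibbs[OF be La] pmf_gibbs[OF be L] mem wt) simp
 qed
qed

text \<open>Overwriting the outside by \<open>et'\<close> is a bijection between the two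
  configuration spaces and changes no weight, since every incident edge has its ends in
  \<open>F\<close>. On finite windows the kernel thus depends on finitely many boundary
  heights.\<close>

lemma gibbs_pmf_local:
 assumes La: "finite La" and F: "\<And>e. e \<in> pos_edges La ==> fst e \<in> F \<and> snd e \<in> F" and eq: "\<And>y. y \<in> F - La ==> et y = et' y"
 shows "map_pmf (%h. restrict h F) (gibbs_pmf be La et) = map_pmf (%h. restrict h F) (gibbs_pmf be La et')"
proof -
 let ?G = "%h y. if y \<in> La then h y else et' y" and ?H = "%k y. if y \<in> La then k y else et y"
 have off: "h y = et y" if "h \<in> heights La et" "y \<notin> La" for h et y using that unfolding heights_def by blast
 have inj: "inj_on ?G (set_pmf (gibbs_pmf be La et))"
  unfolding set_gibbs_pmf[OF be La]
 proof (rule inj_onI, rule ext)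
  fix h h' y assume h: "h \<in> heights La et" "h' \<in> heights La et" and g: "?G h = ?G h'"
  show "h y = h' y" using fun_cong[OF g, of y] off[OF h(1), of y] off[OF h(2), of y] by (cases "y \<in> La") simp_all
 qed
 have wt: "height_weight be La (?H k) = height_weight be La k" if "k \<in> heights La et'" for k
  unfolding height_weight_def
 proof (rule prod.cong[OF refl])
  fix e assume "e \<in> pos_edges La"
  have "?H k y = k y" if "y \<in> F" for y
   using that eq[of y] off[OF \<open>k \<in> heights La et'\<close>, of y] by simp
  then have "?H k (fst e) = k (fst e)" "?H k (snd e) = k (snd e)" using F[OF \<open>e \<in> pos_edges La\<close>] by blast+
  then show "pmf (skellam_pmf be) (?H k (snd e) - ?H k (fst e)) = pmf (skellam_pmf be) (k (snd e) - k (fst e))" by (simp only:)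
 qed
 have "gibbs_pmf be La et' = map_pmf ?G (gibbs_pmf be La et)"
 proof (rule pmf_eq_proportional)
  fix k
  show "pmf (gibbs_pmf be La et') k = (gibbs_partition be La et / gibbs_partition be La et') * pmf (map_pmf ?G (gibbs_pmf be La et)) k"
  proof (cases "k \<in> heights La et'")
   case True
   have H: "?H k \<in> heights La et" by (simp add: heights_def)
   have "?G (?H k) = k" using off[OF True] by auto
   moreover have "pmf (map_pmf ?G (gibbs_pmf be La et)) (?G (?H k)) = pmf (gibbs_pmf be La et) (?H k)"
    by (rule pmf_map_inj[OF inj]) (use H in \<open>simp only: set_gibbs_pmf[OF be La]\<close>)
   ultimately have "pmf (map_pmf ?G (gibbs_pmf be La et)) k = height_weight be La k / gibbs_partition be La et"
    using H by (simp only: pmf_gibbs[OF be La] wt[OF True] if_True)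
   then show ?thesis using True gibbs_partition_pos[OF be La, of et] by (simp add: pmf_gibbs[OF be La])
  next
   case False
   have "k \<notin> set_pmf (map_pmf ?G (gibbs_pmf be La et))"
   proof
    assume "k \<in> set_pmf (map_pmf ?G (gibbs_pmf be La et))"
    then obtain h where "k = ?G h" by auto
    then have "k \<in> heights La et'" by (simp add: heights_def)
    then show False using False by simp
   qed
   then show ?thesis using False by (simp only: pmf_gibbs[OF be La] pmf_eq_0_set_pmf[symmetric]) simp
  qed
 qed
 moreover have "map_pmf (%h. restrict h F) (map_pmf ?G (gibbs_pmf be La et)) = map_pmf (%h. restrict h F) (gibbs_pmf be La et)"
  unfolding pmf.map_comp
 proof (rule map_pmf_cong[OF refl])
  fix h assume "h \<in> set_pmf (gibbs_pmf be La et)"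
  then have h: "h \<in> heights La et" by (simp only: set_gibbs_pmf[OF be La])
  show "((%h. restrict h F) \<circ> ?G) h = restrict h F"
  proof
   fix y show "((%h. restrict h F) \<circ> ?G) h y = restrict h F y"
    using off[OF h, of y] eq[of y] by (cases "y \<in> F") auto
  qed
 qed
 ultimately show ?thesis by simp
qed

text \<open>The shift \<open>z\<close> and the base point \<open>x\<close> are independent
  parameters, so a further translation changes the shift only.\<close>

definition shifted_law :: "nat => site => site => (site => int) pmf" where
 "shifted_law R z x = map_pmf (%h y. h (y + z) - h x) (gibbs_pmf be (square R) (%_. 0))"

text \<open>If the base point is outside the resampled region, its height is the same before and
  after, so subtracting it commutes with resampling.\<close>

lemma shifted_law_gibbs:
 assumes La: "finite La" and sub: "(%y. y + z) ` La \<subseteq> square R" and x: "x \<notin> (%y. y + z) ` La"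
 shows "bind_pmf (shifted_law R z x) (gibbs_pmf be La) = shifted_law R z x"
proof -
 let ?P = "gibbs_pmf be (square R) (%_. 0)" and ?L = "(%y. y + z) ` La"
 have L: "finite ?L" using La by simp
 have "bind_pmf (shifted_law R z x) (gibbs_pmf be La) = bind_pmf ?P (%h. gibbs_pmf be La (%y. h (y + z) - h x))"
  unfolding shifted_law_def by (simp add: bind_map_pmf)
 also have "... = bind_pmf ?P (%h. map_pmf (%k y. k (y + z) - k x) (gibbs_pmf be ?L h))"
 proof (rule bind_pmf_cong[OF refl])
  fix h
  show "gibbs_pmf be La (%y. h (y + z) - h x) = map_pmf (%k y. k (y + z) - k x) (gibbs_pmf be ?L h)"
   unfolding gibbs_pmf_shift[OF La, of h z "h x"]
  proof (rule map_pmf_cong[OF refl])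
   fix k assume "k \<in> set_pmf (gibbs_pmf be ?L h)"
   then have "k \<in> heights ?L h" by (simp only: set_gibbs_pmf[OF be L])
   then have "k x = h x" using x unfolding heights_def by blast
   then show "(%y. k (y + z) - h x) = (%y. k (y + z) - k x)" by simp
  qed
 qed
 also have "... = shifted_law R z x"
  unfolding shifted_law_def map_bind_pmf[symmetric] gibbs_pmf_consistent[OF finite_square sub] ..
 finally show ?thesis .
qed

lemma shifted_law_translate: "map_pmf (%h y. h (y + a)) (shifted_law R z x) = shifted_law R (a + z) x"
 by (simp add: shifted_law_def pmf.map_comp o_def add.assoc)

text \<open>A fixed base point would destroy the Gibbs property wherever it is resampled. With a
  uniform base point this happens with probability at most the ratio of the volumes, while averaging
  over the shift yields approximate translation invariance.\<close>

definition averaged_law :: "nat => nat => (site => int) pmf" where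
 "averaged_law L R = bind_pmf (pmf_of_set (square L \<times> square L)) (%(z, x). shifted_law R z x)"

lemma pmf_averaged:
 "pmf (map_pmf f (averaged_law L R)) et = (\<Sum>z\<in>square L. \<Sum>x\<in>square L. pmf (map_pmf f (shifted_law R z x)) et) / (real (card (square L)))\<^sup>2"
 unfolding averaged_law_def map_bind_pmf using square_nonempty
 by (subst pmf_bind_pmf_of_set) (auto simp: sum.cartesian_product case_prod_unfold card_cartesian_product power2_eq_square)

lemma averaged_law_gibbs:
 assumes La: "finite La" "La \<subseteq> square L" and R: "2 * L <= R"
 shows "\<bar>pmf (map_pmf f (bind_pmf (averaged_law L R) (gibbs_pmf be La))) et - pmf (map_pmf f (averaged_law L R)) et\<bar>
  <= real (card La) / real (card (square L))"
proof -
 let ?S = "square L"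
 let ?p = "%z x. pmf (map_pmf f (shifted_law R z x)) et"
 let ?q = "%z x. pmf (map_pmf f (bind_pmf (shifted_law R z x) (gibbs_pmf be La))) et"
 have q: "pmf (map_pmf f (bind_pmf (averaged_law L R) (gibbs_pmf be La))) et = (\<Sum>z\<in>?S. \<Sum>x\<in>?S. ?q z x) / (real (card ?S))\<^sup>2"
  unfolding averaged_law_def bind_assoc_pmf map_bind_pmf using square_nonempty
  by (subst pmf_bind_pmf_of_set) (auto simp: sum.cartesian_product case_prod_unfold card_cartesian_product power2_eq_square map_bind_pmf)
 have N: "real (card ?S) > 0" using square_nonempty by (simp add: card_gt_0_iff)
 have inner: "\<bar>\<Sum>x\<in>?S. ?q z x - ?p z x\<bar> <= real (card La)" if z: "z \<in> ?S" for z
 proof -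
  let ?L = "(%y. y + z) ` La"
  have sub: "?L \<subseteq> square R"
  proof
   fix y assume "y \<in> ?L"
   then obtain w where w: "w \<in> square L" "y = w + z" using La by blast
   then show "y \<in> square R" using z R by (auto simp: mem_square)
  qed
  have "\<bar>\<Sum>x\<in>?S. ?q z x - ?p z x\<bar> <= (\<Sum>x\<in>?S. \<bar>?q z x - ?p z x\<bar>)" by (rule sum_abs)
  also have "... <= (\<Sum>x\<in>?S. if x \<in> ?L then 1 else 0)"
  proof (rule sum_mono)
   fix x
   show "\<bar>?q z x - ?p z x\<bar> <= (if x \<in> ?L then 1 else 0)"
   proof (cases "x \<in> ?L")
    case True
    have "0 <= ?q z x" "?q z x <= 1" "0 <= ?p z x" "?p z x <= 1" by (simp_all add: pmf_le_1)
    then show ?thesis using True by (simp only: if_True)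
   next
    case False
    then show ?thesis using shifted_law_gibbs[OF La(1) sub False] by simp
   qed
  qed
  also have "... = real (card (?S \<inter> ?L))" by (simp add: sum.If_cases)
  also have "... <= real (card La)"
  proof -
   have "card (?S \<inter> ?L) <= card ?L" by (rule card_mono) (use La in auto)
   also have "... <= card La" using La(1) by (rule card_image_le)
   finally show ?thesis by simp
  qed
  finally show ?thesis .
 qed
 have "\<bar>(\<Sum>z\<in>?S. \<Sum>x\<in>?S. ?q z x) - (\<Sum>z\<in>?S. \<Sum>x\<in>?S. ?p z x)\<bar> = \<bar>\<Sum>z\<in>?S. \<Sum>x\<in>?S. ?q z x - ?p z x\<bar>"
  by (simp only: sum_subtractf)
 also have "... <= (\<Sum>z\<in>?S. \<bar>\<Sum>x\<in>?S. ?q z x - ?p z x\<bar>)" by (rule sum_abs)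
 also have "... <= (\<Sum>z\<in>?S. real (card La))" by (rule sum_mono[OF inner])
 finally have "\<bar>(\<Sum>z\<in>?S. \<Sum>x\<in>?S. ?q z x) - (\<Sum>z\<in>?S. \<Sum>x\<in>?S. ?p z x)\<bar> <= real (card ?S) * real (card La)" by simp
 then have "\<bar>(\<Sum>z\<in>?S. \<Sum>x\<in>?S. ?q z x) - (\<Sum>z\<in>?S. \<Sum>x\<in>?S. ?p z x)\<bar> / (real (card ?S))\<^sup>2 <= real (card ?S) * real (card La) / (real (card ?S))\<^sup>2"
  by (rule divide_right_mono) simp
 also have "... = real (card La) / real (card ?S)" using N by (simp add: power2_eq_square)
 finally show ?thesis unfolding q pmf_averaged by (simp add: diff_divide_distrib[symmetric])
qed

lemma averaged_law_translate:
 "\<bar>pmf (map_pmf (%h. f (%y. h (y + a))) (averaged_law L R)) et - pmf (map_pmf f (averaged_law L R)) et\<bar>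
  <= (real (card (square (L + rad a))) - real (card (square L))) / real (card (square L))"
proof -
 let ?S = "square L"
 let ?p = "%z x. pmf (map_pmf f (shifted_law R z x)) et"
 have N: "real (card ?S) > 0" using square_nonempty by (simp add: card_gt_0_iff)
 have e: "map_pmf (%h. f (%y. h (y + a))) (shifted_law R z x) = map_pmf f (shifted_law R (a + z) x)" for z x
  unfolding shifted_law_translate[symmetric] by (simp add: pmf.map_comp o_def)
 have "\<bar>(\<Sum>z\<in>?S. \<Sum>x\<in>?S. ?p (a + z) x) - (\<Sum>z\<in>?S. \<Sum>x\<in>?S. ?p z x)\<bar> =
   \<bar>\<Sum>x\<in>?S. (\<Sum>z\<in>?S. ?p (a + z) x) - (\<Sum>z\<in>?S. ?p z x)\<bar>"
  unfolding sum_subtractf by (subst (1 2) sum.swap) (rule refl)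
 also have "... <= (\<Sum>x\<in>?S. \<bar>(\<Sum>z\<in>?S. ?p (a + z) x) - (\<Sum>z\<in>?S. ?p z x)\<bar>)" by (rule sum_abs)
 also have "... <= (\<Sum>x\<in>?S. real (card (square (L + rad a))) - real (card ?S))"
  by (intro sum_mono square_shift_difference) (simp add: pmf_le_1)
 also have "... = real (card ?S) * (real (card (square (L + rad a))) - real (card ?S))" by simp
 finally have "\<bar>(\<Sum>z\<in>?S. \<Sum>x\<in>?S. ?p (a + z) x) - (\<Sum>z\<in>?S. \<Sum>x\<in>?S. ?p z x)\<bar> / (real (card ?S))\<^sup>2
   <= real (card ?S) * (real (card (square (L + rad a))) - real (card ?S)) / (real (card ?S))\<^sup>2"
  by (rule divide_right_mono) simp
 also have "... = (real (card (square (L + rad a))) - real (card ?S)) / real (card ?S)" using N by (simp add: power2_eq_square)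
 finally show ?thesis unfolding pmf_averaged e by (simp add: diff_divide_distrib[symmetric])
qed

text \<open>Chebyshev's inequality for the increments between y + z and x. They range over
  \<open>square (2 * L)\<close>, so the constant has to be independent of the distance.\<close>

lemma averaged_law_tight:
 assumes F: "finite F" "F \<subseteq> square L" and M: "M > 0"
  and C: "\<And>x y. x \<in> square (2 * L) ==> y \<in> square (2 * L) ==>
   integrable (measure_pmf (gibbs_pmf be (square R) (%_. 0))) (%h. (real_of_int (h y - h x))\<^sup>2) \<and>
   (\<integral>h. (real_of_int (h y - h x))\<^sup>2 \<partial>measure_pmf (gibbs_pmf be (square R) (%_. 0))) <= C"
 shows "measure_pmf.prob (map_pmf (%h. restrict h F) (averaged_law L R)) (F \<rightarrow>\<^sub>E {- int M..int M}) \<ge> 1 - real (card F) * C / (real M)\<^sup>2"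
proof -
 let ?P = "gibbs_pmf be (square R) (%_. 0)"
 let ?bad = "%y. {h :: site => int. (real M)\<^sup>2 <= (real_of_int (h y))\<^sup>2}"
 have one: "measure_pmf.prob (shifted_law R z x) (?bad y) <= C / (real M)\<^sup>2" if zx: "z \<in> square L" "x \<in> square L" and y: "y \<in> F" for z x y
 proof -
  have m: "x \<in> square (2 * L)" "y + z \<in> square (2 * L)" using zx y F(2) by (auto simp: mem_square dest!: subsetD)
  note c = C[OF m]
  have "measure_pmf.prob (shifted_law R z x) (?bad y) = measure_pmf.prob ?P {h \<in> space (measure_pmf ?P). (real M)\<^sup>2 <= (real_of_int (h (y + z) - h x))\<^sup>2}"
   unfolding shifted_law_def by (simp add: vimage_def)
  also have "... <= (\<integral>h. (real_of_int (h (y + z) - h x))\<^sup>2 \<partial>measure_pmf ?P) / (real M)\<^sup>2"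
   by (rule integral_Markov_inequality_measure[where A="space (measure_pmf ?P)"]) (use c M in auto)
  also have "... <= C / (real M)\<^sup>2" using c by (intro divide_right_mono) auto
  finally show ?thesis .
 qed
 have avg: "measure_pmf.prob (averaged_law L R) (?bad y) <= C / (real M)\<^sup>2" if y: "y \<in> F" for y
 proof -
  have "emeasure (averaged_law L R) (?bad y) = (\<integral>\<^sup>+p. emeasure (shifted_law R (fst p) (snd p)) (?bad y) \<partial>pmf_of_set (square L \<times> square L))"
   unfolding averaged_law_def by (simp add: case_prod_unfold)
  also have "... <= (\<integral>\<^sup>+p. ennreal (C / (real M)\<^sup>2) \<partial>pmf_of_set (square L \<times> square L))"
  proof (rule nn_integral_mono_AE, unfold AE_measure_pmf_iff, rule ballI)
   fix p assume "p \<in> set_pmf (pmf_of_set (square L \<times> square L))"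
   then have "fst p \<in> square L" "snd p \<in> square L" using square_nonempty by (auto simp: set_pmf_of_set)
   from one[OF this y] show "emeasure (shifted_law R (fst p) (snd p)) (?bad y) <= ennreal (C / (real M)\<^sup>2)"
    by (simp add: measure_pmf.emeasure_eq_measure ennreal_leI)
  qed
  also have "... = ennreal (C / (real M)\<^sup>2)" by simp
  finally have "ennreal (measure_pmf.prob (averaged_law L R) (?bad y)) <= ennreal (C / (real M)\<^sup>2)"
   by (simp add: measure_pmf.emeasure_eq_measure)
  moreover have "0 <= C / (real M)\<^sup>2"
  proof -
   have o: "(0, 0) \<in> square L" by (simp add: mem_square)
   show ?thesis using one[OF o o y] measure_nonneg[of "measure_pmf (shifted_law R (0, 0) (0, 0))" "?bad y"] by linarith
  qed
  ultimately show ?thesis by simp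
 qed
 let ?good = "(%h. restrict h F) -` (F \<rightarrow>\<^sub>E {- int M..int M})"
 have "- ?good \<subseteq> (\<Union>y\<in>F. ?bad y)"
 proof
  fix h assume "h \<in> - ?good"
  then obtain y where y: "y \<in> F" "\<not> \<bar>h y\<bar> <= int M" by (auto simp: PiE_iff)
  then have "real M <= \<bar>real_of_int (h y)\<bar>" by linarith
  then have "(real M)\<^sup>2 <= (real_of_int (h y))\<^sup>2" using abs_le_square_iff[of "real M" "real_of_int (h y)"] by simp
  then show "h \<in> (\<Union>y\<in>F. ?bad y)" using y by blast
 qed
 then have "measure_pmf.prob (averaged_law L R) (- ?good) <= measure_pmf.prob (averaged_law L R) (\<Union>y\<in>F. ?bad y)"
  by (rule measure_pmf.finite_measure_mono) simp
 also have "... <= (\<Sum>y\<in>F. measure_pmf.prob (averaged_law L R) (?bad y))"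
  by (rule measure_pmf.finite_measure_subadditive_finite[OF F(1)]) simp
 also have "... <= (\<Sum>y\<in>F. C / (real M)\<^sup>2)" by (rule sum_mono[OF avg])
 finally have "measure_pmf.prob (averaged_law L R) (- ?good) <= real (card F) * C / (real M)\<^sup>2" by simp
 moreover have "measure_pmf.prob (averaged_law L R) (- ?good) = 1 - measure_pmf.prob (averaged_law L R) ?good"
  using measure_pmf.prob_compl[of ?good "averaged_law L R"] by (simp add: Compl_eq_Diff_UNIV)
 ultimately show ?thesis by simp
qed

end

section \<open>Limits of the averaged laws\<close>

text \<open>Fatou's lemma shows that no mass is created, tightness that none escapes.\<close>

lemma tight_pmf_limit:
 assumes conv: "\<And>x. (%n. pmf (p n) x) \<longlonglongrightarrow> q x"
  and tight: "\<And>\<epsilon>. \<epsilon> > 0 ==> \<exists>K. finite K \<and> eventually (%n. measure_pmf.prob (p n) K \<ge> 1 - \<epsilon>) sequentially"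
 shows "\<exists>Q. \<forall>x. pmf Q x = q x"
proof -
 have q0: "q x \<ge> 0" for x by (rule LIMSEQ_le_const[OF conv]) simp
 let ?I = "\<integral>\<^sup>+x. ennreal (q x) \<partial>count_space UNIV"
 have "?I = (\<integral>\<^sup>+x. liminf (%n. ennreal (pmf (p n) x)) \<partial>count_space UNIV)"
  by (intro nn_integral_cong) (simp add: lim_imp_Liminf[OF sequentially_bot tendsto_ennrealI[OF conv]])
 also have "... <= liminf (%n. \<integral>\<^sup>+x. ennreal (pmf (p n) x) \<partial>count_space UNIV)"
  by (rule nn_integral_liminf) simp
 also have "... = 1" by (simp add: nn_integral_pmf Liminf_const)
 finally have up: "?I <= 1" .
 have "1 <= ?I"
 proof (rule ennreal_le_epsilon)
  fix e :: real assume e: "e > 0"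
  define d where "d = min e 1"
  have d: "0 < d" "d <= 1" "d <= e" using e by (auto simp: d_def)
  obtain K where K: "finite K" "eventually (%n. measure_pmf.prob (p n) K \<ge> 1 - d) sequentially" using tight[OF d(1)] by blast
  have "(%n. measure_pmf.prob (p n) K) \<longlonglongrightarrow> (\<Sum>x\<in>K. q x)"
   unfolding measure_measure_pmf_finite[OF K(1)] by (intro tendsto_sum conv)
  then have "1 - d <= (\<Sum>x\<in>K. q x)" by (rule tendsto_lowerbound[OF _ K(2)]) simp
  then have "ennreal (1 - d) <= ennreal (\<Sum>x\<in>K. q x)" by (rule ennreal_leI)
  also have "... = (\<Sum>x\<in>K. ennreal (q x))" using q0 by (simp add: sum_ennreal)
  also have "... = (\<integral>\<^sup>+x. ennreal (q x) \<partial>count_space K)" using K(1) by (simp add: nn_integral_count_space_finite)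
  also have "... = (\<integral>\<^sup>+x. ennreal (q x) * indicator K x \<partial>count_space UNIV)"
   by (subst nn_integral_count_space_indicator) auto
  also have "... <= ?I" by (intro nn_integral_mono) (auto simp: indicator_def)
  finally have "ennreal (1 - d) <= ?I" .
  then have "ennreal (1 - d) + ennreal d <= ?I + ennreal e" using d by (intro add_mono ennreal_leI) auto
  moreover have "ennreal (1 - d) + ennreal d = 1" using d by (simp add: ennreal_plus[symmetric] del: ennreal_plus)
  ultimately show "1 <= ?I + ennreal e" by simp
 qed
 with up have I: "?I = 1" by (rule antisym)
 show ?thesis
 proof (intro exI allI)
  show "pmf (embed_pmf q) x = q x" for x by (rule pmf_embed_pmf[OF q0 I])
 qed
qed

text \<open>Fatou's lemma gives the lower bound for every event, and the complement gives the upper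
  one.\<close>

lemma pmf_limit_prob:
 assumes conv: "\<And>x. (%n. pmf (p n) x) \<longlonglongrightarrow> pmf Q x"
 shows "(%n. measure_pmf.prob (p n) A) \<longlonglongrightarrow> measure_pmf.prob Q A"
proof -
 have low: "eventually (%n. c < measure_pmf.prob (p n) A) sequentially" if c: "c < measure_pmf.prob Q A" for c A
 proof (cases "c < 0")
  case True
  then have "c < measure_pmf.prob (p n) A" for n using measure_nonneg[of "measure_pmf (p n)" A] by linarith
  then show ?thesis by simp
 next
  case False
  have "ennreal c < emeasure (measure_pmf Q) A" using c False by (simp add: measure_pmf.emeasure_eq_measure ennreal_less_iff)
  also have "... = (\<integral>\<^sup>+x. ennreal (pmf Q x) \<partial>count_space A)" by (rule nn_integral_pmf[symmetric])
  also have "... = (\<integral>\<^sup>+x. liminf (%n. ennreal (pmf (p n) x)) \<partial>count_space A)"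
   by (intro nn_integral_cong) (simp add: lim_imp_Liminf[OF sequentially_bot tendsto_ennrealI[OF conv]])
  also have "... <= liminf (%n. \<integral>\<^sup>+x. ennreal (pmf (p n) x) \<partial>count_space A)"
   by (rule nn_integral_liminf) simp
  also have "... = liminf (%n. emeasure (measure_pmf (p n)) A)" by (simp add: nn_integral_pmf)
  finally have "eventually (%n. ennreal c < emeasure (measure_pmf (p n)) A) sequentially" by (rule less_LiminfD)
  then show ?thesis
   by (rule eventually_mono) (use False in \<open>simp add: measure_pmf.emeasure_eq_measure ennreal_less_iff\<close>)
 qed
 have compl: "measure_pmf.prob P (- A) = 1 - measure_pmf.prob P A" for P
  using measure_pmf.prob_compl[of A P] by (simp add: Compl_eq_Diff_UNIV)
 show ?thesis
 proof (rule order_tendstoI)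
  fix c assume "measure_pmf.prob Q A < c"
  then have "1 - c < measure_pmf.prob Q (- A)" unfolding compl by simp
  from low[OF this] show "eventually (%n. measure_pmf.prob (p n) A < c) sequentially"
   unfolding compl by (rule eventually_mono) simp
 qed (rule low)
qed

lemma diagonal_convergent_subsequence:
 fixes u :: "nat => 'a::countable => real"
 assumes bdd: "\<And>n l. u n l \<in> {0..1}"
 shows "\<exists>r. strict_mono (r :: nat => nat) \<and> (\<forall>l. convergent (%n. u (r n) l))"
proof -
 let ?P = "%n. %s. convergent (%k. u (s k) (from_nat n))"
 interpret nat: subseqs ?P
 proof (unfold convergent_def, unfold subseqs_def, auto)
  fix n :: nat and s :: "nat => nat" assume s: "strict_mono s"
  have "\<exists>l s'. strict_mono s' \<and> ((%k. u (s k) (from_nat n)) \<circ> s') \<longlonglongrightarrow> l"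
   using bdd compact_Icc compact_imp_seq_compact seq_compactE by metis
  then show "\<exists>s'. strict_mono (s' :: nat => nat) \<and> (\<exists>l. (%k. u (s (s' k)) (from_nat n)) \<longlonglongrightarrow> l)"
   by (auto simp: comp_def)
 qed
 have "convergent (%k. u (nat.diagseq k) (from_nat n))" for n
 proof -
  have 1: "(%k. u ((nat.seqseq (Suc n) \<circ> (%k. nat.fold_reduce (Suc n) k (Suc n + k))) k) (from_nat n)) =
    (%k. u (nat.seqseq (Suc n) k) (from_nat n)) \<circ> (%k. nat.fold_reduce (Suc n) k (Suc n + k))"
   by auto
  have "?P n (nat.diagseq \<circ> ((+) (Suc n)))"
   unfolding nat.diagseq_seqseq 1
   by (intro convergent_subseq_convergent nat.seqseq_holds nat.subseq_diagonal_rest)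
  then obtain L where "(%k. u (nat.diagseq (k + Suc n)) (from_nat n)) \<longlonglongrightarrow> L"
   by (auto simp: add.commute dest: convergentD)
  then have "(%k. u (nat.diagseq k) (from_nat n)) \<longlonglongrightarrow> L" by (rule LIMSEQ_offset)
  then show ?thesis by (auto simp: convergent_def)
 qed
 then have "convergent (%k. u (nat.diagseq k) l)" for l using from_nat_to_nat[of l] by metis
 then show ?thesis using nat.subseq_diagseq by blast
qed

definition covers :: "site set => site set => bool" where
 "covers F La \<longleftrightarrow> finite F \<and> La \<subseteq> F \<and> (\<forall>e\<in>pos_edges La. fst e \<in> F \<and> snd e \<in> F)"

text \<open>Consistency, translation invariance and the Gibbs property, expressed by the laws on
  finite windows alone; these are discrete and survive pointwise limits.\<close>

definition gibbs_marginals :: "real => (site set => (site => int) pmf) => bool" where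
 "gibbs_marginals be Q \<longleftrightarrow>
   (\<forall>J H. finite H \<and> J \<subseteq> H --> map_pmf (%et. restrict et J) (Q H) = Q J) \<and>
   (\<forall>F a. finite F --> map_pmf (%et. \<lambda>y\<in>F. et (y + a)) (Q ((%y. y + a) ` F)) = Q F) \<and>
   (\<forall>La F. covers F La --> bind_pmf (Q F) (%et. map_pmf (%h. restrict h F) (gibbs_pmf be La et)) = Q F)"

text \<open>The kernel can reach \<open>k\<close> only from boundary heights agreeing with
  \<open>k\<close>, and then its value does not depend on the remaining data. The resampled mass is
  therefore a constant times one probability, which makes it continuous under limits of
  \<open>P\<close>.\<close>

lemma pmf_bind_gibbs:
 assumes be: "be > 0" and cov: "covers F La"
 shows "pmf (bind_pmf P (%et. map_pmf (%h. restrict h F) (gibbs_pmf be La et))) k =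
  pmf (map_pmf (%h. restrict h F) (gibbs_pmf be La k)) k * measure_pmf.prob P {et. \<forall>y\<in>F - La. et y = k y}"
proof -
 let ?\<kappa> = "%et. map_pmf (%h. restrict h F) (gibbs_pmf be La et)" and ?S = "{et. \<forall>y\<in>F - La. et y = k y}"
 have La: "finite La" and E: "\<And>e. e \<in> pos_edges La ==> fst e \<in> F \<and> snd e \<in> F"
  using cov finite_subset unfolding covers_def by blast+
 have v: "pmf (?\<kappa> et) k = pmf (?\<kappa> k) k * indicator ?S et" for et
 proof (cases "et \<in> ?S")
  case True
  have "?\<kappa> et = ?\<kappa> k" by (rule gibbs_pmf_local[OF be La E]) (use True in blast)+
  then show ?thesis using True by simp
 next
  case False
  have "k \<notin> set_pmf (?\<kappa> et)"
  proof
   assume "k \<in> set_pmf (?\<kappa> et)"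
   then obtain h where h: "h \<in> heights La et" "k = restrict h F" by (auto simp: set_gibbs_pmf[OF be La])
   have "et y = k y" if "y \<in> F - La" for y
   proof -
    have "h y = et y" using h(1) that unfolding heights_def by blast
    then show ?thesis using that h(2) by simp
   qed
   then show False using False by blast
  qed
  then show ?thesis using False by (simp add: pmf_eq_0_set_pmf)
 qed
 have "pmf (bind_pmf P ?\<kappa>) k = (\<integral>et. pmf (?\<kappa> k) k * indicator ?S et \<partial>measure_pmf P)" unfolding pmf_bind v[symmetric] ..
 then show ?thesis by simp
qed

lemma card_square_lower: "real (card (square L)) \<ge> real (Suc L)"
proof -
 have "Suc L <= (2 * L + 1) * 1" by simp
 also have "... <= (2 * L + 1) * (2 * L + 1)" by (rule mult_le_mono2) simp
 finally show ?thesis unfolding card_square by (simp add: power2_eq_square)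
qed

lemma card_square_growth:
 "(real (card (square (L + m))) - real (card (square L))) / real (card (square L)) <= (4 * real m + 4 * (real m)\<^sup>2) * inverse (real (Suc L))"
proof -
 define N where "N = 2 * real L + 1"
 have N: "N \<ge> 1" "N \<ge> real (Suc L)" by (auto simp: N_def)
 have c: "real (card (square L)) = N\<^sup>2" "real (card (square (L + m))) = (N + 2 * real m)\<^sup>2"
  unfolding card_square by (simp_all add: N_def algebra_simps)
 have "(N + 2 * real m)\<^sup>2 - N\<^sup>2 = N * (4 * real m) + 4 * (real m)\<^sup>2" by (simp add: power2_eq_square algebra_simps)
 also have "... <= N * (4 * real m) + N * (4 * (real m)\<^sup>2)" using mult_right_mono[OF N(1), of "4 * (real m)\<^sup>2"] by simp
 also have "... = N * (4 * real m + 4 * (real m)\<^sup>2)" by (simp add: algebra_simps)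
 finally have "((N + 2 * real m)\<^sup>2 - N\<^sup>2) / N\<^sup>2 <= N * (4 * real m + 4 * (real m)\<^sup>2) / N\<^sup>2" by (rule divide_right_mono) simp
 also have "... = (4 * real m + 4 * (real m)\<^sup>2) * inverse N" using N(1) by (simp add: power2_eq_square field_simps)
 also have "... <= (4 * real m + 4 * (real m)\<^sup>2) * inverse (real (Suc L))"
  using N(2) by (intro mult_left_mono le_imp_inverse_le) auto
 finally show ?thesis unfolding c .
qed

text \<open>Along a subsequence all cylinder probabilities converge. Tightness turns the limits into
  laws on finite windows, and the errors in shift invariance and in the Gibbs property vanish like
  the inverse of the averaging size.\<close>

lemma gibbs_marginals_exist:
 assumes be: "be > 0"
  and var: "\<forall>x y. eventually (%R. integrable (measure_pmf (gibbs_pmf be (square R) (%_. 0))) (%h. (real_of_int (h y - h x))\<^sup>2) \<and>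
  (\<integral>h. (real_of_int (h y - h x))\<^sup>2 \<partial>measure_pmf (gibbs_pmf be (square R) (%_. 0))) <= C) sequentially"
 shows "\<exists>Q. gibbs_marginals be Q"
proof -
 define good where "good R x y \<longleftrightarrow> integrable (measure_pmf (gibbs_pmf be (square R) (%_. 0))) (%h. (real_of_int (h y - h x))\<^sup>2) \<and>
  (\<integral>h. (real_of_int (h y - h x))\<^sup>2 \<partial>measure_pmf (gibbs_pmf be (square R) (%_. 0))) <= C" for R x y
 \<comment> \<open>The outer square must hold every shifted window, and be large enough for the
   variance bounds of the finitely many pairs involved to hold at once.\<close>
 have "\<exists>R\<ge>2 * L. \<forall>x\<in>square (2 * L). \<forall>y\<in>square (2 * L). good R x y" for L
 proof -
  have "eventually (%R. \<forall>x\<in>square (2 * L). \<forall>y\<in>square (2 * L). good R x y) sequentially"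
   by (intro eventually_ball_finite ballI finite_square) (unfold good_def, rule var[rule_format])
  then have "eventually (%R. (\<forall>x\<in>square (2 * L). \<forall>y\<in>square (2 * L). good R x y) \<and> 2 * L <= R) sequentially"
   by (intro eventually_conj eventually_ge_at_top)
  from eventually_happens'[OF sequentially_bot this] show ?thesis by blast
 qed
 then obtain Rf where Rf: "\<And>L. Rf L \<ge> 2 * L" "\<And>L x y. x \<in> square (2 * L) ==> y \<in> square (2 * L) ==> good (Rf L) x y" by metis
 define \<nu> where "\<nu> L = averaged_law be L (Rf L)" for L
 \<comment> \<open>Cylinders are indexed by lists of prescribed values, a countable type, so one
   diagonal sequence serves all windows.\<close>
 define u where "u L l = measure_pmf.prob (\<nu> L) {h. \<forall>t\<in>set l. h (fst t) = snd t}" for L and l :: "(site \<times> int) list"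
 obtain r where r: "strict_mono r" "\<And>l. convergent (%n. u (r n) l)"
  using diagonal_convergent_subsequence[of u] by (auto simp: u_def)
 define p where "p F n = map_pmf (%h. restrict h F) (\<nu> (r n))" for F n
 have inv0: "(%n. K * inverse (real (Suc (r n)))) \<longlonglongrightarrow> 0" for K
  using tendsto_mult_right_zero[OF LIMSEQ_subseq_LIMSEQ[OF LIMSEQ_inverse_real_of_nat r(1)], of K] by (simp add: o_def)
 have big: "eventually (%n. F \<subseteq> square (r n)) sequentially" if F: "finite F" for F
 proof -
  obtain L0 where L0: "F \<subseteq> square L0" using finite_subset_square[OF F] by blast
  show ?thesis
  proof (rule eventually_sequentiallyI)
   fix n assume "L0 <= n"
   then have "L0 <= r n" using seq_suble[OF r(1), of n] by simp
   then show "F \<subseteq> square (r n)" using L0 square_mono by blast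
  qed
 qed
 have conv: "\<exists>q. (%n. pmf (p F n) et) \<longlonglongrightarrow> q" if F: "finite F" for F et
 proof (cases "et \<in> extensional F")
  case True
  obtain xs where xs: "set xs = F" using finite_list[OF F] by blast
  have "(%h. restrict h F) -` {et} = {h. \<forall>t\<in>set (map (%x. (x, et x)) xs). h (fst t) = snd t}"
  proof (intro set_eqI iffI)
   fix h assume "h \<in> (%h. restrict h F) -` {et}"
   then have eq: "restrict h F = et" by simp
   have "h x = et x" if "x \<in> F" for x using fun_cong[OF eq, of x] that by simp
   then show "h \<in> {h. \<forall>t\<in>set (map (%x. (x, et x)) xs). h (fst t) = snd t}" using xs by auto
  next
   fix h assume "h \<in> {h. \<forall>t\<in>set (map (%x. (x, et x)) xs). h (fst t) = snd t}"
   then have "h x = et x" if "x \<in> F" for x using that xs by auto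
   then have "restrict h F = et" by (intro extensionalityI[OF _ True]) auto
   then show "h \<in> (%h. restrict h F) -` {et}" by simp
  qed
  then have "pmf (p F n) et = u (r n) (map (%x. (x, et x)) xs)" for n by (simp add: p_def pmf_map u_def)
  then show ?thesis using r(2)[of "map (%x. (x, et x)) xs"] by (simp add: convergent_def)
 next
  case False
  then have "et \<notin> set_pmf (p F n)" for n by (auto simp: p_def)
  then have "pmf (p F n) et = 0" for n by (simp add: pmf_eq_0_set_pmf)
  then show ?thesis by auto
 qed
 have ex: "\<exists>Q. \<forall>et. (%n. pmf (p F n) et) \<longlonglongrightarrow> pmf Q et" if F: "finite F" for F
 proof -
  obtain q where q: "\<And>et. (%n. pmf (p F n) et) \<longlonglongrightarrow> q et" using conv[OF F] by metis
  have "\<exists>Q. \<forall>et. pmf Q et = q et"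
  proof (rule tight_pmf_limit[OF q])
   fix \<epsilon> :: real assume \<epsilon>: "\<epsilon> > 0"
   \<comment> \<open>The summand 1 gives M >= 1, so the bound by \<open>\<epsilon>\<close> times M
     is also one by \<open>\<epsilon>\<close> times its square.\<close>
   obtain M where M: "real M > real (card F) * \<bar>C\<bar> / \<epsilon> + 1" using reals_Archimedean2 by blast
   have t0: "0 <= real (card F) * \<bar>C\<bar> / \<epsilon>" using \<epsilon> by simp
   have M1: "real M \<ge> 1" using M t0 by linarith
   have "real (card F) * C <= real (card F) * \<bar>C\<bar>" by (intro mult_left_mono) auto
   also have "... <= \<epsilon> * real M" using M \<epsilon> by (simp add: field_simps)
   also have "... <= \<epsilon> * (real M)\<^sup>2" using \<epsilon> M1 by (intro mult_left_mono) (auto simp: power2_eq_square)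
   finally have CM: "real (card F) * C / (real M)\<^sup>2 <= \<epsilon>" using M1 by (simp add: field_simps)
   show "\<exists>K. finite K \<and> eventually (%n. measure_pmf.prob (p F n) K \<ge> 1 - \<epsilon>) sequentially"
   proof (intro exI conjI)
    show "finite (F \<rightarrow>\<^sub>E {- int M..int M})" using F by (intro finite_PiE) auto
    show "eventually (%n. measure_pmf.prob (p F n) (F \<rightarrow>\<^sub>E {- int M..int M}) \<ge> 1 - \<epsilon>) sequentially"
     using big[OF F]
    proof eventually_elim
     case (elim n)
     have "1 - real (card F) * C / (real M)\<^sup>2 <= measure_pmf.prob (p F n) (F \<rightarrow>\<^sub>E {- int M..int M})"
      unfolding p_def \<nu>_def
      by (rule averaged_law_tight[OF be F elim]) (use M1 Rf(2)[unfolded good_def] in auto)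
     then show ?case using CM by linarith
    qed
   qed
  qed
  then show ?thesis using q by metis
 qed
 define Q where "Q F = (SOME Q. \<forall>et. (%n. pmf (p F n) et) \<longlonglongrightarrow> pmf Q et)" for F
 have Q: "(%n. pmf (p F n) et) \<longlonglongrightarrow> pmf (Q F) et" if "finite F" for F et
  using someI_ex[OF ex[OF that]] unfolding Q_def by blast
 have pr: "(%n. measure_pmf.prob (p F n) A) \<longlonglongrightarrow> measure_pmf.prob (Q F) A" if "finite F" for F A
  by (rule pmf_limit_prob[OF Q[OF that]])
 have image: "(%n. pmf (map_pmf f (p F n)) k) \<longlonglongrightarrow> pmf (map_pmf f (Q F)) k" if "finite F" for F and f :: "_ => site => int" and k
  unfolding pmf_map by (rule pr[OF that])
 show ?thesis
  unfolding gibbs_marginals_def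
 proof (intro exI conjI allI impI)
  fix J H :: "site set" assume JH: "finite H \<and> J \<subseteq> H"
  then have J: "finite J" using finite_subset by blast
  have m: "map_pmf (%et. restrict et J) (p H n) = p J n" for n
   using JH by (simp add: p_def pmf.map_comp o_def Int_absorb2 Int_absorb1)
  show "map_pmf (%et. restrict et J) (Q H) = Q J"
  proof (rule pmf_eqI)
   fix k
   have "(%n. pmf (p J n) k) \<longlonglongrightarrow> pmf (map_pmf (%et. restrict et J) (Q H)) k"
    using image[of H "%et. restrict et J" k] JH unfolding m by blast
   then show "pmf (map_pmf (%et. restrict et J) (Q H)) k = pmf (Q J) k" by (rule LIMSEQ_unique[OF _ Q[OF J]])
  qed
 next
  fix F :: "site set" and a assume F: "finite F"
  let ?G = "(%y. y + a) ` F" and ?t = "%et :: site => int. \<lambda>y\<in>F. et (y + a)"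
  have G: "finite ?G" using F by simp
  have m: "map_pmf ?t (p ?G n) = map_pmf (%h. restrict (%y. h (y + a)) F) (\<nu> (r n))" for n
   unfolding p_def pmf.map_comp by (rule map_pmf_cong[OF refl]) (auto simp: restrict_def)
  show "map_pmf ?t (Q ?G) = Q F"
  proof (rule pmf_eqI)
   fix k
   have "(%n. pmf (map_pmf ?t (p ?G n)) k - pmf (p F n) k) \<longlonglongrightarrow> 0"
   proof (rule Lim_null_comparison[OF _ inv0])
    have "norm (pmf (map_pmf ?t (p ?G n)) k - pmf (p F n) k) <= (4 * real (rad a) + 4 * (real (rad a))\<^sup>2) * inverse (real (Suc (r n)))" for n
    proof -
     have "\<bar>pmf (map_pmf ?t (p ?G n)) k - pmf (p F n) k\<bar> <= (real (card (square (r n + rad a))) - real (card (square (r n)))) / real (card (square (r n)))"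
      unfolding m unfolding p_def \<nu>_def by (rule averaged_law_translate[OF be, of "%h. restrict h F"])
     then show ?thesis using card_square_growth[of "r n" "rad a"] by (simp only: real_norm_def)
    qed
    then show "eventually (%n. norm (pmf (map_pmf ?t (p ?G n)) k - pmf (p F n) k) <= (4 * real (rad a) + 4 * (real (rad a))\<^sup>2) * inverse (real (Suc (r n)))) sequentially" by simp
   qed
   moreover have "(%n. pmf (map_pmf ?t (p ?G n)) k - pmf (p F n) k) \<longlonglongrightarrow> pmf (map_pmf ?t (Q ?G)) k - pmf (Q F) k"
    by (intro tendsto_diff image[OF G] Q[OF F])
   ultimately have "0 = pmf (map_pmf ?t (Q ?G)) k - pmf (Q F) k" by (rule LIMSEQ_unique)
   then show "pmf (map_pmf ?t (Q ?G)) k = pmf (Q F) k" by simp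
  qed
 next
  fix La F assume cov: "covers F La"
  have F: "finite F" and La: "finite La" and E: "\<And>e. e \<in> pos_edges La ==> fst e \<in> F \<and> snd e \<in> F"
   using cov finite_subset unfolding covers_def by blast+
  let ?\<kappa> = "%et. map_pmf (%h. restrict h F) (gibbs_pmf be La et)"
  have m: "bind_pmf (p F n) ?\<kappa> = map_pmf (%h. restrict h F) (bind_pmf (\<nu> (r n)) (gibbs_pmf be La))" for n
   unfolding p_def bind_map_pmf map_bind_pmf
  proof (rule bind_pmf_cong[OF refl])
   fix h :: "site => int"
   show "?\<kappa> (restrict h F) = ?\<kappa> h" by (rule gibbs_pmf_local[OF be La E]) auto
  qed
  show "bind_pmf (Q F) ?\<kappa> = Q F"
  proof (rule pmf_eqI)
   fix k
   have "(%n. pmf (bind_pmf (p F n) ?\<kappa>) k - pmf (p F n) k) \<longlonglongrightarrow> 0"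
   proof (rule Lim_null_comparison[OF _ inv0])
    show "eventually (%n. norm (pmf (bind_pmf (p F n) ?\<kappa>) k - pmf (p F n) k) <= real (card La) * inverse (real (Suc (r n)))) sequentially"
     using big[OF La]
    proof eventually_elim
     case (elim n)
     have "\<bar>pmf (bind_pmf (p F n) ?\<kappa>) k - pmf (p F n) k\<bar> <= real (card La) / real (card (square (r n)))"
      unfolding m unfolding p_def \<nu>_def by (rule averaged_law_gibbs[OF be La elim Rf(1)])
     also have "... <= real (card La) / real (Suc (r n))"
      by (rule divide_left_mono[OF card_square_lower]) (use card_square_lower[of "r n"] in auto)
     finally show ?case by (simp add: divide_inverse)
    qed
   qed
   moreover have "(%n. pmf (bind_pmf (p F n) ?\<kappa>) k - pmf (p F n) k) \<longlonglongrightarrow> pmf (bind_pmf (Q F) ?\<kappa>) k - pmf (Q F) k"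
    unfolding pmf_bind_gibbs[OF be cov] by (intro tendsto_diff tendsto_mult tendsto_const pr[OF F] Q[OF F])
   ultimately have "0 = pmf (bind_pmf (Q F) ?\<kappa>) k - pmf (Q F) k" by (rule LIMSEQ_unique)
   then show "pmf (bind_pmf (Q F) ?\<kappa>) k = pmf (Q F) k" by simp
  qed
 qed
qed

section \<open>From marginals to a Gibbs measure\<close>

text \<open>Each undirected edge occurs in both orientations, and the potential is even by the
  symmetry of the Skellam law, so the weight is a product over positive edges. The factors exp be
  from the Bessel functions depend on the volume only and cancel.\<close>

lemma gibbs_kernel_pmf:
 assumes be: "be > 0" and La: "finite La"
 shows "gibbs_kernel (height_potential be) La \<phi> = distr (measure_pmf (gibbs_pmf be La \<phi>)) height_space (%h. h)"
proof -
 let ?E = "pos_edges La" and ?H = "heights La \<phi>" and ?P = "gibbs_pmf be La \<phi>"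
 let ?V = "height_potential be" and ?f = "%h. exp (- edge_sum (incident_edges La) (%(x, y). height_potential be (h y - h x)))"
 define c where "c = exp be ^ card ?E * gibbs_partition be La \<phi>"
 have c: "c > 0" unfolding c_def using gibbs_partition_pos[OF be La] by simp
 have bpos: "bessel_I n be > 0" for n
  unfolding bessel_skellam[OF be] using set_pmf_skellam[OF be] by (simp add: pmf_positive_iff)
 have Vm: "?V (- n) = ?V n" for n
  by (simp add: height_potential_def bessel_skellam[OF be] pmf_skellam_minus)
 have weight: "?f h = exp be ^ card ?E * height_weight be La h" for h
 proof -
  let ?v = "%e. ?V (h (snd e) - h (fst e))"
  have sw: "?v (prod.swap e) = ?v e" for e
   using Vm[of "h (snd e) - h (fst e)"] by simp
  have "edge_sum (incident_edges La) (%(x, y). ?V (h y - h x)) = (\<Sum>e\<in>incident_edges La. ?v e) / 2"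
   by (simp add: edge_sum_def case_prod_unfold)
  also have "(\<Sum>e\<in>incident_edges La. ?v e) = (\<Sum>e\<in>?E. ?v e) + (\<Sum>e\<in>prod.swap ` ?E. ?v e)"
   unfolding incident_pos_edges(1) using incident_pos_edges(2) La by (intro sum.union_disjoint) auto
  also have "(\<Sum>e\<in>prod.swap ` ?E. ?v e) = (\<Sum>e\<in>?E. ?v e)"
   by (subst sum.reindex) (simp_all only: o_def sw inj_swap)
  finally have "- edge_sum (incident_edges La) (%(x, y). ?V (h y - h x)) = (\<Sum>e\<in>?E. ln (bessel_I (h (snd e) - h (fst e)) be))"
   by (simp add: height_potential_def sum_negf)
  then have "?f h = (\<Prod>e\<in>?E. bessel_I (h (snd e) - h (fst e)) be)"
   using La bpos by (simp add: exp_sum)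
  also have "... = exp be ^ card ?E * height_weight be La h"
   by (simp add: bessel_skellam[OF be] height_weight_def prod.distrib)
  finally show ?thesis .
 qed
 have f: "?f h = c * pmf ?P h" if "h \<in> ?H" for h
  using that gibbs_partition_pos[OF be La, of \<phi>] by (simp add: weight c_def pmf_gibbs[OF be La])
 have "(\<integral>\<^sup>+h. ennreal (?f h) \<partial>count_space ?H) = (\<integral>\<^sup>+h. ennreal c * ennreal (pmf ?P h) \<partial>count_space ?H)"
  using c by (intro nn_integral_cong) (simp only: space_count_space f ennreal_mult less_imp_le pmf_nonneg)
 also have "... = ennreal c * emeasure (measure_pmf ?P) ?H" by (subst nn_integral_cmult) (auto simp: nn_integral_pmf)
 also have "emeasure (measure_pmf ?P) ?H = 1" using emeasure_pmf[of ?P] by (simp only: set_gibbs_pmf[OF be La])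
 finally have norm: "(\<integral>\<^sup>+h. ennreal (?f h) \<partial>count_space ?H) = ennreal c" by simp
 let ?D = "density (count_space ?H) (%h. ennreal (?f h) / ennreal c)"
 have dens: "ennreal (?f h) / ennreal c = ennreal (pmf ?P h)" if "h \<in> ?H" for h
  unfolding f[OF that] using c by (simp add: divide_ennreal)
 have "gibbs_kernel ?V La \<phi> = distr ?D height_space (%h. h)"
  unfolding gibbs_kernel_def normalised_density_def norm[unfolded heights_def] heights_def ..
 also have "... = distr (measure_pmf ?P) height_space (%h. h)"
 proof (rule measure_eqI)
  fix A assume "A \<in> sets (distr ?D height_space (%h. h))"
  then have A: "A \<in> sets height_space" by simp
  have sp: "space height_space = UNIV" by (simp add: height_space_def space_PiM)
  have m1: "(%h. h) \<in> measurable ?D height_space" by (simp add: sp measurable_def Pi_iff)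
  have m2: "(%h. h) \<in> measurable (measure_pmf ?P) height_space" by (simp add: sp)
  have "emeasure (distr ?D height_space (%h. h)) A = emeasure ?D (A \<inter> ?H)"
   by (simp add: emeasure_distr[OF m1 A])
  also have "... = (\<integral>\<^sup>+h. ennreal (?f h) / ennreal c * indicator (A \<inter> ?H) h \<partial>count_space ?H)"
   by (rule emeasure_density) auto
  also have "... = (\<integral>\<^sup>+h. ennreal (pmf ?P h) * indicator (A \<inter> ?H) h \<partial>count_space ?H)"
   by (intro nn_integral_cong) (simp only: space_count_space dens)
  also have "... = (\<integral>\<^sup>+h. ennreal (pmf ?P h) * indicator (A \<inter> ?H) h * indicator ?H h \<partial>count_space UNIV)"
   by (subst nn_integral_count_space_indicator) auto
  also have "... = (\<integral>\<^sup>+h. ennreal (pmf ?P h) * indicator (A \<inter> ?H) h \<partial>count_space UNIV)"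
   by (intro nn_integral_cong) (auto simp: indicator_def)
  also have "... = (\<integral>\<^sup>+h. ennreal (pmf ?P h) \<partial>count_space (A \<inter> ?H))"
   by (subst (2) nn_integral_count_space_indicator) auto
  also have "... = emeasure (measure_pmf ?P) (A \<inter> set_pmf ?P)"
   by (simp only: nn_integral_pmf set_gibbs_pmf[OF be La])
  also have "... = emeasure (measure_pmf ?P) A" by (rule emeasure_Int_set_pmf)
  also have "... = emeasure (distr (measure_pmf ?P) height_space (%h. h)) A"
   by (simp add: emeasure_distr[OF m2 A])
  finally show "emeasure (distr ?D height_space (%h. h)) A = emeasure (distr (measure_pmf ?P) height_space (%h. h)) A" .
 qed simp
 finally show ?thesis .
qed

lemma restrict_height_measurable:
 "(%h. restrict h F) \<in> measurable height_space (Pi\<^sub>M F (%_. count_space UNIV :: int measure))"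
 unfolding height_space_def by (rule measurable_restrict_subset) simp

lemma height_law_kernel:
 assumes be: "be > 0" and La: "finite La" and A: "A \<in> sets (Pi\<^sub>M La (%_. count_space UNIV))"
 shows "emeasure (height_law La (gibbs_kernel (height_potential be) La \<phi>)) A =
  emeasure (measure_pmf (map_pmf (%h. restrict h La) (gibbs_pmf be La \<phi>))) A"
proof -
 let ?P = "measure_pmf (gibbs_pmf be La \<phi>)"
 have m: "(%h. h) \<in> measurable ?P height_space" by (simp add: height_space_def space_PiM)
 have m': "(%h. restrict h La) \<in> measurable ?P (Pi\<^sub>M La (%_. count_space UNIV :: int measure))" by (simp add: space_PiM)
 have "height_law La (gibbs_kernel (height_potential be) La \<phi>) = distr ?P (Pi\<^sub>M La (%_. count_space UNIV)) (%h. restrict h La)"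
  unfolding height_law_def gibbs_kernel_pmf[OF be La] distr_distr[OF restrict_height_measurable m] by (simp add: o_def)
 then show ?thesis by (simp add: emeasure_distr[OF m' A])
qed

text \<open>Integer heights are regarded as reals so that the extension theorem of
  \<open>polish_projective\<close> applies on Borel spaces; the floor function leads back.\<close>

definition real_cylinder :: "(site => int) pmf => site set => (site => real) measure" where
 "real_cylinder P J = distr (measure_pmf P) (Pi\<^sub>M J (%_. borel)) (%et. \<lambda>x\<in>J. real_of_int (et x))"

lemma gibbs_measure_from_marginals:
 assumes be: "be > 0" and Q: "gibbs_marginals be Q"
 shows "\<exists>\<nu>. gibbs_measure (height_potential be) \<nu> \<and> translation_invariant \<nu>"
proof -
 have cons: "map_pmf (%et. restrict et J) (Q H) = Q J" if "finite H" "J \<subseteq> H" for J H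
  using Q that unfolding gibbs_marginals_def by blast
 have shift: "map_pmf (%et. \<lambda>y\<in>F. et (y + a)) (Q ((%y. y + a) ` F)) = Q F" if "finite F" for F a
  using Q that unfolding gibbs_marginals_def by blast
 have dlr: "bind_pmf (Q F) (%et. map_pmf (%h. restrict h F) (gibbs_pmf be La et)) = Q F" if "covers F La" for F La
  using Q that unfolding gibbs_marginals_def by blast
 let ?C = "%F. Pi\<^sub>M F (%_. count_space UNIV :: int measure)" and ?B = "%F. Pi\<^sub>M F (%_. borel :: real measure)"
 let ?e = "%J (et :: site => int). \<lambda>x\<in>J. real_of_int (et x)"
 have em: "?e J \<in> measurable (measure_pmf P) (?B J)" for J P by (simp add: space_PiM)
 have pf: "projective_family UNIV (%J. real_cylinder (Q J) J) (%_. borel)"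
 proof (rule projective_family.intro)
  fix J H :: "site set" assume JH: "J \<subseteq> H" "finite H"
  have rm: "(%f. restrict f J) \<in> measurable (?B H) (?B J)" by (rule measurable_restrict_subset[OF JH(1)])
  have "real_cylinder (Q J) J = distr (distr (measure_pmf (Q H)) (count_space UNIV) (%et. restrict et J)) (?B J) (?e J)"
   unfolding real_cylinder_def cons[OF JH(2,1), symmetric] map_pmf_rep_eq ..
  also have "... = distr (measure_pmf (Q H)) (?B J) (?e J \<circ> (%et. restrict et J))"
   by (rule distr_distr) (auto simp: space_PiM)
  also have "?e J \<circ> (%et. restrict et J) = (%f. restrict f J) \<circ> ?e H"
   using JH(1) by (auto simp: fun_eq_iff restrict_def)
  also have "distr (measure_pmf (Q H)) (?B J) ((%f. restrict f J) \<circ> ?e H) = distr (real_cylinder (Q H) H) (?B J) (%f. restrict f J)"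
   unfolding real_cylinder_def by (rule distr_distr[OF rm em, symmetric])
  finally show "real_cylinder (Q J) J = distr (real_cylinder (Q H) H) (?B J) (%f. restrict f J)" .
 next
  fix J :: "site set"
  show "prob_space (real_cylinder (Q J) J)"
   unfolding real_cylinder_def by (rule measure_pmf.prob_space_distr[OF em])
 qed
 interpret PP: polish_projective "UNIV :: site set" "%J. real_cylinder (Q J) J"
  by (rule polish_projective.intro[OF pf])
 \<comment> \<open>Taking floors makes the configuration integer valued everywhere, not only almost
   surely.\<close>
 define \<nu> where "\<nu> = distr PP.lim height_space (%f x. \<lfloor>f x\<rfloor>)"
 have fl: "(%f. \<lfloor>f x\<rfloor>) \<in> measurable (?B F) (count_space UNIV)" if "x \<in> F" for x :: site and F
 proof -
  have "(%f. f x) \<in> borel_measurable (?B F)" by (rule measurable_component_singleton[OF that])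
  then show ?thesis by (rule measurable_compose[OF _ measurable_real_floor])
 qed
 have floor_m: "(%f x. \<lfloor>f x\<rfloor>) \<in> measurable PP.lim height_space"
  unfolding height_space_def measurable_cong_sets[OF PP.sets_lim refl]
  by (rule measurable_abs_UNIV, rule fl) simp
 have sets: "sets \<nu> = sets height_space" by (simp add: \<nu>_def)
 interpret \<nu>: prob_space \<nu> unfolding \<nu>_def by (rule PP.P.prob_space_distr[OF floor_m])
 have restrict_m: "(%h. restrict h F) \<in> measurable \<nu> (?C F)" for F
  unfolding measurable_cong_sets[OF sets refl] by (rule restrict_height_measurable)
 have marginal: "height_law F \<nu> = distr (measure_pmf (Q F)) (?C F) (%et. restrict et F)" if F: "finite F" for F
 proof -
  have rl: "(%f. restrict f F) \<in> measurable PP.lim (?B F)"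
   unfolding measurable_cong_sets[OF PP.sets_lim refl] by (rule measurable_restrict_subset) simp
  have fm: "(%g. \<lambda>x\<in>F. \<lfloor>g x\<rfloor>) \<in> measurable (?B F) (?C F)" by (rule measurable_restrict, rule fl)
  have lim: "distr PP.lim (?B F) (%f. restrict f F) = real_cylinder (Q F) F"
  proof (rule measure_eqI)
   fix X assume "X \<in> sets (distr PP.lim (?B F) (%f. restrict f F))"
   then have X: "X \<in> sets (?B F)" by simp
   have "emeasure (distr PP.lim (?B F) (%f. restrict f F)) X = emeasure PP.lim (prod_emb UNIV (%_. borel) F X)"
    unfolding emeasure_distr[OF rl X] by (simp add: prod_emb_def space_PiM)
   also have "... = emeasure (real_cylinder (Q F) F) X" by (rule PP.emeasure_lim_emb[OF subset_UNIV F X])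
   finally show "emeasure (distr PP.lim (?B F) (%f. restrict f F)) X = emeasure (real_cylinder (Q F) F) X" .
  qed (simp add: real_cylinder_def)
  have "height_law F \<nu> = distr PP.lim (?C F) ((%h. restrict h F) \<circ> (%f x. \<lfloor>f x\<rfloor>))"
   unfolding height_law_def \<nu>_def by (rule distr_distr[OF restrict_height_measurable floor_m])
  also have "(%h. restrict h F) \<circ> (%f x. \<lfloor>f x\<rfloor>) = (%g. \<lambda>x\<in>F. \<lfloor>g x\<rfloor>) \<circ> (%f :: site => real. restrict f F)"
   by (auto simp: fun_eq_iff restrict_def)
  also have "distr PP.lim (?C F) ((%g. \<lambda>x\<in>F. \<lfloor>g x\<rfloor>) \<circ> (%f. restrict f F)) = distr (real_cylinder (Q F) F) (?C F) (%g. \<lambda>x\<in>F. \<lfloor>g x\<rfloor>)"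
   unfolding lim[symmetric] by (rule distr_distr[OF fm rl, symmetric])
  also have "... = distr (measure_pmf (Q F)) (?C F) ((%g. \<lambda>x\<in>F. \<lfloor>g x\<rfloor>) \<circ> ?e F)"
   unfolding real_cylinder_def by (rule distr_distr[OF fm em])
  also have "(%g. \<lambda>x\<in>F. \<lfloor>g x\<rfloor>) \<circ> ?e F = (%et. restrict et F)" by (auto simp: fun_eq_iff restrict_def)
  finally show ?thesis .
 qed
 have pm: "(%et. restrict et F) \<in> measurable (measure_pmf P) (?C F)" for F P by (simp add: space_PiM)
 have "gibbs_measure (height_potential be) \<nu>"
  unfolding gibbs_measure_def
 proof (intro conjI allI impI ballI sets)
  show "prob_space \<nu>" by (rule \<nu>.prob_space_axioms)
  fix La :: "site set" and A assume La: "finite La" and A: "A \<in> sets (?C La)"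
  \<comment> \<open>The volume together with the ends of its incident edges: all that the kernel
    looks at.\<close>
  define F where "F = La \<union> fst ` pos_edges La \<union> snd ` pos_edges La"
  have cov: "covers F La" using La by (auto simp: covers_def F_def)
  have F: "finite F" and sub: "La \<subseteq> F" and E: "\<And>e. e \<in> pos_edges La ==> fst e \<in> F \<and> snd e \<in> F"
   using cov unfolding covers_def by blast+
  define K where "K \<phi> = emeasure (measure_pmf (map_pmf (%h. restrict h La) (gibbs_pmf be La \<phi>))) A" for \<phi>
  have two: "map_pmf (%h. restrict h La) (map_pmf (%h. restrict h F) P) = map_pmf (%h. restrict h La) P" for P :: "(site => int) pmf"
   using sub by (simp add: pmf.map_comp o_def Int_absorb1)
  have Kr: "K (restrict \<phi> F) = K \<phi>" for \<phi>
  proof -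
   have "map_pmf (%h. restrict h F) (gibbs_pmf be La (restrict \<phi> F)) = map_pmf (%h. restrict h F) (gibbs_pmf be La \<phi>)"
    by (rule gibbs_pmf_local[OF be La E]) auto
   then have "map_pmf (%h. restrict h La) (gibbs_pmf be La (restrict \<phi> F)) = map_pmf (%h. restrict h La) (gibbs_pmf be La \<phi>)"
    using two by metis
   then show ?thesis by (simp only: K_def)
  qed
  \<comment> \<open>On a finite window the product of discrete spaces is itself discrete, so
    measurability is automatic.\<close>
  have Km: "K \<in> borel_measurable (?C F)"
  proof -
   have "?C F = count_space (PiE F (%_. UNIV))" by (rule count_space_PiM_finite[OF F]) simp
   then show ?thesis by simp
  qed
  have "(\<integral>\<^sup>+\<phi>. emeasure (height_law La (gibbs_kernel (height_potential be) La \<phi>)) A \<partial>\<nu>) = (\<integral>\<^sup>+\<phi>. K (restrict \<phi> F) \<partial>\<nu>)"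
   by (simp only: height_law_kernel[OF be La A] Kr) (simp only: K_def)
  also have "... = (\<integral>\<^sup>+et. K et \<partial>height_law F \<nu>)"
   unfolding height_law_def by (rule nn_integral_distr[OF restrict_m, symmetric]) (use Km in simp)
  also have "... = (\<integral>\<^sup>+et. K (restrict et F) \<partial>measure_pmf (Q F))"
   unfolding marginal[OF F] by (rule nn_integral_distr[OF pm]) (use Km in simp)
  also have "... = emeasure (measure_pmf (bind_pmf (Q F) (%et. map_pmf (%h. restrict h La) (gibbs_pmf be La et)))) A"
   unfolding Kr by (simp only: emeasure_bind_pmf K_def)
  also have "bind_pmf (Q F) (%et. map_pmf (%h. restrict h La) (gibbs_pmf be La et)) =
    map_pmf (%h. restrict h La) (bind_pmf (Q F) (%et. map_pmf (%h. restrict h F) (gibbs_pmf be La et)))"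
   unfolding map_bind_pmf two ..
  also have "... = map_pmf (%h. restrict h La) (Q La)"
   unfolding dlr[OF cov] cons[OF F sub] cons[OF La subset_refl] ..
  also have "emeasure (measure_pmf (map_pmf (%h. restrict h La) (Q La))) A = emeasure (height_law La \<nu>) A"
   unfolding marginal[OF La] emeasure_distr[OF pm A] by simp
  finally show "emeasure (height_law La \<nu>) A = (\<integral>\<^sup>+\<phi>. emeasure (height_law La (gibbs_kernel (height_potential be) La \<phi>)) A \<partial>\<nu>)" by (rule sym)
 qed
 moreover have "translation_invariant \<nu>"
  unfolding translation_invariant_def
 proof
  fix a :: site
  have shm: "(%h x. h (x + a)) \<in> measurable \<nu> height_space"
   unfolding measurable_cong_sets[OF sets refl] unfolding height_space_def
   by (rule measurable_abs_UNIV, rule measurable_component_singleton) simp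
  let ?\<nu>' = "distr \<nu> height_space (%h x. h (x + a))"
  have law: "height_law J ?\<nu>' = height_law J \<nu>" if J: "finite J" for J
  proof -
   let ?G = "(%y. y + a) ` J" and ?t = "%et :: site => int. \<lambda>y\<in>J. et (y + a)"
   have G: "finite ?G" using J by simp
   have tm: "?t \<in> measurable (?C ?G) (?C J)" by (rule measurable_restrict, rule measurable_component_singleton) simp
   have tpm: "?t \<in> measurable (measure_pmf P) (?C J)" for P by (simp add: space_PiM)
   have "height_law J ?\<nu>' = distr \<nu> (?C J) ((%h. restrict h J) \<circ> (%h x. h (x + a)))"
    unfolding height_law_def by (rule distr_distr[OF restrict_height_measurable shm])
   also have "(%h. restrict h J) \<circ> (%h x. h (x + a)) = ?t \<circ> (%h :: site => int. restrict h ?G)"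
    by (auto simp: fun_eq_iff restrict_def)
   also have "distr \<nu> (?C J) (?t \<circ> (%h. restrict h ?G)) = distr (height_law ?G \<nu>) (?C J) ?t"
    unfolding height_law_def by (rule distr_distr[OF tm restrict_m, symmetric])
   also have "... = distr (measure_pmf (Q ?G)) (?C J) (?t \<circ> (%et. restrict et ?G))"
    unfolding marginal[OF G] by (rule distr_distr[OF tm pm])
   also have "?t \<circ> (%et. restrict et ?G) = (%et. restrict et J) \<circ> ?t" by (auto simp: fun_eq_iff restrict_def)
   also have "distr (measure_pmf (Q ?G)) (?C J) ((%et. restrict et J) \<circ> ?t) =
     distr (distr (measure_pmf (Q ?G)) (count_space UNIV) ?t) (?C J) (%et. restrict et J)"
    by (rule distr_distr[symmetric]) (auto simp: space_PiM)
   also have "... = distr (measure_pmf (Q J)) (?C J) (%et. restrict et J)"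
    unfolding map_pmf_rep_eq[symmetric] shift[OF J] ..
   also have "... = height_law J \<nu>" by (rule marginal[OF J, symmetric])
   finally show ?thesis .
  qed
  show "?\<nu>' = \<nu>"
  proof (rule measure_eqI_PiM_infinite[where M="%_. count_space UNIV" and I=UNIV])
   show "sets ?\<nu>' = sets (Pi\<^sub>M UNIV (%_. count_space UNIV))" by (simp add: height_space_def)
   show "sets \<nu> = sets (Pi\<^sub>M UNIV (%_. count_space UNIV))" by (simp add: sets height_space_def)
   show "finite_measure ?\<nu>'" using \<nu>.prob_space_distr[OF shm] by (simp add: prob_space_def)
   fix A :: "site => int set" and J :: "site set" assume J: "finite J"
   let ?X = "Pi\<^sub>E J A"
   have X: "?X \<in> sets (?C J)" using J by (intro sets_PiM_I_finite) auto
   have emb: "prod_emb UNIV (%_. count_space UNIV) J ?X = (%h. restrict h J) -` ?X"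
    by (simp add: prod_emb_def)
   have rm': "(%h. restrict h J) \<in> measurable ?\<nu>' (?C J)" using restrict_height_measurable by simp
   have "space ?\<nu>' = UNIV" "space \<nu> = UNIV"
    by (simp_all add: height_space_def space_PiM \<nu>_def)
   then show "emeasure ?\<nu>' (prod_emb UNIV (%_. count_space UNIV) J ?X) = emeasure \<nu> (prod_emb UNIV (%_. count_space UNIV) J ?X)"
    using arg_cong[OF law[OF J], of "%M. emeasure M ?X"] unfolding height_law_def emeasure_distr[OF rm' X] emeasure_distr[OF restrict_m X] emb
    by simp
  qed
 qed
 ultimately show ?thesis by blast
qed

text \<open>The reflection in the vertical line at k / 2 exchanges the dual bonds of the edges 0 and
  k, so the correlation is of the form treated by reflection positivity. The line passes through
  sites for even k and bisects bonds for odd k.\<close>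

lemma row_current_nonneg:
 assumes c: "c \<ge> 0" and k: "k > 0" shows "row_current c k \<ge> 0"
proof -
 let ?R = "%x :: site. (int k - fst x, snd x)" and ?L = "{x :: site. 2 * fst x < int k}"
 \<comment> \<open>The boxes are centred on the reflection line so that the bond sets are mirror
   symmetric; monotonicity makes their limit the same as along squares.\<close>
 define B where "B n = {x :: site. - int n <= fst x \<and> fst x <= int k + int n \<and> \<bar>snd x\<bar> <= int n}" for n
 define F where "F n = {b\<in>Z2_edges. fst b \<in> B n \<and> snd b \<in> B n}" for n
 have finB: "finite (B n)" for n
  by (rule finite_subset[of _ "{- int n..int k + int n} \<times> {- int n..int n}"]) (auto simp: B_def)
 have finF: "finite (F n)" for n
  by (rule finite_subset[OF _ finite_cartesian_product[OF finB finB]]) (auto simp: F_def)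
 have ex: "eventually (%n. b \<in> F n) sequentially" if "b \<in> Z2_edges" for b
 proof (rule eventually_sequentiallyI)
  fix n assume "rad (fst b) + rad (snd b) <= n"
  then show "b \<in> F n" using that by (auto simp: F_def B_def rad_def)
 qed
 have RL: "?R ` ?L = {x. 2 * fst x > int k}"
 proof (intro equalityI subsetI)
  fix x :: site assume "x \<in> {x. 2 * fst x > int k}"
  then have "?R x \<in> ?L" "x = ?R (?R x)" by (auto simp: prod_eq_iff)
  then show "x \<in> ?R ` ?L" by blast
 qed auto
 let ?g = "%th. edge_current th (row_edge 0 0)"
 have g: "bdd_meas spin_space ?g" unfolding edge_current_def by (rule bdd_meas_bond)
 have gR: "?g (%x. th (?R x)) = edge_current th (row_edge 0 (int k))" for th
  by (simp add: edge_current_def bond_row_edge)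
 have pos: "xy_mean c (F n) (%th. edge_current th (row_edge 0 0) * edge_current th (row_edge 0 (int k))) \<ge> 0" for n
 proof -
  have "xy_mean c (F n) (%th. ?g th * ?g (%x. th (?R x))) \<ge> 0"
  proof (rule xy_reflection_positive[where L="?L", OF c finF _ _ _ _ _ g])
   show "?R (?R x) = x" for x by simp
   show "?L \<inter> ?R ` ?L = {}" unfolding RL by auto
   show "?R x = x" if "x \<notin> ?L" "x \<notin> ?R ` ?L" for x using that unfolding RL by (simp add: prod_eq_iff)
   show "(?R x, ?R y) \<in> F n" if "(x, y) \<in> F n" for x y using that by (auto simp: F_def B_def Z2_edges_def)
   show "y = ?R x" if "(x, y) \<in> F n" "x \<in> ?L \<and> y \<in> ?R ` ?L \<or> x \<in> ?R ` ?L \<and> y \<in> ?L" for x y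
    using that unfolding RL by (auto simp: F_def Z2_edges_iff prod_eq_iff)
   show "?g th = ?g th'" if "\<And>x. x \<notin> ?R ` ?L ==> th x = th' x" for th th'
   proof -
    have "(0, 0) \<notin> ?R ` ?L" "(0, -1) \<notin> ?R ` ?L" unfolding RL by auto
    then have "th (0, 0) = th' (0, 0)" "th (0, -1) = th' (0, -1)" using that by blast+
    then show ?thesis by (simp add: edge_current_def bond_row_edge)
   qed
  qed
  then show ?thesis unfolding gR .
 qed
 have "(%n. xy_mean c (F n) (%th. edge_current th (row_edge 0 0) * edge_current th (row_edge 0 (int k)))) \<longlonglongrightarrow> row_current c k"
  unfolding row_current_def current_covariance_def xy_mean_current
  by (intro tendsto_divide tendsto_diff tendsto_const xy_lim_tendsto spin.character_mult spin.character_cnj bond_character c finF ex)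
   (auto simp: F_def)
 then show ?thesis by (rule LIMSEQ_le_const) (use pos in blast)
qed

text \<open>The four-spin inequality is applied to the faces above and below the edges 0 and k and
  passes to the limit; translation invariance identifies the upper and the lower two-point
  function.\<close>

lemma row_current_le:
 assumes c: "c \<ge> 0"
 shows "row_current c k <= (xy_lim c (chi2 (0, 0) (int k, 0)))\<^sup>2 - xy_lim c (chi4 (0, 0) (0, -1) (int k, 0) (int k, -1)) / 2"
proof -
 let ?p = "(0, 0) :: site" and ?q = "(int k, 0) :: site" and ?p' = "(0, -1) :: site" and ?q' = "(int k, -1) :: site"
 let ?F = "%n. dual_bonds n"
 have lim: "(%n. xy_mean c (?F n) (%th. Re (\<xi> th))) \<longlonglongrightarrow> xy_lim c \<xi>" if "spin.character \<xi>" for \<xi>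
  by (intro xy_lim_tendsto that c dual_bonds_Z2 eventually_dual_bonds)
 have e: "Re (chi4 ?p ?q' ?p' ?q th) = Re (bond th (face_bond (row_edge 0 0)) * cnj (bond th (face_bond (row_edge 0 (int k)))))"
  "Re (chi4 ?p ?q ?p' ?q' th) = Re (bond th (face_bond (row_edge 0 0)) * bond th (face_bond (row_edge 0 (int k))))" for th
  unfolding chi4_def bond_row_edge by (simp_all add: algebra_simps)
 have "xy_lim c (%th. chi2 ?p ?q (%i. th (i + ?p'))) = xy_lim c (chi2 ?p ?q)" by (rule xy_lim_shift[OF chi_character(2)])
 moreover have "(%th. chi2 ?p ?q (%i. th (i + ?p'))) = chi2 ?p' ?q'" by (simp add: chi2_def fun_eq_iff)
 ultimately have low: "xy_lim c (chi2 ?p' ?q') = xy_lim c (chi2 ?p ?q)" by simp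
 have "(%n. (xy_mean c (?F n) (%th. Re (chi4 ?p ?q' ?p' ?q th)) - xy_mean c (?F n) (%th. Re (chi4 ?p ?q ?p' ?q' th))) / 2) \<longlonglongrightarrow> row_current c k"
  unfolding e row_current_def current_covariance_def
  by (intro tendsto_divide tendsto_diff tendsto_const lim spin.character_mult spin.character_cnj bond_character) simp
 moreover have "(%n. xy_mean c (?F n) (%th. Re (chi2 ?p ?q th)) * xy_mean c (?F n) (%th. Re (chi2 ?p' ?q' th)) - xy_mean c (?F n) (%th. Re (chi4 ?p ?p' ?q ?q' th)) / 2)
   \<longlonglongrightarrow> xy_lim c (chi2 ?p ?q) * xy_lim c (chi2 ?p' ?q') - xy_lim c (chi4 ?p ?p' ?q ?q') / 2"
  by (intro tendsto_diff tendsto_mult tendsto_divide tendsto_const lim chi_character) simp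
 ultimately have "row_current c k <= xy_lim c (chi2 ?p ?q) * xy_lim c (chi2 ?p' ?q') - xy_lim c (chi4 ?p ?p' ?q ?q') / 2"
  by (rule LIMSEQ_le) (intro exI allI impI xy_four_point_bound[OF c])
 then show ?thesis unfolding low by (simp add: power2_eq_square)
qed

theorem corollary4p3:
  fixes \<beta> :: real and \<mu> :: "site form measure"
  assumes "\<beta> > 0"
    and "subsequential_torus_limit (xy_potential \<beta>) \<mu>"
    and "delocalises (height_potential \<beta>)"
  shows "(\<Sum>i. ereal (real (Suc i) * (two_point \<mu> (Suc i))\<^sup>2))
           \<ge> (\<Sum>i. ereal (real (Suc i) * ((two_point \<mu> (Suc i))\<^sup>2 - 1/2 * four_point \<mu> (Suc i)))) \<and>
         (\<lambda>i. ereal (real (Suc i) * ((two_point \<mu> (Suc i))\<^sup>2 - 1/2 * four_point \<mu> (Suc i)))) sums \<infinity>"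
proof -
  define A where "A i = real (Suc i) * ((two_point \<mu> (Suc i))\<^sup>2 - 1/2 * four_point \<mu> (Suc i))" for i
  let ?c = "\<beta> / 2"
  have c: "?c \<ge> 0" using assms(1) by simp
  note b = torus_limit_bounds[OF assms(1,2)]
  \<comment> \<open>The free two-point function is nonnegative, so its lower bound for the torus
    limit may be squared.\<close>
  have low: "real (Suc i) * row_current ?c (Suc i) \<le> A i" for i
  proof -
    let ?\<tau> = "xy_lim ?c (chi2 (0, 0) (int (Suc i), 0))"
    have "0 \<le> ?\<tau>" by (rule xy_lim_nonneg[OF chi_character(2) c])
    then have "?\<tau>\<^sup>2 \<le> (two_point \<mu> (Suc i))\<^sup>2" using b(1) by (rule power_mono[rotated])
    then have "row_current ?c (Suc i) \<le> (two_point \<mu> (Suc i))\<^sup>2 - 1/2 * four_point \<mu> (Suc i)"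
      using row_current_le[OF c, of "Suc i"] b(3)[of "Suc i"] by linarith
    then show ?thesis unfolding A_def by (rule mult_left_mono) simp
  qed
  have cur: "row_current ?c (Suc i) \<ge> 0" for i by (rule row_current_nonneg[OF c]) simp
  have A0: "A i \<ge> 0" for i using low[of i] cur[of i] by (meson mult_nonneg_nonneg of_nat_0_le_iff order.trans)
  have "\<not> summable A"
  proof
    assume s: "summable A"
    \<comment> \<open>The partial first moments of the current correlations are dominated termwise
      by the series, whose terms are nonnegative.\<close>
    have B: "(\<Sum>k<n. real (Suc k) * row_current ?c (Suc k)) \<le> suminf A" for n
    proof -
      have "(\<Sum>k<n. real (Suc k) * row_current ?c (Suc k)) \<le> (\<Sum>k<n. A k)" by (intro sum_mono low)
      also have "\<dots> \<le> suminf A" by (rule sum_le_suminf[OF s]) (auto simp: A0)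
      finally show ?thesis .
    qed
    from height_variance_bounded[OF assms(1) cur B] gibbs_marginals_exist[OF assms(1)] gibbs_measure_from_marginals[OF assms(1)]
    have "\<exists>\<nu>. gibbs_measure (height_potential \<beta>) \<nu> \<and> translation_invariant \<nu>" by blast
    then show False using assms(3) by (simp add: delocalises_def)
  qed
  then have inf: "(\<Sum>i. ereal (A i)) = \<infinity>" using summable_ereal[of A] A0 by blast
  have "(\<lambda>i. ereal (A i)) sums \<infinity>"
    using summable_sums[OF summable_ereal_pos[of "\<lambda>i. ereal (A i)"]] A0 unfolding inf by simp
  moreover have "(\<Sum>i. ereal (A i)) \<le> (\<Sum>i. ereal (real (Suc i) * (two_point \<mu> (Suc i))\<^sup>2))"
  proof (rule suminf_le_pos)
    fix i
    show "0 \<le> ereal (A i)" using A0 by simp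
    have "A i \<le> real (Suc i) * (two_point \<mu> (Suc i))\<^sup>2"
      unfolding A_def using b(2)[of "Suc i"] by (intro mult_left_mono) auto
    then show "ereal (A i) \<le> ereal (real (Suc i) * (two_point \<mu> (Suc i))\<^sup>2)" by simp
  qed
  ultimately show ?thesis unfolding A_def by blast
qed

end
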